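(* Let $n,d\ge1$, let $\Omega\subset\mathbb{R}^n$ be a bounded Lipschitz domain, and let $M:\Omega\times\mathbb{R}^{n\times d}\to[0,\infty)$ be a weak $N$-function that is continuous with respect to both variables and such that $$M(x,\boldsymbol{\xi})=\sum_{i=1}^dM_i(x,\boldsymbol{\xi}^i),\qquad\boldsymbol{\xi}=(\boldsymbol{\xi}^1,\dots,\boldsymbol{\xi}^d)\in\mathbb{R}^{n\times d},\ \boldsymbol{\xi}^i\in\mathbb{R}^n,$$ for some weak $N$-functions $M_i:\Omega\times\mathbb{R}^n\to[0,\infty)$. Then the following assertions hold. (i) If $\gamma=0$ and $M$ satisfies condition $\mathsf{(B^{gen}_\gamma)}$ (with $\gamma=0$), then for any $\boldsymbol{\varphi}\in V_0^1L_M(\Omega)$ there exists a sequence $\{\boldsymbol{\varphi}_\delta\}_{\delta>0}\subset C_c^\infty(\Omega)$ such that, as $\delta\to0$, $\boldsymbol{\varphi}_\delta\to\boldsymbol{\varphi}$ strongly in $L^1(\Omega)$ and in measure, and $\nabla\boldsymbol{\varphi}_\delta\to\nabla\boldsymbol{\varphi}$ modularly in $L_M(\Omega;\mathbb{R}^{n\times d})$. (ii) If $\gamma\in(0,1]$ and $M$ satisfies condition $\mathsf{(B^{gen}_\gamma)}$, then for any $\boldsymbol{\varphi}\in V_0^1L_M(\Omega)\cap C^{0,\gamma}(\Omega)$ there exists a sequence $\{\boldsymbol{\varphi}_\delta\}_{\delta>0}\subset C_c^\infty(\Omega)$ such that, as $\delta\to0$, $\boldsymbol{\varphi}_\delta\to\boldsymbol{\varphi}$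 strongly in $L^1(\Omega)$ and in measure, and $\nabla\boldsymbol{\varphi}_\delta\to\nabla\boldsymbol{\varphi}$ modularly in $L_M(\Omega;\mathbb{R}^{n\times d})$. Moreover, in both cases, if $\boldsymbol{\varphi}\in L^\infty(\Omega;\mathbb{R}^d)$, then there exists $c=c(\Omega)>0$ such that $\|\boldsymbol{\varphi}_\delta\|_{L^\infty(\Omega;\mathbb{R}^d)}\le c\|\boldsymbol{\varphi}\|_{L^\infty(\Omega;\mathbb{R}^d)}$.
   Context: Weak $N$-functions. For $\ell\ge1$, a function $N:\Omega\times\mathbb{R}^\ell\to[0,\infty)$ is a weak $N$-function if: (1) it is Carathéodory (measurable in $x$, continuous in $\xi$); (2) $N(x,0)=0$ and $\xi\mapsto N(x,\xi)$ is convex for a.a. $x\in\Omega$; (3) $N(x,\xi)=N(x,-\xi)$ for a.a. $x\in\Omega$ and all $\xi$; (4) there exist convex functions $m_1,m_2:[0,\infty)\to[0,\infty)$ with $m_1(0)=0$, $m_1(s)>0$ for $s>0$, such that $m_1(|\xi|)\le N(x,\xi)\le m_2(|\xi|)$ for a.a. $x\in\Omega$ and all $\xi$. Here $\mathbb{R}^{n\times d}$ is identified with $\mathbb{R}^{nd}$. For a ball $B\subset\mathbb{R}^n$ and a weak $N$-function $N$: $N_B^-(\xi)=\operatorname{ess\,inf}_{y\in B\cap\Omega}N(y,\xi)$ and $N_B^+(\xi)=\operatorname{ess\,sup}_{y\in B\cap\Omega}N(y,\xi)$. Condition $\mathsf{(B^{gen}_\gamma)}$ for $M$ on $\Omega\times\mathbb{R}^{n\times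 d}$: $M(x,\boldsymbol{\xi})=\sum_{j=1}^{K}N_j(x,\xi_j)$ for some $K\ge1$, where $\boldsymbol{\xi}=(\xi_1,\dots,\xi_K)$ with $\xi_j\in\mathbb{R}^{\ell_j}$, $\mathbb{R}^{\ell_1}\times\dots\times\mathbb{R}^{\ell_K}=\mathbb{R}^{n\times d}$, and $N_j:\Omega\times\mathbb{R}^{\ell_j}\to[0,\infty)$ are weak $N$-functions; and there exist constants $c^\Diamond,C^\Diamond>1$ such that for every ball $B$ with radius $r\le1$, all $j$, and all $\xi_j\in\mathbb{R}^{\ell_j}$ satisfying $(N_j)_B^-(C^\Diamond\xi_j)\le\sup_{|\eta_j|=1}(N_j)_B^-(\eta_jc^\Diamond r^{\gamma-1})$, there holds $(N_j)_B^+(\xi_j)\le(N_j)_B^-(C^\Diamond\xi_j)+1$. Function spaces (of $\mathbb{R}^d$-valued maps; $\nabla\mathbf{u}=(\nabla u^1,\dots,\nabla u^d)$ for $\mathbf{u}=(u^1,\dots,u^d)$). $L_M(\Omega;\mathbb{R}^{n\times d})$ is the smallest linear space containing all measurable $\boldsymbol{\xi}:\Omega\to\mathbb{R}^{n\times d}$ with $\int_\Omega M(x,\boldsymbol{\xi}(x))\,dx<\infty$. $V^1_0L_M(\Omega)=\{\mathbf{f}\in W^{1,1}_0(\Omega;\mathbb{R}^d):\nabla\mathbf{f}\in L_M(\Omega;\mathbb{R}^{n\times d})\}$. $C_c^\infty(\Omega)$, $L^1(\Omega)$ and $C^{0,\gamma}(\Omega)$ denote the corresponding spaces of $\mathbb{R}^d$-valued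 maps, where for $\gamma\in(0,1]$, $\mathbf{h}\in C^{0,\gamma}(\Omega)$ means $\sup_{x\ne y\in\Omega}|\mathbf{h}(x)-\mathbf{h}(y)|/|x-y|^\gamma<\infty$. A family $\boldsymbol{\xi}_\delta$ converges modularly to $\boldsymbol{\xi}$ in $L_M(\Omega;\mathbb{R}^{n\times d})$ if there exists $\lambda>0$ such that $\int_\Omega M\left(x,\frac{\boldsymbol{\xi}_\delta-\boldsymbol{\xi}}{\lambda}\right)dx\to0$. *)

theory Defs
  imports "HOL-Analysis.Analysis" "HOL-Probability.Essential_Supremum"
begin

text \<open>The boundary of \<open>\<Omega>\<close> is locally the graph, over the hyperplane orthogonal to a unit
  vector \<open>e\<close>, of a Lipschitz function \<open>g\<close>, with \<open>\<Omega>\<close> lying on one side of the graph.\<close>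

definition bounded_Lipschitz_domain :: "(real ^ 'n) set \<Rightarrow> bool" where
  "bounded_Lipschitz_domain \<Omega> \<longleftrightarrow>
     open \<Omega> \<and> connected \<Omega> \<and> \<Omega> \<noteq> {} \<and> bounded \<Omega> \<and>
     (\<forall>a \<in> frontier \<Omega>. \<exists>r>0. \<exists>e L g. norm e = 1 \<and> L-lipschitz_on {y. y \<bullet> e = 0} g \<and>
        \<Omega> \<inter> ball a r = {x \<in> ball a r. g (x - (x \<bullet> e) *\<^sub>R e) < x \<bullet> e})"

text \<open>The linear subspace \<open>E\<close> plays the role of \<open>\<real>\<^sup>l\<close>, with \<open>l = dim E\<close>; values of \<open>N x\<close>
  outside \<open>E\<close>, and of \<open>N\<close> at points outside \<open>\<Omega>\<close>, are irrelevant. With \<open>E = UNIV\<close> this is the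
  notion on the whole Euclidean space, where for matrices the norm is the Euclidean norm of all
  entries.\<close>

definition weak_N_function ::
    "(real ^ 'n) set \<Rightarrow> 'a::euclidean_space set \<Rightarrow> (real ^ 'n \<Rightarrow> 'a \<Rightarrow> real) \<Rightarrow> bool" where
  "weak_N_function \<Omega> E N \<longleftrightarrow>
     (\<forall>x\<in>\<Omega>. \<forall>\<xi>\<in>E. 0 \<le> N x \<xi>) \<and>
     (\<forall>\<xi>\<in>E. (\<lambda>x. N x \<xi>) \<in> borel_measurable (lebesgue_on \<Omega>)) \<and>
     (AE x in lebesgue_on \<Omega>. continuous_on E (N x)) \<and>
     (AE x in lebesgue_on \<Omega>. N x 0 = 0 \<and> convex_on E (N x)) \<and>
     (AE x in lebesgue_on \<Omega>. \<forall>\<xi>\<in>E. N x \<xi> = N x (- \<xi>)) \<and>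
     (\<exists>m1 m2 :: real \<Rightarrow> real.
        convex_on {0..} m1 \<and> convex_on {0..} m2 \<and>
        (\<forall>s\<ge>0. 0 \<le> m1 s \<and> 0 \<le> m2 s) \<and>
        m1 0 = 0 \<and> (\<forall>s>0. 0 < m1 s) \<and>
        (AE x in lebesgue_on \<Omega>. \<forall>\<xi>\<in>E. m1 (norm \<xi>) \<le> N x \<xi> \<and> N x \<xi> \<le> m2 (norm \<xi>)))"

definition N_plus ::
    "(real ^ 'n) set \<Rightarrow> (real ^ 'n \<Rightarrow> 'a \<Rightarrow> real) \<Rightarrow> (real ^ 'n) set \<Rightarrow> 'a \<Rightarrow> ereal" where
  "N_plus \<Omega> N B \<xi> = esssup (lebesgue_on (B \<inter> \<Omega>)) (\<lambda>y. ereal (N y \<xi>))"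

definition N_minus ::
    "(real ^ 'n) set \<Rightarrow> (real ^ 'n \<Rightarrow> 'a \<Rightarrow> real) \<Rightarrow> (real ^ 'n) set \<Rightarrow> 'a \<Rightarrow> ereal" where
  "N_minus \<Omega> N B \<xi> = - esssup (lebesgue_on (B \<inter> \<Omega>)) (\<lambda>y. - ereal (N y \<xi>))"

text \<open>A splitting of the matrix space into \<open>K\<close> factors is given by assigning to each entry
  \<open>(i, k)\<close> the number \<open>p i k\<close> of the factor it belongs to. The \<open>j\<close>-th factor is realised as the
  coordinate subspace of matrices whose entries outside block \<open>j\<close> vanish.\<close>

definition block_space :: "('d \<Rightarrow> 'n \<Rightarrow> nat) \<Rightarrow> nat \<Rightarrow> (real ^ 'n ^ 'd) set" where
  "block_space p j = {\<xi>. \<forall>i k. p i k \<noteq> j \<longrightarrow> \<xi> $ i $ k = 0}"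

definition block_proj :: "('d \<Rightarrow> 'n \<Rightarrow> nat) \<Rightarrow> nat \<Rightarrow> real ^ 'n ^ 'd \<Rightarrow> real ^ 'n ^ 'd" where
  "block_proj p j \<xi> = (\<chi> i k. if p i k = j then \<xi> $ i $ k else 0)"

definition B_gen ::
    "(real ^ 'n) set \<Rightarrow> real \<Rightarrow> (real ^ 'n \<Rightarrow> real ^ 'n ^ 'd \<Rightarrow> real) \<Rightarrow> bool" where
  "B_gen \<Omega> \<gamma> M \<longleftrightarrow>
     (\<exists>(K::nat) p N.
        1 \<le> K \<and> {p i k | i k. True} = {1..K} \<and>
        (\<forall>j\<in>{1..K}. weak_N_function \<Omega> (block_space p j) (N j)) \<and>
        (\<forall>x\<in>\<Omega>. \<forall>\<xi>. M x \<xi> = (\<Sum>j=1..K. N j x (block_proj p j \<xi>))) \<and>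
        (\<exists>c C :: real. 1 < c \<and> 1 < C \<and>
           (\<forall>a r. 0 < r \<and> r \<le> 1 \<longrightarrow> (\<forall>j\<in>{1..K}. \<forall>\<xi> \<in> block_space p j.
              N_minus \<Omega> (N j) (ball a r) (C *\<^sub>R \<xi>)
                \<le> (SUP \<eta> \<in> {\<eta> \<in> block_space p j. norm \<eta> = 1}.
                     N_minus \<Omega> (N j) (ball a r) ((c * r powr (\<gamma> - 1)) *\<^sub>R \<eta>)) \<longrightarrow>
              N_plus \<Omega> (N j) (ball a r) \<xi> \<le> N_minus \<Omega> (N j) (ball a r) (C *\<^sub>R \<xi>) + 1))))"

text \<open>\<open>L_M \<Omega> M\<close> is the smallest set of functions closed under pointwise linear combinations
  that contains all measurable functions with finite modular.\<close>

definition linear_function_space :: "('x \<Rightarrow> 'a::real_vector) set \<Rightarrow> bool" where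
  "linear_function_space S \<longleftrightarrow>
     (\<lambda>x. 0) \<in> S \<and> (\<forall>f\<in>S. \<forall>g\<in>S. (\<lambda>x. f x + g x) \<in> S) \<and> (\<forall>c. \<forall>f\<in>S. (\<lambda>x. c *\<^sub>R f x) \<in> S)"

definition modular ::
    "(real ^ 'n) set \<Rightarrow> (real ^ 'n \<Rightarrow> 'a \<Rightarrow> real) \<Rightarrow> (real ^ 'n \<Rightarrow> 'a) \<Rightarrow> ennreal" where
  "modular \<Omega> M \<xi> = (\<integral>\<^sup>+x. ennreal (M x (\<xi> x)) \<partial>lebesgue_on \<Omega>)"

definition L_M ::
    "(real ^ 'n) set \<Rightarrow> (real ^ 'n \<Rightarrow> 'a::euclidean_space \<Rightarrow> real) \<Rightarrow> (real ^ 'n \<Rightarrow> 'a) set" where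
  "L_M \<Omega> M = \<Inter> {S. linear_function_space S \<and>
     {\<xi> \<in> borel_measurable (lebesgue_on \<Omega>). modular \<Omega> M \<xi> < \<infinity>} \<subseteq> S}"

definition modular_convergence ::
    "(real ^ 'n) set \<Rightarrow> (real ^ 'n \<Rightarrow> 'a::euclidean_space \<Rightarrow> real) \<Rightarrow>
      ('i \<Rightarrow> real ^ 'n \<Rightarrow> 'a) \<Rightarrow> (real ^ 'n \<Rightarrow> 'a) \<Rightarrow> 'i filter \<Rightarrow> bool" where
  "modular_convergence \<Omega> M \<xi>s \<xi> F \<longleftrightarrow>
     (\<exists>\<mu>>0. ((\<lambda>\<delta>. modular \<Omega> M (\<lambda>x. (\<xi>s \<delta> x - \<xi> x) /\<^sub>R \<mu>)) \<longlongrightarrow> 0) F)"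

definition L1_convergence ::
    "(real ^ 'n) set \<Rightarrow> ('i \<Rightarrow> real ^ 'n \<Rightarrow> 'a::euclidean_space) \<Rightarrow>
      (real ^ 'n \<Rightarrow> 'a) \<Rightarrow> 'i filter \<Rightarrow> bool" where
  "L1_convergence \<Omega> fs f F \<longleftrightarrow>
     ((\<lambda>\<delta>. \<integral>\<^sup>+x. ennreal (norm (fs \<delta> x - f x)) \<partial>lebesgue_on \<Omega>) \<longlongrightarrow> 0) F"

definition measure_convergence ::
    "(real ^ 'n) set \<Rightarrow> ('i \<Rightarrow> real ^ 'n \<Rightarrow> 'a::euclidean_space) \<Rightarrow>
      (real ^ 'n \<Rightarrow> 'a) \<Rightarrow> 'i filter \<Rightarrow> bool" where
  "measure_convergence \<Omega> fs f F \<longleftrightarrow>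
     (\<forall>\<epsilon>>0. ((\<lambda>\<delta>. emeasure lebesgue {x \<in> \<Omega>. \<epsilon> \<le> norm (fs \<delta> x - f x)}) \<longlongrightarrow> 0) F)"

primrec C_k :: "nat \<Rightarrow> (real ^ 'n \<Rightarrow> 'a::euclidean_space) \<Rightarrow> bool" where
  "C_k 0 f \<longleftrightarrow> continuous_on UNIV f"
| "C_k (Suc k) f \<longleftrightarrow>
     f differentiable_on UNIV \<and> (\<forall>v. C_k k (\<lambda>x. frechet_derivative f (at x) v))"

definition Cc_infty :: "(real ^ 'n) set \<Rightarrow> (real ^ 'n \<Rightarrow> 'a::euclidean_space) set" where
  "Cc_infty \<Omega> = {f. (\<forall>k. C_k k f) \<and>
     compact (closure {x. f x \<noteq> 0}) \<and> closure {x. f x \<noteq> 0} \<subseteq> \<Omega>}"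

text \<open>Row \<open>i\<close> of the gradient is the gradient of the \<open>i\<close>-th component function.\<close>

definition grad :: "(real ^ 'n \<Rightarrow> real ^ 'd) \<Rightarrow> real ^ 'n \<Rightarrow> real ^ 'n ^ 'd" where
  "grad f x = jacobian f (at x)"

definition weak_gradient ::
    "(real ^ 'n) set \<Rightarrow> (real ^ 'n \<Rightarrow> real ^ 'd) \<Rightarrow> (real ^ 'n \<Rightarrow> real ^ 'n ^ 'd) \<Rightarrow> bool" where
  "weak_gradient \<Omega> f G \<longleftrightarrow>
     (\<forall>A. compact A \<and> A \<subseteq> \<Omega> \<longrightarrow>
        integrable (lebesgue_on A) f \<and> integrable (lebesgue_on A) G) \<and>
     (\<forall>\<psi> :: real ^ 'n \<Rightarrow> real. \<psi> \<in> Cc_infty \<Omega> \<longrightarrow> (\<forall>i k.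
        (LINT x|lebesgue_on \<Omega>. f x $ i * frechet_derivative \<psi> (at x) (axis k 1))
          = - (LINT x|lebesgue_on \<Omega>. G x $ i $ k * \<psi> x)))"

definition W11 :: "(real ^ 'n) set \<Rightarrow> (real ^ 'n \<Rightarrow> real ^ 'd) set" where
  "W11 \<Omega> = {f. integrable (lebesgue_on \<Omega>) f \<and>
     (\<exists>G. weak_gradient \<Omega> f G \<and> integrable (lebesgue_on \<Omega>) G)}"

text \<open>The closure of \<open>Cc_infty \<Omega>\<close> in the norm of \<open>W11 \<Omega>\<close>.\<close>

definition W11_0 :: "(real ^ 'n) set \<Rightarrow> (real ^ 'n \<Rightarrow> real ^ 'd) set" where
  "W11_0 \<Omega> = {f \<in> W11 \<Omega>. \<exists>G \<psi>. weak_gradient \<Omega> f G \<and> (\<forall>m::nat. \<psi> m \<in> Cc_infty \<Omega>) \<and>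
     L1_convergence \<Omega> \<psi> f sequentially \<and>
     L1_convergence \<Omega> (\<lambda>m. grad (\<psi> m)) G sequentially}"

definition V01_L_M ::
    "(real ^ 'n) set \<Rightarrow> (real ^ 'n \<Rightarrow> real ^ 'n ^ 'd \<Rightarrow> real) \<Rightarrow> (real ^ 'n \<Rightarrow> real ^ 'd) set" where
  "V01_L_M \<Omega> M = {f \<in> W11_0 \<Omega>. \<exists>G. weak_gradient \<Omega> f G \<and> G \<in> L_M \<Omega> M}"

definition Hoelder :: "(real ^ 'n) set \<Rightarrow> real \<Rightarrow> (real ^ 'n \<Rightarrow> real ^ 'd) set" where
  "Hoelder \<Omega> \<gamma> = {h. bdd_above {norm (h x - h y) / norm (x - y) powr \<gamma> | x y.
     x \<in> \<Omega> \<and> y \<in> \<Omega> \<and> x \<noteq> y}}"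

definition Linf_norm :: "(real ^ 'n) set \<Rightarrow> (real ^ 'n \<Rightarrow> real ^ 'd) \<Rightarrow> ereal" where
  "Linf_norm \<Omega> f = esssup (lebesgue_on \<Omega>) (\<lambda>x. ereal (norm (f x)))"

definition Linf :: "(real ^ 'n) set \<Rightarrow> (real ^ 'n \<Rightarrow> real ^ 'd) set" where
  "Linf \<Omega> = {f \<in> borel_measurable (lebesgue_on \<Omega>). Linf_norm \<Omega> f < \<infinity>}"

definition approximated_by ::
    "(real ^ 'n) set \<Rightarrow> (real ^ 'n \<Rightarrow> real ^ 'n ^ 'd \<Rightarrow> real) \<Rightarrow>
      (real ^ 'n \<Rightarrow> real ^ 'd) \<Rightarrow> (real \<Rightarrow> real ^ 'n \<Rightarrow> real ^ 'd) \<Rightarrow> bool" where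
  "approximated_by \<Omega> M f fs \<longleftrightarrow>
     (\<forall>\<delta>>0. fs \<delta> \<in> Cc_infty \<Omega>) \<and>
     L1_convergence \<Omega> fs f (at_right 0) \<and>
     measure_convergence \<Omega> fs f (at_right 0) \<and>
     (\<forall>G. weak_gradient \<Omega> f G \<longrightarrow>
        modular_convergence \<Omega> M (\<lambda>\<delta>. grad (fs \<delta>)) G (at_right 0))"

end

theory Submission
  imports Defs "HOL-Real_Asymp.Real_Asymp"
begin

text \<open>Extend \<open>u \<in> W\<^sup>1\<^sup>,\<^sup>1\<^sub>0\<close> and its weak gradient \<open>G\<close> by zero. Near a boundary point of a Lipschitz domain some
  direction \<open>v\<close> points inwards, so that the average of \<open>u\<close> over the ball of radius \<open>\<delta>\<close> about
  \<open>x - \<delta> v\<close> vanishes for \<open>x\<close> near the boundary. Gluing these shifted mollifications with a smooth partition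
  of unity \<open>\<theta>\<^sub>j\<close> gives \<open>u\<^sub>\<delta> x = (\<Sum>j. \<theta>\<^sub>j x * (\<rho>\<^sub>\<delta> * u) (x - \<delta> v\<^sub>j))\<close> in \<open>C\<^sub>c\<^sup>\<infinity>(\<Omega>)\<close>
  (\<open>glue_Cc_infty\<close>). Being averages, the values obey every bound on \<open>\<bar>u\<bar>\<close>, so the constant is \<open>c = 1\<close>. The
  gradient of \<open>u\<^sub>\<delta>\<close> is the same expression formed from \<open>G\<close>, plus an error from the derivatives of the
  \<open>\<theta>\<^sub>j\<close> that is bounded and tends to zero in \<open>L\<^sup>1\<close>, because these derivatives add up to zero in \<open>\<Omega>\<close>.
  Only translations are applied to \<open>G\<close>, no change of coordinates: \<open>M\<close> is anisotropic, and nothing is known about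
  its values in rotated directions.

  Modular convergence needs a majorant of \<open>M x (\<nabla>u\<^sub>\<delta> x / \<Lambda>)\<close> that converges in \<open>L\<^sup>1\<close>
  (\<open>nn_integral_compose_L1_limit\<close>). The mollification of \<open>y \<mapsto> M y (G y / \<mu>)\<close> would be one by Jensen's
  inequality, were it not for the dependence of \<open>M\<close> on its first argument. The balance condition compares
  \<open>M x\<close> with the infimum of the \<open>M y\<close> over a ball, for vectors of size up to \<open>\<delta> powr (\<gamma> - 1)\<close>, and this is
  the size of a mollified gradient: moving the derivative to the kernel bounds it by \<open>1 / \<delta>\<close> times the
  oscillation of \<open>u\<close>, which is of order one for bounded \<open>u\<close> and of order \<open>\<delta> powr \<gamma>\<close> for Hoelder
  continuous \<open>u\<close> (\<open>conv_gradient_bound\<close>). The infimum is not convex, so Jensen's inequality does not apply to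
  it; instead a supporting affine function of \<open>M x\<close>, which may be integrated against the kernel, is shown to
  lie below a multiple of \<open>M y\<close> for all \<open>y\<close> in the ball (\<open>affine_minorant\<close>, \<open>conv_modular_bound\<close>).

  Two points remain. A Hoelder continuous \<open>u \<in> W\<^sup>1\<^sup>,\<^sup>1\<^sub>0\<close> has boundary values zero, so its extension by zero is
  Hoelder continuous on the whole space (\<open>Hoelder_zero_extension\<close>). For \<open>\<gamma> = 0\<close> and unbounded \<open>u\<close> the
  components are truncated; here the splitting of \<open>M\<close> into rows is used. Since the scale \<open>\<mu>\<close> must exceed a multiple of the
  oscillation, the truncations are approximated one layer of height one after the other, at a scale that is
  the same for all layers (\<open>layered_approximation\<close>).\<close>

section \<open>Smooth functions and mollifiers\<close>

lemma C_k_Suc_imp: "C_k (Suc k) f \<Longrightarrow> C_k k f"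
proof (induction k arbitrary: f)
  case 0
  then show ?case by (auto intro: differentiable_imp_continuous_on)
next
  case (Suc k)
  show ?case
    using Suc.prems Suc.IH[of "\<lambda>x. frechet_derivative f (at x) v" for v]
    unfolding C_k.simps(2)[of "Suc k"] C_k.simps(2)[of k f] by (auto simp del: C_k.simps)
qed

lemma C_k_imp_continuous: "C_k k f \<Longrightarrow> continuous_on UNIV f"
  by (cases k) (auto intro: differentiable_imp_continuous_on)

lemma C_k_SucI:
  assumes "\<And>x. (f has_derivative f' x) (at x)" "\<And>v. C_k k (\<lambda>x. f' x v)"
  shows "C_k (Suc k) f"
proof -
  have "frechet_derivative f (at x) = f' x" for x
    using assms(1) frechet_derivative_at by metis
  then show ?thesis
    using assms by (auto simp: differentiable_on_def differentiable_def intro: has_derivative_at_withinI)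
qed

lemma C_k_SucD:
  assumes "C_k (Suc k) f"
  shows "(f has_derivative frechet_derivative f (at x)) (at x)"
    "C_k k (\<lambda>x. frechet_derivative f (at x) v)"
proof -
  have "f differentiable (at x)"
    using assms by (auto simp: differentiable_on_def)
  then show "(f has_derivative frechet_derivative f (at x)) (at x)"
    by (simp add: frechet_derivative_works)
qed (use assms in auto)

lemma C_k_const: "C_k k (\<lambda>x. c)"
  by (induction k arbitrary: c) auto

lemma C_k_add:
  assumes "C_k k f" "C_k k g" shows "C_k k (\<lambda>x. f x + g x)"
  using assms
proof (induction k arbitrary: f g)
  case 0
  then show ?case by (auto intro: continuous_intros)
next
  case (Suc k)
  show ?case
    by (rule C_k_SucI[OF has_derivative_add[OF C_k_SucD(1)[OF Suc.prems(1)] C_k_SucD(1)[OF Suc.prems(2)]]])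
       (intro Suc.IH C_k_SucD(2) Suc.prems)
qed

lemma C_k_sum:
  assumes "\<And>i. i \<in> I \<Longrightarrow> C_k k (f i)" shows "C_k k (\<lambda>x. \<Sum>i\<in>I. f i x)"
  using assms by (induction I rule: infinite_finite_induct) (auto intro: C_k_add C_k_const)

lemma C_k_scaleR:
  fixes f :: "real ^ 'n \<Rightarrow> real"
  assumes "C_k k f" "C_k k g" shows "C_k k (\<lambda>x. f x *\<^sub>R g x)"
  using assms
proof (induction k arbitrary: f g)
  case 0
  then show ?case by (auto intro: continuous_intros)
next
  case (Suc k)
  note d = has_derivative_scaleR[OF C_k_SucD(1)[OF Suc.prems(1)] C_k_SucD(1)[OF Suc.prems(2)]]
  show ?case
    by (rule C_k_SucI[OF d]) (intro Suc.IH C_k_SucD(2) Suc.prems C_k_add C_k_Suc_imp)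
qed

lemma C_k_mult:
  fixes f g :: "real ^ 'n \<Rightarrow> real"
  assumes "C_k k f" "C_k k g" shows "C_k k (\<lambda>x. f x * g x)"
  using C_k_scaleR[OF assms] by simp

lemma C_k_affine:
  assumes "C_k k f" shows "C_k k (\<lambda>x. f (a + c *\<^sub>R x))"
  using assms
proof (induction k arbitrary: f)
  case 0
  then have "continuous_on UNIV (f \<circ> (\<lambda>x. a + c *\<^sub>R x))"
    by (intro continuous_on_compose continuous_intros) (auto intro: continuous_on_subset)
  then show ?case by (simp add: o_def)
next
  case (Suc k)
  let ?f' = "\<lambda>x. frechet_derivative f (at x)"
  have lin: "linear (?f' x)" for x
    using C_k_SucD(1)[OF Suc.prems] has_derivative_linear by blast
  show ?case
  proof (rule C_k_SucI)
    fix x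
    have "((\<lambda>x. a + c *\<^sub>R x) has_derivative (\<lambda>h. c *\<^sub>R h)) (at x)"
      by (auto intro!: derivative_eq_intros)
    from diff_chain_at[OF this C_k_SucD(1)[OF Suc.prems]]
    show "((\<lambda>x. f (a + c *\<^sub>R x)) has_derivative (\<lambda>h. c *\<^sub>R ?f' (a + c *\<^sub>R x) h)) (at x)"
      by (simp add: o_def linear_scale[OF lin])
  next
    show "C_k k (\<lambda>x. c *\<^sub>R ?f' (a + c *\<^sub>R x) v)" for v
      using C_k_scaleR[OF C_k_const[of k c] Suc.IH[OF C_k_SucD(2)[OF Suc.prems]]] by simp
  qed
qed

lemma C_k_inner: "C_k k (\<lambda>x :: real ^ 'n. x \<bullet> v)"
proof (cases k)
  case (Suc m)
  show ?thesis unfolding Suc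
    by (rule C_k_SucI[where f'="\<lambda>x h. h \<bullet> v"]) (auto intro!: derivative_eq_intros C_k_const)
qed (auto intro: continuous_intros)

text \<open>The case \<open>m = 0\<close>, applied to \<open>1 - x \<bullet> x\<close>, is the standard bump. The powers \<open>t ^ m\<close> are
  included because the derivative of such a function is a linear combination of two functions of the same
  kind, which makes the smoothness of all of them a single induction.\<close>

definition flat_exp :: "nat \<Rightarrow> real \<Rightarrow> real" where
  "flat_exp m t = (if t > 0 then exp (- (1 / t)) / t ^ m else 0)"

lemma flat_exp_bigo: "((\<lambda>h. flat_exp m h / h) \<longlongrightarrow> 0) (at (0::real))"
proof -
  have "((\<lambda>h. flat_exp m h / h) \<longlongrightarrow> 0) (at_right 0)"
  proof -
    have "((\<lambda>x::real. exp (- (1 / x)) / x ^ m / x) \<longlongrightarrow> 0) (at_right 0)"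
    proof -
      have "filterlim (\<lambda>s::real. s ^ Suc m / exp s) (nhds 0) at_top"
        by (rule tendsto_power_div_exp_0)
      then have "filterlim (\<lambda>x::real. (inverse x) ^ Suc m / exp (inverse x)) (nhds 0) (at_right 0)"
        by (rule filterlim_compose[OF _ filterlim_inverse_at_top_right])
      moreover have "(inverse x) ^ Suc m / exp (inverse x) = exp (- (1 / x)) / x ^ m / x" for x :: real
        by (simp add: exp_minus field_simps power_inverse)
      ultimately show ?thesis by simp
    qed
    moreover have "eventually (\<lambda>x::real. exp (- (1 / x)) / x ^ m / x = flat_exp m x / x) (at_right 0)"
      by (auto simp: flat_exp_def eventually_at_right_field intro: exI[of _ 1])
    ultimately show ?thesis by (rule Lim_transform_eventually)
  qed
  moreover have "((\<lambda>h. flat_exp m h / h) \<longlongrightarrow> 0) (at_left (0::real))"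
    by (rule Lim_transform_eventually[OF tendsto_const])
       (auto simp: flat_exp_def eventually_at_left_field intro: exI[of _ "-1"])
  ultimately show ?thesis by (simp add: filterlim_split_at)
qed

lemma flat_exp_has_derivative:
  "(flat_exp m has_real_derivative flat_exp (m + 2) t - real m * flat_exp (m + 1) t) (at t)"
proof -
  consider "t > 0" | "t < 0" | "t = 0" by linarith
  then show ?thesis
  proof cases
    case 1
    have "((\<lambda>t. exp (- (1 / t)) / t ^ m) has_real_derivative
            flat_exp (m + 2) t - real m * flat_exp (m + 1) t) (at t)"
    proof (rule DERIV_cong)
      have e: "((\<lambda>t. exp (- (1 / t))) has_real_derivative exp (- (1 / t)) * (1 / t\<^sup>2)) (at t)"
        using 1 by (auto intro!: derivative_eq_intros simp: field_simps power2_eq_square)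
      show "((\<lambda>t. exp (- (1 / t)) / t ^ m) has_real_derivative
          (exp (- (1 / t)) * (1 / t\<^sup>2) * t ^ m - exp (- (1 / t)) * (real m * t ^ (m - Suc 0))) / (t ^ m * t ^ m)) (at t)"
        using 1 by (intro DERIV_divide e DERIV_pow) auto
      show "(exp (- (1 / t)) * (1 / t\<^sup>2) * t ^ m - exp (- (1 / t)) * (real m * t ^ (m - Suc 0))) / (t ^ m * t ^ m)
          = flat_exp (m + 2) t - real m * flat_exp (m + 1) t"
      proof -
        have "exp (- (1 / t)) * (1 / t\<^sup>2) * t ^ m / (t ^ m * t ^ m) = exp (- (1 / t)) / t ^ (m + 2)"
          using 1 by (simp add: power_add power2_eq_square)
        then have a: "exp (- (1 / t)) * (1 / t\<^sup>2) * t ^ m / (t ^ m * t ^ m) = flat_exp (m + 2) t"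
          using 1 by (simp only: flat_exp_def if_True)
        have "exp (- (1 / t)) * (real m * t ^ (m - Suc 0)) / (t ^ m * t ^ m)
            = real m * (exp (- (1 / t)) / t ^ (m + 1))"
          using 1 by (cases m) (simp_all add: power_add)
        then have b: "exp (- (1 / t)) * (real m * t ^ (m - Suc 0)) / (t ^ m * t ^ m) = real m * flat_exp (m + 1) t"
          using 1 by (simp only: flat_exp_def if_True)
        show ?thesis unfolding diff_divide_distrib a b ..
      qed
    qed
    then show ?thesis
      by (rule has_field_derivative_transform_within_open[where S="{0<..}"])
         (use 1 in \<open>auto simp: flat_exp_def\<close>)
  next
    case 2
    have "((\<lambda>t. 0) has_real_derivative 0) (at t)" by simp
    then have "(flat_exp m has_real_derivative 0) (at t)"
      by (rule has_field_derivative_transform_within_open[where S="{..<0}"])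
         (use 2 in \<open>auto simp: flat_exp_def\<close>)
    then show ?thesis using 2 by (simp add: flat_exp_def)
  next
    case 3
    then show ?thesis
      using flat_exp_bigo[of m] by (simp add: has_field_derivative_iff flat_exp_def)
  qed
qed

lemma C_k_flat_exp_sphere:
  "C_k k (\<lambda>x :: real ^ 'n. flat_exp m (1 - x \<bullet> x))"
proof (induction k arbitrary: m)
  case 0
  have "continuous_on UNIV (flat_exp m \<circ> (\<lambda>x :: real ^ 'n. 1 - x \<bullet> x))"
    by (intro continuous_on_compose continuous_intros)
       (auto intro!: continuous_at_imp_continuous_on DERIV_isCont[OF flat_exp_has_derivative])
  then show ?case by (simp add: o_def)
next
  case (Suc k)
  show ?case
  proof (rule C_k_SucI)
    fix x :: "real ^ 'n"
    have "((\<lambda>x :: real ^ 'n. 1 - x \<bullet> x) has_derivative (\<lambda>h. - 2 * (x \<bullet> h))) (at x)"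
      by (auto intro!: derivative_eq_intros simp: inner_commute)
    from diff_chain_at[OF this flat_exp_has_derivative[of m "1 - x \<bullet> x", unfolded has_field_derivative_def]]
    show "((\<lambda>x. flat_exp m (1 - x \<bullet> x)) has_derivative
        (\<lambda>h. (flat_exp (m + 2) (1 - x \<bullet> x) + (- real m) * flat_exp (m + 1) (1 - x \<bullet> x)) * ((- 2) * (x \<bullet> h)))) (at x)"
      by (simp add: o_def)
  next
    show "C_k k (\<lambda>x. (flat_exp (m + 2) (1 - x \<bullet> x) + (- real m) * flat_exp (m + 1) (1 - x \<bullet> x)) * ((- 2) * (x \<bullet> v)))"
      for v :: "real ^ 'n"
      by (intro C_k_mult C_k_add C_k_const C_k_inner Suc.IH)
  qed
qed

text \<open>Bounded support is easier to propagate than compactness of the closed support, and gives a class that is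
  closed under directional derivatives and affine substitutions.\<close>

definition test_fun :: "(real ^ 'n \<Rightarrow> real) \<Rightarrow> bool" where
  "test_fun \<eta> \<longleftrightarrow> (\<forall>k. C_k k \<eta>) \<and> (\<exists>R. \<forall>x. R < norm x \<longrightarrow> \<eta> x = 0)"

definition dirder :: "(real ^ 'n \<Rightarrow> real) \<Rightarrow> real ^ 'n \<Rightarrow> real ^ 'n \<Rightarrow> real" where
  "dirder \<eta> v x = frechet_derivative \<eta> (at x) v"

lemma test_fun_has_derivative:
  "test_fun \<eta> \<Longrightarrow> (\<eta> has_derivative (\<lambda>v. dirder \<eta> v x)) (at x)"
  unfolding test_fun_def dirder_def using C_k_SucD(1) by blast

lemma dirder_eqI: "(\<eta> has_derivative D) (at x) \<Longrightarrow> dirder \<eta> v x = D v"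
  unfolding dirder_def using frechet_derivative_at by metis

lemma dirder_linear: "test_fun \<eta> \<Longrightarrow> linear (\<lambda>v. dirder \<eta> v x)"
  by (rule has_derivative_linear[OF test_fun_has_derivative])

lemma has_derivative_zero_on_open:
  assumes "open S" "x \<in> S" "\<And>y. y \<in> S \<Longrightarrow> f y = c"
  shows "(f has_derivative (\<lambda>h. 0)) (at x)"
proof -
  have "((\<lambda>y. c) has_derivative (\<lambda>h. 0)) (at x)" by simp
  then show ?thesis
    by (rule has_derivative_transform_within_open[OF _ assms(1,2)]) (simp add: assms(3))
qed

lemma dirder_zero:
  assumes "\<And>x. R < norm x \<Longrightarrow> \<eta> x = 0" "R < norm x"
  shows "dirder \<eta> v x = 0"
proof (rule dirder_eqI[of _ "\<lambda>h. 0"])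
  have "open {x :: real ^ 'n. R < norm x}" by (intro open_Collect_less continuous_intros)
  then show "(\<eta> has_derivative (\<lambda>h. 0)) (at x)"
    by (rule has_derivative_zero_on_open) (use assms in auto)
qed

lemma test_fun_dirder:
  assumes "test_fun \<eta>" shows "test_fun (dirder \<eta> v)"
proof -
  obtain R where R: "\<And>x. R < norm x \<Longrightarrow> \<eta> x = 0" using assms unfolding test_fun_def by blast
  have "C_k k (dirder \<eta> v)" for k
    using assms C_k_SucD(2)[of k \<eta>] unfolding test_fun_def dirder_def[abs_def] by blast
  moreover have "\<forall>x. R < norm x \<longrightarrow> dirder \<eta> v x = 0" using dirder_zero[of R \<eta>] R by blast
  ultimately show ?thesis unfolding test_fun_def by blast
qed

lemma test_fun_continuous: "test_fun \<eta> \<Longrightarrow> continuous_on UNIV \<eta>"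
  unfolding test_fun_def using C_k_imp_continuous by blast

lemma test_fun_bounded:
  assumes "test_fun \<eta>" obtains B where "\<And>x. \<bar>\<eta> x\<bar> \<le> B" "0 \<le> B"
proof -
  obtain R where R: "\<And>x. R < norm x \<Longrightarrow> \<eta> x = 0" using assms unfolding test_fun_def by blast
  have "compact (\<eta> ` cball 0 R)"
    by (intro compact_continuous_image continuous_on_subset[OF test_fun_continuous[OF assms]]) auto
  then obtain B where B: "\<And>y. y \<in> \<eta> ` cball 0 R \<Longrightarrow> norm y \<le> B"
    using compact_imp_bounded bounded_iff by metis
  have "\<bar>\<eta> x\<bar> \<le> max B 0" for x
  proof (cases "R < norm x")
    case True
    then show ?thesis using R by auto
  next
    case False
    then have "\<eta> x \<in> \<eta> ` cball 0 R" by auto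
    then show ?thesis using B by fastforce
  qed
  then show ?thesis using that by (metis max.cobounded2)
qed

lemma test_fun_borel: "test_fun \<eta> \<Longrightarrow> \<eta> \<in> borel_measurable borel"
  by (intro borel_measurable_continuous_onI test_fun_continuous)

lemma test_fun_integrable:
  assumes "test_fun \<eta>" shows "integrable lborel \<eta>"
proof -
  obtain R where R: "\<And>x. R < norm x \<Longrightarrow> \<eta> x = 0" using assms unfolding test_fun_def by blast
  have "integrable lborel (\<lambda>x. indicator (cball 0 R) x *\<^sub>R \<eta> x)"
    by (intro borel_integrable_compact continuous_on_subset[OF test_fun_continuous[OF assms]]) auto
  moreover have "indicator (cball 0 R) x *\<^sub>R \<eta> x = \<eta> x" for x
    using R[of x] by (auto simp: indicator_def)
  ultimately show ?thesis by (simp only:)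
qed

lemma test_fun_affine:
  assumes "test_fun \<eta>" "c \<noteq> 0" shows "test_fun (\<lambda>x. b * \<eta> (a + c *\<^sub>R x))"
proof -
  obtain R where R: "\<And>x. R < norm x \<Longrightarrow> \<eta> x = 0" using assms unfolding test_fun_def by blast
  have "\<eta> (a + c *\<^sub>R x) = 0" if "(\<bar>R\<bar> + norm a) / \<bar>c\<bar> < norm x" for x
  proof (rule R)
    have "\<bar>R\<bar> + norm a < \<bar>c\<bar> * norm x" using that assms(2) by (simp add: field_simps)
    moreover have "norm (c *\<^sub>R x) \<le> norm (a + c *\<^sub>R x) + norm a"
      using norm_triangle_ineq4[of "a + c *\<^sub>R x" a] by simp
    ultimately show "R < norm (a + c *\<^sub>R x)" by simp
  qed
  then have "\<forall>x. (\<bar>R\<bar> + norm a) / \<bar>c\<bar> < norm x \<longrightarrow> b * \<eta> (a + c *\<^sub>R x) = 0" by simp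
  moreover have "C_k k (\<lambda>x. b * \<eta> (a + c *\<^sub>R x))" for k
    using assms unfolding test_fun_def by (intro C_k_mult C_k_const C_k_affine) auto
  ultimately show ?thesis unfolding test_fun_def by blast
qed

definition mollifier :: "(real ^ 'n \<Rightarrow> real) \<Rightarrow> bool" where
  "mollifier \<rho> \<longleftrightarrow> (\<forall>k. C_k k \<rho>) \<and> (\<forall>x. 0 \<le> \<rho> x) \<and> (\<forall>x. 1 < norm x \<longrightarrow> \<rho> x = 0) \<and>
     integral\<^sup>L lborel \<rho> = 1"

lemma mollifier_test_fun: "mollifier \<rho> \<Longrightarrow> test_fun \<rho>"
  unfolding mollifier_def test_fun_def by blast

lemma mollifier_exists: "\<exists>\<rho> :: real ^ 'n \<Rightarrow> real. mollifier \<rho>"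
proof -
  define \<beta> where "\<beta> = (\<lambda>x :: real ^ 'n. flat_exp 0 (1 - x \<bullet> x))"
  have C: "C_k k \<beta>" for k unfolding \<beta>_def by (rule C_k_flat_exp_sphere)
  have out: "\<beta> x = 0" if "1 < norm x" for x
  proof -
    have "1 < (norm x)\<^sup>2" using that by (simp add: one_less_power)
    then show ?thesis by (simp add: \<beta>_def flat_exp_def dot_square_norm)
  qed
  have t: "test_fun \<beta>" unfolding test_fun_def using C out by blast
  have pos: "0 \<le> \<beta> x" for x by (simp add: \<beta>_def flat_exp_def)
  have "integral\<^sup>L lborel \<beta> \<noteq> 0"
  proof
    assume "integral\<^sup>L lborel \<beta> = 0"
    then have "AE x in lborel. \<beta> x = 0"
      using integral_nonneg_eq_0_iff_AE[OF test_fun_integrable[OF t]] pos by auto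
    then have "AE x in lborel. x \<notin> ball (0 :: real ^ 'n) 1"
    proof eventually_elim
      case (elim x)
      have "\<beta> x > 0" if "norm x < 1"
      proof -
        have "(norm x)\<^sup>2 < 1" using that by (simp add: abs_square_less_1)
        then show ?thesis by (simp add: \<beta>_def flat_exp_def dot_square_norm)
      qed
      then show ?case using elim by auto
    qed
    then have "ball (0 :: real ^ 'n) 1 \<in> null_sets lborel"
      by (subst AE_iff_null_sets) auto
    then have "emeasure lborel (ball (0 :: real ^ 'n) 1) = 0" by auto
    then show False
      using content_ball_pos[of 1 "0 :: real ^ 'n"] by (simp add: measure_def)
  qed
  moreover have "0 \<le> integral\<^sup>L lborel \<beta>" using pos by (simp add: integral_nonneg_AE)
  ultimately have I: "0 < integral\<^sup>L lborel \<beta>" by simp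
  define \<rho> where "\<rho> = (\<lambda>x. (1 / integral\<^sup>L lborel \<beta>) * \<beta> x)"
  have "mollifier \<rho>"
    unfolding mollifier_def
  proof (intro conjI allI impI)
    show "C_k k \<rho>" for k unfolding \<rho>_def by (intro C_k_mult C_k_const C)
    show "integral\<^sup>L lborel \<rho> = 1"
      unfolding \<rho>_def using I by (subst integral_mult_right_zero) auto
  qed (use pos out I in \<open>auto simp: \<rho>_def \<beta>_def\<close>)
  then show ?thesis by blast
qed

section \<open>Mollification of integrable functions\<close>

lemma integrable_lborel_affine:
  fixes g :: "'a :: euclidean_space \<Rightarrow> 'b :: euclidean_space"
  assumes g: "integrable lborel g" and "c \<noteq> 0"
  shows "integrable lborel (\<lambda>x. g (t + c *\<^sub>R x))"
proof -
  have [measurable]: "g \<in> borel_measurable borel" using borel_measurable_integrable[OF g] by simp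
  have "integrable (density (distr lborel borel (\<lambda>x. t + c *\<^sub>R x)) (\<lambda>_. ennreal (\<bar>c\<bar> ^ DIM('a)))) g"
    using g lborel_affine[OF \<open>c \<noteq> 0\<close>, of t] by simp
  then have "integrable lborel (\<lambda>x. (\<bar>c\<bar> ^ DIM('a)) *\<^sub>R g (t + c *\<^sub>R x))"
    by (subst (asm) integrable_density) (auto simp: integrable_distr_eq)
  then have "integrable lborel (\<lambda>x. (1 / \<bar>c\<bar> ^ DIM('a)) *\<^sub>R ((\<bar>c\<bar> ^ DIM('a)) *\<^sub>R g (t + c *\<^sub>R x)))"
    by (rule integrable_scaleR_right)
  then show ?thesis using \<open>c \<noteq> 0\<close> by (simp only: scaleR_scaleR) simp
qed

lemma integral_lborel_affine:
  fixes g :: "'a :: euclidean_space \<Rightarrow> 'b :: euclidean_space"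
  assumes [measurable]: "g \<in> borel_measurable borel" and "c \<noteq> 0"
  shows "integral\<^sup>L lborel g = (\<bar>c\<bar> ^ DIM('a)) *\<^sub>R (\<integral>x. g (t + c *\<^sub>R x) \<partial>lborel)"
  by (subst lborel_affine[OF \<open>c \<noteq> 0\<close>, of t])
     (simp add: integral_density integral_distr)

lemma integrable_bounded_scaleR:
  fixes f :: "'a \<Rightarrow> 'b :: euclidean_space"
  assumes "integrable M f" "g \<in> borel_measurable M" "\<And>x. \<bar>g x\<bar> \<le> B"
  shows "integrable M (\<lambda>x. g x *\<^sub>R f x)"
proof (rule Bochner_Integration.integrable_bound)
  show "integrable M (\<lambda>x. B *\<^sub>R f x)" using assms(1) by simp
  show "(\<lambda>x. g x *\<^sub>R f x) \<in> borel_measurable M"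
    using assms(2) borel_measurable_integrable[OF assms(1)] by measurable
  show "AE x in M. norm (g x *\<^sub>R f x) \<le> norm (B *\<^sub>R f x)"
  proof (intro always_eventually allI)
    fix x
    have "\<bar>g x\<bar> \<le> \<bar>B\<bar>" using assms(3)[of x] by linarith
    then show "norm (g x *\<^sub>R f x) \<le> norm (B *\<^sub>R f x)" by (simp add: mult_right_mono)
  qed
qed

lemma integrable_borel_measurable:
  fixes f :: "'a :: euclidean_space \<Rightarrow> 'b :: euclidean_space"
  shows "integrable lborel f \<Longrightarrow> f \<in> borel_measurable borel"
  using borel_measurable_integrable by fastforce

text \<open>\<open>mol \<eta> f\<close> is the convolution of \<open>\<eta>\<close> and \<open>f\<close>. The rescaled form \<open>conv \<rho> \<delta> f\<close> averages \<open>f\<close> over a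
  ball of radius \<open>\<delta>\<close> with the fixed weight \<open>\<rho>\<close>.\<close>

definition mol :: "(real ^ 'n \<Rightarrow> real) \<Rightarrow> (real ^ 'n \<Rightarrow> 'b::euclidean_space) \<Rightarrow> real ^ 'n \<Rightarrow> 'b" where
  "mol \<eta> f z = (\<integral>y. \<eta> (z - y) *\<^sub>R f y \<partial>lborel)"

definition conv :: "(real ^ 'n \<Rightarrow> real) \<Rightarrow> real \<Rightarrow> (real ^ 'n \<Rightarrow> 'b::euclidean_space) \<Rightarrow> real ^ 'n \<Rightarrow> 'b" where
  "conv \<rho> \<delta> f z = (\<integral>w. \<rho> w *\<^sub>R f (z - \<delta> *\<^sub>R w) \<partial>lborel)"

definition scaled :: "(real ^ 'n \<Rightarrow> real) \<Rightarrow> real \<Rightarrow> real ^ 'n \<Rightarrow> real" where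
  "scaled \<rho> \<delta> x = (1 / \<delta> ^ CARD('n)) * \<rho> (x /\<^sub>R \<delta>)"

lemma test_fun_scaled:
  fixes \<rho> :: "real ^ 'n \<Rightarrow> real"
  shows "test_fun \<rho> \<Longrightarrow> \<delta> \<noteq> 0 \<Longrightarrow> test_fun (scaled \<rho> \<delta>)"
  unfolding scaled_def[abs_def] using test_fun_affine[of \<rho> "inverse \<delta>" "1 / \<delta> ^ CARD('n)" 0] by simp

lemma mol_scaled:
  fixes \<rho> :: "real ^ 'n \<Rightarrow> real"
  assumes "test_fun \<rho>" "f \<in> borel_measurable borel" "\<delta> > 0"
  shows "mol (scaled \<rho> \<delta>) f z = conv \<rho> \<delta> f z"
proof -
  have [measurable]: "scaled \<rho> \<delta> \<in> borel_measurable borel" "f \<in> borel_measurable borel"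
    using test_fun_borel[OF test_fun_scaled[of \<rho> \<delta>]] assms by auto
  have "mol (scaled \<rho> \<delta>) f z = (\<bar>-\<delta>\<bar> ^ DIM(real ^ 'n)) *\<^sub>R
      (\<integral>w. scaled \<rho> \<delta> (z - (z + (- \<delta>) *\<^sub>R w)) *\<^sub>R f (z + (- \<delta>) *\<^sub>R w) \<partial>lborel)"
    unfolding mol_def using assms(3) by (intro integral_lborel_affine) auto
  also have "\<dots> = (\<integral>w. (\<bar>-\<delta>\<bar> ^ DIM(real ^ 'n)) *\<^sub>R (scaled \<rho> \<delta> (z - (z + (- \<delta>) *\<^sub>R w)) *\<^sub>R f (z + (- \<delta>) *\<^sub>R w)) \<partial>lborel)"
    by (rule integral_scaleR_right[symmetric])
  also have "\<dots> = conv \<rho> \<delta> f z"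
    unfolding conv_def scaled_def using assms(3) by (intro Bochner_Integration.integral_cong) auto
  finally show ?thesis .
qed

lemma dirder_scaled:
  assumes "test_fun \<rho>" "\<delta> > 0"
  shows "dirder (scaled \<rho> \<delta>) v = (\<lambda>x. (1 / \<delta>) * scaled (dirder \<rho> v) \<delta> x)"
proof (rule ext)
  fix x :: "real ^ 'a"
  have "((\<lambda>x. x /\<^sub>R \<delta>) has_derivative (\<lambda>h. h /\<^sub>R \<delta>)) (at x)"
    by (auto intro!: derivative_eq_intros)
  from diff_chain_at[OF this test_fun_has_derivative[OF assms(1)]]
  have "((\<lambda>x. \<rho> (x /\<^sub>R \<delta>)) has_derivative (\<lambda>h. dirder \<rho> h (x /\<^sub>R \<delta>) / \<delta>)) (at x)"
    by (simp add: o_def linear_scale[OF dirder_linear[OF assms(1)]] divide_inverse mult.commute)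
  then have "(scaled \<rho> \<delta> has_derivative (\<lambda>h. (1 / \<delta> ^ CARD('a)) * (dirder \<rho> h (x /\<^sub>R \<delta>) / \<delta>))) (at x)"
    unfolding scaled_def[abs_def] by (rule has_derivative_mult_right)
  from dirder_eqI[OF this] show "dirder (scaled \<rho> \<delta>) v x = (1 / \<delta>) * scaled (dirder \<rho> v) \<delta> x"
    by (simp add: scaled_def)
qed

lemma dirder_Basis_expansion:
  assumes "test_fun \<eta>"
  shows "dirder \<eta> h x = (\<Sum>b\<in>Basis. (h \<bullet> b) * dirder \<eta> b x)"
proof -
  have "dirder \<eta> (\<Sum>b\<in>Basis. (h \<bullet> b) *\<^sub>R b) x = (\<Sum>b\<in>Basis. dirder \<eta> ((h \<bullet> b) *\<^sub>R b) x)"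
    using linear_sum[OF dirder_linear[OF assms]] .
  also have "\<dots> = (\<Sum>b\<in>Basis. (h \<bullet> b) * dirder \<eta> b x)"
    by (intro sum.cong refl) (use linear_scale[OF dirder_linear[OF assms, of x]] in simp)
  finally show ?thesis by (simp only: euclidean_representation)
qed

lemma test_fun_dirder_bound:
  assumes "test_fun \<eta>" obtains L where "0 \<le> L" "\<And>h x. \<bar>dirder \<eta> h x\<bar> \<le> L * norm h"
proof -
  have "\<forall>b. \<exists>B. (\<forall>x. \<bar>dirder \<eta> b x\<bar> \<le> B) \<and> 0 \<le> B"
    using test_fun_bounded[OF test_fun_dirder[OF assms]] by metis
  then obtain B where B: "\<And>b x. \<bar>dirder \<eta> b x\<bar> \<le> B b" "\<And>b. 0 \<le> B b" by metis
  show ?thesis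
  proof
    show "0 \<le> (\<Sum>b\<in>Basis. B b)" by (intro sum_nonneg B)
    fix h x :: "real ^ 'a"
    note dirder_Basis_expansion[OF assms, of h x]
    then have "\<bar>dirder \<eta> h x\<bar> \<le> (\<Sum>b\<in>Basis. \<bar>h \<bullet> b\<bar> * \<bar>dirder \<eta> b x\<bar>)"
      using sum_abs[of "\<lambda>b. (h \<bullet> b) * dirder \<eta> b x" Basis] by (simp add: abs_mult)
    also have "\<dots> \<le> (\<Sum>b\<in>Basis. norm h * B b)"
      by (intro sum_mono mult_mono) (auto simp: Basis_le_norm B)
    finally show "\<bar>dirder \<eta> h x\<bar> \<le> (\<Sum>b\<in>Basis. B b) * norm h"
      by (simp add: sum_distrib_left mult.commute)
  qed
qed

lemma test_fun_Lipschitz: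
  assumes "test_fun \<eta>" obtains L where "0 \<le> L" "\<And>x y. \<bar>\<eta> x - \<eta> y\<bar> \<le> L * norm (x - y)"
proof -
  obtain L where L: "0 \<le> L" "\<And>h x. \<bar>dirder \<eta> h x\<bar> \<le> L * norm h"
    using test_fun_dirder_bound[OF assms] by metis
  have "norm (\<eta> x - \<eta> y) \<le> L * norm (x - y)" for x y
  proof (rule differentiable_bound[where S=UNIV and f'="\<lambda>x h. dirder \<eta> h x"])
    show "(\<eta> has_derivative (\<lambda>h. dirder \<eta> h x)) (at x within UNIV)" for x
      using test_fun_has_derivative[OF assms] by simp
    show "onorm (\<lambda>h. dirder \<eta> h x) \<le> L" for x
      using L by (intro onorm_bound) auto
  qed auto
  then show ?thesis using that L(1) by simp
qed

text \<open>A second-order Taylor bound uniform in \<open>x\<close>: with it, differentiation of a convolution under the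
  integral sign is a single estimate.\<close>

lemma test_fun_second_order:
  assumes "test_fun \<eta>"
  obtains L where "0 \<le> L" "\<And>x h. \<bar>\<eta> (x + h) - \<eta> x - dirder \<eta> h x\<bar> \<le> L * (norm h)\<^sup>2"
proof -
  have "\<forall>b. \<exists>L. 0 \<le> L \<and> (\<forall>x y. \<bar>dirder \<eta> b x - dirder \<eta> b y\<bar> \<le> L * norm (x - y))"
    using test_fun_Lipschitz[OF test_fun_dirder[OF assms]] by metis
  then obtain B where B: "\<And>b. 0 \<le> B b" "\<And>b x y. \<bar>dirder \<eta> b x - dirder \<eta> b y\<bar> \<le> B b * norm (x - y)"
    by metis
  define L where "L = (\<Sum>b\<in>Basis. B b)"
  have L0: "0 \<le> L" unfolding L_def by (intro sum_nonneg B)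
  have Lip: "\<bar>dirder \<eta> h x - dirder \<eta> h y\<bar> \<le> L * norm (x - y) * norm h" for h x y
  proof -
    note dirder_Basis_expansion[OF assms, of h]
    then have "\<bar>dirder \<eta> h x - dirder \<eta> h y\<bar> = \<bar>\<Sum>b\<in>Basis. (h \<bullet> b) * (dirder \<eta> b x - dirder \<eta> b y)\<bar>"
      by (simp add: sum_subtractf right_diff_distrib)
    also have "\<dots> \<le> (\<Sum>b\<in>Basis. \<bar>h \<bullet> b\<bar> * \<bar>dirder \<eta> b x - dirder \<eta> b y\<bar>)"
      using sum_abs[of "\<lambda>b. (h \<bullet> b) * (dirder \<eta> b x - dirder \<eta> b y)" Basis] by (simp add: abs_mult)
    also have "\<dots> \<le> (\<Sum>b\<in>Basis. norm h * (B b * norm (x - y)))"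
      by (intro sum_mono mult_mono) (auto simp: Basis_le_norm B)
    also have "\<dots> = L * norm (x - y) * norm h"
      unfolding L_def sum_distrib_right by (intro sum.cong refl) simp
    finally show ?thesis .
  qed
  have "\<bar>\<eta> (x + h) - \<eta> x - dirder \<eta> h x\<bar> \<le> L * (norm h)\<^sup>2" for x h
  proof -
    let ?g = "\<lambda>s. \<eta> (x + s) - dirder \<eta> s x"
    have "norm (?g h - ?g 0) \<le> (L * norm h) * norm (h - 0)"
    proof (rule differentiable_bound[where S="cball 0 (norm h)" and f'="\<lambda>s k. dirder \<eta> k (x + s) - dirder \<eta> k x"])
      show "(?g has_derivative (\<lambda>k. dirder \<eta> k (x + s) - dirder \<eta> k x)) (at s within cball 0 (norm h))" for s
      proof (rule has_derivative_diff)
        have "((\<lambda>s. x + s) has_derivative (\<lambda>k. k)) (at s)" by (auto intro!: derivative_eq_intros)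
        from diff_chain_at[OF this test_fun_has_derivative[OF assms]]
        show "((\<lambda>s. \<eta> (x + s)) has_derivative (\<lambda>k. dirder \<eta> k (x + s))) (at s within cball 0 (norm h))"
          by (simp add: o_def has_derivative_at_withinI)
        show "((\<lambda>s. dirder \<eta> s x) has_derivative (\<lambda>k. dirder \<eta> k x)) (at s within cball 0 (norm h))"
          by (rule linear_imp_has_derivative[OF dirder_linear[OF assms]])
      qed
      show "onorm (\<lambda>k. dirder \<eta> k (x + s) - dirder \<eta> k x) \<le> L * norm h" if "s \<in> cball 0 (norm h)" for s
      proof (rule onorm_bound)
        fix k
        have "norm (dirder \<eta> k (x + s) - dirder \<eta> k x) \<le> L * norm s * norm k"
          using Lip[of k "x + s" x] by simp
        also have "\<dots> \<le> L * norm h * norm k"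
          using that L0 by (intro mult_right_mono mult_left_mono) auto
        finally show "norm (dirder \<eta> k (x + s) - dirder \<eta> k x) \<le> L * norm h * norm k" .
      qed (use L0 in auto)
    qed auto
    moreover have "dirder \<eta> 0 x = 0" using linear_0[OF dirder_linear[OF assms]] .
    ultimately show ?thesis by (simp add: power2_eq_square algebra_simps)
  qed
  then show ?thesis using that L0 by blast
qed

lemma mol_integrable:
  fixes f :: "real ^ 'n \<Rightarrow> 'b :: euclidean_space"
  assumes "test_fun \<eta>" "integrable lborel f"
  shows "integrable lborel (\<lambda>y. \<eta> (z - y) *\<^sub>R f y)"
proof -
  note [measurable] = test_fun_borel[OF assms(1)]
  obtain B where "\<And>x. \<bar>\<eta> x\<bar> \<le> B" using test_fun_bounded[OF assms(1)] by metis
  then show ?thesis by (intro integrable_bounded_scaleR[OF assms(2), of _ B]) auto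
qed

lemma mol_has_derivative:
  assumes \<eta>: "test_fun \<eta>" and f: "integrable lborel f"
  shows "(mol \<eta> f has_derivative (\<lambda>h. mol (dirder \<eta> h) f z)) (at z)"
proof -
  obtain L where L: "0 \<le> L" "\<And>x h. \<bar>\<eta> (x + h) - \<eta> x - dirder \<eta> h x\<bar> \<le> L * (norm h)\<^sup>2"
    using test_fun_second_order[OF \<eta>] by metis
  note I = mol_integrable[OF \<eta> f] and I' = mol_integrable[OF test_fun_dirder[OF \<eta>] f]
  have lin: "linear (\<lambda>h. mol (dirder \<eta> h) f z)"
    unfolding mol_def
    by (rule linearI)
       (simp_all add: linear_add[OF dirder_linear[OF \<eta>]] linear_scale[OF dirder_linear[OF \<eta>]]
          scaleR_left_distrib I' flip: scaleR_scaleR)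
  have est: "norm (mol \<eta> f (z + h) - mol \<eta> f z - mol (dirder \<eta> h) f z) \<le> L * (norm h)\<^sup>2 * (\<integral>y. norm (f y) \<partial>lborel)" for h
  proof -
    have "norm (mol \<eta> f (z + h) - mol \<eta> f z - mol (dirder \<eta> h) f z)
        = norm (\<integral>y. \<eta> (z + h - y) *\<^sub>R f y - \<eta> (z - y) *\<^sub>R f y - dirder \<eta> h (z - y) *\<^sub>R f y \<partial>lborel)"
      unfolding mol_def by (simp add: I I')
    also have "\<dots> \<le> (\<integral>y. norm (\<eta> (z + h - y) *\<^sub>R f y - \<eta> (z - y) *\<^sub>R f y - dirder \<eta> h (z - y) *\<^sub>R f y) \<partial>lborel)"
      by (rule integral_norm_bound)
    also have "\<dots> \<le> (\<integral>y. (L * (norm h)\<^sup>2) * norm (f y) \<partial>lborel)"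
    proof (rule integral_mono)
      show "integrable lborel (\<lambda>y. norm (\<eta> (z + h - y) *\<^sub>R f y - \<eta> (z - y) *\<^sub>R f y - dirder \<eta> h (z - y) *\<^sub>R f y))"
        by (intro integrable_norm Bochner_Integration.integrable_diff I I')
      show "integrable lborel (\<lambda>y. (L * (norm h)\<^sup>2) * norm (f y))" using f by simp
      fix y
      have eq: "z - y + h = z + h - y" by simp
      have "\<bar>\<eta> (z + h - y) - \<eta> (z - y) - dirder \<eta> h (z - y)\<bar> \<le> L * (norm h)\<^sup>2"
        using L(2)[of "z - y" h] unfolding eq .
      then show "norm (\<eta> (z + h - y) *\<^sub>R f y - \<eta> (z - y) *\<^sub>R f y - dirder \<eta> h (z - y) *\<^sub>R f y) \<le> (L * (norm h)\<^sup>2) * norm (f y)"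
        unfolding scaleR_left_diff_distrib[symmetric] norm_scaleR real_norm_def by (rule mult_right_mono) simp
    qed
    finally show ?thesis by simp
  qed
  show ?thesis
  proof (rule has_derivativeI_sandwich[where e=1 and H="\<lambda>y. L * norm (y - z) * (\<integral>y. norm (f y) \<partial>lborel)"])
    show "bounded_linear (\<lambda>h. mol (dirder \<eta> h) f z)" using lin by (simp add: linear_conv_bounded_linear)
    show "((\<lambda>y. L * norm (y - z) * (\<integral>y. norm (f y) \<partial>lborel)) \<longlongrightarrow> 0) (at z)"
      by (rule tendsto_eq_intros refl)+ auto
    fix y assume "y \<noteq> z"
    then show "norm (mol \<eta> f y - mol \<eta> f z - mol (dirder \<eta> (y - z)) f z) / norm (y - z)
       \<le> L * norm (y - z) * (\<integral>y. norm (f y) \<partial>lborel)"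
      using est[of "y - z"] by (simp add: divide_le_eq power2_eq_square mult_ac)
  qed auto
qed

lemma C_k_mol:
  assumes "test_fun \<eta>" "integrable lborel f" shows "C_k k (mol \<eta> f)"
  using assms(1)
proof (induction k arbitrary: \<eta>)
  case 0
  have "continuous_on UNIV (mol \<eta> f)"
    by (intro continuous_at_imp_continuous_on ballI has_derivative_continuous[OF mol_has_derivative[OF 0 assms(2)]])
  then show ?case by simp
next
  case (Suc k)
  show ?case
    by (rule C_k_SucI[OF mol_has_derivative[OF Suc.prems assms(2)]])
       (use Suc.IH[OF test_fun_dirder[OF Suc.prems]] in \<open>simp add: mol_def[abs_def]\<close>)
qed

lemma conv_eq_mol:
  assumes "test_fun \<rho>" "integrable lborel f" "\<delta> > 0"
  shows "conv \<rho> \<delta> f = mol (scaled \<rho> \<delta>) f"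
  using mol_scaled[OF assms(1) integrable_borel_measurable[OF assms(2)] assms(3)] by (simp add: fun_eq_iff)

lemma conv_integrable:
  fixes f :: "real ^ 'n \<Rightarrow> 'b :: euclidean_space"
  assumes "test_fun \<rho>" "integrable lborel f" "\<delta> \<noteq> 0"
  shows "integrable lborel (\<lambda>w. \<rho> w *\<^sub>R f (z - \<delta> *\<^sub>R w))"
proof -
  obtain B where "\<And>x. \<bar>\<rho> x\<bar> \<le> B" using test_fun_bounded[OF assms(1)] by metis
  then show ?thesis
    using integrable_lborel_affine[OF assms(2), of "- \<delta>" z] assms(3) test_fun_borel[OF assms(1)]
    by (intro integrable_bounded_scaleR[of _ _ _ B]) auto
qed

text \<open>For the indicator of an open set this is dominated convergence, since a point of an open set stays in
  it under small translations. Open sets approximate Borel sets of finite measure, and simple functions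
  approximate integrable ones.\<close>

lemma translation_L1:
  fixes f :: "'a :: euclidean_space \<Rightarrow> 'b :: euclidean_space"
  assumes "integrable lborel f" "h \<longlonglongrightarrow> 0"
  shows "(\<lambda>n. \<integral>x. norm (f (x + h n) - f x) \<partial>lborel) \<longlonglongrightarrow> 0"
  using assms(1)
proof (induction f rule: integrable_induct)
  case (base A c)
  have shift: "integrable lborel (\<lambda>x. g (x + t))" if "integrable lborel g" for g :: "'a \<Rightarrow> real" and t
    using integrable_lborel_affine[OF that, of 1 t] by (simp add: add.commute)
  have shift_int: "(\<integral>x. g (x + t) \<partial>lborel) = integral\<^sup>L lborel g" if "integrable lborel g" for g :: "'a \<Rightarrow> real" and t
    using integral_lborel_affine[OF integrable_borel_measurable[OF that], of 1 t] by (simp add: add.commute)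
  have open_case: "(\<lambda>n. \<integral>x. \<bar>indicat_real U (x + h n) - indicat_real U x\<bar> \<partial>lborel) \<longlonglongrightarrow> 0"
    if U: "open U" "emeasure lborel U < \<infinity>" for U :: "'a set"
  proof -
    have iU: "integrable lborel (indicator U :: 'a \<Rightarrow> real)" using U by (simp add: borel_open)
    have iUh: "integrable lborel (\<lambda>x. indicator U x * indicator U (x + t) :: real)" for t
    proof (rule Bochner_Integration.integrable_bound[OF iU])
      have [measurable]: "U \<in> sets borel" using U by (simp add: borel_open)
      show "(\<lambda>x. indicator U x * indicator U (x + t) :: real) \<in> borel_measurable lborel" by measurable
    qed (auto simp: indicator_def)
    have lim: "(\<lambda>n. \<integral>x. indicator U x * indicator U (x + h n) \<partial>lborel) \<longlonglongrightarrow> (\<integral>x. indicator U x \<partial>lborel :: real)"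
    proof (rule integral_dominated_convergence[where w="indicator U"])
      show "AE x in lborel. (\<lambda>n. indicator U x * indicator U (x + h n) :: real) \<longlonglongrightarrow> indicator U x"
      proof (intro always_eventually allI)
        fix x
        show "(\<lambda>n. indicator U x * indicator U (x + h n) :: real) \<longlonglongrightarrow> indicator U x"
        proof (cases "x \<in> U")
          case True
          have "(\<lambda>n. x + h n) \<longlonglongrightarrow> x" using tendsto_add[OF tendsto_const assms(2)] by simp
          then have "\<forall>\<^sub>F n in sequentially. x + h n \<in> U" by (rule topological_tendstoD) (use U True in auto)
          then show ?thesis
            by (intro tendsto_eventually) (auto elim!: eventually_mono simp: True)
        qed simp
      qed
      have [measurable]: "U \<in> sets borel" using U by (simp add: borel_open)
      show "indicator U \<in> borel_measurable lborel" by measurable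
      show "(\<lambda>x. indicator U x * indicator U (x + h n) :: real) \<in> borel_measurable lborel" for n by measurable
    qed (use iU in \<open>auto simp: indicator_def\<close>)
    have "(\<integral>x. \<bar>indicat_real U (x + h n) - indicat_real U x\<bar> \<partial>lborel)
        = 2 * (\<integral>x. indicator U x \<partial>lborel) - 2 * (\<integral>x. indicator U x * indicator U (x + h n) \<partial>lborel :: real)" for n
    proof -
      have "\<bar>indicat_real U (x + h n) - indicat_real U x\<bar>
          = indicator U (x + h n) + indicator U x - 2 * (indicator U x * indicator U (x + h n) :: real)" for x
        by (auto simp: indicator_def)
      then have "(\<integral>x. \<bar>indicat_real U (x + h n) - indicat_real U x\<bar> \<partial>lborel :: real)
          = (\<integral>x. indicator U (x + h n) + indicator U x - 2 * (indicator U x * indicator U (x + h n)) \<partial>lborel)"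
        by simp
      also have "\<dots> = (\<integral>x. indicator U (x + h n) \<partial>lborel) + (\<integral>x. indicator U x \<partial>lborel)
          - 2 * (\<integral>x. indicator U x * indicator U (x + h n) \<partial>lborel :: real)"
        using shift[OF iU] iU iUh by simp
      finally show ?thesis using shift_int[OF iU, of "h n"] by simp
    qed
    then show ?thesis using tendsto_diff[OF tendsto_const tendsto_mult_left[OF lim, of 2], of "2 * (\<integral>x. indicator U x \<partial>lborel)"]
      by simp
  qed
  have A: "A \<in> sets borel" "emeasure lborel A < \<infinity>" using base by auto
  have set_case: "(\<lambda>n. \<integral>x. \<bar>indicat_real A (x + h n) - indicat_real A x\<bar> \<partial>lborel :: real) \<longlonglongrightarrow> 0"
  proof (rule LIMSEQ_I)
    fix e :: real assume e: "e > 0"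
    obtain U where U: "open U" "A \<subseteq> U" "emeasure lborel (U - A) < ennreal (e / 4)"
      using outer_regular_lborel[OF A(1), of "e/4"] e by auto
    have "emeasure lborel U \<le> emeasure lborel A + emeasure lborel (U - A)"
      by (rule order_trans[OF _ emeasure_subadditive]) (use U A in \<open>auto intro!: emeasure_mono simp: borel_open\<close>)
    also have "\<dots> < \<infinity>" using U(3) A(2) by (auto simp: less_top[symmetric] top_unique)
    finally have Ufin: "emeasure lborel U < \<infinity>" .
    define D where "D = (indicator (U - A) :: 'a \<Rightarrow> real)"
    have UA: "emeasure lborel (U - A) < \<infinity>" using U(3) by (auto simp: less_top[symmetric] top_unique)
    have iD: "integrable lborel D" unfolding D_def using UA U A by (simp add: borel_open)
    have D: "integral\<^sup>L lborel D < e / 4"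
      unfolding D_def using U(3) UA U A e
      by (simp add: borel_open emeasure_eq_ennreal_measure less_top[symmetric] ennreal_less_iff)
    have iI: "integrable lborel (indicator U :: 'a \<Rightarrow> real)" "integrable lborel (indicator A :: 'a \<Rightarrow> real)"
      using Ufin A U by (auto simp: borel_open)
    obtain N where N: "\<And>n. n \<ge> N \<Longrightarrow> \<bar>\<integral>x. \<bar>indicat_real U (x + h n) - indicat_real U x\<bar> \<partial>lborel :: real\<bar> < e / 4"
      using LIMSEQ_D[OF open_case[OF U(1) Ufin], of "e/4"] e by auto
    show "\<exists>N. \<forall>n\<ge>N. norm ((\<integral>x. \<bar>indicat_real A (x + h n) - indicat_real A x\<bar> \<partial>lborel :: real) - 0) < e"
    proof (intro exI allI impI)
      fix n assume "n \<ge> N"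
      have "(\<integral>x. \<bar>indicat_real A (x + h n) - indicat_real A x\<bar> \<partial>lborel :: real)
          \<le> (\<integral>x. D (x + h n) + \<bar>indicat_real U (x + h n) - indicat_real U x\<bar> + D x \<partial>lborel)"
      proof (rule integral_mono)
        show "integrable lborel (\<lambda>x. \<bar>indicat_real A (x + h n) - indicat_real A x\<bar>)"
          "integrable lborel (\<lambda>x. D (x + h n) + \<bar>indicat_real U (x + h n) - indicat_real U x\<bar> + D x)"
          by (intro Bochner_Integration.integrable_add integrable_abs Bochner_Integration.integrable_diff shift iI iD)+
      qed (use U(2) in \<open>auto simp: D_def indicator_def\<close>)
      also have "\<dots> = integral\<^sup>L lborel D + (\<integral>x. \<bar>indicat_real U (x + h n) - indicat_real U x\<bar> \<partial>lborel) + integral\<^sup>L lborel D"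
        using shift[OF iI(1)] iI iD shift[OF iD] shift_int[OF iD] by simp
      also have "\<dots> < e" using D N[OF \<open>n \<ge> N\<close>] e by linarith
      finally show "norm ((\<integral>x. \<bar>indicat_real A (x + h n) - indicat_real A x\<bar> \<partial>lborel :: real) - 0) < e"
        by simp
    qed
  qed
  have "norm (indicator A (x + h n) *\<^sub>R c - indicator A x *\<^sub>R c) = norm c * \<bar>indicat_real A (x + h n) - indicat_real A x\<bar>" for x n
    by (auto simp: indicator_def)
  then show ?case using tendsto_mult_left[OF set_case, of "norm c"] by simp
next
  case (add f g)
  have sh: "integrable lborel (\<lambda>x. u (x + t))" if "integrable lborel u" for u :: "'a \<Rightarrow> 'b" and t
    using integrable_lborel_affine[OF that, of 1 t] by (simp add: add.commute)
  show ?case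
  proof (rule tendsto_sandwich[OF _ _ tendsto_const])
    show "(\<lambda>n. (\<integral>x. norm (f (x + h n) - f x) \<partial>lborel) + (\<integral>x. norm (g (x + h n) - g x) \<partial>lborel)) \<longlonglongrightarrow> 0"
      using tendsto_add[OF add.IH] by simp
    show "\<forall>\<^sub>F n in sequentially. (\<integral>x. norm (f (x + h n) + g (x + h n) - (f x + g x)) \<partial>lborel)
       \<le> (\<integral>x. norm (f (x + h n) - f x) \<partial>lborel) + (\<integral>x. norm (g (x + h n) - g x) \<partial>lborel)"
    proof (intro always_eventually allI)
      fix n
      have "(\<integral>x. norm (f (x + h n) + g (x + h n) - (f x + g x)) \<partial>lborel)
          \<le> (\<integral>x. norm (f (x + h n) - f x) + norm (g (x + h n) - g x) \<partial>lborel)"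
        using add.hyps sh by (intro integral_mono norm_diff_triangle_ineq) auto
      then show "(\<integral>x. norm (f (x + h n) + g (x + h n) - (f x + g x)) \<partial>lborel)
          \<le> (\<integral>x. norm (f (x + h n) - f x) \<partial>lborel) + (\<integral>x. norm (g (x + h n) - g x) \<partial>lborel)"
        using add.hyps sh by simp
    qed
  qed auto
next
  case (lim f s)
  have sh: "integrable lborel (\<lambda>x. u (x + t))" if "integrable lborel u" for u :: "'a \<Rightarrow> 'b" and t
    using integrable_lborel_affine[OF that, of 1 t] by (simp add: add.commute)
  have sh_int: "(\<integral>x. norm (u (x + t)) \<partial>lborel) = (\<integral>x. norm (u x) \<partial>lborel)" if "integrable lborel u" for u :: "'a \<Rightarrow> 'b" and t
    using integral_lborel_affine[of "\<lambda>x. norm (u x)" 1 t] integrable_borel_measurable[OF that]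
    by (simp add: add.commute)
  have approx: "(\<lambda>i. \<integral>x. norm (s i x - f x) \<partial>lborel) \<longlonglongrightarrow> integral\<^sup>L (lborel :: 'a measure) (\<lambda>x. 0)"
  proof (rule integral_dominated_convergence[where w="\<lambda>x. 3 * norm (f x)"])
    show "(\<lambda>x. norm (s i x - f x)) \<in> borel_measurable lborel" for i
      using lim.hyps by (intro borel_measurable_norm borel_measurable_diff borel_measurable_integrable) auto
    show "AE x in lborel. (\<lambda>i. norm (s i x - f x)) \<longlonglongrightarrow> 0"
      using lim.hyps(2) by (intro always_eventually allI tendsto_norm_zero) (simp add: LIM_zero)
    show "AE x in lborel. norm (norm (s i x - f x)) \<le> 3 * norm (f x)" for i
    proof (intro always_eventually allI)
      fix x
      have "norm (s i x - f x) \<le> norm (s i x) + norm (f x)" by (rule norm_triangle_ineq4)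
      then show "norm (norm (s i x - f x)) \<le> 3 * norm (f x)" using lim.hyps(3)[of x i] by simp
    qed
  qed (use lim.hyps in auto)
  show ?case
  proof (rule LIMSEQ_I)
    fix e :: real assume e: "e > 0"
    obtain i where i: "(\<integral>x. norm (s i x - f x) \<partial>lborel) < e / 3"
      using LIMSEQ_D[OF approx, of "e/3"] e by fastforce
    obtain N where N: "\<And>n. n \<ge> N \<Longrightarrow> (\<integral>x. norm (s i (x + h n) - s i x) \<partial>lborel) < e / 3"
      using LIMSEQ_D[OF lim.IH[of i], of "e/3"] e by fastforce
    have I: "integrable lborel (\<lambda>x. s i x - f x)" using lim.hyps by auto
    show "\<exists>N. \<forall>n\<ge>N. norm ((\<integral>x. norm (f (x + h n) - f x) \<partial>lborel) - 0) < e"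
    proof (intro exI allI impI)
      fix n assume "n \<ge> N"
      have "(\<integral>x. norm (f (x + h n) - f x) \<partial>lborel)
         \<le> (\<integral>x. norm (s i (x + h n) - f (x + h n)) + norm (s i (x + h n) - s i x) + norm (s i x - f x) \<partial>lborel)"
      proof (rule integral_mono)
        fix x
        have "f (x + h n) - f x = - (s i (x + h n) - f (x + h n)) + (s i (x + h n) - s i x) + (s i x - f x)" by simp
        then show "norm (f (x + h n) - f x) \<le> norm (s i (x + h n) - f (x + h n)) + norm (s i (x + h n) - s i x) + norm (s i x - f x)"
          by (metis norm_minus_cancel norm_triangle_le norm_triangle_mono order_refl)
      qed (use lim.hyps sh I in auto)
      also have "\<dots> = (\<integral>x. norm (s i x - f x) \<partial>lborel) + (\<integral>x. norm (s i (x + h n) - s i x) \<partial>lborel) + (\<integral>x. norm (s i x - f x) \<partial>lborel)"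
        using lim.hyps sh I sh[OF I] sh_int[OF I, of "h n"] by simp
      also have "\<dots> < e" using i N[OF \<open>n \<ge> N\<close>] by linarith
      finally show "norm ((\<integral>x. norm (f (x + h n) - f x) \<partial>lborel) - 0) < e" by simp
    qed
  qed
qed

lemma translation_L1_at_0:
  fixes f :: "'a :: euclidean_space \<Rightarrow> 'b :: euclidean_space"
  assumes "integrable lborel f" "e > 0"
  obtains d where "d > 0" "\<And>h. norm h < d \<Longrightarrow> (\<integral>x. norm (f (x + h) - f x) \<partial>lborel) < e"
proof -
  have "\<exists>d>0. \<forall>h. norm h < d \<longrightarrow> (\<integral>x. norm (f (x + h) - f x) \<partial>lborel) < e"
  proof (rule ccontr)
    assume "\<not> ?thesis"
    then have "\<forall>n. \<exists>h. norm h < inverse (real (Suc n)) \<and> \<not> (\<integral>x. norm (f (x + h) - f x) \<partial>lborel) < e"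
      by (metis inverse_positive_iff_positive of_nat_0_less_iff zero_less_Suc)
    then obtain h where h: "\<And>n. norm (h n) < inverse (real (Suc n))"
        "\<And>n. \<not> (\<integral>x. norm (f (x + h n) - f x) \<partial>lborel) < e" by metis
    have "h \<longlonglongrightarrow> 0"
      by (rule Lim_null_comparison[OF always_eventually[OF allI[OF less_imp_le[OF h(1)]]] LIMSEQ_inverse_real_of_nat])
    from LIMSEQ_D[OF translation_L1[OF assms(1) this] assms(2)] h(2) show False by fastforce
  qed
  then show ?thesis using that by blast
qed

text \<open>The centres of the balls may drift away from \<open>x\<close> at the rate \<open>\<delta>\<close>: every point that enters the
  average differs from \<open>x\<close> by at most \<open>\<delta> * (norm v + 1)\<close>, so the continuity of translations in
  \<open>L\<^sup>1\<close> and Fubini's theorem give the limit.\<close>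

lemma conv_shift_L1:
  fixes f :: "real ^ 'n \<Rightarrow> 'b :: euclidean_space"
  assumes \<rho>: "mollifier \<rho>" and f: "integrable lborel f"
    and \<delta>: "\<delta> \<longlonglongrightarrow> 0" "\<And>n. \<delta> n > 0"
  shows "(\<lambda>n. \<integral>\<^sup>+x. ennreal (norm (conv \<rho> (\<delta> n) f (x - \<delta> n *\<^sub>R v) - f x)) \<partial>lborel) \<longlonglongrightarrow> 0"
proof -
  note t = mollifier_test_fun[OF \<rho>]
  note [measurable] = test_fun_borel[OF t] integrable_borel_measurable[OF f]
  have \<rho>0: "\<rho> x \<ge> 0" "1 < norm x \<Longrightarrow> \<rho> x = 0" for x using \<rho> by (auto simp: mollifier_def)
  have I1: "integral\<^sup>L lborel \<rho> = 1" using \<rho> by (auto simp: mollifier_def)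
  have nn1: "(\<integral>\<^sup>+w. ennreal (\<rho> w) \<partial>lborel) = 1"
    using nn_integral_eq_integral[OF test_fun_integrable[OF t]] I1 \<rho>0 by simp
  show ?thesis
  proof (rule tendsto_zero_ennreal)
    fix e :: real assume e: "e > 0"
    obtain d where d: "d > 0" "\<And>h. norm h < d \<Longrightarrow> (\<integral>x. norm (f (x + h) - f x) \<partial>lborel) < e / 2"
      using translation_L1_at_0[OF f, of "e/2"] e by auto
    have "(\<lambda>n. \<delta> n * (norm v + 1)) \<longlonglongrightarrow> 0"
      using tendsto_mult_right[OF \<delta>(1), of "norm v + 1"] by simp
    then have "\<forall>\<^sub>F n in sequentially. \<delta> n * (norm v + 1) < d" by (rule order_tendstoD) fact
    then show "\<forall>\<^sub>F n in sequentially. (\<integral>\<^sup>+x. ennreal (norm (conv \<rho> (\<delta> n) f (x - \<delta> n *\<^sub>R v) - f x)) \<partial>lborel) < ennreal e"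
    proof eventually_elim
      case (elim n)
      define D where "D = \<delta> n"
      have D: "D > 0" "D * (norm v + 1) < d" using elim \<delta>(2) by (auto simp: D_def)
      have pt: "ennreal (norm (conv \<rho> D f (x - D *\<^sub>R v) - f x))
          \<le> (\<integral>\<^sup>+w. ennreal (\<rho> w * norm (f (x - D *\<^sub>R v - D *\<^sub>R w) - f x)) \<partial>lborel)" for x
      proof -
        note I = conv_integrable[OF t f, of D "x - D *\<^sub>R v"]
        have "integrable lborel (\<lambda>w. \<rho> w *\<^sub>R f x)" using test_fun_integrable[OF t] by simp
        then have "ennreal (norm (conv \<rho> D f (x - D *\<^sub>R v) - f x))
            = ennreal (norm (\<integral>w. \<rho> w *\<^sub>R f (x - D *\<^sub>R v - D *\<^sub>R w) - \<rho> w *\<^sub>R f x \<partial>lborel))"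
          unfolding conv_def using I D I1 test_fun_integrable[OF t] by simp
        also have "\<dots> \<le> (\<integral>\<^sup>+w. norm (\<rho> w *\<^sub>R f (x - D *\<^sub>R v - D *\<^sub>R w) - \<rho> w *\<^sub>R f x) \<partial>lborel)"
          by (rule integral_norm_bound_ennreal) (use I D test_fun_integrable[OF t] in auto)
        finally show ?thesis by (simp add: \<rho>0 flip: scaleR_right_diff_distrib)
      qed
      have inner: "(\<integral>\<^sup>+x. ennreal (\<rho> w * norm (f (x - D *\<^sub>R v - D *\<^sub>R w) - f x)) \<partial>lborel) \<le> ennreal (\<rho> w) * ennreal (e / 2)" for w
      proof (cases "\<rho> w = 0")
        case False
        define h where "h = - (D *\<^sub>R v + D *\<^sub>R w)"
        have "norm w \<le> 1" using False \<rho>0(2)[of w] by force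
        have "norm h \<le> norm (D *\<^sub>R v) + norm (D *\<^sub>R w)" unfolding h_def norm_minus_cancel by (rule norm_triangle_ineq)
        also have "\<dots> \<le> D * norm v + D * 1" using D \<open>norm w \<le> 1\<close> by (auto intro!: mult_left_mono)
        finally have "norm h < d" using D(2) by (simp add: algebra_simps)
        have "integrable lborel (\<lambda>x. f (x + h))"
          using integrable_lborel_affine[OF f, of 1 h] by (simp add: add.commute)
        then have "(\<integral>\<^sup>+x. ennreal (norm (f (x + h) - f x)) \<partial>lborel) = ennreal (\<integral>x. norm (f (x + h) - f x) \<partial>lborel)"
          using f by (intro nn_integral_eq_integral) auto
        also have "\<dots> \<le> ennreal (e / 2)" using d(2)[OF \<open>norm h < d\<close>] by (intro ennreal_leI) simp
        finally have "(\<integral>\<^sup>+x. ennreal (norm (f (x + h) - f x)) \<partial>lborel) \<le> ennreal (e / 2)" .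
        moreover have eq: "x - D *\<^sub>R v - D *\<^sub>R w = x + h" for x by (simp add: h_def)
        ultimately show ?thesis unfolding eq
          using \<rho>0 by (simp add: ennreal_mult nn_integral_cmult mult_left_mono)
      qed simp
      have "(\<integral>\<^sup>+x. ennreal (norm (conv \<rho> D f (x - D *\<^sub>R v) - f x)) \<partial>lborel)
          \<le> (\<integral>\<^sup>+x. (\<integral>\<^sup>+w. ennreal (\<rho> w * norm (f (x - D *\<^sub>R v - D *\<^sub>R w) - f x)) \<partial>lborel) \<partial>lborel)"
        by (intro nn_integral_mono pt)
      also have "\<dots> = (\<integral>\<^sup>+w. (\<integral>\<^sup>+x. ennreal (\<rho> w * norm (f (x - D *\<^sub>R v - D *\<^sub>R w) - f x)) \<partial>lborel) \<partial>lborel)"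
        by (rule lborel_pair.Fubini') measurable
      also have "\<dots> \<le> (\<integral>\<^sup>+w. ennreal (\<rho> w) * ennreal (e / 2) \<partial>lborel)"
        by (intro nn_integral_mono inner)
      also have "\<dots> = ennreal (e / 2)" by (simp add: nn_integral_multc nn1)
      also have "\<dots> < ennreal e" using e by (simp add: ennreal_lessI)
      finally show ?case unfolding D_def .
    qed
  qed
qed

section \<open>Sobolev functions with zero boundary values\<close>

lemma norm_vec_le_sum: "norm (x :: 'a :: real_normed_vector ^ 'd) \<le> (\<Sum>i\<in>UNIV. norm (x $ i))"
  unfolding norm_vec_def by (rule L2_set_le_sum) simp

lemma norm_matrix_vector_le:
  fixes A :: "real ^ 'n ^ 'd"
  shows "norm (A *v x) \<le> real CARD('d) * norm A * norm x"
proof -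
  have "norm (A *v x) \<le> (\<Sum>i\<in>UNIV. norm ((A *v x) $ i))" by (rule norm_vec_le_sum)
  also have "\<dots> \<le> (\<Sum>i\<in>(UNIV :: 'd set). norm A * norm x)"
  proof (rule sum_mono)
    fix i
    have "norm ((A *v x) $ i) \<le> norm (A $ i) * norm x"
      unfolding matrix_vector_mul_component real_norm_def by (rule Cauchy_Schwarz_ineq2)
    also have "\<dots> \<le> norm A * norm x"
      by (intro mult_right_mono Finite_Cartesian_Product.norm_nth_le) auto
    finally show "norm ((A *v x) $ i) \<le> norm A * norm x" .
  qed
  finally show ?thesis by simp
qed

lemma bounded_linear_matrix_vector_left: "bounded_linear (\<lambda>A :: real ^ 'n ^ 'd. A *v h)"
proof (rule bounded_linear_intro)
  show "norm (A *v h) \<le> norm A * (real CARD('d) * norm h)" for A :: "real ^ 'n ^ 'd"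
    using norm_matrix_vector_le[of A h] by (simp add: mult_ac)
qed (simp_all add: matrix_vector_mult_add_rdistrib scaleR_matrix_vector_assoc)

lemma integrable_continuous_bounded_support:
  fixes f :: "'a :: euclidean_space \<Rightarrow> 'b :: euclidean_space"
  assumes "continuous_on UNIV f" "\<And>x. R < norm x \<Longrightarrow> f x = 0"
  shows "integrable lborel f"
proof -
  have "integrable lborel (\<lambda>x. indicator (cball 0 R) x *\<^sub>R f x)"
    by (intro borel_integrable_compact continuous_on_subset[OF assms(1)]) auto
  moreover have "(\<lambda>x. indicator (cball 0 R) x *\<^sub>R f x) = f"
    using assms(2) by (force simp: indicator_def)
  ultimately show ?thesis by (simp only:)
qed

text \<open>Difference quotients have integral zero, by translation invariance; the derivative is their dominated
  limit.\<close>

lemma integral_derivative_zero: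
  fixes f :: "'a :: euclidean_space \<Rightarrow> 'b :: euclidean_space"
  assumes der: "\<And>x. (f has_derivative f' x) (at x)"
    and bd: "\<And>x h. norm (f' x h) \<le> B * norm h"
    and supp: "\<And>x. R < norm x \<Longrightarrow> f x = 0"
  shows "integral\<^sup>L lborel (\<lambda>x. f' x v) = 0"
proof (cases "v = 0")
  case True
  then show ?thesis using linear_0[OF has_derivative_linear[OF der]] by simp
next
  case False
  have cont: "continuous_on UNIV f"
    by (intro continuous_at_imp_continuous_on ballI has_derivative_continuous[OF der])
  note int = integrable_continuous_bounded_support[OF cont supp]
  define t where "t = (\<lambda>n. inverse (real (Suc n)))"
  have t: "t n > 0" "t n \<le> 1" for n by (auto simp: t_def inverse_le_1_iff)
  have t0: "t \<longlonglongrightarrow> 0" unfolding t_def by (rule LIMSEQ_inverse_real_of_nat)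
  define s where "s = (\<lambda>n x. (f (x + t n *\<^sub>R v) - f x) /\<^sub>R t n)"
  have sh: "integrable lborel (\<lambda>x. f (x + a))" for a
    using integrable_lborel_affine[OF int, where c=1 and t=a] by (simp add: add.commute)
  have sh_int: "(\<integral>x. f (x + a) \<partial>lborel) = integral\<^sup>L lborel f" for a
    using integral_lborel_affine[OF integrable_borel_measurable[OF int], where c=1 and t=a] by (simp add: add.commute)
  have s_int: "integrable lborel (s n)" for n unfolding s_def using sh int by simp
  have s_zero: "integral\<^sup>L lborel (s n) = 0" for n
    unfolding s_def using sh int sh_int[of "t n *\<^sub>R v"] by simp
  have lip: "norm (f x - f y) \<le> B * norm (x - y)" for x y
    by (rule differentiable_bound[where S=UNIV and f'=f'])
       (use der bd in \<open>auto intro!: onorm_le\<close>)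
  have B0: "0 \<le> B"
  proof -
    have "0 \<le> B * norm v" using order_trans[OF norm_ge_zero bd[of undefined v]] .
    then show ?thesis using False by (simp add: zero_le_mult_iff)
  qed
  have lim: "(\<lambda>n. s n x) \<longlonglongrightarrow> f' x v" for x
  proof -
    have "((\<lambda>h. norm (f (x + h) - f x - f' x h) / norm h) \<longlongrightarrow> 0) (at 0)"
      using der[of x] unfolding has_derivative_at by blast
    moreover have "filterlim (\<lambda>n. t n *\<^sub>R v) (at 0) sequentially"
      unfolding filterlim_at using tendsto_scaleR[OF t0 tendsto_const[of v]] t False
      by (auto simp: less_imp_neq[symmetric] intro!: always_eventually)
    ultimately have "(\<lambda>n. norm (f (x + t n *\<^sub>R v) - f x - f' x (t n *\<^sub>R v)) / norm (t n *\<^sub>R v)) \<longlonglongrightarrow> 0"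
      by (rule filterlim_compose)
    from tendsto_mult_left[OF this, of "norm v"]
    have *: "(\<lambda>n. norm v * (norm (f (x + t n *\<^sub>R v) - f x - f' x (t n *\<^sub>R v)) / norm (t n *\<^sub>R v))) \<longlonglongrightarrow> 0"
      by simp
    have "norm v * (norm (f (x + t n *\<^sub>R v) - f x - f' x (t n *\<^sub>R v)) / norm (t n *\<^sub>R v)) = norm (s n x - f' x v)" for n
    proof -
      have "s n x - f' x v = (f (x + t n *\<^sub>R v) - f x - f' x (t n *\<^sub>R v)) /\<^sub>R t n"
        using t(1)[of n] by (simp add: s_def linear_scale[OF has_derivative_linear[OF der]] scaleR_right_diff_distrib)
      then show ?thesis using t(1)[of n] False by (simp add: divide_inverse)
    qed
    then have "(\<lambda>n. norm (s n x - f' x v)) \<longlonglongrightarrow> 0" using * by simp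
    then show ?thesis using LIM_zero_cancel tendsto_norm_zero_iff by blast
  qed
  have bound: "norm (s n x) \<le> B * norm v * indicator (cball 0 (R + norm v)) x" for n x
  proof (cases "norm x \<le> R + norm v")
    case True
    have "norm (s n x) \<le> B * norm (t n *\<^sub>R v) / t n"
      using lip[of "x + t n *\<^sub>R v" x] t(1)[of n] by (simp add: s_def divide_inverse mult.commute)
    also have "\<dots> = B * norm v" using t(1)[of n] by simp
    finally show ?thesis using True by simp
  next
    case F: False
    have "norm (t n *\<^sub>R v) \<le> norm v" using t[of n] by (simp add: mult_left_le_one_le)
    moreover have "norm x \<le> norm (x + t n *\<^sub>R v) + norm (t n *\<^sub>R v)"
      using norm_triangle_ineq4[of "x + t n *\<^sub>R v" "t n *\<^sub>R v"] by simp
    moreover have "0 \<le> norm v" by simp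
    ultimately have "R < norm (x + t n *\<^sub>R v)" "R < norm x" using F by linarith+
    then show ?thesis using supp B0 by (simp add: s_def)
  qed
  have "(\<lambda>n. integral\<^sup>L lborel (s n)) \<longlonglongrightarrow> integral\<^sup>L lborel (\<lambda>x. f' x v)"
  proof (rule integral_dominated_convergence[where w="\<lambda>x. B * norm v * indicator (cball 0 (R + norm v)) x"])
    show "(\<lambda>x. f' x v) \<in> borel_measurable lborel"
      by (rule borel_measurable_LIMSEQ_metric[OF borel_measurable_integrable[OF s_int] lim])
    have "emeasure lborel (cball (0 :: 'a) (R + norm v)) < \<infinity>"
      using emeasure_compact_finite[OF compact_cball] by simp
    then show "integrable lborel (\<lambda>x. B * norm v * indicator (cball 0 (R + norm v) :: 'a set) x)"
      by (intro integrable_mult_right) (auto intro!: integrable_real_indicator)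
  qed (use s_int lim bound in auto)
  then show ?thesis by (simp add: s_zero LIMSEQ_const_iff)
qed

text \<open>Functions in \<open>W\<^sup>1\<^sup>,\<^sup>1\<^sub>0\<close> and their weak gradients are handled as pairs of functions on the whole
  space, extended by zero: \<open>L\<^sup>1\<close>-limits of \<open>C\<^sup>1\<close> maps vanishing outside \<open>\<Omega>\<close> together with their
  derivatives.\<close>

definition C1_pair :: "(real ^ 'n) set \<Rightarrow> (real ^ 'n \<Rightarrow> real ^ 'd) \<Rightarrow> (real ^ 'n \<Rightarrow> real ^ 'n ^ 'd) \<Rightarrow> bool" where
  "C1_pair \<Omega> \<psi> D \<longleftrightarrow> (\<forall>x. (\<psi> has_derivative (\<lambda>h. D x *v h)) (at x)) \<and> continuous_on UNIV D \<and>
     (\<forall>x. x \<notin> \<Omega> \<longrightarrow> \<psi> x = 0 \<and> D x = 0)"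

definition sobolev_pair :: "(real ^ 'n) set \<Rightarrow> (real ^ 'n \<Rightarrow> real ^ 'd) \<Rightarrow> (real ^ 'n \<Rightarrow> real ^ 'n ^ 'd) \<Rightarrow> bool" where
  "sobolev_pair \<Omega> u G \<longleftrightarrow> integrable lborel u \<and> integrable lborel G \<and> (\<forall>x. x \<notin> \<Omega> \<longrightarrow> u x = 0 \<and> G x = 0) \<and>
     (\<exists>\<psi> D. (\<forall>m::nat. C1_pair \<Omega> (\<psi> m) (D m)) \<and>
        (\<lambda>m. \<integral>\<^sup>+x. ennreal (norm (\<psi> m x - u x)) \<partial>lborel) \<longlonglongrightarrow> 0 \<and>
        (\<lambda>m. \<integral>\<^sup>+x. ennreal (norm (D m x - G x)) \<partial>lborel) \<longlonglongrightarrow> 0)"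

lemma C1_pair_integrable:
  assumes "C1_pair \<Omega> \<psi> D" "bounded \<Omega>"
  shows "integrable lborel \<psi>" "integrable lborel D"
proof -
  obtain R where "\<And>x. x \<in> \<Omega> \<Longrightarrow> norm x \<le> R" using assms(2) bounded_iff by blast
  then have R: "R < norm x \<Longrightarrow> x \<notin> \<Omega>" for x by fastforce
  have "continuous_on UNIV \<psi>"
    using assms(1) unfolding C1_pair_def
    by (intro continuous_at_imp_continuous_on ballI has_derivative_continuous) blast
  then show "integrable lborel \<psi>"
    using R assms(1) by (intro integrable_continuous_bounded_support[of _ R]) (auto simp: C1_pair_def)
  show "integrable lborel D"
    using R assms(1) by (intro integrable_continuous_bounded_support[of _ R]) (auto simp: C1_pair_def)
qed

lemma continuous_bounded_support_bounded:
  fixes f :: "'a :: euclidean_space \<Rightarrow> 'b :: real_normed_vector"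
  assumes "continuous_on UNIV f" "\<And>x. R < norm x \<Longrightarrow> f x = 0"
  obtains B where "\<And>x. norm (f x) \<le> B" "0 \<le> B"
proof -
  have "compact (f ` cball 0 R)"
    by (intro compact_continuous_image continuous_on_subset[OF assms(1)]) auto
  then obtain B where B: "\<And>y. y \<in> f ` cball 0 R \<Longrightarrow> norm y \<le> B"
    using compact_imp_bounded bounded_iff by metis
  have "norm (f x) \<le> max B 0" for x
  proof (cases "R < norm x")
    case False
    then have "f x \<in> f ` cball 0 R" by auto
    then show ?thesis using B by fastforce
  qed (use assms(2) in auto)
  then show ?thesis using that by (metis max.cobounded2)
qed

lemma mol_C1_pair:
  fixes \<psi> :: "real ^ 'n \<Rightarrow> real ^ 'd"
  assumes \<eta>: "test_fun \<eta>" and \<psi>: "C1_pair \<Omega> \<psi> D" and \<Omega>: "bounded \<Omega>"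
  shows "mol (dirder \<eta> h) \<psi> z = mol \<eta> D z *v h"
proof -
  note int = C1_pair_integrable[OF \<psi> \<Omega>]
  have der: "(\<psi> has_derivative (\<lambda>h. D x *v h)) (at x)" and D: "continuous_on UNIV D"
    and out: "x \<notin> \<Omega> \<Longrightarrow> \<psi> x = 0" "x \<notin> \<Omega> \<Longrightarrow> D x = 0" for x
    using \<psi> by (auto simp: C1_pair_def)
  obtain R where "\<And>x. x \<in> \<Omega> \<Longrightarrow> norm x \<le> R" using \<Omega> bounded_iff by blast
  then have R: "R < norm x \<Longrightarrow> x \<notin> \<Omega>" for x by fastforce
  have c\<psi>: "continuous_on UNIV \<psi>"
    by (intro continuous_at_imp_continuous_on ballI has_derivative_continuous[OF der])
  obtain B1 where B1: "\<And>x. norm (\<psi> x) \<le> B1" "0 \<le> B1"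
    using continuous_bounded_support_bounded[OF c\<psi>, of R] R out by metis
  obtain B2 where B2: "\<And>x. norm (D x) \<le> B2" "0 \<le> B2"
    using continuous_bounded_support_bounded[OF D, of R] R out by metis
  obtain B3 where B3: "\<And>x. \<bar>\<eta> x\<bar> \<le> B3" "0 \<le> B3" using test_fun_bounded[OF \<eta>] by metis
  obtain L where L: "0 \<le> L" "\<And>h x. \<bar>dirder \<eta> h x\<bar> \<le> L * norm h" using test_fun_dirder_bound[OF \<eta>] by metis
  let ?f = "\<lambda>y. \<eta> (z - y) *\<^sub>R \<psi> y"
  define f' where "f' = (\<lambda>y k. \<eta> (z - y) *\<^sub>R (D y *v k) + (- dirder \<eta> k (z - y)) *\<^sub>R \<psi> y)"
  have "integral\<^sup>L lborel (\<lambda>y. f' y h) = 0"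
  proof (rule integral_derivative_zero[where f="?f" and B="B3 * (real CARD('d) * B2) + L * B1" and R=R])
    fix y
    have "((\<lambda>y. z - y) has_derivative (\<lambda>k. - k)) (at y)" by (auto intro!: derivative_eq_intros)
    from diff_chain_at[OF this test_fun_has_derivative[OF \<eta>]]
    have "((\<lambda>y. \<eta> (z - y)) has_derivative (\<lambda>k. - dirder \<eta> k (z - y))) (at y)"
      by (simp add: o_def linear_neg[OF dirder_linear[OF \<eta>]])
    from has_derivative_scaleR[OF this der]
    show "(?f has_derivative f' y) (at y)" unfolding f'_def .
    fix k
    have "norm (f' y k) \<le> \<bar>\<eta> (z - y)\<bar> * norm (D y *v k) + \<bar>dirder \<eta> k (z - y)\<bar> * norm (\<psi> y)"
      unfolding f'_def by (rule norm_triangle_le) simp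
    also have "\<dots> \<le> B3 * (real CARD('d) * B2 * norm k) + (L * norm k) * B1"
    proof (intro add_mono mult_mono B3 B1 L)
      have "norm (D y *v k) \<le> real CARD('d) * norm (D y) * norm k" by (rule norm_matrix_vector_le)
      also have "\<dots> \<le> real CARD('d) * B2 * norm k" by (intro mult_right_mono mult_left_mono B2) auto
      finally show "norm (D y *v k) \<le> real CARD('d) * B2 * norm k" .
    qed (use L B1 in auto)
    finally show "norm (f' y k) \<le> (B3 * (real CARD('d) * B2) + L * B1) * norm k"
      by (simp add: algebra_simps)
  qed (use R out in auto)
  moreover have i1: "integrable lborel (\<lambda>y. \<eta> (z - y) *\<^sub>R D y)" by (rule mol_integrable[OF \<eta> int(2)])
  have i2: "integrable lborel (\<lambda>y. \<eta> (z - y) *\<^sub>R (D y *v h))"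
    using integrable_bounded_linear[OF bounded_linear_matrix_vector_left[of h] i1]
    by (simp add: scaleR_matrix_vector_assoc)
  have i3: "integrable lborel (\<lambda>y. dirder \<eta> h (z - y) *\<^sub>R \<psi> y)"
    by (rule mol_integrable[OF test_fun_dirder[OF \<eta>] int(1)])
  have "mol \<eta> D z *v h = (\<integral>y. \<eta> (z - y) *\<^sub>R (D y *v h) \<partial>lborel)"
    unfolding mol_def
    using integral_bounded_linear[OF bounded_linear_matrix_vector_left[of h] i1]
    by (simp add: scaleR_matrix_vector_assoc)
  ultimately show ?thesis using i2 i3 by (simp add: mol_def f'_def)
qed

lemma mol_tendsto_L1:
  fixes u :: "real ^ 'n \<Rightarrow> 'b :: euclidean_space"
  assumes \<eta>: "test_fun \<eta>" and int: "\<And>m. integrable lborel (\<psi> m)" "integrable lborel u"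
    and lim: "(\<lambda>m. \<integral>\<^sup>+x. ennreal (norm (\<psi> m x - u x)) \<partial>lborel) \<longlonglongrightarrow> 0"
  shows "(\<lambda>m. mol \<eta> (\<psi> m) z) \<longlonglongrightarrow> mol \<eta> u z"
  unfolding mol_def
proof (rule tendsto_L1_int)
  obtain B where B: "\<And>x. \<bar>\<eta> x\<bar> \<le> B" "0 \<le> B" using test_fun_bounded[OF \<eta>] by metis
  note [measurable] = test_fun_borel[OF \<eta>] integrable_borel_measurable[OF int(1)] integrable_borel_measurable[OF int(2)]
  show "(\<lambda>m. \<integral>\<^sup>+y. ennreal (norm (\<eta> (z - y) *\<^sub>R \<psi> m y - \<eta> (z - y) *\<^sub>R u y)) \<partial>lborel) \<longlonglongrightarrow> 0"
  proof (rule tendsto_sandwich[OF _ _ tendsto_const])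
    show "(\<lambda>m. ennreal B * (\<integral>\<^sup>+x. ennreal (norm (\<psi> m x - u x)) \<partial>lborel)) \<longlonglongrightarrow> 0"
      using ennreal_tendsto_cmult[OF _ lim, of "ennreal B"] by simp
    show "\<forall>\<^sub>F m in sequentially. (\<integral>\<^sup>+y. ennreal (norm (\<eta> (z - y) *\<^sub>R \<psi> m y - \<eta> (z - y) *\<^sub>R u y)) \<partial>lborel)
        \<le> ennreal B * (\<integral>\<^sup>+x. ennreal (norm (\<psi> m x - u x)) \<partial>lborel)"
    proof (intro always_eventually allI)
      fix m
      have "(\<integral>\<^sup>+y. ennreal (norm (\<eta> (z - y) *\<^sub>R \<psi> m y - \<eta> (z - y) *\<^sub>R u y)) \<partial>lborel)
          \<le> (\<integral>\<^sup>+y. ennreal B * ennreal (norm (\<psi> m y - u y)) \<partial>lborel)"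
        using B by (intro nn_integral_mono) (auto simp flip: scaleR_right_diff_distrib ennreal_mult intro!: ennreal_leI mult_right_mono)
      then show "(\<integral>\<^sup>+y. ennreal (norm (\<eta> (z - y) *\<^sub>R \<psi> m y - \<eta> (z - y) *\<^sub>R u y)) \<partial>lborel)
          \<le> ennreal B * (\<integral>\<^sup>+x. ennreal (norm (\<psi> m x - u x)) \<partial>lborel)"
        by (simp add: nn_integral_cmult)
    qed
  qed auto
qed (intro mol_integrable[OF \<eta>] int)+

text \<open>Integration by parts against a kernel, inherited from the approximating \<open>C\<^sup>1\<close> pairs: both sides
  are continuous in \<open>L\<^sup>1\<close>. As \<open>\<eta>\<close> need not be supported in \<open>\<Omega>\<close>, this uses the zero boundary
  values.\<close>

lemma mol_sobolev_pair:
  assumes \<eta>: "test_fun \<eta>" and u: "sobolev_pair \<Omega> u G" and \<Omega>: "bounded \<Omega>"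
  shows "mol (dirder \<eta> h) u z = mol \<eta> G z *v h"
proof -
  obtain \<psi> D where \<psi>: "\<And>m::nat. C1_pair \<Omega> (\<psi> m) (D m)"
     "(\<lambda>m. \<integral>\<^sup>+x. ennreal (norm (\<psi> m x - u x)) \<partial>lborel) \<longlonglongrightarrow> 0"
     "(\<lambda>m. \<integral>\<^sup>+x. ennreal (norm (D m x - G x)) \<partial>lborel) \<longlonglongrightarrow> 0"
    and int: "integrable lborel u" "integrable lborel G"
    using u unfolding sobolev_pair_def by blast
  note I = C1_pair_integrable[OF \<psi>(1) \<Omega>]
  have "(\<lambda>m. mol (dirder \<eta> h) (\<psi> m) z) \<longlonglongrightarrow> mol (dirder \<eta> h) u z"
    by (rule mol_tendsto_L1[OF test_fun_dirder[OF \<eta>] I(1) int(1) \<psi>(2)])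
  moreover have "(\<lambda>m. mol \<eta> (D m) z *v h) \<longlonglongrightarrow> mol \<eta> G z *v h"
    by (rule bounded_linear.tendsto[OF bounded_linear_matrix_vector_left mol_tendsto_L1[OF \<eta> I(2) int(2) \<psi>(3)]])
  ultimately show ?thesis
    using LIMSEQ_unique by (simp add: mol_C1_pair[OF \<eta> \<psi>(1) \<Omega>])
qed

lemma conv_sobolev_has_derivative:
  fixes u :: "real ^ 'n \<Rightarrow> real ^ 'd"
  assumes \<rho>: "test_fun \<rho>" and u: "sobolev_pair \<Omega> u G" and \<Omega>: "bounded \<Omega>" and \<delta>: "\<delta> > 0"
  shows "(conv \<rho> \<delta> u has_derivative (\<lambda>h. conv \<rho> \<delta> G z *v h)) (at z)"
proof -
  have t: "test_fun (scaled \<rho> \<delta>)" using test_fun_scaled[OF \<rho>] \<delta> by simp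
  have int: "integrable lborel u" "integrable lborel G" using u unfolding sobolev_pair_def by auto
  show ?thesis
    using mol_has_derivative[OF t int(1)] mol_sobolev_pair[OF t u \<Omega>]
    by (simp add: conv_eq_mol[OF \<rho> int(1) \<delta>] conv_eq_mol[OF \<rho> int(2) \<delta>])
qed

text \<open>The mollified gradient is controlled by the oscillation of \<open>u\<close>: it equals the
  convolution of \<open>u\<close> with the derivative of the kernel, whose integral vanishes.\<close>

lemma conv_gradient_bound:
  fixes \<rho> :: "real ^ 'n \<Rightarrow> real"
  assumes \<rho>: "mollifier \<rho>" and \<Omega>: "bounded \<Omega>"
  obtains C :: real where "C > 0" and
    "\<And>u :: real ^ 'n \<Rightarrow> real ^ 'd. \<And>G \<delta> H z. sobolev_pair \<Omega> u G \<Longrightarrow> \<delta> > 0 \<Longrightarrow>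
      (\<And>w. norm w \<le> 1 \<Longrightarrow> norm (u (z - \<delta> *\<^sub>R w) - u z) \<le> H) \<Longrightarrow> norm (conv \<rho> \<delta> G z) \<le> C * H / \<delta>"
proof -
  note t = mollifier_test_fun[OF \<rho>]
  define K where "K = (\<Sum>b\<in>(Basis :: (real ^ 'n) set). \<integral>w. \<bar>dirder \<rho> b w\<bar> \<partial>lborel)"
  have K0: "0 \<le> K" unfolding K_def by (intro sum_nonneg) auto
  have out: "dirder \<rho> h w = 0" if "1 < norm w" for h w
    by (rule dirder_zero[OF _ that]) (use \<rho> in \<open>auto simp: mollifier_def\<close>)
  have zero: "(\<integral>w. dirder \<rho> h w \<partial>lborel) = 0" for h
  proof -
    obtain L where L: "\<And>h x. \<bar>dirder \<rho> h x\<bar> \<le> L * norm h" using test_fun_dirder_bound[OF t] by metis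
    show ?thesis
      by (rule integral_derivative_zero[where f=\<rho> and B=L and R=1 and f'="\<lambda>x h. dirder \<rho> h x"])
         (use test_fun_has_derivative[OF t] L \<rho> in \<open>auto simp: mollifier_def\<close>)
  qed
  have main: "norm (conv \<rho> \<delta> G z) \<le> (K * real CARD('d) + 1) * H / \<delta>"
    if u: "sobolev_pair \<Omega> u G" and \<delta>: "\<delta> > 0" and H: "\<And>w. norm w \<le> 1 \<Longrightarrow> norm (u (z - \<delta> *\<^sub>R w) - u z) \<le> H"
    for u :: "real ^ 'n \<Rightarrow> real ^ 'd" and G \<delta> H z
  proof -
    have H0: "0 \<le> H" using H[of 0] by simp
    have int: "integrable lborel u" "integrable lborel G" using u unfolding sobolev_pair_def by auto
    have ts: "test_fun (scaled \<rho> \<delta>)" using test_fun_scaled[OF t] \<delta> by simp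
    have col: "norm (conv \<rho> \<delta> G z *v b) \<le> H / \<delta> * (\<integral>w. \<bar>dirder \<rho> b w\<bar> \<partial>lborel)" for b
    proof -
      note tb = test_fun_dirder[OF t, of b]
      have "conv \<rho> \<delta> G z *v b = mol (dirder (scaled \<rho> \<delta>) b) u z"
        using mol_sobolev_pair[OF ts u \<Omega>] by (simp add: conv_eq_mol[OF t int(2) \<delta>])
      also have "\<dots> = (1 / \<delta>) *\<^sub>R mol (scaled (dirder \<rho> b) \<delta>) u z"
        unfolding dirder_scaled[OF t \<delta>] mol_def integral_scaleR_right[symmetric] scaleR_scaleR ..
      also have "\<dots> = (1 / \<delta>) *\<^sub>R (\<integral>w. dirder \<rho> b w *\<^sub>R u (z - \<delta> *\<^sub>R w) \<partial>lborel)"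
        using mol_scaled[OF tb integrable_borel_measurable[OF int(1)] \<delta>] by (simp add: conv_def)
      also have "(\<integral>w. dirder \<rho> b w *\<^sub>R u (z - \<delta> *\<^sub>R w) \<partial>lborel)
          = (\<integral>w. dirder \<rho> b w *\<^sub>R (u (z - \<delta> *\<^sub>R w) - u z) \<partial>lborel)"
        using conv_integrable[OF tb int(1), of \<delta> z] \<delta> test_fun_integrable[OF tb] zero[of b]
        by (simp add: scaleR_right_diff_distrib)
      finally have eq: "conv \<rho> \<delta> G z *v b = (1 / \<delta>) *\<^sub>R (\<integral>w. dirder \<rho> b w *\<^sub>R (u (z - \<delta> *\<^sub>R w) - u z) \<partial>lborel)" .
      have "norm (\<integral>w. dirder \<rho> b w *\<^sub>R (u (z - \<delta> *\<^sub>R w) - u z) \<partial>lborel) \<le> (\<integral>w. \<bar>dirder \<rho> b w\<bar> * H \<partial>lborel)"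
      proof (rule order_trans[OF integral_norm_bound integral_mono])
        show "integrable lborel (\<lambda>w. norm (dirder \<rho> b w *\<^sub>R (u (z - \<delta> *\<^sub>R w) - u z)))"
          unfolding scaleR_right_diff_distrib
          using conv_integrable[OF tb int(1), of \<delta> z] \<delta> test_fun_integrable[OF tb]
          by (intro integrable_norm Bochner_Integration.integrable_diff) auto
        show "integrable lborel (\<lambda>w. \<bar>dirder \<rho> b w\<bar> * H)" using test_fun_integrable[OF tb] by simp
        show "norm (dirder \<rho> b w *\<^sub>R (u (z - \<delta> *\<^sub>R w) - u z)) \<le> \<bar>dirder \<rho> b w\<bar> * H" for w
          by (cases "norm w \<le> 1") (use H out in \<open>auto intro!: mult_left_mono\<close>)
      qed
      then show ?thesis unfolding eq using \<delta> by (simp add: divide_simps mult.commute)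
    qed
    let ?A = "conv \<rho> \<delta> G z"
    have "norm ?A \<le> (\<Sum>i\<in>UNIV. norm (?A $ i))" by (rule norm_vec_le_sum)
    also have "\<dots> \<le> (\<Sum>i\<in>(UNIV :: 'd set). K * H / \<delta>)"
    proof (rule sum_mono)
      fix i :: 'd
      have "norm (?A $ i) \<le> (\<Sum>b\<in>Basis. \<bar>?A $ i \<bullet> b\<bar>)" by (rule norm_le_l1)
      also have "\<dots> \<le> (\<Sum>b\<in>Basis. H / \<delta> * (\<integral>w. \<bar>dirder \<rho> b w\<bar> \<partial>lborel))"
      proof (rule sum_mono)
        fix b :: "real ^ 'n"
        have "\<bar>?A $ i \<bullet> b\<bar> = norm ((?A *v b) $ i)" by (simp add: matrix_vector_mul_component)
        also have "\<dots> \<le> norm (?A *v b)" by (rule Finite_Cartesian_Product.norm_nth_le)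
        also note col[of b]
        finally show "\<bar>?A $ i \<bullet> b\<bar> \<le> H / \<delta> * (\<integral>w. \<bar>dirder \<rho> b w\<bar> \<partial>lborel)" .
      qed
      also have "\<dots> = H / \<delta> * K" unfolding K_def by (rule sum_distrib_left[symmetric])
      also have "\<dots> = K * H / \<delta>" by simp
      finally show "norm (?A $ i) \<le> K * H / \<delta>" .
    qed
    also have "\<dots> = K * real CARD('d) * H / \<delta>" by simp
    also have "\<dots> \<le> (K * real CARD('d) + 1) * H / \<delta>"
      using H0 \<delta> by (intro divide_right_mono mult_right_mono) auto
    finally show ?thesis .
  qed
  have "0 < K * real CARD('d) + 1" using K0 by (intro add_nonneg_pos mult_nonneg_nonneg) auto
  from that[OF this main] show ?thesis .
qed

lemma nn_L1_imp_integral_L1: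
  fixes u :: "nat \<Rightarrow> 'a \<Rightarrow> 'b :: {banach, second_countable_topology}"
  assumes "\<And>n. integrable M (u n)" "integrable M f"
    and "(\<lambda>n. \<integral>\<^sup>+x. ennreal (norm (u n x - f x)) \<partial>M) \<longlonglongrightarrow> 0"
  shows "(\<lambda>n. \<integral>x. norm (u n x - f x) \<partial>M) \<longlonglongrightarrow> 0"
proof -
  have "(\<integral>\<^sup>+x. ennreal (norm (u n x - f x)) \<partial>M) = ennreal (\<integral>x. norm (u n x - f x) \<partial>M)" for n
    using assms(1,2) by (intro nn_integral_eq_integral) auto
  then have "(\<lambda>n. ennreal (\<integral>x. norm (u n x - f x) \<partial>M)) \<longlonglongrightarrow> ennreal 0"
    using assms(3) by simp
  then show ?thesis
    by (subst (asm) tendsto_ennreal_iff) (auto intro!: always_eventually integral_nonneg_AE)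
qed

lemma L1_AE_subseq:
  fixes u :: "nat \<Rightarrow> 'a \<Rightarrow> 'b :: {banach, second_countable_topology}"
  assumes "\<And>n. integrable M (u n)" "integrable M f"
    and "(\<lambda>n. \<integral>\<^sup>+x. ennreal (norm (u n x - f x)) \<partial>M) \<longlonglongrightarrow> 0"
  obtains r :: "nat \<Rightarrow> nat" where "strict_mono r" "AE x in M. (\<lambda>n. u (r n) x) \<longlonglongrightarrow> f x"
proof -
  have "integrable M (\<lambda>x. u n x - f x)" for n using assms(1,2) by simp
  from tendsto_L1_AE_subseq[OF this nn_L1_imp_integral_L1[OF assms]]
  obtain r where r: "strict_mono r" "AE x in M. (\<lambda>n. u (r n) x - f x) \<longlonglongrightarrow> 0" by blast
  from r(2) have "AE x in M. (\<lambda>n. u (r n) x) \<longlonglongrightarrow> f x"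
    by eventually_elim (rule LIM_zero_cancel)
  with r(1) that show ?thesis by blast
qed

text \<open>Componentwise composition with a real function, and the factor it puts on the rows of
  the gradient.\<close>

definition comp_rows :: "(real \<Rightarrow> real) \<Rightarrow> (real ^ 'n \<Rightarrow> real ^ 'd) \<Rightarrow> real ^ 'n \<Rightarrow> real ^ 'd" where
  "comp_rows F u x = (\<chi> i. F (u x $ i))"

definition scale_rows ::
    "(real \<Rightarrow> real) \<Rightarrow> (real ^ 'n \<Rightarrow> real ^ 'd) \<Rightarrow> (real ^ 'n \<Rightarrow> real ^ 'n ^ 'd) \<Rightarrow> real ^ 'n \<Rightarrow> real ^ 'n ^ 'd" where
  "scale_rows F u G x = (\<chi> i. F (u x $ i) *\<^sub>R G x $ i)"

lemma continuous_on_comp_rows: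
  assumes "continuous_on UNIV F" shows "continuous_on UNIV (\<lambda>v :: real ^ 'd. \<chi> i. F (v $ i))"
  by (intro continuous_on_vec_lambda continuous_on_compose2[OF assms] continuous_intros) auto

lemma continuous_on_scale_rows:
  assumes "continuous_on UNIV F"
  shows "continuous_on UNIV (\<lambda>(v :: real ^ 'd, A :: real ^ 'n ^ 'd). \<chi> i. F (v $ i) *\<^sub>R A $ i)"
  unfolding case_prod_beta
  by (intro continuous_on_vec_lambda continuous_on_scaleR continuous_on_compose2[OF assms] continuous_intros) auto

lemma borel_measurable_comp_rows:
  assumes "continuous_on UNIV F" "u \<in> borel_measurable M"
  shows "comp_rows F u \<in> borel_measurable M"
  unfolding comp_rows_def[abs_def]
  using borel_measurable_continuous_on[OF continuous_on_comp_rows[OF assms(1)] assms(2)] .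

lemma borel_measurable_scale_rows:
  fixes u :: "real ^ 'n \<Rightarrow> real ^ 'd" and G :: "real ^ 'n \<Rightarrow> real ^ 'n ^ 'd"
  assumes "continuous_on UNIV F" "u \<in> borel_measurable M" "G \<in> borel_measurable M"
  shows "scale_rows F u G \<in> borel_measurable M"
proof -
  have "(\<lambda>x. (u x, G x)) \<in> borel_measurable M" using assms(2,3) by simp
  from borel_measurable_continuous_on[OF continuous_on_scale_rows[OF assms(1)] this]
  show ?thesis unfolding scale_rows_def[abs_def] by simp
qed

lemma norm_scale_rows_le:
  assumes "\<And>t. \<bar>F t\<bar> \<le> B"
  shows "norm (scale_rows F u G x) \<le> B * norm (G x)"
proof -
  have B: "0 \<le> B" using assms[of 0] by linarith
  have "norm (scale_rows F u G x) \<le> norm (B *\<^sub>R G x)"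
  proof (rule norm_le_componentwise_cart)
    fix i
    have "\<bar>F (u x $ i)\<bar> * norm (G x $ i) \<le> B * norm (G x $ i)" using assms by (rule mult_right_mono) simp
    then show "norm (scale_rows F u G x $ i) \<le> norm ((B *\<^sub>R G x) $ i)"
      using B by (simp add: scale_rows_def)
  qed
  then show ?thesis using B by simp
qed

lemma norm_comp_rows_diff:
  assumes "\<And>s t. \<bar>F s - F t\<bar> \<le> B * \<bar>s - t\<bar>" "0 \<le> B"
  shows "norm (comp_rows F u x - comp_rows F w y) \<le> B * norm (u x - w y)"
proof -
  have "norm (comp_rows F u x - comp_rows F w y) \<le> norm (B *\<^sub>R (u x - w y))"
    using assms by (intro norm_le_componentwise_cart) (auto simp: comp_rows_def abs_mult)
  then show ?thesis using assms(2) by simp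
qed

lemma C1_pair_comp_rows:
  fixes \<psi> :: "real ^ 'n \<Rightarrow> real ^ 'd"
  assumes \<psi>: "C1_pair \<Omega> \<psi> D"
    and F: "\<And>t. (F has_real_derivative F' t) (at t)" "continuous_on UNIV F'" "F 0 = 0"
  shows "C1_pair \<Omega> (comp_rows F \<psi>) (scale_rows F' \<psi> D)"
  unfolding C1_pair_def
proof (intro conjI allI impI)
  have der: "(\<psi> has_derivative (\<lambda>h. D x *v h)) (at x)" and D: "continuous_on UNIV D"
    and out: "x \<notin> \<Omega> \<Longrightarrow> \<psi> x = 0" "x \<notin> \<Omega> \<Longrightarrow> D x = 0" for x
    using \<psi> by (auto simp: C1_pair_def)
  show "(comp_rows F \<psi> has_derivative (\<lambda>h. scale_rows F' \<psi> D x *v h)) (at x)" for x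
  proof (subst has_derivative_componentwise_within, intro ballI)
    fix b :: "real ^ 'd" assume "b \<in> Basis"
    then obtain i where b: "b = axis i 1" by (auto simp: Basis_vec_def)
    have "((\<lambda>y. \<psi> y \<bullet> b) has_derivative (\<lambda>h. (D x *v h) \<bullet> b)) (at x)"
      by (rule has_derivative_inner_left[OF der])
    from diff_chain_at[OF this F(1)[of "\<psi> x \<bullet> b", unfolded has_field_derivative_def]]
    have "((\<lambda>y. F (\<psi> y $ i)) has_derivative (\<lambda>h. F' (\<psi> x $ i) * (D x *v h) $ i)) (at x)"
      by (simp add: o_def b inner_axis)
    then show "((\<lambda>y. comp_rows F \<psi> y \<bullet> b) has_derivative (\<lambda>h. (scale_rows F' \<psi> D x *v h) \<bullet> b)) (at x)"
      by (simp add: b inner_axis comp_rows_def scale_rows_def matrix_vector_mul_component)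
  qed
  have c\<psi>: "continuous_on UNIV \<psi>"
    by (intro continuous_at_imp_continuous_on ballI has_derivative_continuous[OF der])
  show "continuous_on UNIV (scale_rows F' \<psi> D)"
    using continuous_on_compose2[OF continuous_on_scale_rows[OF F(2)] continuous_on_Pair[OF c\<psi> D]]
    by (simp add: scale_rows_def[abs_def])
  fix x assume "x \<notin> \<Omega>"
  then show "comp_rows F \<psi> x = 0" "scale_rows F' \<psi> D x = 0"
    using out F(3) by (simp_all add: comp_rows_def scale_rows_def vec_eq_iff)
qed

text \<open>With \<open>(\<psi>\<^sub>n, D\<^sub>n)\<close> approximating \<open>(u, G)\<close>, the gradients differ by
  \<open>F' (\<psi>\<^sub>n) (D\<^sub>n - G) + (F' (\<psi>\<^sub>n) - F' u) G\<close>. The first term is small because \<open>F'\<close> is bounded,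
  the second one by dominated convergence along a subsequence on which \<open>\<psi>\<^sub>n\<close> converges almost
  everywhere.\<close>

lemma sobolev_pair_comp_rows:
  fixes u :: "real ^ 'n \<Rightarrow> real ^ 'd"
  assumes u: "sobolev_pair \<Omega> u G" and \<Omega>: "bounded \<Omega>"
    and F: "\<And>t. (F has_real_derivative F' t) (at t)" "continuous_on UNIV F'" "F 0 = 0"
    and B: "\<And>t. \<bar>F' t\<bar> \<le> B"
  shows "sobolev_pair \<Omega> (comp_rows F u) (scale_rows F' u G)"
proof -
  obtain \<psi> D where \<psi>: "\<And>m::nat. C1_pair \<Omega> (\<psi> m) (D m)"
     "(\<lambda>m. \<integral>\<^sup>+x. ennreal (norm (\<psi> m x - u x)) \<partial>lborel) \<longlonglongrightarrow> 0"
     "(\<lambda>m. \<integral>\<^sup>+x. ennreal (norm (D m x - G x)) \<partial>lborel) \<longlonglongrightarrow> 0"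
    and int: "integrable lborel u" "integrable lborel G" and out: "\<And>x. x \<notin> \<Omega> \<Longrightarrow> u x = 0 \<and> G x = 0"
    using u unfolding sobolev_pair_def by blast
  note I = C1_pair_integrable[OF \<psi>(1) \<Omega>]
  have B0: "0 \<le> B" using B[of 0] by linarith
  have cF: "continuous_on UNIV F" by (intro continuous_at_imp_continuous_on ballI DERIV_isCont[OF F(1)])
  have lip: "\<bar>F s - F t\<bar> \<le> B * \<bar>s - t\<bar>" for s t
  proof -
    have "norm (F s - F t) \<le> B * norm (s - t)"
      by (rule field_differentiable_bound[where S=UNIV and f'=F']) (use F(1) B in auto)
    then show ?thesis by simp
  qed
  note mu = borel_measurable_integrable[OF int(1)] and mG = borel_measurable_integrable[OF int(2)]
  note [measurable] = mu mG borel_measurable_integrable[OF I(1)] borel_measurable_integrable[OF I(2)]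
  note [measurable] = borel_measurable_comp_rows[OF cF mu] borel_measurable_scale_rows[OF F(2) mu mG]
  obtain r where r: "strict_mono r" "AE x in lborel. (\<lambda>n. \<psi> (r n) x) \<longlonglongrightarrow> u x"
    by (rule L1_AE_subseq[OF I(1) int(1) \<psi>(2)])
  define e where "e = (\<lambda>n x. (\<Sum>i\<in>UNIV. \<bar>F' (\<psi> (r n) x $ i) - F' (u x $ i)\<bar>) * norm (G x))"
  note [measurable] = borel_measurable_continuous_onI[OF F(2)]
  have [measurable]: "(\<lambda>x. F' (w x $ i)) \<in> borel_measurable lborel" if "w \<in> borel_measurable lborel" for i and w :: "real ^ 'n \<Rightarrow> real ^ 'd"
    by (rule borel_measurable_continuous_on[OF _ that])
       (intro continuous_on_compose2[OF F(2)] continuous_intros, auto)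
  have [measurable]: "e n \<in> borel_measurable lborel" for n
    unfolding e_def by measurable
  have "(\<lambda>n. integral\<^sup>L lborel (e n)) \<longlonglongrightarrow> integral\<^sup>L (lborel :: (real ^ 'n) measure) (\<lambda>x. 0)"
  proof (rule integral_dominated_convergence[where w="\<lambda>x. real CARD('d) * (2 * B) * norm (G x)"])
    show "AE x in lborel. (\<lambda>n. e n x) \<longlonglongrightarrow> 0"
      using r(2)
    proof eventually_elim
      case (elim x)
      have "(\<lambda>n. F' (\<psi> (r n) x $ i)) \<longlonglongrightarrow> F' (u x $ i)" for i
        by (rule continuous_on_tendsto_compose[OF F(2) tendsto_vec_nth[OF elim]]) auto
      then have "(\<lambda>n. (\<Sum>i\<in>UNIV. \<bar>F' (\<psi> (r n) x $ i) - F' (u x $ i)\<bar>) * norm (G x))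
          \<longlonglongrightarrow> (\<Sum>i\<in>(UNIV :: 'd set). \<bar>F' (u x $ i) - F' (u x $ i)\<bar>) * norm (G x)"
        by (intro tendsto_intros)
      then show ?case by (simp add: e_def)
    qed
    show "AE x in lborel. norm (e n x) \<le> real CARD('d) * (2 * B) * norm (G x)" for n
    proof (intro always_eventually allI)
      fix x
      have "(\<Sum>i\<in>UNIV. \<bar>F' (\<psi> (r n) x $ i) - F' (u x $ i)\<bar>) \<le> (\<Sum>i\<in>(UNIV :: 'd set). 2 * B)"
      proof (rule sum_mono)
        fix i show "\<bar>F' (\<psi> (r n) x $ i) - F' (u x $ i)\<bar> \<le> 2 * B"
          using B[of "\<psi> (r n) x $ i"] B[of "u x $ i"] by linarith
      qed
      then show "norm (e n x) \<le> real CARD('d) * (2 * B) * norm (G x)"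
        by (auto simp: e_def abs_mult sum_nonneg intro!: mult_right_mono)
    qed
  qed (use int in auto)
  then have e_lim: "(\<lambda>n. integral\<^sup>L lborel (e n)) \<longlonglongrightarrow> 0" by simp
  have e_int: "integrable lborel (e n)" for n
  proof (rule Bochner_Integration.integrable_bound[where f="\<lambda>x. real CARD('d) * (2 * B) * norm (G x)"])
    show "AE x in lborel. norm (e n x) \<le> norm (real CARD('d) * (2 * B) * norm (G x))"
    proof (intro always_eventually allI)
      fix x
      have "(\<Sum>i\<in>UNIV. \<bar>F' (\<psi> (r n) x $ i) - F' (u x $ i)\<bar>) \<le> (\<Sum>i\<in>(UNIV :: 'd set). 2 * B)"
      proof (rule sum_mono)
        fix i show "\<bar>F' (\<psi> (r n) x $ i) - F' (u x $ i)\<bar> \<le> 2 * B"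
          using B[of "\<psi> (r n) x $ i"] B[of "u x $ i"] by linarith
      qed
      then show "norm (e n x) \<le> norm (real CARD('d) * (2 * B) * norm (G x))"
        using B0 by (auto simp: e_def abs_mult sum_nonneg intro!: mult_right_mono)
    qed
  qed (use int in auto)
  have e0: "0 \<le> e n x" for n x by (simp add: e_def sum_nonneg)
  have "(\<integral>\<^sup>+x. ennreal (e n x) \<partial>lborel) = ennreal (integral\<^sup>L lborel (e n))" for n
    using e_int e0 by (intro nn_integral_eq_integral) auto
  then have e_nn: "(\<lambda>n. \<integral>\<^sup>+x. ennreal (e n x) \<partial>lborel) \<longlonglongrightarrow> 0"
    using tendsto_ennrealI[OF e_lim] by simp
  show ?thesis
    unfolding sobolev_pair_def
  proof (intro conjI exI allI impI)
    show "integrable lborel (comp_rows F u)"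
    proof (rule Bochner_Integration.integrable_bound[where f="\<lambda>x. B *\<^sub>R u x"])
      show "AE x in lborel. norm (comp_rows F u x) \<le> norm (B *\<^sub>R u x)"
      proof (intro always_eventually allI)
        fix x :: "real ^ 'n"
        have "comp_rows F (\<lambda>x. 0) x = (0 :: real ^ 'd)" by (simp add: comp_rows_def F(3) vec_eq_iff)
        then show "norm (comp_rows F u x) \<le> norm (B *\<^sub>R u x)"
          using norm_comp_rows_diff[OF lip B0, of u x "\<lambda>x. 0" x] B0 by simp
      qed
    qed (use int in auto)
    show "integrable lborel (scale_rows F' u G)"
    proof (rule Bochner_Integration.integrable_bound[where f="\<lambda>x. B *\<^sub>R G x"])
      show "AE x in lborel. norm (scale_rows F' u G x) \<le> norm (B *\<^sub>R G x)"
        using norm_scale_rows_le[where F=F' and u=u and G=G, OF B] B0 by simp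
    qed (use int in auto)
    show "comp_rows F u x = 0" "scale_rows F' u G x = 0" if "x \<notin> \<Omega>" for x
      using out[OF that] F(3) by (simp_all add: comp_rows_def scale_rows_def vec_eq_iff)
    show "C1_pair \<Omega> (comp_rows F (\<psi> (r m))) (scale_rows F' (\<psi> (r m)) (D (r m)))" for m
      by (rule C1_pair_comp_rows[OF \<psi>(1) F])
    have sub: "(\<lambda>m. \<integral>\<^sup>+x. ennreal (norm (\<psi> (r m) x - u x)) \<partial>lborel) \<longlonglongrightarrow> 0"
      "(\<lambda>m. \<integral>\<^sup>+x. ennreal (norm (D (r m) x - G x)) \<partial>lborel) \<longlonglongrightarrow> 0"
      using LIMSEQ_subseq_LIMSEQ[OF \<psi>(2) r(1)] LIMSEQ_subseq_LIMSEQ[OF \<psi>(3) r(1)] by (auto simp: o_def)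
    show "(\<lambda>m. \<integral>\<^sup>+x. ennreal (norm (comp_rows F (\<psi> (r m)) x - comp_rows F u x)) \<partial>lborel) \<longlonglongrightarrow> 0"
    proof (rule tendsto_sandwich[OF _ _ tendsto_const])
      show "(\<lambda>m. ennreal B * (\<integral>\<^sup>+x. ennreal (norm (\<psi> (r m) x - u x)) \<partial>lborel)) \<longlonglongrightarrow> 0"
        using ennreal_tendsto_cmult[OF _ sub(1), of "ennreal B"] by simp
      show "\<forall>\<^sub>F m in sequentially. (\<integral>\<^sup>+x. ennreal (norm (comp_rows F (\<psi> (r m)) x - comp_rows F u x)) \<partial>lborel)
          \<le> ennreal B * (\<integral>\<^sup>+x. ennreal (norm (\<psi> (r m) x - u x)) \<partial>lborel)"
        using norm_comp_rows_diff[OF lip B0] B0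
        by (intro always_eventually allI, subst nn_integral_cmult[symmetric])
           (auto intro!: nn_integral_mono ennreal_leI simp flip: ennreal_mult)
    qed auto
    show "(\<lambda>m. \<integral>\<^sup>+x. ennreal (norm (scale_rows F' (\<psi> (r m)) (D (r m)) x - scale_rows F' u G x)) \<partial>lborel) \<longlonglongrightarrow> 0"
    proof (rule tendsto_sandwich[OF _ _ tendsto_const])
      let ?C = "real CARD('d) * B"
      show "(\<lambda>m. ennreal ?C * (\<integral>\<^sup>+x. ennreal (norm (D (r m) x - G x)) \<partial>lborel) + (\<integral>\<^sup>+x. ennreal (e m x) \<partial>lborel)) \<longlonglongrightarrow> 0"
        using tendsto_add[OF ennreal_tendsto_cmult[OF _ sub(2), of "ennreal ?C"] e_nn] by simp
      show "\<forall>\<^sub>F m in sequentially. (\<integral>\<^sup>+x. ennreal (norm (scale_rows F' (\<psi> (r m)) (D (r m)) x - scale_rows F' u G x)) \<partial>lborel)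
          \<le> ennreal ?C * (\<integral>\<^sup>+x. ennreal (norm (D (r m) x - G x)) \<partial>lborel) + (\<integral>\<^sup>+x. ennreal (e m x) \<partial>lborel)"
      proof (intro always_eventually allI)
        fix m
        have pt: "norm (scale_rows F' (\<psi> (r m)) (D (r m)) x - scale_rows F' u G x) \<le> ?C * norm (D (r m) x - G x) + e m x" for x
        proof -
          let ?a = "\<lambda>i. F' (\<psi> (r m) x $ i)" and ?b = "\<lambda>i. F' (u x $ i)"
          have "norm (scale_rows F' (\<psi> (r m)) (D (r m)) x - scale_rows F' u G x)
             \<le> (\<Sum>i\<in>UNIV. norm (?a i *\<^sub>R D (r m) x $ i - ?b i *\<^sub>R G x $ i))"
            using norm_vec_le_sum[of "scale_rows F' (\<psi> (r m)) (D (r m)) x - scale_rows F' u G x"] by (simp add: scale_rows_def)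
          also have "\<dots> \<le> (\<Sum>i\<in>(UNIV :: 'd set). B * norm (D (r m) x - G x) + \<bar>?a i - ?b i\<bar> * norm (G x))"
          proof (rule sum_mono)
            fix i
            have "?a i *\<^sub>R D (r m) x $ i - ?b i *\<^sub>R G x $ i = ?a i *\<^sub>R (D (r m) x - G x) $ i + (?a i - ?b i) *\<^sub>R G x $ i"
              by (simp add: algebra_simps)
            also have "norm \<dots> \<le> \<bar>?a i\<bar> * norm ((D (r m) x - G x) $ i) + \<bar>?a i - ?b i\<bar> * norm (G x $ i)"
              by (rule norm_triangle_le) simp
            also have "\<dots> \<le> B * norm (D (r m) x - G x) + \<bar>?a i - ?b i\<bar> * norm (G x)"
              using B0 by (intro add_mono mult_mono B Finite_Cartesian_Product.norm_nth_le) auto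
            finally show "norm (?a i *\<^sub>R D (r m) x $ i - ?b i *\<^sub>R G x $ i) \<le> B * norm (D (r m) x - G x) + \<bar>?a i - ?b i\<bar> * norm (G x)" .
          qed
          also have "\<dots> = ?C * norm (D (r m) x - G x) + e m x"
            by (simp add: sum.distrib e_def sum_distrib_right)
          finally show ?thesis .
        qed
        have "(\<integral>\<^sup>+x. ennreal (norm (scale_rows F' (\<psi> (r m)) (D (r m)) x - scale_rows F' u G x)) \<partial>lborel)
          \<le> (\<integral>\<^sup>+x. ennreal ?C * ennreal (norm (D (r m) x - G x)) + ennreal (e m x) \<partial>lborel)"
          using B0 e0 pt by (intro nn_integral_mono) (auto intro!: ennreal_leI simp flip: ennreal_mult ennreal_plus)
        also have "\<dots> = ennreal ?C * (\<integral>\<^sup>+x. ennreal (norm (D (r m) x - G x)) \<partial>lborel) + (\<integral>\<^sup>+x. ennreal (e m x) \<partial>lborel)"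
          by (simp add: nn_integral_add nn_integral_cmult)
        finally show "(\<integral>\<^sup>+x. ennreal (norm (scale_rows F' (\<psi> (r m)) (D (r m)) x - scale_rows F' u G x)) \<partial>lborel)
          \<le> ennreal ?C * (\<integral>\<^sup>+x. ennreal (norm (D (r m) x - G x)) \<partial>lborel) + (\<integral>\<^sup>+x. ennreal (e m x) \<partial>lborel)" .
      qed
    qed auto
  qed
qed

section \<open>Uniqueness of weak gradients and Borel representatives\<close>

lemma lebesgue_on_AE_iff:
  "A \<in> sets lebesgue \<Longrightarrow> (AE x in lebesgue_on A. P x) \<longleftrightarrow> (AE x in lborel. x \<in> A \<longrightarrow> P x)"
  by (subst AE_restrict_space_iff) (auto simp: AE_completion_iff)

lemma lebesgue_on_nn_integral:
  "A \<in> sets lebesgue \<Longrightarrow> (\<integral>\<^sup>+x. f x \<partial>lebesgue_on A) = (\<integral>\<^sup>+x. f x * indicator A x \<partial>lborel)"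
  by (subst nn_integral_restrict_space) (auto simp: nn_integral_completion)

lemma borel_representative:
  fixes g :: "'a :: euclidean_space \<Rightarrow> 'b :: euclidean_space"
  assumes "g \<in> borel_measurable lebesgue"
  obtains g1 where "g1 \<in> borel_measurable borel" "AE x in lborel. g x = g1 x"
proof -
  have "\<exists>h. h \<in> borel_measurable lborel \<and> (AE x in lborel. g x \<bullet> b = h x)" for b
  proof -
    have "(\<lambda>x. g x \<bullet> b) \<in> borel_measurable lebesgue" using assms by simp
    from completion_ex_borel_measurable_real[OF this] show ?thesis by blast
  qed
  then obtain h where h: "\<And>b. h b \<in> borel_measurable lborel" "\<And>b. AE x in lborel. g x \<bullet> b = h b x"
    by metis
  have "AE x in lborel. \<forall>b\<in>Basis. g x \<bullet> b = h b x"
    using h(2) by (intro AE_finite_allI) auto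
  then have "AE x in lborel. g x = (\<Sum>b\<in>Basis. h b x *\<^sub>R b)"
  proof eventually_elim
    case (elim x)
    then have "(\<Sum>b\<in>Basis. h b x *\<^sub>R b) = (\<Sum>b\<in>Basis. (g x \<bullet> b) *\<^sub>R b)" by simp
    then show ?case by (simp add: euclidean_representation)
  qed
  moreover have "(\<lambda>x. \<Sum>b\<in>Basis. h b x *\<^sub>R b) \<in> borel_measurable lborel"
    using h(1) by (intro borel_measurable_sum borel_measurable_scaleR) auto
  ultimately show ?thesis using that by simp
qed

lemma integrable_borel_representative:
  fixes g :: "'a :: euclidean_space \<Rightarrow> 'b :: euclidean_space"
  assumes "integrable (lebesgue_on A) g" "A \<in> sets borel"
  obtains g1 where "integrable lborel g1" "\<And>x. x \<notin> A \<Longrightarrow> g1 x = 0" "AE x in lborel. x \<in> A \<longrightarrow> g1 x = g x"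
proof -
  have i: "integrable lebesgue (\<lambda>x. indicator A x *\<^sub>R g x)"
    using assms by (subst (asm) integrable_restrict_space) auto
  from borel_representative[OF borel_measurable_integrable[OF i]]
  obtain g1 where g1: "g1 \<in> borel_measurable borel" "AE x in lborel. indicator A x *\<^sub>R g x = g1 x" by metis
  have m: "(\<lambda>x. indicator A x *\<^sub>R g1 x) \<in> borel_measurable lborel" using g1(1) assms(2) by simp
  have "AE x in lebesgue. indicator A x *\<^sub>R g x = indicator A x *\<^sub>R g1 x"
    unfolding AE_completion_iff using g1(2) by eventually_elim (auto simp: indicator_def)
  then have "integrable lebesgue (\<lambda>x. indicator A x *\<^sub>R g1 x)"
    using i m by (subst integrable_cong_AE[symmetric]) (auto intro: measurable_completion)
  then have "integrable lborel (\<lambda>x. indicator A x *\<^sub>R g1 x)"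
    using m by (simp add: integrable_completion)
  moreover have "AE x in lborel. x \<in> A \<longrightarrow> indicator A x *\<^sub>R g1 x = g x"
    using g1(2) by eventually_elim auto
  ultimately show ?thesis using that[of "\<lambda>x. indicator A x *\<^sub>R g1 x"] by simp
qed

lemma test_fun_Cc_infty:
  fixes \<eta> :: "real ^ 'n \<Rightarrow> real"
  assumes "\<And>k. C_k k \<eta>" "compact K" "K \<subseteq> \<Omega>" "\<And>x. x \<notin> K \<Longrightarrow> \<eta> x = 0"
  shows "\<eta> \<in> Cc_infty \<Omega>"
proof -
  have "closure {x. \<eta> x \<noteq> 0} \<subseteq> K"
    using assms(2,4) by (intro closure_minimal compact_imp_closed) auto
  then have "closure {x. \<eta> x \<noteq> 0} = K \<inter> closure {x. \<eta> x \<noteq> 0}" by blast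
  then have "compact (closure {x. \<eta> x \<noteq> 0})"
    using compact_Int_closed[OF assms(2) closed_closure] by metis
  then show ?thesis
    using assms(1,3) \<open>closure {x. \<eta> x \<noteq> 0} \<subseteq> K\<close> unfolding Cc_infty_def by auto
qed

text \<open>A locally integrable function orthogonal to all test functions has vanishing
  mollifications, hence vanishes almost everywhere.\<close>

lemma locally_integrable_test_zero:
  fixes h :: "real ^ 'n \<Rightarrow> real"
  assumes \<Omega>: "open \<Omega>"
    and int: "\<And>A. compact A \<Longrightarrow> A \<subseteq> \<Omega> \<Longrightarrow> integrable (lebesgue_on A) h"
    and zero: "\<And>\<psi> :: real ^ 'n \<Rightarrow> real. \<psi> \<in> Cc_infty \<Omega> \<Longrightarrow> (LINT x|lebesgue_on \<Omega>. h x * \<psi> x) = 0"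
  shows "AE x in lborel. x \<in> \<Omega> \<longrightarrow> h x = 0"
proof -
  obtain \<rho> :: "real ^ 'n \<Rightarrow> real" where \<rho>: "mollifier \<rho>" using mollifier_exists by blast
  note t = mollifier_test_fun[OF \<rho>]
  have local: "AE x in lborel. x \<in> A \<longrightarrow> h x = 0" if A: "compact A" "A \<subseteq> \<Omega>" for A
  proof -
    obtain \<epsilon> where \<epsilon>: "\<epsilon> > 0" "(\<Union>x\<in>A. cball x \<epsilon>) \<subseteq> \<Omega>"
      using compact_subset_open_imp_cball_epsilon_subset[OF A(1) \<Omega> A(2)] by metis
    define A' where "A' = {x + y | x y. x \<in> A \<and> y \<in> cball 0 \<epsilon>}"
    have A': "compact A'" unfolding A'_def by (intro compact_sums A compact_cball)
    have A'sub: "A' \<subseteq> \<Omega>"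
    proof
      fix z assume "z \<in> A'"
      then obtain x y where "z = x + y" "x \<in> A" "norm y \<le> \<epsilon>" unfolding A'_def by auto
      then have "z \<in> cball x \<epsilon>" by (simp add: dist_norm norm_minus_commute)
      then show "z \<in> \<Omega>" using \<epsilon> \<open>x \<in> A\<close> by blast
    qed
    have cb: "cball x \<epsilon> \<subseteq> A'" if "x \<in> A" for x
    proof
      fix z assume "z \<in> cball x \<epsilon>"
      then have "z = x + (z - x)" "z - x \<in> cball 0 \<epsilon>" by (auto simp: dist_norm norm_minus_commute)
      then show "z \<in> A'" unfolding A'_def using \<open>x \<in> A\<close> by blast
    qed
    have A'b: "A' \<in> sets borel" using A' by (simp add: borel_compact)
    obtain g where g: "integrable lborel g" "\<And>x. x \<notin> A' \<Longrightarrow> g x = 0" "AE x in lborel. x \<in> A' \<longrightarrow> g x = h x"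
      by (rule integrable_borel_representative[OF int[OF A' A'sub] A'b]) blast
    have vanish: "conv \<rho> \<delta> g x = 0" if x: "x \<in> A" and \<delta>: "0 < \<delta>" "\<delta> \<le> \<epsilon>" for x \<delta>
    proof -
      define \<kappa> where "\<kappa> = (\<lambda>y. scaled \<rho> \<delta> (x - y))"
      have \<kappa>_eq: "\<kappa> = (\<lambda>y. (1 / \<delta> ^ CARD('n)) * \<rho> (x /\<^sub>R \<delta> + (- inverse \<delta>) *\<^sub>R y))"
        unfolding \<kappa>_def scaled_def by (simp add: scaleR_right_diff_distrib)
      have t\<kappa>: "test_fun \<kappa>" unfolding \<kappa>_eq using \<delta> by (intro test_fun_affine[OF t]) auto
      have \<kappa>0: "\<kappa> y = 0" if "y \<notin> cball x \<delta>" for y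
      proof -
        have "norm ((x - y) /\<^sub>R \<delta>) = norm (x - y) / \<delta>"
          unfolding norm_scaleR using \<delta> by (simp add: divide_inverse)
        then have "1 < norm ((x - y) /\<^sub>R \<delta>)" using that \<delta> by (simp add: dist_norm)
        then have "\<rho> ((x - y) /\<^sub>R \<delta>) = 0" using \<rho> by (auto simp: mollifier_def)
        then show ?thesis by (simp add: \<kappa>_def scaled_def)
      qed
      have sub: "cball x \<delta> \<subseteq> A'" using cb[OF x] \<delta>(2) by auto
      have "\<kappa> \<in> Cc_infty \<Omega>"
        by (rule test_fun_Cc_infty[of _ "cball x \<delta>"]) (use t\<kappa> \<kappa>0 sub A'sub in \<open>auto simp: test_fun_def\<close>)
      from zero[OF this] have "(\<integral>y. indicator \<Omega> y *\<^sub>R (h y * \<kappa> y) \<partial>lebesgue) = 0"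
        using \<Omega> by (subst (asm) integral_restrict_space) (auto simp: borel_open)
      moreover have "(\<integral>y. indicator \<Omega> y *\<^sub>R (h y * \<kappa> y) \<partial>lebesgue) = (\<integral>y. \<kappa> y *\<^sub>R g y \<partial>lebesgue)"
      proof (rule integral_cong_AE)
        have "integrable lebesgue (\<lambda>y. indicator A' y *\<^sub>R h y)"
          using int[OF A' A'sub] A'b by (subst (asm) integrable_restrict_space) auto
        from borel_measurable_integrable[OF this]
        have m: "(\<lambda>y. \<kappa> y * (indicator A' y *\<^sub>R h y)) \<in> borel_measurable lebesgue"
          using test_fun_borel[OF t\<kappa>] by (intro borel_measurable_times) (auto intro: measurable_completion)
        have "(\<lambda>y. \<kappa> y * (indicator A' y *\<^sub>R h y)) = (\<lambda>y. indicator \<Omega> y *\<^sub>R (h y * \<kappa> y))"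
          using \<kappa>0 sub A'sub by (fastforce simp: indicator_def)
        with m show "(\<lambda>y. indicator \<Omega> y *\<^sub>R (h y * \<kappa> y)) \<in> borel_measurable lebesgue" by simp
        show "(\<lambda>y. \<kappa> y *\<^sub>R g y) \<in> borel_measurable lebesgue"
          using test_fun_borel[OF t\<kappa>] integrable_borel_measurable[OF g(1)]
          by (intro measurable_completion) simp
        show "AE y in lebesgue. indicator \<Omega> y *\<^sub>R (h y * \<kappa> y) = \<kappa> y *\<^sub>R g y"
          unfolding AE_completion_iff using g(3)
        proof eventually_elim
          case (elim y)
          then show ?case using \<kappa>0[of y] sub A'sub by (cases "y \<in> cball x \<delta>") (auto simp: indicator_def)
        qed
      qed
      moreover have "(\<integral>y. \<kappa> y *\<^sub>R g y \<partial>lebesgue) = (\<integral>y. \<kappa> y *\<^sub>R g y \<partial>lborel)"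
        using test_fun_borel[OF t\<kappa>] integrable_borel_measurable[OF g(1)] by (intro integral_completion) simp
      moreover have "(\<integral>y. \<kappa> y *\<^sub>R g y \<partial>lborel) = conv \<rho> \<delta> g x"
        using mol_scaled[OF t integrable_borel_measurable[OF g(1)] \<delta>(1)] by (simp add: mol_def \<kappa>_def)
      ultimately show ?thesis by simp
    qed
    define \<delta> where "\<delta> = (\<lambda>n. \<epsilon> * inverse (real (Suc n)))"
    have \<delta>: "\<delta> n > 0" "\<delta> n \<le> \<epsilon>" for n
      using \<epsilon>(1) by (auto simp: \<delta>_def inverse_le_1_iff intro!: mult_left_le)
    have \<delta>0: "\<delta> \<longlonglongrightarrow> 0"
      unfolding \<delta>_def using tendsto_mult_left[OF LIMSEQ_inverse_real_of_nat, of \<epsilon>] by simp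
    note [measurable] = integrable_borel_measurable[OF g(1)]
    have Ab: "A \<in> sets borel" using A by (simp add: borel_compact)
    have "(\<integral>\<^sup>+x. ennreal (norm (g x)) * indicator A x \<partial>lborel)
        \<le> (\<integral>\<^sup>+x. ennreal (norm (conv \<rho> (\<delta> n) g (x - \<delta> n *\<^sub>R 0) - g x)) \<partial>lborel)" for n
      using vanish \<delta>[of n] by (intro nn_integral_mono) (auto simp: indicator_def)
    then have "(\<integral>\<^sup>+x. ennreal (norm (g x)) * indicator A x \<partial>lborel) \<le> 0"
      by (intro LIMSEQ_le_const[OF conv_shift_L1[OF \<rho> g(1) \<delta>0 \<delta>(1), of 0]]) auto
    then have "(\<integral>\<^sup>+x. ennreal (norm (g x)) * indicator A x \<partial>lborel) = 0" by simp
    then have "AE x in lborel. ennreal (norm (g x)) * indicator A x = 0"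
      using Ab by (subst (asm) nn_integral_0_iff_AE) auto
    with g(3) show ?thesis
    proof eventually_elim
      case (elim x)
      show ?case
      proof
        assume "x \<in> A"
        moreover then have "x \<in> A'" using cb[of x] \<epsilon>(1) by auto
        ultimately show "h x = 0" using elim by auto
      qed
    qed
  qed
  have "\<exists>C :: nat \<Rightarrow> _. (\<forall>n. compact (C n)) \<and> (\<forall>n. C n \<subseteq> \<Omega>) \<and> \<Union> (range C) = \<Omega>"
    by (rule open_Union_compact_subsets[OF \<Omega>]) (intro exI conjI allI; assumption)
  then obtain C :: "nat \<Rightarrow> _" where C: "\<And>n. compact (C n)" "\<And>n. C n \<subseteq> \<Omega>" and UC: "\<Union> (range C) = \<Omega>"
    by blast
  have "AE x in lborel. \<forall>n::nat. x \<in> C n \<longrightarrow> h x = 0"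
    using local[OF C(1,2)] by (subst AE_all_countable) blast
  then show ?thesis
  proof eventually_elim
    case (elim x)
    then show ?case using UC by blast
  qed
qed

lemma weak_gradient_unique:
  fixes f :: "real ^ 'n \<Rightarrow> real ^ 'd"
  assumes \<Omega>: "open \<Omega>" and G: "weak_gradient \<Omega> f G" and G': "weak_gradient \<Omega> f G'"
  shows "AE x in lborel. x \<in> \<Omega> \<longrightarrow> G x = G' x"
proof -
  have comp: "AE x in lborel. x \<in> \<Omega> \<longrightarrow> G x $ i $ k - G' x $ i $ k = 0" for i k
  proof (rule locally_integrable_test_zero[OF \<Omega>])
    have cmp: "integrable M (\<lambda>x. H x $ i $ k)" if "integrable M H" for M and H :: "real ^ 'n \<Rightarrow> real ^ 'n ^ 'd"
      using integrable_bounded_linear[OF bounded_linear_vec_nth[of k] integrable_bounded_linear[OF bounded_linear_vec_nth[of i] that]] .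
    show "integrable (lebesgue_on A) (\<lambda>x. G x $ i $ k - G' x $ i $ k)" if "compact A" "A \<subseteq> \<Omega>" for A
    proof -
      have "integrable (lebesgue_on A) G" "integrable (lebesgue_on A) G'"
        using G G' that unfolding weak_gradient_def by auto
      then show ?thesis by (intro Bochner_Integration.integrable_diff cmp)
    qed
    fix \<psi> :: "real ^ 'n \<Rightarrow> real" assume \<psi>: "\<psi> \<in> Cc_infty \<Omega>"
    define A where "A = closure {x. \<psi> x \<noteq> 0}"
    have A: "compact A" "A \<subseteq> \<Omega>" using \<psi> by (auto simp: Cc_infty_def A_def)
    have \<psi>c: "continuous_on UNIV \<psi>" using \<psi> C_k_imp_continuous by (auto simp: Cc_infty_def)
    have \<psi>0: "\<psi> x = 0" if "x \<notin> A" for x using that closure_subset[of "{x. \<psi> x \<noteq> 0}"] by (auto simp: A_def)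
    obtain R where "\<And>x. x \<in> A \<Longrightarrow> norm x \<le> R" using compact_imp_bounded[OF A(1)] bounded_iff by blast
    then have "\<And>x. R < norm x \<Longrightarrow> \<psi> x = 0" using \<psi>0 by fastforce
    then obtain B where B: "\<And>x. norm (\<psi> x) \<le> B" using continuous_bounded_support_bounded[OF \<psi>c] by metis
    have I: "integrable (lebesgue_on \<Omega>) (\<lambda>x. H x $ i $ k * \<psi> x)"
      if "integrable (lebesgue_on A) H" for H :: "real ^ 'n \<Rightarrow> real ^ 'n ^ 'd"
    proof -
      have "integrable lebesgue (\<lambda>x. indicator A x *\<^sub>R H x $ i $ k)"
        using cmp[OF that] A borel_compact[OF A(1)] by (subst (asm) integrable_restrict_space) auto
      from integrable_bounded_scaleR[OF this, of \<psi> B]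
      have "integrable lebesgue (\<lambda>x. \<psi> x *\<^sub>R (indicator A x *\<^sub>R H x $ i $ k))"
        using B borel_measurable_continuous_onI[OF \<psi>c] by (simp add: measurable_completion)
      moreover have "(\<lambda>x. \<psi> x *\<^sub>R (indicator A x *\<^sub>R H x $ i $ k)) = (\<lambda>x. indicator \<Omega> x *\<^sub>R (H x $ i $ k * \<psi> x))"
        using \<psi>0 A(2) by (fastforce simp: indicator_def)
      ultimately show ?thesis using \<Omega> by (subst integrable_restrict_space) (auto simp: borel_open)
    qed
    have iG: "integrable (lebesgue_on A) G" "integrable (lebesgue_on A) G'"
      using G G' A unfolding weak_gradient_def by auto
    have "(LINT x|lebesgue_on \<Omega>. G x $ i $ k * \<psi> x) = (LINT x|lebesgue_on \<Omega>. G' x $ i $ k * \<psi> x)"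
    proof -
      have "(LINT x|lebesgue_on \<Omega>. f x $ i * frechet_derivative \<psi> (at x) (axis k 1)) = - (LINT x|lebesgue_on \<Omega>. G x $ i $ k * \<psi> x)"
        using G \<psi> unfolding weak_gradient_def by blast
      moreover have "(LINT x|lebesgue_on \<Omega>. f x $ i * frechet_derivative \<psi> (at x) (axis k 1)) = - (LINT x|lebesgue_on \<Omega>. G' x $ i $ k * \<psi> x)"
        using G' \<psi> unfolding weak_gradient_def by blast
      ultimately show ?thesis by linarith
    qed
    then show "(LINT x|lebesgue_on \<Omega>. (G x $ i $ k - G' x $ i $ k) * \<psi> x) = 0"
      using I[OF iG(1)] I[OF iG(2)] by (simp add: left_diff_distrib)
  qed
  have "AE x in lborel. \<forall>i k. x \<in> \<Omega> \<longrightarrow> G x $ i $ k - G' x $ i $ k = 0"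
    using comp by (subst AE_all_countable, intro allI, subst AE_all_countable) auto
  then show ?thesis by eventually_elim (simp add: vec_eq_iff)
qed

lemma grad_eqI:
  fixes f :: "real ^ 'n \<Rightarrow> real ^ 'd"
  shows "(f has_derivative (\<lambda>h. A *v h)) (at x) \<Longrightarrow> grad f x = A"
  by (simp add: grad_def jacobian_def frechet_derivative_at[of f "\<lambda>h. A *v h" x, symmetric])

lemma Cc_infty_C1_pair:
  fixes f :: "real ^ 'n \<Rightarrow> real ^ 'd"
  assumes "f \<in> Cc_infty \<Omega>"
  shows "C1_pair \<Omega> f (grad f)"
  unfolding C1_pair_def
proof (intro conjI allI impI)
  have C: "C_k k f" for k using assms by (simp add: Cc_infty_def)
  note der = C_k_SucD(1)[OF C[of "Suc 0"]]
  have gr: "grad f x *v h = frechet_derivative f (at x) h" for x h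
    unfolding grad_def jacobian_def
    by (simp add: matrix_works linear_matrix_vector_mul_eq has_derivative_linear[OF der])
  show "(f has_derivative (\<lambda>h. grad f x *v h)) (at x)" for x
    unfolding gr using der .
  show "continuous_on UNIV (grad f)"
  proof -
    have "continuous_on UNIV (\<lambda>x. frechet_derivative f (at x) (axis k 1) $ i)" for k i
      using C_k_SucD(2)[OF C[of "Suc 0"], of "axis k 1"] by (intro bounded_linear.continuous_on[OF bounded_linear_vec_nth]) (simp add: C_k_imp_continuous)
    moreover have "grad f x = (\<chi> i k. frechet_derivative f (at x) (axis k 1) $ i)" for x
      by (simp add: grad_def jacobian_def matrix_def)
    ultimately show ?thesis by (simp add: continuous_on_vec_lambda)
  qed
  fix x assume x: "x \<notin> \<Omega>"
  let ?S = "closure {x. f x \<noteq> 0}"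
  have S: "x \<in> - ?S" using assms x by (auto simp: Cc_infty_def)
  have zero: "f y = 0" if "y \<in> - ?S" for y using that closure_subset[of "{x. f x \<noteq> 0}"] by auto
  show "f x = 0" using zero[OF S] .
  have "(f has_derivative (\<lambda>h. 0)) (at x)"
    by (rule has_derivative_zero_on_open[OF open_Compl[OF closed_closure] S zero])
  then show "grad f x = 0" by (intro grad_eqI) (simp add: matrix_vector_mult_0)
qed

lemma L1_distance_zero_extension:
  fixes a b c :: "real ^ 'n \<Rightarrow> 'z :: euclidean_space"
  assumes "\<Omega> \<in> sets lebesgue" "\<And>x. x \<notin> \<Omega> \<Longrightarrow> a x = 0" "\<And>x. x \<notin> \<Omega> \<Longrightarrow> c x = 0"
    "AE x in lborel. x \<in> \<Omega> \<longrightarrow> c x = b x"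
  shows "(\<integral>\<^sup>+x. ennreal (norm (a x - b x)) \<partial>lebesgue_on \<Omega>) = (\<integral>\<^sup>+x. ennreal (norm (a x - c x)) \<partial>lborel)"
  unfolding lebesgue_on_nn_integral[OF assms(1)]
proof (rule nn_integral_cong_AE, use assms(4) in eventually_elim)
  case (elim x)
  then show ?case using assms(2,3)[of x] by (cases "x \<in> \<Omega>") auto
qed

text \<open>Maps in \<open>C\<^sub>c\<^sup>\<infinity>(\<Omega>)\<close> extend by zero to smooth maps, so the \<open>L\<^sup>1\<close> limits on \<open>\<Omega>\<close> are limits on the
  whole space, where translations and convolutions are available. Borel representatives make the
  extended functions measurable there.\<close>

lemma W11_0_sobolev_pair:
  fixes f :: "real ^ 'n \<Rightarrow> real ^ 'd"
  assumes f: "f \<in> W11_0 \<Omega>" and \<Omega>: "open \<Omega>"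
  obtains u G where "sobolev_pair \<Omega> u G" "AE x in lborel. x \<in> \<Omega> \<longrightarrow> u x = f x"
    "\<And>G'. weak_gradient \<Omega> f G' \<Longrightarrow> AE x in lborel. x \<in> \<Omega> \<longrightarrow> G' x = G x"
proof -
  from f obtain G0 \<psi> where G0: "weak_gradient \<Omega> f G0" and \<psi>: "\<And>m::nat. \<psi> m \<in> Cc_infty \<Omega>"
    and lim: "L1_convergence \<Omega> \<psi> f sequentially" "L1_convergence \<Omega> (\<lambda>m. grad (\<psi> m)) G0 sequentially"
    by (auto simp: W11_0_def)
  from f obtain G2 where f_int: "integrable (lebesgue_on \<Omega>) f" and G2: "weak_gradient \<Omega> f G2" "integrable (lebesgue_on \<Omega>) G2"
    by (auto simp: W11_0_def W11_def)
  have \<Omega>b: "\<Omega> \<in> sets borel" "\<Omega> \<in> sets lebesgue" using \<Omega> by (auto simp: borel_open)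
  obtain u where u: "integrable lborel u" "\<And>x. x \<notin> \<Omega> \<Longrightarrow> u x = 0" "AE x in lborel. x \<in> \<Omega> \<longrightarrow> u x = f x"
    by (rule integrable_borel_representative[OF f_int \<Omega>b(1)]) blast
  obtain G where G: "integrable lborel G" "\<And>x. x \<notin> \<Omega> \<Longrightarrow> G x = 0" "AE x in lborel. x \<in> \<Omega> \<longrightarrow> G x = G2 x"
    by (rule integrable_borel_representative[OF G2(2) \<Omega>b(1)]) blast
  have uniq: "AE x in lborel. x \<in> \<Omega> \<longrightarrow> G' x = G x" if "weak_gradient \<Omega> f G'" for G'
    using weak_gradient_unique[OF \<Omega> that G2(1)] G(3) by eventually_elim auto
  have C1: "C1_pair \<Omega> (\<psi> m) (grad (\<psi> m))" for m by (rule Cc_infty_C1_pair[OF \<psi>])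
  have G0G: "AE x in lborel. x \<in> \<Omega> \<longrightarrow> G x = G0 x" using uniq[OF G0] by eventually_elim auto
  have "sobolev_pair \<Omega> u G"
    unfolding sobolev_pair_def
  proof (intro conjI exI allI impI)
    show "C1_pair \<Omega> (\<psi> m) (grad (\<psi> m))" for m by (rule C1)
    show "(\<lambda>m. \<integral>\<^sup>+x. ennreal (norm (\<psi> m x - u x)) \<partial>lborel) \<longlonglongrightarrow> 0"
      using lim(1) C1 u(2) unfolding L1_convergence_def C1_pair_def
      by (simp add: L1_distance_zero_extension[OF \<Omega>b(2) _ _ u(3)])
    show "(\<lambda>m. \<integral>\<^sup>+x. ennreal (norm (grad (\<psi> m) x - G x)) \<partial>lborel) \<longlonglongrightarrow> 0"
      using lim(2) C1 G(2) unfolding L1_convergence_def C1_pair_def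
      by (simp add: L1_distance_zero_extension[OF \<Omega>b(2) _ _ G0G])
  qed (use u G in auto)
  with u(3) uniq that show ?thesis by blast
qed

section \<open>Lipschitz domains: inward translations and a partition of unity\<close>

text \<open>Near a boundary point the domain is a strict epigraph over the hyperplane orthogonal to \<open>e\<close>.
  Moving in the direction \<open>e\<close> by a distance \<open>\<kappa> \<delta>\<close> with \<open>\<kappa>\<close> larger than the Lipschitz constant
  beats every further displacement of size \<open>\<delta>\<close>, so points of the closure are moved into the domain.\<close>

lemma Lipschitz_domain_patch:
  assumes \<Omega>: "bounded_Lipschitz_domain \<Omega>" and a: "a \<in> closure \<Omega>"
  shows "\<exists>r v d. 0 < r \<and> 0 < d \<and> (\<forall>\<delta> x w. 0 < \<delta> \<and> \<delta> < d \<and> x \<in> cball a r \<and> norm w \<le> 1 \<and>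
      x - \<delta> *\<^sub>R (v + w) \<in> closure \<Omega> \<longrightarrow> x \<in> \<Omega>)"
proof (cases "a \<in> \<Omega>")
  case True
  have "open \<Omega>" using \<Omega> by (simp add: bounded_Lipschitz_domain_def)
  then obtain r where "r > 0" "cball a r \<subseteq> \<Omega>" using True open_contains_cball by blast
  then show ?thesis by (intro exI[of _ r] exI[of _ 0] exI[of _ 1]) auto
next
  case False
  have op: "open \<Omega>" using \<Omega> by (simp add: bounded_Lipschitz_domain_def)
  have "a \<in> frontier \<Omega>" using a False op by (simp add: frontier_def interior_open)
  then obtain r e L g where r: "r > 0" and e: "norm e = 1"
    and g: "L-lipschitz_on {y. y \<bullet> e = 0} g"
    and epi: "\<Omega> \<inter> ball a r = {x \<in> ball a r. g (x - (x \<bullet> e) *\<^sub>R e) < x \<bullet> e}"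
    using \<Omega> unfolding bounded_Lipschitz_domain_def by blast
  define p where "p = (\<lambda>x :: real ^ 'a. x - (x \<bullet> e) *\<^sub>R e)"
  have ee: "e \<bullet> e = 1" using e by (simp add: dot_square_norm)
  have p0: "p x \<in> {y. y \<bullet> e = 0}" for x by (simp add: p_def inner_diff_left ee)
  have L: "0 \<le> L" using g by (rule lipschitz_on_nonneg)
  have cg: "continuous_on UNIV (\<lambda>x. g (p x))"
    by (rule continuous_on_compose2[OF lipschitz_on_continuous_on[OF g]])
       (use p0 in \<open>auto simp: p_def intro!: continuous_intros\<close>)
  have closed: "closed {x. g (p x) \<le> x \<bullet> e}"
    by (intro closed_Collect_le cg continuous_intros)
  \<comment> \<open>A displacement \<open>w\<close> of norm at most one changes \<open>g\<close> by at most \<open>2 * L\<close> and the height by at most one;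
     the remaining unit makes the inequality strict.\<close>
  define \<kappa> where "\<kappa> = 2 * L + 2"
  define d where "d = r / (4 * (\<kappa> + 1))"
  have \<kappa>: "\<kappa> > 0" using L by (simp add: \<kappa>_def)
  have d: "d > 0" using r \<kappa> by (simp add: d_def)
  have "x \<in> \<Omega>" if \<delta>: "0 < \<delta>" "\<delta> < d" and x: "x \<in> cball a (r / 4)" and w: "norm w \<le> 1"
    and z: "x - \<delta> *\<^sub>R (\<kappa> *\<^sub>R e + w) \<in> closure \<Omega>" for \<delta> x w
  proof -
    define z where "z = x - \<delta> *\<^sub>R (\<kappa> *\<^sub>R e + w)"
    have "norm (\<kappa> *\<^sub>R e + w) \<le> \<kappa> + 1" using e w \<kappa> norm_triangle_ineq[of "\<kappa> *\<^sub>R e" w] by simp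
    then have "norm (\<delta> *\<^sub>R (\<kappa> *\<^sub>R e + w)) \<le> \<delta> * (\<kappa> + 1)" using \<delta>(1) by (simp add: mult_left_mono)
    also have "\<dots> < d * (\<kappa> + 1)" using \<delta> \<kappa> by (intro mult_strict_right_mono) auto
    also have "\<dots> = r / 4" using \<kappa> by (simp add: d_def field_simps)
    finally have "norm (x - z) < r / 4" by (simp add: z_def)
    moreover have "dist a x \<le> r / 4" using x by simp
    ultimately have zb: "z \<in> ball a r"
      using dist_triangle[of a z x] r by (simp add: dist_norm)
    have "z \<in> closure (\<Omega> \<inter> ball a r)"
      using z zb open_Int_closure_subset[OF open_ball, of a r \<Omega>] by (auto simp: z_def Int_commute)
    moreover have "closure (\<Omega> \<inter> ball a r) \<subseteq> {x. g (p x) \<le> x \<bullet> e}"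
      unfolding epi by (rule closure_minimal[OF _ closed]) (auto simp: p_def)
    ultimately have gz: "g (p z) \<le> z \<bullet> e" by blast
    have we: "\<bar>w \<bullet> e\<bar> \<le> 1" using Cauchy_Schwarz_ineq2[of w e] e w by simp
    have xz: "x = z + \<delta> *\<^sub>R (\<kappa> *\<^sub>R e + w)" by (simp add: z_def)
    have xe: "x \<bullet> e = z \<bullet> e + \<delta> * \<kappa> + \<delta> * (w \<bullet> e)"
      unfolding xz by (simp add: inner_add_left ee algebra_simps)
    have "p x - p z = \<delta> *\<^sub>R (w - (w \<bullet> e) *\<^sub>R e)"
      unfolding p_def xe by (simp add: xz algebra_simps)
    moreover have "norm (w - (w \<bullet> e) *\<^sub>R e) \<le> 2"
      using norm_triangle_ineq4[of w "(w \<bullet> e) *\<^sub>R e"] we w e by simp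
    ultimately have "norm (p x - p z) \<le> \<delta> * 2" using \<delta>(1) by (simp add: mult_left_mono)
    then have "dist (g (p x)) (g (p z)) \<le> L * (\<delta> * 2)"
      using lipschitz_onD[OF g p0[of x] p0[of z]] L by (metis dist_norm mult_left_mono order_trans)
    then have "g (p x) \<le> g (p z) + L * (\<delta> * 2)" by (simp add: dist_real_def)
    moreover have "\<delta> * (w \<bullet> e) \<ge> - \<delta>"
    proof -
      have "\<delta> * (- 1) \<le> \<delta> * (w \<bullet> e)" using we \<delta>(1) by (intro mult_left_mono) auto
      then show ?thesis by simp
    qed
    moreover have "\<delta> * \<kappa> = L * (\<delta> * 2) + 2 * \<delta>" by (simp add: \<kappa>_def algebra_simps)
    ultimately have "g (p x) < x \<bullet> e" using gz xe \<delta>(1) by linarith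
    moreover have "x \<in> ball a r" using x r by auto
    ultimately have "x \<in> \<Omega> \<inter> ball a r" unfolding epi by (simp add: p_def)
    then show ?thesis by blast
  qed
  then show ?thesis using r d
    by (intro exI[of _ "r / 4"] exI[of _ "\<kappa> *\<^sub>R e"] exI[of _ d]) auto
qed

text \<open>The partition of unity is obtained by mollifying a Borel partition of a neighbourhood of the closure
  of \<open>\<Omega>\<close>, so that no quotients of bump functions are needed. The last clause is what puts the supports of the
  glued functions inside \<open>\<Omega>\<close>: where \<open>\<theta> j\<close> does not vanish, a shifted ball that still meets \<open>\<Omega>\<close> is centred
  at the shift of a point of a compact subset of \<open>\<Omega>\<close>.\<close>

lemma Lipschitz_domain_partition:
  fixes \<Omega> :: "(real ^ 'n) set"
  assumes \<Omega>: "bounded_Lipschitz_domain \<Omega>"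
  obtains N :: nat and \<theta> :: "nat \<Rightarrow> real ^ 'n \<Rightarrow> real" and v d where "0 < d"
    "\<And>j. test_fun (\<theta> j)" "\<And>j x. 0 \<le> \<theta> j x" "\<And>x. (\<Sum>j<N. \<theta> j x) \<le> 1"
    "\<And>x. x \<in> \<Omega> \<Longrightarrow> (\<Sum>j<N. \<theta> j x) = 1"
    "\<And>j \<delta>. j < N \<Longrightarrow> 0 < \<delta> \<Longrightarrow> \<delta> < d \<Longrightarrow> \<exists>K. compact K \<and> K \<subseteq> \<Omega> \<and>
       (\<forall>x w. \<theta> j x \<noteq> 0 \<and> norm w \<le> 1 \<and> x - \<delta> *\<^sub>R (v j + w) \<in> \<Omega> \<longrightarrow> x \<in> K)"
proof -
  have "\<forall>a\<in>closure \<Omega>. \<exists>r v d. 0 < r \<and> 0 < d \<and> (\<forall>\<delta> x w. 0 < \<delta> \<and> \<delta> < d \<and> x \<in> cball a r \<and> norm w \<le> 1 \<and>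
      x - \<delta> *\<^sub>R (v + w) \<in> closure \<Omega> \<longrightarrow> x \<in> \<Omega>)"
    using Lipschitz_domain_patch[OF \<Omega>] by blast
  then obtain r v d where rvd: "\<And>a. a \<in> closure \<Omega> \<Longrightarrow> 0 < r a \<and> 0 < d a \<and>
      (\<forall>\<delta> x w. 0 < \<delta> \<and> \<delta> < d a \<and> x \<in> cball a (r a) \<and> norm w \<le> 1 \<and>
      x - \<delta> *\<^sub>R (v a + w) \<in> closure \<Omega> \<longrightarrow> x \<in> \<Omega>)"
    by metis
  have bd: "bounded \<Omega>" "\<Omega> \<noteq> {}" using \<Omega> by (auto simp: bounded_Lipschitz_domain_def)
  have cpt: "compact (closure \<Omega>)" using bd(1) by (simp add: compact_closure)
  have "closure \<Omega> \<subseteq> (\<Union>a\<in>closure \<Omega>. ball a (r a / 2))" using rvd by force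
  then obtain T where T: "T \<subseteq> closure \<Omega>" "finite T" "closure \<Omega> \<subseteq> (\<Union>a\<in>T. ball a (r a / 2))"
    by (rule compactE_image[where f="\<lambda>a. ball a (r a / 2)", OF cpt open_ball])
  have "T \<noteq> {}" using T(3) bd(2) closure_subset by fastforce
  obtain e where e: "bij_betw e {..<card T} T"
    using ex_bij_betw_nat_finite[OF T(2)] by (auto simp: atLeast0LessThan)
  define N where "N = card T"
  have eT: "e j \<in> T" if "j < N" for j using e that unfolding N_def bij_betw_def by auto
  define B where "B = (\<lambda>j. if j < N then ball (e j) (r (e j) / 2) else {})"
  define U where "U = (\<Union>j<N. B j)"
  have "closure \<Omega> \<subseteq> U"
  proof
    fix x assume "x \<in> closure \<Omega>"
    then obtain a where "a \<in> T" "x \<in> ball a (r a / 2)" using T(3) by blast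
    moreover then have "a \<in> e ` {..<N}" using e unfolding N_def bij_betw_def by blast
    then obtain j where "j < N" "e j = a" by auto
    ultimately show "x \<in> U" unfolding U_def B_def by auto
  qed
  moreover have "open U" unfolding U_def B_def by auto
  ultimately obtain \<epsilon>1 where \<epsilon>1: "\<epsilon>1 > 0" "(\<Union>x\<in>closure \<Omega>. cball x \<epsilon>1) \<subseteq> U"
    using compact_subset_open_imp_cball_epsilon_subset[OF cpt] by metis
  define \<epsilon> where "\<epsilon> = min \<epsilon>1 (Min ((\<lambda>a. r a / 2) ` T))"
  have Mr: "Min ((\<lambda>a. r a / 2) ` T) > 0" using T \<open>T \<noteq> {}\<close> rvd by (subst Min_gr_iff) auto
  have \<epsilon>: "\<epsilon> > 0" "\<epsilon> \<le> \<epsilon>1" using \<epsilon>1 Mr by (auto simp: \<epsilon>_def)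
  have \<epsilon>r: "\<epsilon> \<le> r a / 2" if "a \<in> T" for a
  proof -
    have "Min ((\<lambda>a. r a / 2) ` T) \<le> r a / 2" using that T(2) by (intro Min_le) auto
    then show ?thesis unfolding \<epsilon>_def by linarith
  qed
  define A where "A = disjointed B"
  obtain \<rho> :: "real ^ 'n \<Rightarrow> real" where \<rho>: "mollifier \<rho>" using mollifier_exists by blast
  note t = mollifier_test_fun[OF \<rho>]
  have \<rho>0: "\<rho> w \<ge> 0" "1 < norm w \<Longrightarrow> \<rho> w = 0" for w using \<rho> by (auto simp: mollifier_def)
  have \<rho>1: "integral\<^sup>L lborel \<rho> = 1" using \<rho> by (auto simp: mollifier_def)
  define \<theta> where "\<theta> = (\<lambda>j. conv \<rho> \<epsilon> (indicat_real (A j)))"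
  have Bb: "B j \<in> sets borel" for j unfolding B_def by (simp add: borel_open)
  have AB: "A j \<subseteq> B j" for j unfolding A_def by (rule disjointed_subset)
  have Ab: "A j \<in> sets borel" for j
    unfolding A_def using sets.range_disjointed_sets[of B borel] Bb by auto
  have Abd: "bounded (B j)" for j unfolding B_def by auto
  have iA: "integrable lborel (indicat_real (A j))" for j
  proof -
    have "emeasure lborel (A j) < \<infinity>"
      using emeasure_bounded_finite[OF bounded_subset[OF Abd AB]] .
    then show ?thesis using Ab by (intro integrable_real_indicator) auto
  qed
  have pos: "0 \<le> \<theta> j x" for j x
    unfolding \<theta>_def conv_def by (intro integral_nonneg_AE) (auto simp: \<rho>0)
  have supp: "\<exists>w. norm w \<le> 1 \<and> x - \<epsilon> *\<^sub>R w \<in> A j" if "\<theta> j x \<noteq> 0" for j x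
  proof (rule ccontr)
    assume *: "\<not> ?thesis"
    have "\<rho> w *\<^sub>R indicat_real (A j) (x - \<epsilon> *\<^sub>R w) = 0" for w
      using * \<rho>0(2)[of w] by (cases "norm w \<le> 1") (auto simp: indicator_def)
    then have "\<theta> j x = 0" unfolding \<theta>_def conv_def by (simp only: Bochner_Integration.integral_zero)
    with that show False by simp
  qed
  have supp': "x \<in> cball (e j) (r (e j))" if nz: "\<theta> j x \<noteq> 0" and jN: "j < N" for j x
  proof -
    obtain w where w: "norm w \<le> 1" "x - \<epsilon> *\<^sub>R w \<in> A j" using supp[OF nz] by blast
    then have "dist (e j) (x - \<epsilon> *\<^sub>R w) < r (e j) / 2" using AB jN by (force simp: B_def)
    moreover have "dist (x - \<epsilon> *\<^sub>R w) x \<le> \<epsilon>" using w(1) \<epsilon>(1) by (simp add: dist_norm mult_left_le)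
    ultimately show ?thesis
      using \<epsilon>r[OF eT[OF jN]] dist_triangle[of "e j" x "x - \<epsilon> *\<^sub>R w"] by simp
  qed
  have tf: "test_fun (\<theta> j)" for j
  proof -
    have "C_k k (\<theta> j)" for k
      unfolding \<theta>_def conv_eq_mol[OF t iA \<epsilon>(1)] using \<epsilon>(1) by (intro C_k_mol iA test_fun_scaled[OF t]) auto
    moreover obtain R where R: "\<And>x. x \<in> B j \<Longrightarrow> norm x \<le> R" using Abd bounded_iff by blast
    have "\<theta> j x = 0" if "R + \<epsilon> < norm x" for x
    proof (rule ccontr)
      assume "\<theta> j x \<noteq> 0"
      then obtain w where w: "norm w \<le> 1" "x - \<epsilon> *\<^sub>R w \<in> A j" using supp by blast
      have "norm x \<le> norm (x - \<epsilon> *\<^sub>R w) + norm (\<epsilon> *\<^sub>R w)" using norm_triangle_ineq[of "x - \<epsilon> *\<^sub>R w" "\<epsilon> *\<^sub>R w"] by simp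
      also have "\<dots> \<le> R + \<epsilon>" using R w AB[of j] \<epsilon>(1) by (intro add_mono) (auto simp: mult_left_le)
      finally show False using that by simp
    qed
    ultimately show ?thesis unfolding test_fun_def by blast
  qed
  have ind: "(\<Sum>j<N. indicat_real (A j) y) = indicator U y" for y
  proof -
    have "disjoint_family_on A {..<N}" using disjoint_family_disjointed[of B] unfolding A_def disjoint_family_on_def by blast
    then have "(\<Sum>j<N. indicat_real (A j) y) = indicator (\<Union>j<N. A j) y"
      by (simp add: indicator_UN_disjoint)
    also have "(\<Union>j<N. A j) = U"
      unfolding U_def A_def using finite_UN_disjointed_eq[of B N] by (simp add: atLeast0LessThan)
    finally show ?thesis .
  qed
  have sum: "(\<Sum>j<N. \<theta> j x) = (\<integral>w. \<rho> w * indicator U (x - \<epsilon> *\<^sub>R w) \<partial>lborel)" for x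
  proof -
    have "(\<Sum>j<N. \<theta> j x) = (\<integral>w. (\<Sum>j<N. \<rho> w *\<^sub>R indicat_real (A j) (x - \<epsilon> *\<^sub>R w)) \<partial>lborel)"
      unfolding \<theta>_def conv_def
      by (rule Bochner_Integration.integral_sum[symmetric]) (use \<epsilon>(1) in \<open>intro conv_integrable[OF t iA], simp\<close>)
    also have "\<dots> = (\<integral>w. \<rho> w * indicator U (x - \<epsilon> *\<^sub>R w) \<partial>lborel)"
      by (simp add: ind flip: sum_distrib_left)
    finally show ?thesis .
  qed
  have sum_int: "integrable lborel (\<lambda>w. \<rho> w * indicator U (x - \<epsilon> *\<^sub>R w))" for x
  proof -
    have "integrable lborel (\<lambda>w. (\<Sum>j<N. \<rho> w *\<^sub>R indicat_real (A j) (x - \<epsilon> *\<^sub>R w)))"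
      by (rule Bochner_Integration.integrable_sum) (use \<epsilon>(1) in \<open>intro conv_integrable[OF t iA], simp\<close>)
    then show ?thesis by (simp add: ind flip: sum_distrib_left)
  qed
  have le1: "(\<Sum>j<N. \<theta> j x) \<le> 1" for x
    unfolding sum \<rho>1[symmetric]
    by (intro integral_mono sum_int test_fun_integrable[OF t]) (auto simp: indicator_def \<rho>0)
  have eq1: "(\<Sum>j<N. \<theta> j x) = 1" if "x \<in> \<Omega>" for x
  proof -
    have "\<rho> w * indicator U (x - \<epsilon> *\<^sub>R w) = \<rho> w" for w
    proof (cases "norm w \<le> 1")
      case True
      then have "norm (\<epsilon> *\<^sub>R w) \<le> \<epsilon>1" using \<epsilon> by (metis abs_of_pos mult_left_le norm_scaleR order_trans less_imp_le)
      then have "x - \<epsilon> *\<^sub>R w \<in> cball x \<epsilon>1" by (simp add: dist_norm)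
      then have "x - \<epsilon> *\<^sub>R w \<in> U" using \<epsilon>1(2) that closure_subset by blast
      then show ?thesis by simp
    qed (simp add: \<rho>0)
    then show ?thesis unfolding sum by (simp only: \<rho>1)
  qed
  define D where "D = Min (d ` T)"
  have D: "D > 0" unfolding D_def using T \<open>T \<noteq> {}\<close> rvd by (subst Min_gr_iff) auto
  show ?thesis
  proof (rule that[of D \<theta> N "\<lambda>j. v (e j)"])
    fix j \<delta> assume j: "j < N" and \<delta>: "0 < \<delta>" "\<delta> < D"
    let ?K = "cball (e j) (r (e j)) \<inter> {y + z | y z. y \<in> closure \<Omega> \<and> z \<in> (\<lambda>w. \<delta> *\<^sub>R (v (e j) + w)) ` cball 0 1}"
    have ecl: "e j \<in> closure \<Omega>" using eT[OF j] T(1) by blast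
    have "D \<le> d (e j)" unfolding D_def using eT[OF j] T(2) by (intro Min_le) auto
    then have dj: "\<delta> < d (e j)" using \<delta>(2) by linarith
    show "\<exists>K. compact K \<and> K \<subseteq> \<Omega> \<and> (\<forall>x w. \<theta> j x \<noteq> 0 \<and> norm w \<le> 1 \<and> x - \<delta> *\<^sub>R (v (e j) + w) \<in> \<Omega> \<longrightarrow> x \<in> K)"
    proof (intro exI[of _ ?K] conjI allI impI)
      show "compact ?K"
        by (intro compact_Int compact_cball compact_sums cpt compact_continuous_image continuous_intros)
      show "?K \<subseteq> \<Omega>"
      proof
        fix x assume "x \<in> ?K"
        then obtain y w where "x \<in> cball (e j) (r (e j))" "x = y + \<delta> *\<^sub>R (v (e j) + w)" "y \<in> closure \<Omega>" "norm w \<le> 1"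
          by auto
        moreover then have "x - \<delta> *\<^sub>R (v (e j) + w) \<in> closure \<Omega>" by simp
        ultimately show "x \<in> \<Omega>" using rvd[OF ecl] \<delta>(1) dj by blast
      qed
      fix x w assume *: "\<theta> j x \<noteq> 0 \<and> norm w \<le> 1 \<and> x - \<delta> *\<^sub>R (v (e j) + w) \<in> \<Omega>"
      have "x = (x - \<delta> *\<^sub>R (v (e j) + w)) + \<delta> *\<^sub>R (v (e j) + w)" by simp
      moreover have "x - \<delta> *\<^sub>R (v (e j) + w) \<in> closure \<Omega>" using * closure_subset by blast
      moreover have "w \<in> cball 0 1" using * by simp
      ultimately have "x \<in> {y + z | y z. y \<in> closure \<Omega> \<and> z \<in> (\<lambda>w. \<delta> *\<^sub>R (v (e j) + w)) ` cball 0 1}"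
        by blast
      then show "x \<in> ?K" using supp'[OF _ j] * by blast
    qed
  qed (use D tf pos le1 eq1 in auto)
qed

section \<open>The approximating functions\<close>

definition outer :: "real ^ 'd \<Rightarrow> real ^ 'n \<Rightarrow> real ^ 'n ^ 'd" where
  "outer a b = (\<chi> i. (a $ i) *\<^sub>R b)"

definition tgrad :: "(real ^ 'n \<Rightarrow> real) \<Rightarrow> real ^ 'n \<Rightarrow> real ^ 'n" where
  "tgrad \<eta> x = (\<chi> k. dirder \<eta> (axis k 1) x)"

lemma outer_mult: "outer a b *v h = (b \<bullet> h) *\<^sub>R a"
  by (simp add: vec_eq_iff outer_def matrix_vector_mul_component)

lemma outer_diff_left: "outer (a - b) c = outer a c - outer b c"
  by (simp add: outer_def vec_eq_iff scaleR_left_diff_distrib algebra_simps)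

lemma outer_sum_right: "outer a (\<Sum>i\<in>I. f i) = (\<Sum>i\<in>I. outer a (f i))"
  by (simp add: outer_def vec_eq_iff sum_distrib_left)

lemma norm_outer_le: "norm (outer a b :: real ^ 'n ^ 'd) \<le> real CARD('d) * norm a * norm b"
proof -
  have "norm (outer a b :: real ^ 'n ^ 'd) \<le> (\<Sum>i\<in>UNIV. norm (outer a b $ i))" by (rule norm_vec_le_sum)
  also have "\<dots> \<le> (\<Sum>i\<in>(UNIV :: 'd set). norm a * norm b)"
    by (intro sum_mono) (auto simp: outer_def component_le_norm_cart intro!: mult_right_mono)
  finally show ?thesis by simp
qed

lemma dirder_tgrad:
  assumes "test_fun \<eta>" shows "dirder \<eta> h x = tgrad \<eta> x \<bullet> h"
proof -
  have "dirder \<eta> (\<Sum>k\<in>UNIV. h $ k *\<^sub>R axis k 1) x = (\<Sum>k\<in>UNIV. dirder \<eta> (h $ k *\<^sub>R axis k 1) x)"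
    using linear_sum[OF dirder_linear[OF assms]] .
  also have "\<dots> = (\<Sum>k\<in>UNIV. h $ k * dirder \<eta> (axis k 1) x)"
    by (intro sum.cong refl) (use linear_scale[OF dirder_linear[OF assms, of x]] in simp)
  also have "(\<Sum>k\<in>UNIV. h $ k *\<^sub>R axis k 1) = h" using basis_expansion[of h] by (simp add: scalar_mult_eq_scaleR)
  finally show ?thesis by (simp add: tgrad_def inner_vec_def mult.commute)
qed

lemma tgrad_bounded:
  assumes "test_fun \<eta>" obtains B where "0 \<le> B" "\<And>x. norm (tgrad \<eta> x) \<le> B"
proof -
  obtain L where L: "0 \<le> L" "\<And>h x. \<bar>dirder \<eta> h x\<bar> \<le> L * norm h" using test_fun_dirder_bound[OF assms] by metis
  have "norm (tgrad \<eta> x) \<le> L" for x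
  proof -
    have "norm (tgrad \<eta> x) * norm (tgrad \<eta> x) = dirder \<eta> (tgrad \<eta> x) x"
      by (simp add: dirder_tgrad[OF assms] dot_square_norm power2_eq_square)
    also have "\<dots> \<le> L * norm (tgrad \<eta> x)" using L(2)[of "tgrad \<eta> x" x] by linarith
    finally show ?thesis using L(1) by (cases "tgrad \<eta> x = 0") auto
  qed
  with L(1) that show ?thesis by blast
qed

text \<open>Each mollification is shifted in its own direction \<open>v j\<close>, into the domain near the support of \<open>\<theta> j\<close>.
  The same operation is applied to functions, to their gradients and to the density of the modular.\<close>

definition glue ::
    "(real ^ 'n \<Rightarrow> real) \<Rightarrow> nat \<Rightarrow> (nat \<Rightarrow> real ^ 'n \<Rightarrow> real) \<Rightarrow> (nat \<Rightarrow> real ^ 'n) \<Rightarrow> real \<Rightarrow> (real ^ 'n \<Rightarrow> 'b::euclidean_space) \<Rightarrow> real ^ 'n \<Rightarrow> 'b" where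
  "glue \<rho> N \<theta> v \<delta> u x = (\<Sum>j<N. \<theta> j x *\<^sub>R conv \<rho> \<delta> u (x - \<delta> *\<^sub>R v j))"

definition glue_error ::
    "(real ^ 'n \<Rightarrow> real) \<Rightarrow> nat \<Rightarrow> (nat \<Rightarrow> real ^ 'n \<Rightarrow> real) \<Rightarrow> (nat \<Rightarrow> real ^ 'n) \<Rightarrow> real \<Rightarrow> (real ^ 'n \<Rightarrow> real ^ 'd) \<Rightarrow> real ^ 'n \<Rightarrow> real ^ 'n ^ 'd" where
  "glue_error \<rho> N \<theta> v \<delta> u x = (\<Sum>j<N. outer (conv \<rho> \<delta> u (x - \<delta> *\<^sub>R v j)) (tgrad (\<theta> j) x))"

text \<open>A summand that does not vanish at \<open>x\<close> averages over a point of \<open>\<Omega>\<close>, which puts \<open>x\<close> into the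
  compact set \<open>K\<close>.\<close>

lemma glue_Cc_infty:
  fixes u :: "real ^ 'n \<Rightarrow> 'b :: euclidean_space"
  assumes \<rho>: "mollifier \<rho>" and u: "integrable lborel u" "\<And>x. x \<notin> \<Omega> \<Longrightarrow> u x = 0"
    and \<theta>: "\<And>j. test_fun (\<theta> j)" and \<delta>: "0 < \<delta>"
    and K: "\<And>j. j < N \<Longrightarrow> \<exists>K. compact K \<and> K \<subseteq> \<Omega> \<and>
       (\<forall>x w. \<theta> j x \<noteq> 0 \<and> norm w \<le> 1 \<and> x - \<delta> *\<^sub>R (v j + w) \<in> \<Omega> \<longrightarrow> x \<in> K)"
  shows "glue \<rho> N \<theta> v \<delta> u \<in> Cc_infty \<Omega>"
proof -
  note t = mollifier_test_fun[OF \<rho>]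
  have C: "C_k k (glue \<rho> N \<theta> v \<delta> u)" for k
  proof -
    have "C_k k (\<lambda>x. conv \<rho> \<delta> u (- (\<delta> *\<^sub>R v j) + 1 *\<^sub>R x))" for j
      unfolding conv_eq_mol[OF t u(1) \<delta>] by (intro C_k_affine C_k_mol u(1) test_fun_scaled[OF t]) (use \<delta> in auto)
    then have "C_k k (\<lambda>x. \<theta> j x *\<^sub>R conv \<rho> \<delta> u (x - \<delta> *\<^sub>R v j))" for j
      using \<theta>[of j] by (intro C_k_scaleR) (auto simp: test_fun_def algebra_simps)
    then show ?thesis unfolding glue_def[abs_def] by (rule C_k_sum)
  qed
  obtain K where K: "\<And>j. j < N \<Longrightarrow> compact (K j) \<and> K j \<subseteq> \<Omega> \<and>
       (\<forall>x w. \<theta> j x \<noteq> 0 \<and> norm w \<le> 1 \<and> x - \<delta> *\<^sub>R (v j + w) \<in> \<Omega> \<longrightarrow> x \<in> K j)"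
    using K by metis
  let ?K = "\<Union>j<N. K j"
  have cK: "compact ?K" using K by (intro compact_UN) auto
  have "x \<in> ?K" if "glue \<rho> N \<theta> v \<delta> u x \<noteq> 0" for x
  proof -
    obtain j where j: "j < N" "\<theta> j x *\<^sub>R conv \<rho> \<delta> u (x - \<delta> *\<^sub>R v j) \<noteq> 0"
      using \<open>glue \<rho> N \<theta> v \<delta> u x \<noteq> 0\<close> unfolding glue_def by (metis (no_types, lifting) lessThan_iff sum.neutral)
    have "\<exists>w. norm w \<le> 1 \<and> x - \<delta> *\<^sub>R (v j + w) \<in> \<Omega>"
    proof (rule ccontr)
      assume *: "\<not> ?thesis"
      have "\<rho> w *\<^sub>R u (x - \<delta> *\<^sub>R v j - \<delta> *\<^sub>R w) = 0" for w
      proof (cases "norm w \<le> 1")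
        case True
        then have "x - \<delta> *\<^sub>R v j - \<delta> *\<^sub>R w \<notin> \<Omega>" using * by (simp add: algebra_simps)
        then show ?thesis using u(2) by simp
      next
        case False
        then show ?thesis using \<rho> by (auto simp: mollifier_def)
      qed
      then have "conv \<rho> \<delta> u (x - \<delta> *\<^sub>R v j) = 0" unfolding conv_def by (simp only: Bochner_Integration.integral_zero)
      with j(2) show False by simp
    qed
    then show ?thesis using K[OF j(1)] j by auto
  qed
  then have sub: "closure {x. glue \<rho> N \<theta> v \<delta> u x \<noteq> 0} \<subseteq> ?K"
    using cK by (intro closure_minimal compact_imp_closed) auto
  then have "closure {x. glue \<rho> N \<theta> v \<delta> u x \<noteq> 0} = ?K \<inter> closure {x. glue \<rho> N \<theta> v \<delta> u x \<noteq> 0}" by blast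
  then have "compact (closure {x. glue \<rho> N \<theta> v \<delta> u x \<noteq> 0})"
    using compact_Int_closed[OF cK closed_closure] by metis
  moreover have "?K \<subseteq> \<Omega>" using K by blast
  ultimately show ?thesis unfolding Cc_infty_def using C sub by blast
qed

lemma glue_grad:
  fixes u :: "real ^ 'n \<Rightarrow> real ^ 'd"
  assumes \<rho>: "test_fun \<rho>" and u: "sobolev_pair \<Omega> u G" and \<Omega>: "bounded \<Omega>"
    and \<theta>: "\<And>j. test_fun (\<theta> j)" and \<delta>: "0 < \<delta>"
  shows "grad (glue \<rho> N \<theta> v \<delta> u) x = glue \<rho> N \<theta> v \<delta> G x + glue_error \<rho> N \<theta> v \<delta> u x"
proof (rule grad_eqI)
  have "((\<lambda>x. \<theta> j x *\<^sub>R conv \<rho> \<delta> u (x - \<delta> *\<^sub>R v j)) has_derivative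
     (\<lambda>h. \<theta> j x *\<^sub>R (conv \<rho> \<delta> G (x - \<delta> *\<^sub>R v j) *v h) + dirder (\<theta> j) h x *\<^sub>R conv \<rho> \<delta> u (x - \<delta> *\<^sub>R v j))) (at x)" for j
  proof (rule has_derivative_scaleR[OF test_fun_has_derivative[OF \<theta>]])
    have "((\<lambda>x. x - \<delta> *\<^sub>R v j) has_derivative (\<lambda>h. h)) (at x)" by (auto intro!: derivative_eq_intros)
    from diff_chain_at[OF this conv_sobolev_has_derivative[OF \<rho> u \<Omega> \<delta>]]
    show "((\<lambda>x. conv \<rho> \<delta> u (x - \<delta> *\<^sub>R v j)) has_derivative (\<lambda>h. conv \<rho> \<delta> G (x - \<delta> *\<^sub>R v j) *v h)) (at x)"
      by (simp add: o_def)
  qed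
  then have "((\<lambda>x. \<Sum>j<N. \<theta> j x *\<^sub>R conv \<rho> \<delta> u (x - \<delta> *\<^sub>R v j)) has_derivative
     (\<lambda>h. \<Sum>j<N. \<theta> j x *\<^sub>R (conv \<rho> \<delta> G (x - \<delta> *\<^sub>R v j) *v h) + dirder (\<theta> j) h x *\<^sub>R conv \<rho> \<delta> u (x - \<delta> *\<^sub>R v j))) (at x)"
    by (rule has_derivative_sum)
  moreover have "(\<Sum>j<N. \<theta> j x *\<^sub>R (conv \<rho> \<delta> G (x - \<delta> *\<^sub>R v j) *v h) + dirder (\<theta> j) h x *\<^sub>R conv \<rho> \<delta> u (x - \<delta> *\<^sub>R v j))
      = (glue \<rho> N \<theta> v \<delta> G x + glue_error \<rho> N \<theta> v \<delta> u x) *v h" for h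
  proof -
    have mv: "(\<Sum>j<N. A j) *v h = (\<Sum>j<N. A j *v h)" for A :: "nat \<Rightarrow> real ^ 'n ^ 'd"
      using linear_sum[OF bounded_linear.linear[OF bounded_linear_matrix_vector_left[of h]]] .
    show ?thesis
      unfolding glue_def glue_error_def matrix_vector_mult_add_rdistrib mv
      by (simp add: sum.distrib outer_mult dirder_tgrad[OF \<theta>] scaleR_matrix_vector_assoc)
  qed
  ultimately show "(glue \<rho> N \<theta> v \<delta> u has_derivative (\<lambda>h. (glue \<rho> N \<theta> v \<delta> G x + glue_error \<rho> N \<theta> v \<delta> u x) *v h)) (at x)"
    unfolding glue_def[abs_def] by simp
qed

lemma partition_tgrad_sum:
  assumes "open \<Omega>" "x \<in> \<Omega>" "\<And>j. test_fun (\<theta> j)" "\<And>x. x \<in> \<Omega> \<Longrightarrow> (\<Sum>j<N. \<theta> j x) = 1"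
  shows "(\<Sum>j<N. tgrad (\<theta> j) x) = 0"
proof -
  have "((\<lambda>x. \<Sum>j<N. \<theta> j x) has_derivative (\<lambda>h. \<Sum>j<N. dirder (\<theta> j) h x)) (at x)"
    by (rule has_derivative_sum[OF test_fun_has_derivative[OF assms(3)]])
  moreover have "((\<lambda>x. \<Sum>j<N. \<theta> j x) has_derivative (\<lambda>h. 0)) (at x)"
    by (rule has_derivative_zero_on_open[OF assms(1,2,4)])
  ultimately have "(\<lambda>h. \<Sum>j<N. dirder (\<theta> j) h x) = (\<lambda>h. 0)" by (rule has_derivative_unique)
  then have "(\<Sum>j<N. dirder (\<theta> j) h x) = 0" for h by (rule fun_cong)
  then show ?thesis by (simp add: vec_eq_iff tgrad_def)
qed

lemma conv_norm_le:
  fixes u :: "real ^ 'n \<Rightarrow> 'b :: euclidean_space"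
  assumes \<rho>: "mollifier \<rho>" and u: "integrable lborel u" "\<And>x. norm (u x) \<le> b" and \<delta>: "\<delta> \<noteq> 0"
  shows "norm (conv \<rho> \<delta> u z) \<le> b"
proof -
  note t = mollifier_test_fun[OF \<rho>]
  have "norm (conv \<rho> \<delta> u z) \<le> (\<integral>w. norm (\<rho> w *\<^sub>R u (z - \<delta> *\<^sub>R w)) \<partial>lborel)"
    unfolding conv_def by (rule integral_norm_bound)
  also have "\<dots> \<le> (\<integral>w. \<rho> w * b \<partial>lborel)"
  proof (rule integral_mono)
    show "integrable lborel (\<lambda>w. norm (\<rho> w *\<^sub>R u (z - \<delta> *\<^sub>R w)))"
      by (rule integrable_norm[OF conv_integrable[OF t u(1) \<delta>]])
    show "integrable lborel (\<lambda>w. \<rho> w * b)" using test_fun_integrable[OF t] by simp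
  qed (use u(2) \<rho> in \<open>auto simp: mollifier_def intro!: mult_left_mono\<close>)
  also have "\<dots> = b" using \<rho> by (simp add: mollifier_def)
  finally show ?thesis .
qed

lemma glue_norm_le:
  fixes u :: "real ^ 'n \<Rightarrow> 'b :: euclidean_space"
  assumes \<rho>: "mollifier \<rho>" and u: "integrable lborel u" "\<And>x. norm (u x) \<le> b" and \<delta>: "\<delta> \<noteq> 0"
    and \<theta>: "\<And>j x. 0 \<le> \<theta> j x" "\<And>x. (\<Sum>j<N. \<theta> j x) \<le> 1"
  shows "norm (glue \<rho> N \<theta> v \<delta> u x) \<le> b"
proof -
  have b: "0 \<le> b" using order_trans[OF norm_ge_zero u(2)] .
  have "norm (glue \<rho> N \<theta> v \<delta> u x) \<le> (\<Sum>j<N. \<theta> j x * b)"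
    unfolding glue_def using \<theta>(1) conv_norm_le[OF \<rho> u \<delta>]
    by (intro sum_norm_le) (auto intro!: mult_left_mono)
  also have "\<dots> = (\<Sum>j<N. \<theta> j x) * b" by (simp add: sum_distrib_right)
  also have "\<dots> \<le> b" using mult_right_mono[OF \<theta>(2) b] by simp
  finally show ?thesis .
qed

lemma glue_error_norm_le:
  fixes u :: "real ^ 'n \<Rightarrow> real ^ 'd"
  assumes \<rho>: "mollifier \<rho>" and u: "integrable lborel u" "\<And>x. norm (u x) \<le> b" and \<delta>: "\<delta> \<noteq> 0"
    and B: "\<And>j x. norm (tgrad (\<theta> j) x) \<le> B"
  shows "norm (glue_error \<rho> N \<theta> v \<delta> u x) \<le> real N * (real CARD('d) * b * B)"
proof -
  have b: "0 \<le> b" using order_trans[OF norm_ge_zero u(2)] .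
  have "norm (glue_error \<rho> N \<theta> v \<delta> u x) \<le> (\<Sum>j<N. real CARD('d) * b * B)"
    unfolding glue_error_def
  proof (rule sum_norm_le)
    fix j
    have "norm (outer (conv \<rho> \<delta> u (x - \<delta> *\<^sub>R v j)) (tgrad (\<theta> j) x) :: real ^ 'n ^ 'd)
        \<le> real CARD('d) * norm (conv \<rho> \<delta> u (x - \<delta> *\<^sub>R v j)) * norm (tgrad (\<theta> j) x)" by (rule norm_outer_le)
    also have "\<dots> \<le> real CARD('d) * b * B"
      using b by (intro mult_mono conv_norm_le[OF \<rho> u \<delta>] B) auto
    finally show "norm (outer (conv \<rho> \<delta> u (x - \<delta> *\<^sub>R v j)) (tgrad (\<theta> j) x) :: real ^ 'n ^ 'd) \<le> real CARD('d) * b * B" .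
  qed
  then show ?thesis by simp
qed

lemma conv_borel_measurable:
  fixes f :: "real ^ 'n \<Rightarrow> 'b :: euclidean_space"
  assumes "test_fun \<rho>" "integrable lborel f" "\<delta> > 0"
  shows "(\<lambda>x. conv \<rho> \<delta> f (x - a)) \<in> borel_measurable borel"
proof -
  have "continuous_on UNIV (conv \<rho> \<delta> f)"
    unfolding conv_eq_mol[OF assms] using assms by (intro C_k_imp_continuous[OF C_k_mol[of _ _ 0]] test_fun_scaled) auto
  from borel_measurable_continuous_onI[OF this] show ?thesis by measurable
qed

lemma glue_L1:
  fixes f :: "real ^ 'n \<Rightarrow> 'b :: euclidean_space"
  assumes \<rho>: "mollifier \<rho>" and f: "integrable lborel f"
    and \<theta>: "\<And>j. test_fun (\<theta> j)" "\<And>j x. 0 \<le> \<theta> j x" "\<And>x. x \<in> \<Omega> \<Longrightarrow> (\<Sum>j<N. \<theta> j x) = 1"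
    and \<delta>: "\<delta> \<longlonglongrightarrow> 0" "\<And>n. \<delta> n > 0"
  shows "(\<lambda>n. \<integral>\<^sup>+x. ennreal (norm (glue \<rho> N \<theta> v (\<delta> n) f x - f x)) * indicator \<Omega> x \<partial>lborel) \<longlonglongrightarrow> 0"
proof (rule tendsto_sandwich[OF _ _ tendsto_const])
  note t = mollifier_test_fun[OF \<rho>]
  note [measurable] = conv_borel_measurable[OF t f \<delta>(2)] integrable_borel_measurable[OF f]
  let ?e = "\<lambda>n j x. norm (conv \<rho> (\<delta> n) f (x - \<delta> n *\<^sub>R v j) - f x)"
  show "(\<lambda>n. \<Sum>j<N. \<integral>\<^sup>+x. ennreal (?e n j x) \<partial>lborel) \<longlonglongrightarrow> 0"
    using tendsto_sum[of "{..<N}" "\<lambda>j n. \<integral>\<^sup>+x. ennreal (?e n j x) \<partial>lborel" "\<lambda>_. 0" sequentially] conv_shift_L1[OF \<rho> f \<delta>]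
    by simp
  show "\<forall>\<^sub>F n in sequentially. (\<integral>\<^sup>+x. ennreal (norm (glue \<rho> N \<theta> v (\<delta> n) f x - f x)) * indicator \<Omega> x \<partial>lborel)
      \<le> (\<Sum>j<N. \<integral>\<^sup>+x. ennreal (?e n j x) \<partial>lborel)"
  proof (intro always_eventually allI)
    fix n
    have "ennreal (norm (glue \<rho> N \<theta> v (\<delta> n) f x - f x)) * indicator \<Omega> x \<le> ennreal (\<Sum>j<N. ?e n j x)" for x
    proof (cases "x \<in> \<Omega>")
      case True
      have "glue \<rho> N \<theta> v (\<delta> n) f x - f x = glue \<rho> N \<theta> v (\<delta> n) f x - (\<Sum>j<N. \<theta> j x) *\<^sub>R f x"
        using \<theta>(3)[OF True] by simp
      also have "\<dots> = (\<Sum>j<N. \<theta> j x *\<^sub>R (conv \<rho> (\<delta> n) f (x - \<delta> n *\<^sub>R v j) - f x))"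
        by (simp add: glue_def scaleR_left.sum sum_subtractf[symmetric] scaleR_right_diff_distrib)
      finally have "norm (glue \<rho> N \<theta> v (\<delta> n) f x - f x) = norm (\<Sum>j<N. \<theta> j x *\<^sub>R (conv \<rho> (\<delta> n) f (x - \<delta> n *\<^sub>R v j) - f x))"
        by simp
      also have "\<dots> \<le> (\<Sum>j<N. ?e n j x)"
      proof (rule sum_norm_le)
        fix j assume "j \<in> {..<N}"
        then have "\<theta> j x \<le> (\<Sum>j<N. \<theta> j x)" by (intro member_le_sum) (auto simp: \<theta>(2))
        then have "\<theta> j x \<le> 1" using \<theta>(3)[OF True] by simp
        then show "norm (\<theta> j x *\<^sub>R (conv \<rho> (\<delta> n) f (x - \<delta> n *\<^sub>R v j) - f x)) \<le> ?e n j x"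
          using \<theta>(2)[of j x] by (simp add: mult_left_le_one_le)
      qed
      finally show ?thesis using True by (simp add: ennreal_leI)
    qed simp
    then have "(\<integral>\<^sup>+x. ennreal (norm (glue \<rho> N \<theta> v (\<delta> n) f x - f x)) * indicator \<Omega> x \<partial>lborel)
        \<le> (\<integral>\<^sup>+x. ennreal (\<Sum>j<N. ?e n j x) \<partial>lborel)" by (rule nn_integral_mono)
    also have "\<dots> = (\<integral>\<^sup>+x. (\<Sum>j<N. ennreal (?e n j x)) \<partial>lborel)" by simp
    also have "\<dots> = (\<Sum>j<N. \<integral>\<^sup>+x. ennreal (?e n j x) \<partial>lborel)" by (rule nn_integral_sum) measurable
    finally show "(\<integral>\<^sup>+x. ennreal (norm (glue \<rho> N \<theta> v (\<delta> n) f x - f x)) * indicator \<Omega> x \<partial>lborel)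
      \<le> (\<Sum>j<N. \<integral>\<^sup>+x. ennreal (?e n j x) \<partial>lborel)" .
  qed
qed auto

text \<open>On \<open>\<Omega>\<close> the gradients of the \<open>\<theta>\<^sub>j\<close> add up to zero, so \<open>u\<close> may be subtracted from each of its
  mollifications.\<close>

lemma glue_error_L1:
  fixes u :: "real ^ 'n \<Rightarrow> real ^ 'd"
  assumes \<rho>: "mollifier \<rho>" and u: "integrable lborel u" and \<Omega>: "open \<Omega>"
    and \<theta>: "\<And>j. test_fun (\<theta> j)" "\<And>x. x \<in> \<Omega> \<Longrightarrow> (\<Sum>j<N. \<theta> j x) = 1"
    and B: "\<And>j x. norm (tgrad (\<theta> j) x) \<le> B" "0 \<le> B"
    and \<delta>: "\<delta> \<longlonglongrightarrow> 0" "\<And>n. \<delta> n > 0"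
  shows "(\<lambda>n. \<integral>\<^sup>+x. ennreal (norm (glue_error \<rho> N \<theta> v (\<delta> n) u x)) * indicator \<Omega> x \<partial>lborel) \<longlonglongrightarrow> 0"
proof (rule tendsto_sandwich[OF _ _ tendsto_const])
  note t = mollifier_test_fun[OF \<rho>]
  note [measurable] = conv_borel_measurable[OF t u \<delta>(2)] integrable_borel_measurable[OF u]
  let ?e = "\<lambda>n j x. norm (conv \<rho> (\<delta> n) u (x - \<delta> n *\<^sub>R v j) - u x)"
  let ?C = "real CARD('d) * B"
  have lim: "(\<lambda>n. \<Sum>j<N. \<integral>\<^sup>+x. ennreal (?e n j x) \<partial>lborel) \<longlonglongrightarrow> 0"
    using tendsto_sum[of "{..<N}" "\<lambda>j n. \<integral>\<^sup>+x. ennreal (?e n j x) \<partial>lborel" "\<lambda>_. 0" sequentially] conv_shift_L1[OF \<rho> u \<delta>]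
    by simp
  show "(\<lambda>n. ennreal ?C * (\<Sum>j<N. \<integral>\<^sup>+x. ennreal (?e n j x) \<partial>lborel)) \<longlonglongrightarrow> 0"
    using ennreal_tendsto_cmult[OF _ lim, of "ennreal ?C"] by simp
  show "\<forall>\<^sub>F n in sequentially. (\<integral>\<^sup>+x. ennreal (norm (glue_error \<rho> N \<theta> v (\<delta> n) u x)) * indicator \<Omega> x \<partial>lborel)
      \<le> ennreal ?C * (\<Sum>j<N. \<integral>\<^sup>+x. ennreal (?e n j x) \<partial>lborel)"
  proof (intro always_eventually allI)
    fix n
    have "ennreal (norm (glue_error \<rho> N \<theta> v (\<delta> n) u x)) * indicator \<Omega> x \<le> ennreal ?C * (\<Sum>j<N. ennreal (?e n j x))" for x
    proof (cases "x \<in> \<Omega>")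
      case True
      have "glue_error \<rho> N \<theta> v (\<delta> n) u x = glue_error \<rho> N \<theta> v (\<delta> n) u x - outer (u x) (\<Sum>j<N. tgrad (\<theta> j) x)"
        using partition_tgrad_sum[OF \<Omega> True \<theta>] by (simp add: outer_def vec_eq_iff)
      also have "\<dots> = (\<Sum>j<N. outer (conv \<rho> (\<delta> n) u (x - \<delta> n *\<^sub>R v j) - u x) (tgrad (\<theta> j) x))"
        by (simp add: glue_error_def outer_sum_right outer_diff_left sum_subtractf)
      finally have "norm (glue_error \<rho> N \<theta> v (\<delta> n) u x) = norm (\<Sum>j<N. outer (conv \<rho> (\<delta> n) u (x - \<delta> n *\<^sub>R v j) - u x) (tgrad (\<theta> j) x))"
        by simp
      also have "\<dots> \<le> (\<Sum>j<N. ?C * ?e n j x)"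
      proof (rule sum_norm_le)
        fix j
        have "norm (outer (conv \<rho> (\<delta> n) u (x - \<delta> n *\<^sub>R v j) - u x) (tgrad (\<theta> j) x) :: real ^ 'n ^ 'd)
            \<le> real CARD('d) * ?e n j x * norm (tgrad (\<theta> j) x)" by (rule norm_outer_le)
        also have "\<dots> \<le> real CARD('d) * ?e n j x * B" by (intro mult_left_mono B) auto
        finally show "norm (outer (conv \<rho> (\<delta> n) u (x - \<delta> n *\<^sub>R v j) - u x) (tgrad (\<theta> j) x) :: real ^ 'n ^ 'd) \<le> ?C * ?e n j x"
          by (simp add: mult_ac)
      qed
      also have "\<dots> = ?C * (\<Sum>j<N. ?e n j x)" by (simp add: sum_distrib_left)
      finally have "norm (glue_error \<rho> N \<theta> v (\<delta> n) u x) \<le> ?C * (\<Sum>j<N. ?e n j x)" .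
      then have "ennreal (norm (glue_error \<rho> N \<theta> v (\<delta> n) u x)) \<le> ennreal ?C * ennreal (\<Sum>j<N. ?e n j x)"
        using B(2) by (subst ennreal_mult[symmetric]) (auto intro: ennreal_leI sum_nonneg)
      then show ?thesis using True by simp
    qed simp
    then have "(\<integral>\<^sup>+x. ennreal (norm (glue_error \<rho> N \<theta> v (\<delta> n) u x)) * indicator \<Omega> x \<partial>lborel)
        \<le> (\<integral>\<^sup>+x. ennreal ?C * (\<Sum>j<N. ennreal (?e n j x)) \<partial>lborel)" by (rule nn_integral_mono)
    also have "\<dots> = ennreal ?C * (\<Sum>j<N. \<integral>\<^sup>+x. ennreal (?e n j x) \<partial>lborel)"
    proof (subst nn_integral_cmult)
      show "ennreal ?C * (\<integral>\<^sup>+x. (\<Sum>j<N. ennreal (?e n j x)) \<partial>lborel) = ennreal ?C * (\<Sum>j<N. \<integral>\<^sup>+x. ennreal (?e n j x) \<partial>lborel)"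
        by (subst nn_integral_sum) auto
    qed measurable
    finally show "(\<integral>\<^sup>+x. ennreal (norm (glue_error \<rho> N \<theta> v (\<delta> n) u x)) * indicator \<Omega> x \<partial>lborel)
      \<le> ennreal ?C * (\<Sum>j<N. \<integral>\<^sup>+x. ennreal (?e n j x) \<partial>lborel)" .
  qed
qed auto

section \<open>The balance condition and Jensen's inequality\<close>

lemma open_AE_empty:
  fixes U :: "'a :: euclidean_space set"
  assumes "open U" "AE x in lborel. x \<notin> U"
  shows "U = {}"
proof (rule ccontr)
  assume "U \<noteq> {}"
  then obtain x r where r: "r > 0" "ball x r \<subseteq> U" using assms(1) open_contains_ball by blast
  have "AE y in lborel. y \<notin> ball x r" using assms(2) by eventually_elim (use r in auto)
  then have "ball x r \<in> null_sets lborel" by (subst AE_iff_null_sets) auto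
  then show False using content_ball_pos[OF r(1), of x] by (auto simp: measure_def)
qed

lemma AE_le_continuous:
  fixes f :: "'a :: euclidean_space \<Rightarrow> real"
  assumes S: "open S" "continuous_on S f" and ae: "AE x in lebesgue_on S. f x \<le> c" and x: "x \<in> S"
  shows "f x \<le> c"
proof -
  have op: "open (S \<inter> f -` {c<..})" by (rule continuous_open_preimage[OF S(2,1)]) auto
  have "AE x in lborel. x \<in> S \<longrightarrow> f x \<le> c"
    using ae S(1) by (subst (asm) lebesgue_on_AE_iff) (auto simp: borel_open)
  then have "AE x in lborel. x \<notin> S \<inter> f -` {c<..}" by eventually_elim auto
  from open_AE_empty[OF op this] x show ?thesis by force
qed

locale regular_N_function =
  fixes \<Omega> :: "(real ^ 'n) set" and M :: "real ^ 'n \<Rightarrow> 'a::euclidean_space \<Rightarrow> real" and m1 m2 :: "real \<Rightarrow> real"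
  assumes open_\<Omega>: "open \<Omega>"
    and M_continuous: "continuous_on (\<Omega> \<times> UNIV) (\<lambda>(x, \<xi>). M x \<xi>)"
    and M_nonneg: "x \<in> \<Omega> \<Longrightarrow> 0 \<le> M x \<xi>"
    and M_zero: "x \<in> \<Omega> \<Longrightarrow> M x 0 = 0"
    and M_convex: "x \<in> \<Omega> \<Longrightarrow> convex_on UNIV (M x)"
    and M_even: "x \<in> \<Omega> \<Longrightarrow> M x (- \<xi>) = M x \<xi>"
    and M_lower: "x \<in> \<Omega> \<Longrightarrow> m1 (norm \<xi>) \<le> M x \<xi>"
    and M_upper: "x \<in> \<Omega> \<Longrightarrow> M x \<xi> \<le> m2 (norm \<xi>)"
    and m1_convex: "convex_on {0..} m1" and m1_zero: "m1 0 = 0" and m1_pos: "s > 0 \<Longrightarrow> m1 s > 0"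
    and m2_convex: "convex_on {0..} m2" and m2_nonneg: "s \<ge> 0 \<Longrightarrow> m2 s \<ge> 0"
begin

lemma M_continuous_compose:
  assumes "continuous_on S a" "continuous_on S b" "a ` S \<subseteq> \<Omega>"
  shows "continuous_on S (\<lambda>x. M (a x) (b x))"
  using continuous_on_compose2[OF M_continuous continuous_on_Pair[OF assms(1,2)]] assms(3) by auto

lemma M_combine:
  assumes "x \<in> \<Omega>" "0 \<le> t" "t \<le> 1"
  shows "M x (t *\<^sub>R \<xi> + (1 - t) *\<^sub>R \<zeta>) \<le> t * M x \<xi> + (1 - t) * M x \<zeta>"
  using convex_onD[OF M_convex[OF assms(1)], of "1 - t" \<xi> \<zeta>] assms(2,3) by simp

lemma M_scale:
  assumes "x \<in> \<Omega>" "0 \<le> t" "t \<le> 1"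
  shows "M x (t *\<^sub>R \<xi>) \<le> t * M x \<xi>"
  using M_combine[OF assms, of \<xi> 0] M_zero[OF assms(1)] by simp

lemma M_scale_le:
  assumes "x \<in> \<Omega>" "0 \<le> t" "t \<le> 1"
  shows "M x (t *\<^sub>R \<xi>) \<le> M x \<xi>"
  using M_scale[OF assms, of \<xi>] mult_right_mono[OF assms(3) M_nonneg[OF assms(1), of \<xi>]] by linarith

lemma M_half:
  assumes "x \<in> \<Omega>"
  shows "M x ((1/2) *\<^sub>R (\<xi> + \<zeta>)) \<le> M x \<xi> / 2 + M x \<zeta> / 2"
  using M_combine[OF assms, of "1/2" \<xi> \<zeta>] by (simp add: scaleR_right_distrib)

lemma M_sum_convex:
  assumes "x \<in> \<Omega>" "finite I" "\<And>i. i \<in> I \<Longrightarrow> 0 \<le> t i" "(\<Sum>i\<in>I. t i) \<le> 1"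
  shows "M x (\<Sum>i\<in>I. t i *\<^sub>R \<xi> i) \<le> (\<Sum>i\<in>I. t i * M x (\<xi> i))"
proof (cases "(\<Sum>i\<in>I. t i) = 0")
  case True
  then have "\<And>i. i \<in> I \<Longrightarrow> t i = 0" using assms by (simp add: sum_nonneg_eq_0_iff)
  then show ?thesis using M_zero[OF assms(1)] by simp
next
  case False
  define s where "s = (\<Sum>i\<in>I. t i)"
  have s: "0 < s" "s \<le> 1" using False assms sum_nonneg[of I t] by (auto simp: s_def)
  have ne: "I \<noteq> {}" using False by auto
  have "M x (\<Sum>i\<in>I. (t i / s) *\<^sub>R \<xi> i) \<le> (\<Sum>i\<in>I. (t i / s) * M x (\<xi> i))"
    using assms s ne by (intro convex_on_sum[OF _ _ M_convex]) (auto simp: s_def simp flip: sum_divide_distrib)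
  moreover have "(\<Sum>i\<in>I. t i *\<^sub>R \<xi> i) = s *\<^sub>R (\<Sum>i\<in>I. (t i / s) *\<^sub>R \<xi> i)"
    using s by (simp add: scaleR_sum_right)
  moreover have "(\<Sum>i\<in>I. t i * M x (\<xi> i)) = s * (\<Sum>i\<in>I. (t i / s) * M x (\<xi> i))"
    using s by (simp add: sum_distrib_left)
  ultimately show ?thesis
    using M_scale[OF assms(1), of s "\<Sum>i\<in>I. (t i / s) *\<^sub>R \<xi> i"] s
    by (smt (verit) mult_left_mono)
qed

lemma M_bounded:
  assumes "x \<in> \<Omega>" "norm \<xi> \<le> R"
  shows "M x \<xi> \<le> m2 0 + m2 R"
proof (cases "R = 0")
  case True
  then show ?thesis using M_upper[OF assms(1), of \<xi>] m2_nonneg[of 0] assms by simp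
next
  case False
  then have R: "R > 0" using assms(2) norm_ge_zero[of \<xi>] by linarith
  define t where "t = norm \<xi> / R"
  have t: "0 \<le> t" "t \<le> 1" using assms(2) R by (auto simp: t_def)
  have "m2 ((1 - t) *\<^sub>R 0 + t *\<^sub>R R) \<le> (1 - t) * m2 0 + t * m2 R"
    using R t by (intro convex_onD[OF m2_convex]) auto
  moreover have "(1 - t) * m2 0 \<le> m2 0" "t * m2 R \<le> m2 R"
    using t m2_nonneg[of 0] m2_nonneg[of R] R by (auto intro: mult_left_le_one_le)
  moreover have "(1 - t) *\<^sub>R 0 + t *\<^sub>R R = norm \<xi>" using R by (simp add: t_def)
  ultimately show ?thesis using M_upper[OF assms(1), of \<xi>] by simp
qed

lemma m1_mono1: "1 \<le> s \<Longrightarrow> m1 1 \<le> m1 s"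
proof -
  assume s: "1 \<le> s"
  have "m1 ((1 - 1 / s) *\<^sub>R 0 + (1 / s) *\<^sub>R s) \<le> (1 - 1 / s) * m1 0 + (1 / s) * m1 s"
    using s by (intro convex_onD[OF m1_convex]) auto
  then have "m1 1 \<le> (1 / s) * m1 s" using s m1_zero by simp
  also have "\<dots> \<le> 1 * m1 s" using s m1_pos[of s] by (intro mult_right_mono) auto
  finally show ?thesis by simp
qed

lemma borel_measurable_M:
  assumes "X \<in> borel_measurable borel"
  shows "(\<lambda>x. M x (X x) * indicator \<Omega> x) \<in> borel_measurable borel"
proof -
  have \<Omega>b: "\<Omega> \<times> (UNIV :: 'a set) \<in> sets borel" using open_\<Omega> by (intro borel_open open_Times) auto
  have "(\<lambda>z. indicator (\<Omega> \<times> UNIV) z *\<^sub>R (case z of (x, \<xi>) \<Rightarrow> M x \<xi>)) \<in> borel_measurable borel"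
    by (rule borel_measurable_continuous_on_indicator[OF \<Omega>b M_continuous])
  moreover have "(\<lambda>x. (x, X x)) \<in> borel \<rightarrow>\<^sub>M borel" using assms by simp
  ultimately have "(\<lambda>x. indicator (\<Omega> \<times> UNIV) (x, X x) *\<^sub>R M x (X x)) \<in> borel_measurable borel"
    using measurable_compose[of "\<lambda>x. (x, X x)" borel borel "\<lambda>z. indicator (\<Omega> \<times> UNIV) z *\<^sub>R (case z of (x, \<xi>) \<Rightarrow> M x \<xi>)"]
    by simp
  moreover have "(\<lambda>x. indicator (\<Omega> \<times> UNIV) (x, X x) *\<^sub>R M x (X x)) = (\<lambda>x. M x (X x) * indicator \<Omega> x)"
    by (auto simp: indicator_def)
  ultimately show ?thesis by simp
qed

end

text \<open>Continuity in \<open>x\<close> turns every almost-everywhere requirement into a pointwise one.\<close>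

lemma weak_N_function_regular:
  fixes M :: "real ^ 'n \<Rightarrow> 'a :: euclidean_space \<Rightarrow> real"
  assumes \<Omega>: "open \<Omega>" and M: "weak_N_function \<Omega> UNIV M" and cont: "continuous_on (\<Omega> \<times> UNIV) (\<lambda>(x, \<xi>). M x \<xi>)"
  obtains m1 m2 where "regular_N_function \<Omega> M m1 m2"
proof -
  have cx: "continuous_on \<Omega> (\<lambda>x. M x \<xi>)" for \<xi>
    using continuous_on_compose2[OF cont continuous_on_Pair[OF continuous_on_id continuous_on_const[of _ \<xi>]]] by auto
  from M obtain m1 m2 :: "real \<Rightarrow> real" where m: "convex_on {0..} m1" "convex_on {0..} m2"
        "\<forall>s\<ge>0. 0 \<le> m1 s \<and> 0 \<le> m2 s" "m1 0 = 0" "\<forall>s>0. 0 < m1 s"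
        and bd: "AE x in lebesgue_on \<Omega>. \<forall>\<xi>\<in>UNIV. m1 (norm \<xi>) \<le> M x \<xi> \<and> M x \<xi> \<le> m2 (norm \<xi>)"
    unfolding weak_N_function_def by auto
  have nn: "0 \<le> M x \<xi>" if "x \<in> \<Omega>" for x \<xi> using M that by (auto simp: weak_N_function_def)
  have ae: "AE x in lebesgue_on \<Omega>. M x 0 = 0 \<and> convex_on UNIV (M x)" "AE x in lebesgue_on \<Omega>. \<forall>\<xi>\<in>UNIV. M x \<xi> = M x (- \<xi>)"
    using M by (auto simp: weak_N_function_def)
  have "regular_N_function \<Omega> M m1 m2"
  proof
    fix x \<xi> assume x: "x \<in> \<Omega>"
    show "M x 0 = 0"
    proof (rule antisym)
      show "M x 0 \<le> 0"
        by (rule AE_le_continuous[OF \<Omega> cx _ x]) (use ae(1) in \<open>eventually_elim, simp\<close>)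
    qed (rule nn[OF x])
    show "convex_on UNIV (M x)"
    proof (rule convex_onI)
      fix t :: real and u v :: 'a assume t: "0 < t" "t < 1"
      have "M x ((1 - t) *\<^sub>R u + t *\<^sub>R v) - ((1 - t) * M x u + t * M x v) \<le> 0"
      proof (rule AE_le_continuous[OF \<Omega> _ _ x])
        show "continuous_on \<Omega> (\<lambda>x. M x ((1 - t) *\<^sub>R u + t *\<^sub>R v) - ((1 - t) * M x u + t * M x v))"
          by (intro continuous_intros cx)
        show "AE x in lebesgue_on \<Omega>. M x ((1 - t) *\<^sub>R u + t *\<^sub>R v) - ((1 - t) * M x u + t * M x v) \<le> 0"
          using ae(1)
        proof eventually_elim
          case (elim y)
          then show ?case using convex_onD[of UNIV "M y" t u v] t by simp
        qed
      qed
      then show "M x ((1 - t) *\<^sub>R u + t *\<^sub>R v) \<le> (1 - t) * M x u + t * M x v" by simp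
    qed simp
    show "M x (- \<xi>) = M x \<xi>"
    proof (rule antisym)
      have "M x (- \<xi>) - M x \<xi> \<le> 0"
        by (rule AE_le_continuous[OF \<Omega> _ _ x])
           (intro continuous_intros cx, use ae(2) in \<open>eventually_elim, simp\<close>)
      then show "M x (- \<xi>) \<le> M x \<xi>" by simp
      have "M x \<xi> - M x (- \<xi>) \<le> 0"
        by (rule AE_le_continuous[OF \<Omega> _ _ x])
           (intro continuous_intros cx, use ae(2) in \<open>eventually_elim, simp\<close>)
      then show "M x \<xi> \<le> M x (- \<xi>)" by simp
    qed
    have "m1 (norm \<xi>) - M x \<xi> \<le> 0"
      by (rule AE_le_continuous[OF \<Omega> _ _ x])
         (intro continuous_intros cx, use bd in \<open>eventually_elim, simp\<close>)
    then show "m1 (norm \<xi>) \<le> M x \<xi>" by simp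
    show "M x \<xi> \<le> m2 (norm \<xi>)"
      by (rule AE_le_continuous[OF \<Omega> cx _ x]) (use bd in \<open>eventually_elim, simp\<close>)
  qed (use \<Omega> cont nn m in auto)
  with that show ?thesis by blast
qed

lemma convex_on_support:
  fixes f :: "'a :: euclidean_space \<Rightarrow> real"
  assumes f: "convex_on UNIV f"
  obtains a where "\<And>\<eta>. f \<xi> + a \<bullet> (\<eta> - \<xi>) \<le> f \<eta>"
proof -
  define T where "T = {(\<eta>, s). f \<eta> < s}"
  have "convex T"
  proof (rule convexI)
    fix p q :: "'a \<times> real" and u v :: real assume *: "p \<in> T" "q \<in> T" "0 \<le> u" "0 \<le> v" "u + v = 1"
    obtain a s b t where pq: "p = (a, s)" "q = (b, t)" by (cases p, cases q)
    have st: "f a < s" "f b < t" using * by (auto simp: T_def pq)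
    have u: "u = 1 - v" using *(5) by simp
    have "f ((1 - v) *\<^sub>R a + v *\<^sub>R b) \<le> (1 - v) * f a + v * f b"
      using * by (intro convex_onD[OF f]) auto
    also have "\<dots> < (1 - v) * s + v * t"
    proof (cases "v = 0")
      case False
      then have "v * f b < v * t" using st * by (intro mult_strict_left_mono) auto
      moreover have "(1 - v) * f a \<le> (1 - v) * s" using st * u by (intro mult_left_mono) auto
      ultimately show ?thesis by linarith
    qed (use st in simp)
    finally show "u *\<^sub>R p + v *\<^sub>R q \<in> T" by (simp add: T_def pq u)
  qed
  moreover have "T \<noteq> {}" unfolding T_def using lt_ex gt_ex by blast
  moreover have "{(\<xi>, f \<xi>)} \<inter> T = {}" by (auto simp: T_def)
  ultimately obtain c b where c: "c \<noteq> 0" "\<forall>x\<in>{(\<xi>, f \<xi>)}. c \<bullet> x \<le> b" "\<forall>x\<in>T. c \<bullet> x \<ge> b"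
    using separating_hyperplane_sets[of "{(\<xi>, f \<xi>)}" T] by auto
  obtain p q where pq: "c = (p, q)" by (cases c)
  have ineq: "p \<bullet> \<xi> + q * f \<xi> \<le> p \<bullet> \<eta> + q * s" if "f \<eta> < s" for \<eta> s
    using c(2,3) that by (fastforce simp: pq T_def)
  have q0: "0 \<le> q" using ineq[of \<xi> "f \<xi> + 1"] by (simp add: algebra_simps)
  have "q \<noteq> 0"
  proof
    assume "q = 0"
    then have "p \<bullet> \<xi> \<le> p \<bullet> (\<xi> - p)" using ineq[of "\<xi> - p" "f (\<xi> - p) + 1"] by simp
    then have "p \<bullet> p \<le> 0" by (simp add: inner_diff_right)
    then have "p = 0" using inner_gt_zero_iff[of p] by linarith
    then show False using c(1) \<open>q = 0\<close> by (simp add: pq zero_prod_def)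
  qed
  then have q: "q > 0" using q0 by simp
  have le: "p \<bullet> \<xi> + q * f \<xi> \<le> p \<bullet> \<eta> + q * f \<eta>" for \<eta>
  proof (rule field_le_epsilon)
    fix e :: real assume e: "e > 0"
    have "p \<bullet> \<xi> + q * f \<xi> \<le> p \<bullet> \<eta> + q * (f \<eta> + e / q)" using q e by (intro ineq) simp
    then show "p \<bullet> \<xi> + q * f \<xi> \<le> p \<bullet> \<eta> + q * f \<eta> + e" using q by (simp add: algebra_simps)
  qed
  show ?thesis
  proof (rule that[of "- (1 / q) *\<^sub>R p"])
    fix \<eta>
    have "f \<xi> - f \<eta> \<le> (p \<bullet> \<eta> - p \<bullet> \<xi>) / q" using le[of \<eta>] q by (simp add: field_simps)
    then show "f \<xi> + (- (1 / q) *\<^sub>R p) \<bullet> (\<eta> - \<xi>) \<le> f \<eta>"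
      by (simp add: inner_diff_right diff_divide_distrib)
  qed
qed

text \<open>The infimum \<open>I\<close> of the functions \<open>M y\<close> over a ball is not convex, so Jensen's inequality does
  not apply to it. It suffices that the supporting affine function of \<open>M x\<close> at a point \<open>\<xi>\<close> of moderate size
  stays, up to an additive one, below a fixed multiple of every \<open>M y (C \<eta>)\<close>. On the sublevel set \<open>{\<eta>. I (C \<eta>) \<le> \<kappa>}\<close> this is the
  balance condition; outside, one moves along the ray through \<open>\<eta>\<close>: the affine function grows at most
  linearly from its size at the sublevel set, \<open>M y\<close> at least linearly.\<close>

lemma (in regular_N_function) affine_minorant:
  fixes S and I :: "'a \<Rightarrow> real"
  defines "I \<equiv> \<lambda>\<eta>. INF y\<in>S. M y \<eta>"
  assumes S: "S \<subseteq> \<Omega>" "x \<in> S" and E: "subspace E" and C: "C > 1" and k0: "0 < k0" "k0 \<le> \<kappa>"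
    and bal: "\<And>\<xi>. \<xi> \<in> E \<Longrightarrow> I (C *\<^sub>R \<xi>) \<le> \<kappa> \<Longrightarrow> \<forall>y\<in>S. M y \<xi> \<le> I (C *\<^sub>R \<xi>) + 1"
    and \<xi>: "\<xi> \<in> E" "I (C *\<^sub>R (2 *\<^sub>R \<xi>)) \<le> \<kappa>"
  obtains a b where "M x \<xi> = a \<bullet> \<xi> - b" "0 \<le> b"
    "\<And>y \<eta>. y \<in> S \<Longrightarrow> \<eta> \<in> E \<Longrightarrow> a \<bullet> \<eta> - b \<le> (4 + 4 / k0) * M y (C *\<^sub>R \<eta>) + 1"
proof -
  have x: "x \<in> \<Omega>" using S by auto
  have I_le: "I \<eta> \<le> M y \<eta>" if "y \<in> S" for y \<eta>
    unfolding I_def using S M_nonneg that by (intro cINF_lower) (auto intro!: bdd_belowI2[where m=0])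
  obtain a where a: "\<And>\<eta>. M x \<xi> + a \<bullet> (\<eta> - \<xi>) \<le> M x \<eta>"
    using convex_on_support[OF M_convex[OF x], of \<xi>] by blast
  define b where "b = a \<bullet> \<xi> - M x \<xi>"
  have minor: "a \<bullet> \<eta> - b \<le> M x \<eta>" for \<eta> using a[of \<eta>] by (simp add: b_def inner_diff_right)
  have b0: "0 \<le> b" using minor[of 0] M_zero[OF x] by simp
  \<comment> \<open>The constant \<open>b\<close> is controlled by the value at \<open>2 \<xi>\<close>; hence the hypothesis at the doubled point.\<close>
  have "M x (2 *\<^sub>R \<xi>) \<le> I (C *\<^sub>R (2 *\<^sub>R \<xi>)) + 1" using bal[OF subspace_scale[OF E \<xi>(1), of 2] \<xi>(2)] S by blast
  moreover have "b \<le> M x (2 *\<^sub>R \<xi>)"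
    using minor[of "2 *\<^sub>R \<xi>"] M_nonneg[OF x, of \<xi>] by (simp add: b_def)
  ultimately have b1: "b \<le> \<kappa> + 1" using \<xi>(2) by linarith
  have c0: "4 + 4 / k0 \<ge> 1" using k0 by (simp add: add_increasing2)
  have main: "a \<bullet> \<eta> - b \<le> (4 + 4 / k0) * M y (C *\<^sub>R \<eta>) + 1" if y: "y \<in> S" and \<eta>: "\<eta> \<in> E" for y \<eta>
  proof (cases "I (C *\<^sub>R \<eta>) \<le> \<kappa>")
    case True
    have My: "0 \<le> M y (C *\<^sub>R \<eta>)" using y S M_nonneg by blast
    have "a \<bullet> \<eta> - b \<le> I (C *\<^sub>R \<eta>) + 1" using minor[of \<eta>] bal[OF \<eta> True] S by fastforce
    also have "\<dots> \<le> M y (C *\<^sub>R \<eta>) + 1" using I_le[OF y] by simp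
    also have "\<dots> \<le> (4 + 4 / k0) * M y (C *\<^sub>R \<eta>) + 1" using mult_right_mono[OF c0 My] by simp
    finally show ?thesis .
  next
    case False
    have yO: "y \<in> \<Omega>" using y S by auto
    let ?m = "M y (C *\<^sub>R \<eta>)"
    have scal: "M y (C *\<^sub>R (t *\<^sub>R \<eta>)) \<le> t * ?m" if "0 \<le> t" "t \<le> 1" for t
      using M_scale[OF yO that, of "C *\<^sub>R \<eta>"] by (simp add: mult.commute)
    \<comment> \<open>Halve \<open>\<eta>\<close> until it enters the sublevel set. Just before, \<open>I\<close> still exceeds \<open>\<kappa>\<close>, which bounds
       \<open>M y (C \<eta>)\<close> from below by \<open>\<kappa> / (2 * t)\<close>.\<close>
    define P where "P = (\<lambda>k::nat. I (C *\<^sub>R (((1/2) ^ k) *\<^sub>R \<eta>)) \<le> \<kappa>)"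
    have "\<exists>k. P k"
    proof -
      have "(\<lambda>k. ((1/2)::real) ^ k * ?m) \<longlonglongrightarrow> 0 * ?m"
        by (intro tendsto_mult tendsto_const LIMSEQ_power_zero) simp
      then have "\<forall>\<^sub>F k in sequentially. ((1/2)::real) ^ k * ?m < \<kappa>"
        by (rule order_tendstoD) (use k0 in simp)
      then obtain k where "((1/2)::real) ^ k * ?m < \<kappa>" by (auto simp: eventually_sequentially)
      then have "P k" unfolding P_def
        using I_le[OF y, of "C *\<^sub>R (((1/2) ^ k) *\<^sub>R \<eta>)"] scal[of "(1/2)^k"] by (simp add: power_le_one)
      then show ?thesis by blast
    qed
    then have PL: "P (LEAST k. P k)" by (rule LeastI_ex)
    have "\<not> P 0" using False by (simp add: P_def)
    then obtain k where k: "(LEAST k. P k) = Suc k" using PL by (cases "LEAST k. P k") auto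
    have "\<not> P k" using not_less_Least[of k P] k by simp
    define t where "t = ((1/2)::real) ^ Suc k"
    have t: "0 < t" "2 * t \<le> 1" by (auto simp: t_def power_le_one)
    have "P (Suc k)" using PL unfolding k .
    then have inside: "I (C *\<^sub>R (t *\<^sub>R \<eta>)) \<le> \<kappa>" unfolding P_def t_def .
    have "\<kappa> < I (C *\<^sub>R ((2 * t) *\<^sub>R \<eta>))" using \<open>\<not> P k\<close> by (simp add: P_def t_def)
    also have "\<dots> \<le> M y (C *\<^sub>R ((2 * t) *\<^sub>R \<eta>))" by (rule I_le[OF y])
    also have "\<dots> \<le> 2 * t * ?m" using scal[of "2 * t"] t by simp
    finally have big: "\<kappa> < 2 * t * ?m" .
    have "a \<bullet> (t *\<^sub>R \<eta>) - b \<le> M x (t *\<^sub>R \<eta>)" by (rule minor)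
    also have "\<dots> \<le> I (C *\<^sub>R (t *\<^sub>R \<eta>)) + 1" using bal[OF subspace_scale[OF E \<eta>] inside] S by blast
    finally have "t * (a \<bullet> \<eta>) \<le> 2 * \<kappa> + 2" using inside b1 by simp
    also have "\<dots> \<le> (2 + 2 / k0) * \<kappa>"
    proof -
      have "1 \<le> \<kappa> / k0" using k0 by simp
      moreover have "(2 + 2 / k0) * \<kappa> = 2 * \<kappa> + 2 * (\<kappa> / k0)" by (simp add: algebra_simps)
      ultimately show ?thesis by linarith
    qed
    also have "\<dots> \<le> (2 + 2 / k0) * (2 * t * ?m)" using big k0 by (intro mult_left_mono) auto
    also have "\<dots> = t * ((4 + 4 / k0) * ?m)" by (simp add: algebra_simps)
    finally have "a \<bullet> \<eta> \<le> (4 + 4 / k0) * ?m" using t(1) by simp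
    then show ?thesis using b0 by simp
  qed
  show ?thesis using that[of a b] main b0 by (simp add: b_def)
qed

subsection \<open>The balance condition on balls\<close>

lemma subspace_block_space: "subspace (block_space p j)"
  by (auto simp: subspace_def block_space_def)

lemma block_proj_in_space: "block_proj p j \<xi> \<in> block_space p j"
  by (auto simp: block_space_def block_proj_def)

lemma block_proj_block_space:
  "\<xi> \<in> block_space p j \<Longrightarrow> block_proj p i \<xi> = (if i = j then \<xi> else 0)"
  by (auto simp: block_space_def block_proj_def vec_eq_iff)

lemma norm_block_proj_le: "norm (block_proj p j \<xi>) \<le> norm \<xi>"
  by (rule norm_le_componentwise_cart, rule norm_le_componentwise_cart) (simp add: block_proj_def)

lemma linear_block_proj: "linear (block_proj p j)"
  by (rule linearI) (auto simp: block_proj_def vec_eq_iff)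

lemma N_minus_continuous_eq:
  fixes N :: "real ^ 'n \<Rightarrow> 'a \<Rightarrow> real"
  assumes S: "open S" "S \<noteq> {}" "S = B \<inter> \<Omega>" and f: "continuous_on S f" "\<And>y. y \<in> S \<Longrightarrow> 0 \<le> f y"
    and meas: "(\<lambda>x. N x \<xi>) \<in> borel_measurable (lebesgue_on \<Omega>)"
    and eq: "AE y in lebesgue_on S. N y \<xi> = f y"
  shows "N_minus \<Omega> N B \<xi> = ereal (INF y\<in>S. f y)"
proof -
  define I where "I = (INF y\<in>S. f y)"
  have [measurable]: "(\<lambda>x. N x \<xi>) \<in> borel_measurable (lebesgue_on S)"
    using meas by (rule measurable_restrict_mono) (use S in auto)
  have I_le: "I \<le> f y" if "y \<in> S" for y
    unfolding I_def using f(2) that by (intro cINF_lower bdd_belowI2[where m=0]) auto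
  have "esssup (lebesgue_on S) (\<lambda>y. - ereal (N y \<xi>)) = ereal (- I)"
  proof (rule antisym)
    show "esssup (lebesgue_on S) (\<lambda>y. - ereal (N y \<xi>)) \<le> ereal (- I)"
    proof (rule esssup_I)
      have "AE y in lebesgue_on S. y \<in> S" by (intro AE_I2) simp
      with eq show "AE y in lebesgue_on S. - ereal (N y \<xi>) \<le> ereal (- I)"
        by eventually_elim (use I_le in auto)
    qed measurable
    show "ereal (- I) \<le> esssup (lebesgue_on S) (\<lambda>y. - ereal (N y \<xi>))"
    proof (rule ccontr)
      assume "\<not> ?thesis"
      then obtain t where t: "esssup (lebesgue_on S) (\<lambda>y. - ereal (N y \<xi>)) < ereal t" "ereal t < ereal (- I)"
        using ereal_dense2[of "esssup (lebesgue_on S) (\<lambda>y. - ereal (N y \<xi>))" "ereal (- I)"] by (auto simp: not_le)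
      have "AE y in lebesgue_on S. - f y \<le> t"
        using esssup_AE[of "\<lambda>y. - ereal (N y \<xi>)" "lebesgue_on S"] eq
      proof eventually_elim
        case (elim y)
        then have "ereal (- f y) \<le> esssup (lebesgue_on S) (\<lambda>y. - ereal (N y \<xi>))" by simp
        also note t(1)
        finally show ?case by simp
      qed
      then have "- f y \<le> t" if "y \<in> S" for y
        by (intro AE_le_continuous[OF S(1) _ _ that]) (auto intro: continuous_on_minus f)
      then have "- t \<le> I" unfolding I_def using S(2) by (intro cINF_greatest) force+
      with t(2) show False by simp
    qed
  qed
  then show ?thesis unfolding N_minus_def I_def[symmetric] S(3)[symmetric] by simp
qed

lemma N_plus_continuous_ge:
  fixes N :: "real ^ 'n \<Rightarrow> 'a \<Rightarrow> real"
  assumes S: "open S" "S = B \<inter> \<Omega>" "x \<in> S" and f: "continuous_on S f"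
    and eq: "AE y in lebesgue_on S. N y \<xi> = f y" and le: "N_plus \<Omega> N B \<xi> \<le> ereal t"
  shows "f x \<le> t"
proof (rule AE_le_continuous[OF S(1) f _ S(3)])
  show "AE y in lebesgue_on S. f y \<le> t"
    using esssup_AE[of "\<lambda>y. ereal (N y \<xi>)" "lebesgue_on S"] eq
  proof eventually_elim
    case (elim y)
    then have "ereal (f y) \<le> N_plus \<Omega> N B \<xi>" by (simp add: N_plus_def S(2))
    also note le
    finally show ?case by simp
  qed
qed

text \<open>The balance condition in terms of \<open>M\<close> alone: on block \<open>j\<close> the other summands vanish, so
  \<open>N j\<close> agrees with the continuous function \<open>M\<close> almost everywhere, and essential bounds on a ball become bounds
  at every point. The threshold \<open>\<kappa>\<close> is the supremum in the balance condition; since \<open>M y\<close> increases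
  along rays, all vectors of norm at most \<open>c * r powr (\<gamma> - 1)\<close> lie in the sublevel set of \<open>\<kappa>\<close>. The lower
  bound \<open>m1 1\<close> for \<open>\<kappa>\<close> is the same for all balls, which keeps the multiple in the affine minorant uniform.\<close>

lemma balance_condition_blocks:
  fixes M :: "real ^ 'n \<Rightarrow> real ^ 'n ^ 'd \<Rightarrow> real"
  assumes reg: "regular_N_function \<Omega> M m1 m2" and B: "B_gen \<Omega> \<gamma> M" and \<gamma>: "\<gamma> \<le> 1"
  obtains K :: nat and p c C where "1 < c" "1 < C"
    "\<And>x \<xi>. x \<in> \<Omega> \<Longrightarrow> M x \<xi> = (\<Sum>j=1..K. M x (block_proj p j \<xi>))"
    "\<And>a r j. 0 < r \<Longrightarrow> r \<le> 1 \<Longrightarrow> ball a r \<inter> \<Omega> \<noteq> {} \<Longrightarrow> j \<in> {1..K} \<Longrightarrow>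
      \<exists>\<kappa>\<ge>m1 1. \<forall>\<xi>\<in>block_space p j.
        (norm \<xi> \<le> c * r powr (\<gamma> - 1) \<longrightarrow> (INF y\<in>ball a r \<inter> \<Omega>. M y \<xi>) \<le> \<kappa>) \<and>
        ((INF y\<in>ball a r \<inter> \<Omega>. M y (C *\<^sub>R \<xi>)) \<le> \<kappa> \<longrightarrow>
          (\<forall>x\<in>ball a r \<inter> \<Omega>. M x \<xi> \<le> (INF y\<in>ball a r \<inter> \<Omega>. M y (C *\<^sub>R \<xi>)) + 1))"
proof -
  interpret regular_N_function \<Omega> M m1 m2 by (rule reg)
  from B obtain K :: nat and p N c C where p: "{p i k | i k. True} = {1..K}"
    and N': "\<forall>j\<in>{1..K}. weak_N_function \<Omega> (block_space p j) (N j)"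
    and MN': "\<forall>x\<in>\<Omega>. \<forall>\<xi>. M x \<xi> = (\<Sum>j=1..K. N j x (block_proj p j \<xi>))"
    and c: "1 < c" "1 < C" and bal': "\<forall>a r. 0 < r \<and> r \<le> 1 \<longrightarrow> (\<forall>j\<in>{1..K}. \<forall>\<xi> \<in> block_space p j.
              N_minus \<Omega> (N j) (ball a r) (C *\<^sub>R \<xi>)
                \<le> (SUP \<eta> \<in> {\<eta> \<in> block_space p j. norm \<eta> = 1}.
                     N_minus \<Omega> (N j) (ball a r) ((c * r powr (\<gamma> - 1)) *\<^sub>R \<eta>)) \<longrightarrow>
              N_plus \<Omega> (N j) (ball a r) \<xi> \<le> N_minus \<Omega> (N j) (ball a r) (C *\<^sub>R \<xi>) + 1)"
    unfolding B_gen_def by (elim exE conjE) (rule that)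
  have N: "\<And>j. j \<in> {1..K} \<Longrightarrow> weak_N_function \<Omega> (block_space p j) (N j)"
    and MN: "\<And>x \<xi>. x \<in> \<Omega> \<Longrightarrow> M x \<xi> = (\<Sum>j=1..K. N j x (block_proj p j \<xi>))"
    using N' MN' by auto
  have bal: "\<And>a r j \<xi>. 0 < r \<Longrightarrow> r \<le> 1 \<Longrightarrow> j \<in> {1..K} \<Longrightarrow> \<xi> \<in> block_space p j \<Longrightarrow>
              N_minus \<Omega> (N j) (ball a r) (C *\<^sub>R \<xi>)
                \<le> (SUP \<eta> \<in> {\<eta> \<in> block_space p j. norm \<eta> = 1}.
                     N_minus \<Omega> (N j) (ball a r) ((c * r powr (\<gamma> - 1)) *\<^sub>R \<eta>)) \<Longrightarrow>
              N_plus \<Omega> (N j) (ball a r) \<xi> \<le> N_minus \<Omega> (N j) (ball a r) (C *\<^sub>R \<xi>) + 1"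
    using bal' by blast
  have \<Omega>l: "\<Omega> \<in> sets lebesgue" using open_\<Omega> by (auto simp: borel_open)
  have N0: "AE x in lebesgue_on \<Omega>. \<forall>i\<in>{1..K}. N i x 0 = 0"
  proof (rule AE_finite_allI)
    fix i assume "i \<in> {1..K}"
    from N[OF this] have "AE x in lebesgue_on \<Omega>. N i x 0 = 0 \<and> convex_on (block_space p i) (N i x)"
      unfolding weak_N_function_def by blast
    then show "AE x in lebesgue_on \<Omega>. N i x 0 = 0" by eventually_elim simp
  qed simp
  have NM: "AE x in lebesgue_on \<Omega>. \<forall>j\<in>{1..K}. \<forall>\<xi>\<in>block_space p j. N j x \<xi> = M x \<xi>"
  proof -
    have "AE x in lebesgue_on \<Omega>. x \<in> \<Omega>" by (intro AE_I2) simp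
    with N0 show ?thesis
    proof eventually_elim
      case (elim x)
      show ?case
      proof (intro ballI)
        fix j \<xi> assume j: "j \<in> {1..K}" and \<xi>: "\<xi> \<in> block_space p j"
        have "M x \<xi> = (\<Sum>i=1..K. if i = j then N j x \<xi> else 0)"
          unfolding MN[OF elim(2)] by (intro sum.cong refl) (use elim(1) in \<open>auto simp: block_proj_block_space[OF \<xi>]\<close>)
        also have "\<dots> = N j x \<xi>" using j by simp
        finally show "N j x \<xi> = M x \<xi>" by simp
      qed
    qed
  qed
  have cM: "continuous_on S (\<lambda>x. M x \<xi>)" if "S \<subseteq> \<Omega>" for S \<xi>
    by (rule M_continuous_compose) (use that in auto)
  show ?thesis
  proof (rule that[OF c])
    fix x \<xi> assume x: "x \<in> \<Omega>"
    have ae: "AE x in lebesgue_on \<Omega>. M x \<xi> = (\<Sum>j=1..K. M x (block_proj p j \<xi>))"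
    proof -
      have "AE x in lebesgue_on \<Omega>. x \<in> \<Omega>" by (intro AE_I2) simp
      with NM show ?thesis
      proof eventually_elim
        case (elim x)
        have "M x \<xi> = (\<Sum>j=1..K. N j x (block_proj p j \<xi>))" by (rule MN[OF elim(2)])
        also have "\<dots> = (\<Sum>j=1..K. M x (block_proj p j \<xi>))"
          using elim(1) block_proj_in_space by (intro sum.cong refl) blast
        finally show ?case .
      qed
    qed
    have "M x \<xi> - (\<Sum>j=1..K. M x (block_proj p j \<xi>)) \<le> 0" "(\<Sum>j=1..K. M x (block_proj p j \<xi>)) - M x \<xi> \<le> 0"
      by (rule AE_le_continuous[OF open_\<Omega> _ _ x]; (intro continuous_intros cM order_refl)?; use ae in \<open>eventually_elim, simp\<close>)+
    then show "M x \<xi> = (\<Sum>j=1..K. M x (block_proj p j \<xi>))" by linarith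
  next
    fix a :: "real ^ 'n" and r :: real and j assume r: "0 < r" "r \<le> 1" and ne: "ball a r \<inter> \<Omega> \<noteq> {}" and j: "j \<in> {1..K}"
    define S where "S = ball a r \<inter> \<Omega>"
    have S: "open S" "S \<noteq> {}" "S = ball a r \<inter> \<Omega>" "S \<subseteq> \<Omega>" using open_\<Omega> ne by (auto simp: S_def)
    define I where "I = (\<lambda>\<xi>. INF y\<in>S. M y \<xi>)"
    have NMS: "AE y in lebesgue_on S. N j y \<xi> = M y \<xi>" if "\<xi> \<in> block_space p j" for \<xi>
    proof -
      have "AE y in lborel. y \<in> S \<longrightarrow> N j y \<xi> = M y \<xi>"
        using NM that j S(4) unfolding lebesgue_on_AE_iff[OF \<Omega>l] by (auto elim!: eventually_mono)
      then show ?thesis using S(1) by (subst lebesgue_on_AE_iff) (auto simp: borel_open)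
    qed
    have minus: "N_minus \<Omega> (N j) (ball a r) \<xi> = ereal (I \<xi>)" if "\<xi> \<in> block_space p j" for \<xi>
      unfolding I_def
    proof (rule N_minus_continuous_eq[where f="\<lambda>y. M y \<xi>" and N="N j" and \<xi>=\<xi>, OF S(1,2,3) cM[OF S(4)] _ _ NMS[OF that]])
      show "(\<lambda>x. N j x \<xi>) \<in> borel_measurable (lebesgue_on \<Omega>)"
        using N[OF j] that unfolding weak_N_function_def by blast
    qed (use M_nonneg S in auto)
    define s where "s = c * r powr (\<gamma> - 1)"
    have "1 \<le> r powr (\<gamma> - 1)" using powr_mono2'[of "\<gamma> - 1" r 1] r \<gamma> by simp
    then have s: "1 \<le> s" unfolding s_def using c by (smt (verit) mult_less_cancel_right1)
    define Sph where "Sph = {\<eta> \<in> block_space p j. norm \<eta> = 1}"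
    have Sph_s: "s *\<^sub>R \<eta> \<in> block_space p j" if "\<eta> \<in> Sph" for \<eta>
      using that subspace_scale[OF subspace_block_space] by (auto simp: Sph_def)
    have Une: "Sph \<noteq> {}"
    proof -
      have "j \<in> {p i k | i k. True}" using j p by (simp only:)
      then obtain i k where ik: "p i k = j" by auto
      have "axis i (axis k 1) \<in> block_space p j" using ik by (auto simp: block_space_def axis_def)
      moreover have "axis i (axis k 1) \<in> (Basis :: (real ^ 'n ^ 'd) set)" by (auto simp: Basis_vec_def)
      ultimately have "axis i (axis k 1) \<in> Sph" by (simp add: Sph_def)
      then show ?thesis by blast
    qed
    have I_le: "I \<xi> \<le> M y \<xi>" if "y \<in> S" for y \<xi>
      unfolding I_def using S(4) M_nonneg that by (intro cINF_lower) (auto intro!: bdd_belowI2[where m=0])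
    have I_mono: "I \<xi> \<le> I \<zeta>" if "\<And>y. y \<in> S \<Longrightarrow> M y \<xi> \<le> M y \<zeta>" for \<xi> \<zeta>
      unfolding I_def[of] by (rule cINF_mono[OF S(2)]) (use that S(4) M_nonneg in \<open>auto intro!: bdd_belowI2[where m=0]\<close>)
    obtain y0 where y0: "y0 \<in> S" using S(2) by blast
    have bdd: "bdd_above ((\<lambda>\<eta>. I (s *\<^sub>R \<eta>)) ` Sph)"
    proof (rule bdd_aboveI2)
      fix \<eta> assume "\<eta> \<in> Sph"
      then have "norm (s *\<^sub>R \<eta>) = s" using s by (simp add: Sph_def)
      then show "I (s *\<^sub>R \<eta>) \<le> m2 s"
        using I_le[OF y0, of "s *\<^sub>R \<eta>"] M_upper[of y0 "s *\<^sub>R \<eta>"] y0 S(4) by fastforce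
    qed
    define \<kappa> where "\<kappa> = (SUP \<eta>\<in>Sph. I (s *\<^sub>R \<eta>))"
    have up: "I (s *\<^sub>R \<eta>) \<le> \<kappa>" if "\<eta> \<in> Sph" for \<eta> unfolding \<kappa>_def using bdd that by (rule cSUP_upper2) simp
    have \<kappa>1: "m1 1 \<le> \<kappa>"
    proof -
      obtain \<eta> where \<eta>: "\<eta> \<in> Sph" using Une by blast
      have "m1 1 \<le> m1 s" by (rule m1_mono1[OF s])
      also have "m1 s \<le> I (s *\<^sub>R \<eta>)"
        unfolding I_def using S(2,4) M_lower[of _ "s *\<^sub>R \<eta>"] \<eta> s by (intro cINF_greatest) (auto simp: Sph_def)
      also note up[OF \<eta>]
      finally show ?thesis .
    qed
    have SUPeq: "(SUP \<eta>\<in>Sph. N_minus \<Omega> (N j) (ball a r) (s *\<^sub>R \<eta>)) = ereal \<kappa>"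
    proof -
      have "(SUP \<eta>\<in>Sph. N_minus \<Omega> (N j) (ball a r) (s *\<^sub>R \<eta>)) = (SUP \<eta>\<in>Sph. ereal (I (s *\<^sub>R \<eta>)))"
        by (intro SUP_cong refl minus Sph_s)
      also have "\<dots> = ereal \<kappa>"
      proof (rule antisym)
        show "(SUP \<eta>\<in>Sph. ereal (I (s *\<^sub>R \<eta>))) \<le> ereal \<kappa>" by (rule SUP_least) (simp add: up)
        show "ereal \<kappa> \<le> (SUP \<eta>\<in>Sph. ereal (I (s *\<^sub>R \<eta>)))"
        proof (rule ccontr)
          assume "\<not> ?thesis"
          then obtain t where t: "(SUP \<eta>\<in>Sph. ereal (I (s *\<^sub>R \<eta>))) < ereal t" "ereal t < ereal \<kappa>"
            using ereal_dense2[of "SUP \<eta>\<in>Sph. ereal (I (s *\<^sub>R \<eta>))" "ereal \<kappa>"] by (auto simp: not_le)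
          have "I (s *\<^sub>R \<eta>) \<le> t" if "\<eta> \<in> Sph" for \<eta>
          proof -
            have "ereal (I (s *\<^sub>R \<eta>)) \<le> (SUP \<eta>\<in>Sph. ereal (I (s *\<^sub>R \<eta>)))" using that by (rule SUP_upper)
            also note t(1)
            finally show ?thesis by simp
          qed
          then have "\<kappa> \<le> t" unfolding \<kappa>_def by (rule cSUP_least[OF Une])
          with t(2) show False by simp
        qed
      qed
      finally show ?thesis .
    qed
    show "\<exists>\<kappa>\<ge>m1 1. \<forall>\<xi>\<in>block_space p j.
        (norm \<xi> \<le> c * r powr (\<gamma> - 1) \<longrightarrow> (INF y\<in>ball a r \<inter> \<Omega>. M y \<xi>) \<le> \<kappa>) \<and>
        ((INF y\<in>ball a r \<inter> \<Omega>. M y (C *\<^sub>R \<xi>)) \<le> \<kappa> \<longrightarrow>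
          (\<forall>x\<in>ball a r \<inter> \<Omega>. M x \<xi> \<le> (INF y\<in>ball a r \<inter> \<Omega>. M y (C *\<^sub>R \<xi>)) + 1))"
      unfolding S_def[symmetric] s_def[symmetric]
    proof (intro exI[of _ \<kappa>] conjI \<kappa>1 ballI impI)
      fix \<xi> assume \<xi>: "\<xi> \<in> block_space p j"
      {
        assume le: "norm \<xi> \<le> s"
        have "I \<xi> \<le> \<kappa>"
        proof (cases "\<xi> = 0")
          case True
          have "I \<xi> \<le> 0" using I_le[OF y0, of \<xi>] M_zero[of y0] y0 S(4) True by auto
          also have "0 \<le> \<kappa>" using \<kappa>1 m1_pos[of 1] by simp
          finally show ?thesis .
        next
          case False
          define \<eta> where "\<eta> = \<xi> /\<^sub>R norm \<xi>"
          have \<eta>: "\<eta> \<in> Sph" using False subspace_scale[OF subspace_block_space \<xi>] by (simp add: Sph_def \<eta>_def)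
          have "\<xi> = (norm \<xi> / s) *\<^sub>R (s *\<^sub>R \<eta>)" using False s by (simp add: \<eta>_def)
          then have "M y \<xi> \<le> M y (s *\<^sub>R \<eta>)" if "y \<in> S" for y
            using M_scale_le[of y "norm \<xi> / s" "s *\<^sub>R \<eta>"] that S(4) s le by auto
          then have "I \<xi> \<le> I (s *\<^sub>R \<eta>)" by (rule I_mono)
          then show ?thesis using up[OF \<eta>] by simp
        qed
        then show "(INF y\<in>S. M y \<xi>) \<le> \<kappa>" unfolding I_def .
      next
        fix x assume le: "(INF y\<in>S. M y (C *\<^sub>R \<xi>)) \<le> \<kappa>" and x: "x \<in> S"
        have C\<xi>: "C *\<^sub>R \<xi> \<in> block_space p j" by (rule subspace_scale[OF subspace_block_space \<xi>])
        have "N_minus \<Omega> (N j) (ball a r) (C *\<^sub>R \<xi>) \<le> (SUP \<eta> \<in> {\<eta> \<in> block_space p j. norm \<eta> = 1}.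
                     N_minus \<Omega> (N j) (ball a r) ((c * r powr (\<gamma> - 1)) *\<^sub>R \<eta>))"
          using SUPeq le unfolding Sph_def s_def minus[OF C\<xi>] I_def by simp
        from bal[OF r j \<xi> this] have "N_plus \<Omega> (N j) (ball a r) \<xi> \<le> ereal (I (C *\<^sub>R \<xi>) + 1)"
          unfolding minus[OF C\<xi>] by simp
        from N_plus_continuous_ge[where f="\<lambda>y. M y \<xi>" and N="N j" and \<xi>=\<xi>, OF S(1,3) x cM[OF S(4)] NMS[OF \<xi>] this]
        show "M x \<xi> \<le> (INF y\<in>S. M y (C *\<^sub>R \<xi>)) + 1" unfolding I_def .
      }
    qed
  qed
qed

text \<open>Integrating the affine minorant against the mollifier replaces Jensen's inequality, one block at a
  time. The ball of radius \<open>R * \<delta>\<close> about \<open>x\<close> contains all points over which \<open>G\<close> is averaged, in spite of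
  the shift by \<open>\<delta> v\<close>. The factor \<open>2\<close> in the bound on the average comes from the doubled point in the
  hypotheses of the affine minorant.\<close>

lemma conv_modular_bound:
  fixes M :: "real ^ 'n \<Rightarrow> real ^ 'n ^ 'd \<Rightarrow> real"
  assumes reg: "regular_N_function \<Omega> M m1 m2" and B: "B_gen \<Omega> \<gamma> M" and \<gamma>: "\<gamma> \<le> 1" and \<rho>: "mollifier \<rho>"
  obtains c C c0 k where "1 < c" "1 < C" "0 \<le> c0" "0 \<le> k"
    "\<And>G \<mu> \<delta> v R x. integrable lborel G \<Longrightarrow> (\<And>x. x \<notin> \<Omega> \<Longrightarrow> G x = 0) \<Longrightarrow> 0 < \<mu> \<Longrightarrow>
       integrable lborel (\<lambda>y. M y (G y /\<^sub>R \<mu>) * indicator \<Omega> y) \<Longrightarrow> 0 < \<delta> \<Longrightarrow> norm v + 1 < R \<Longrightarrow> R * \<delta> \<le> 1 \<Longrightarrow>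
       x \<in> \<Omega> \<Longrightarrow> 2 * norm (conv \<rho> \<delta> G (x - \<delta> *\<^sub>R v)) / \<mu> \<le> c * (R * \<delta>) powr (\<gamma> - 1) \<Longrightarrow>
       M x (conv \<rho> \<delta> G (x - \<delta> *\<^sub>R v) /\<^sub>R (C * \<mu>)) \<le> c0 * conv \<rho> \<delta> (\<lambda>y. M y (G y /\<^sub>R \<mu>) * indicator \<Omega> y) (x - \<delta> *\<^sub>R v) + k"
proof -
  interpret regular_N_function \<Omega> M m1 m2 by (rule reg)
  show ?thesis
  proof (rule balance_condition_blocks[OF reg B \<gamma>])
  fix K :: nat and p c C assume c: "1 < c" "1 < C"
    and blocks: "\<And>x \<xi>. x \<in> \<Omega> \<Longrightarrow> M x \<xi> = (\<Sum>j=1..K. M x (block_proj p j \<xi>))"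
    and bal: "\<And>a r j. 0 < r \<Longrightarrow> r \<le> 1 \<Longrightarrow> ball a r \<inter> \<Omega> \<noteq> {} \<Longrightarrow> j \<in> {1..K} \<Longrightarrow>
      \<exists>\<kappa>\<ge>m1 1. \<forall>\<xi>\<in>block_space p j.
        (norm \<xi> \<le> c * r powr (\<gamma> - 1) \<longrightarrow> (INF y\<in>ball a r \<inter> \<Omega>. M y \<xi>) \<le> \<kappa>) \<and>
        ((INF y\<in>ball a r \<inter> \<Omega>. M y (C *\<^sub>R \<xi>)) \<le> \<kappa> \<longrightarrow>
          (\<forall>x\<in>ball a r \<inter> \<Omega>. M x \<xi> \<le> (INF y\<in>ball a r \<inter> \<Omega>. M y (C *\<^sub>R \<xi>)) + 1))"
  define c1 where "c1 = 4 + 4 / m1 1"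
  have m11: "m1 1 > 0" using m1_pos by simp
  have c1: "0 \<le> c1" using m11 by (simp add: c1_def)
  note t = mollifier_test_fun[OF \<rho>]
  have \<rho>0: "\<rho> w \<ge> 0" "1 < norm w \<Longrightarrow> \<rho> w = 0" for w using \<rho> by (auto simp: mollifier_def)
  have \<rho>1: "integral\<^sup>L lborel \<rho> = 1" using \<rho> by (auto simp: mollifier_def)
  have main: "M x (conv \<rho> \<delta> G (x - \<delta> *\<^sub>R v) /\<^sub>R (C * \<mu>))
      \<le> (real K * c1) * conv \<rho> \<delta> (\<lambda>y. M y (G y /\<^sub>R \<mu>) * indicator \<Omega> y) (x - \<delta> *\<^sub>R v) + real K"
    if G: "integrable lborel G" "\<And>x. x \<notin> \<Omega> \<Longrightarrow> G x = 0" and \<mu>: "0 < \<mu>"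
      and m: "integrable lborel (\<lambda>y. M y (G y /\<^sub>R \<mu>) * indicator \<Omega> y)" and \<delta>: "0 < \<delta>"
      and R: "norm v + 1 < R" "R * \<delta> \<le> 1" and x: "x \<in> \<Omega>"
      and small: "2 * norm (conv \<rho> \<delta> G (x - \<delta> *\<^sub>R v)) / \<mu> \<le> c * (R * \<delta>) powr (\<gamma> - 1)"
    for G \<mu> \<delta> v R x
  proof -
    define z where "z = x - \<delta> *\<^sub>R v"
    define \<xi> where "\<xi> = conv \<rho> \<delta> G z"
    define mm where "mm = (\<lambda>y. M y (G y /\<^sub>R \<mu>) * indicator \<Omega> y)"
    have R0: "0 < R" using R(1) norm_ge_zero[of v] by linarith
    have r: "0 < R * \<delta>" "R * \<delta> \<le> 1" using R0 \<delta> R(2) by auto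
    define S where "S = ball x (R * \<delta>) \<inter> \<Omega>"
    have xS: "x \<in> S" using x r by (simp add: S_def)
    have im: "integrable lborel (\<lambda>w. \<rho> w * mm (z - \<delta> *\<^sub>R w))"
      using conv_integrable[OF t m, of \<delta> z] \<delta> by (simp add: mm_def)
    have block: "M x (block_proj p j (\<xi> /\<^sub>R (C * \<mu>))) \<le> c1 * conv \<rho> \<delta> mm z + 1" if j: "j \<in> {1..K}" for j
    proof -
      obtain \<kappa> where \<kappa>: "m1 1 \<le> \<kappa>" and \<kappa>1: "\<And>\<xi>. \<xi> \<in> block_space p j \<Longrightarrow> norm \<xi> \<le> c * (R * \<delta>) powr (\<gamma> - 1) \<Longrightarrow> (INF y\<in>S. M y \<xi>) \<le> \<kappa>"
        and \<kappa>2: "\<And>\<xi>. \<xi> \<in> block_space p j \<Longrightarrow> (INF y\<in>S. M y (C *\<^sub>R \<xi>)) \<le> \<kappa> \<Longrightarrow> \<forall>x\<in>S. M x \<xi> \<le> (INF y\<in>S. M y (C *\<^sub>R \<xi>)) + 1"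
        using bal[OF r _ j, of x] xS unfolding S_def by blast
      define \<xi>0 where "\<xi>0 = block_proj p j (\<xi> /\<^sub>R (C * \<mu>))"
      have \<xi>0: "\<xi>0 \<in> block_space p j" unfolding \<xi>0_def by (rule block_proj_in_space)
      have "norm (C *\<^sub>R (2 *\<^sub>R \<xi>0)) \<le> C * 2 * norm (\<xi> /\<^sub>R (C * \<mu>))"
        using norm_block_proj_le[of p j "\<xi> /\<^sub>R (C * \<mu>)"] c by (simp add: \<xi>0_def mult_left_mono)
      also have "\<dots> = 2 * norm \<xi> / \<mu>" using c \<mu> by (simp add: field_simps)
      also have "\<dots> \<le> c * (R * \<delta>) powr (\<gamma> - 1)" using small by (simp add: \<xi>_def z_def)
      finally have "(INF y\<in>S. M y (C *\<^sub>R (2 *\<^sub>R \<xi>0))) \<le> \<kappa>"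
        by (intro \<kappa>1 subspace_scale[OF subspace_block_space] \<xi>0)
      from affine_minorant[of S x "block_space p j" C "m1 1" \<kappa> \<xi>0, OF _ xS subspace_block_space c(2) m11 \<kappa> \<kappa>2 \<xi>0 this]
      obtain a b where ab: "M x \<xi>0 = a \<bullet> \<xi>0 - b" "0 \<le> b"
        "\<And>y \<eta>. y \<in> S \<Longrightarrow> \<eta> \<in> block_space p j \<Longrightarrow> a \<bullet> \<eta> - b \<le> c1 * M y (C *\<^sub>R \<eta>) + 1"
        unfolding c1_def S_def by auto
      define \<phi> where "\<phi> = (\<lambda>X. a \<bullet> block_proj p j (X /\<^sub>R (C * \<mu>)))"
      have \<phi>: "bounded_linear \<phi>"
        unfolding \<phi>_def
        using bounded_linear_compose[OF bounded_linear_inner_right bounded_linear_compose[OF linear_block_proj[THEN linear_conv_bounded_linear[THEN iffD1]] bounded_linear_scaleR_right]] .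
      have iG: "integrable lborel (\<lambda>w. \<rho> w *\<^sub>R G (z - \<delta> *\<^sub>R w))" using conv_integrable[OF t G(1)] \<delta> by simp
      have i\<phi>: "integrable lborel (\<lambda>w. \<rho> w * \<phi> (G (z - \<delta> *\<^sub>R w)))"
        using integrable_bounded_linear[OF \<phi> iG] linear_scale[OF bounded_linear.linear[OF \<phi>]] by simp
      have "\<phi> \<xi> = (\<integral>w. \<rho> w * \<phi> (G (z - \<delta> *\<^sub>R w)) \<partial>lborel)"
        unfolding \<xi>_def conv_def
        using integral_bounded_linear[OF \<phi> iG] linear_scale[OF bounded_linear.linear[OF \<phi>]] by simp
      then have "M x \<xi>0 = (\<integral>w. \<rho> w * \<phi> (G (z - \<delta> *\<^sub>R w)) - \<rho> w * b \<partial>lborel)"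
        using i\<phi> test_fun_integrable[OF t] \<rho>1 ab(1) by (simp add: \<phi>_def \<xi>0_def)
      also have "\<dots> \<le> (\<integral>w. c1 * (\<rho> w * mm (z - \<delta> *\<^sub>R w)) + \<rho> w \<partial>lborel)"
      proof (rule integral_mono)
        show "integrable lborel (\<lambda>w. \<rho> w * \<phi> (G (z - \<delta> *\<^sub>R w)) - \<rho> w * b)" using i\<phi> test_fun_integrable[OF t] by simp
        show "integrable lborel (\<lambda>w. c1 * (\<rho> w * mm (z - \<delta> *\<^sub>R w)) + \<rho> w)" using im test_fun_integrable[OF t] by simp
        fix w
        show "\<rho> w * \<phi> (G (z - \<delta> *\<^sub>R w)) - \<rho> w * b \<le> c1 * (\<rho> w * mm (z - \<delta> *\<^sub>R w)) + \<rho> w"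
        proof (cases "norm w \<le> 1")
          case True
          define y where "y = z - \<delta> *\<^sub>R w"
          have "\<phi> (G y) - b \<le> c1 * mm y + 1"
          proof (cases "y \<in> \<Omega>")
            case yO: True
            have "x - y = \<delta> *\<^sub>R (v + w)" by (simp add: y_def z_def scaleR_right_distrib)
            then have "dist x y = \<delta> * norm (v + w)" using \<delta> by (simp add: dist_norm)
            also have "\<dots> < \<delta> * R"
            proof (rule mult_strict_left_mono[OF _ \<delta>])
              show "norm (v + w) < R" using norm_triangle_ineq[of v w] True R(1) by linarith
            qed
            finally have yS: "y \<in> S" using yO by (simp add: S_def mult.commute)
            have "C *\<^sub>R block_proj p j (G y /\<^sub>R (C * \<mu>)) = block_proj p j (G y /\<^sub>R \<mu>)"
              using linear_scale[OF linear_block_proj, of p j C "G y /\<^sub>R (C * \<mu>)"] c \<mu> by (simp add: field_simps)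
            then have "\<phi> (G y) - b \<le> c1 * M y (block_proj p j (G y /\<^sub>R \<mu>)) + 1"
              using ab(3)[OF yS block_proj_in_space, of "G y /\<^sub>R (C * \<mu>)"] by (simp add: \<phi>_def)
            also have "M y (block_proj p j (G y /\<^sub>R \<mu>)) \<le> M y (G y /\<^sub>R \<mu>)"
              unfolding blocks[OF yO, of "G y /\<^sub>R \<mu>"]
              by (rule member_le_sum[OF j]) (use M_nonneg[OF yO] in auto)
            finally show ?thesis using yO c1 by (simp add: mm_def mult_left_mono)
          next
            case False
            then have "\<phi> (G y) = 0" using G(2) linear_0[OF bounded_linear.linear[OF \<phi>]] by simp
            then show ?thesis using False ab(2) by (simp add: mm_def)
          qed
          from mult_left_mono[OF this \<rho>0(1)[of w]] show ?thesis
            unfolding y_def[symmetric] by (simp add: algebra_simps)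
        qed (simp add: \<rho>0)
      qed
      also have "\<dots> = c1 * conv \<rho> \<delta> mm z + 1" using im test_fun_integrable[OF t] \<rho>1 by (simp add: conv_def)
      finally show ?thesis unfolding \<xi>0_def .
    qed
    have "M x (\<xi> /\<^sub>R (C * \<mu>)) \<le> (\<Sum>j=1..K. c1 * conv \<rho> \<delta> mm z + 1)"
      unfolding blocks[OF x, of "\<xi> /\<^sub>R (C * \<mu>)"] by (rule sum_mono[OF block])
    also have "\<dots> = (real K * c1) * conv \<rho> \<delta> mm z + real K" by (simp add: algebra_simps)
    finally show ?thesis unfolding \<xi>_def z_def mm_def .
  qed
  show ?thesis
    by (rule that[of c C "real K * c1" "real K", OF c _ _ main]) (use c1 in auto)
  qed
qed

section \<open>Convergence of modulars\<close>

lemma LIMSEQ_subsequence_principle: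
  fixes a :: "nat \<Rightarrow> 'a :: topological_space"
  assumes "\<And>r :: nat \<Rightarrow> nat. strict_mono r \<Longrightarrow> \<exists>s :: nat \<Rightarrow> nat. strict_mono s \<and> (\<lambda>n. a (r (s n))) \<longlonglongrightarrow> l"
  shows "a \<longlonglongrightarrow> l"
proof (rule ccontr)
  assume "\<not> a \<longlonglongrightarrow> l"
  then obtain U where U: "open U" "l \<in> U" "\<not> (\<forall>\<^sub>F n in sequentially. a n \<in> U)"
    unfolding tendsto_def by blast
  define I where "I = {n. a n \<notin> U}"
  have inf: "infinite I"
  proof
    assume "finite I"
    then obtain b where "\<And>n. n \<in> I \<Longrightarrow> n \<le> b" using finite_nat_set_iff_bounded_le by auto
    then have "\<forall>n\<ge>Suc b. a n \<in> U" unfolding I_def by (metis mem_Collect_eq not_less_eq_eq)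
    then show False using U(3) by (auto simp: eventually_sequentially)
  qed
  have sm: "strict_mono (enumerate I)" using inf by (rule strict_mono_enumerate)
  obtain s where s: "strict_mono s" "(\<lambda>n. a (enumerate I (s n))) \<longlonglongrightarrow> l" using assms[OF sm] by blast
  have "\<forall>\<^sub>F n in sequentially. a (enumerate I (s n)) \<in> U" using s(2) U(1,2) by (rule topological_tendstoD)
  then obtain n where "a (enumerate I (s n)) \<in> U" by (auto simp: eventually_sequentially)
  moreover have "enumerate I (s n) \<in> I" using inf by (rule enumerate_in_set)
  ultimately show False by (simp add: I_def)
qed

text \<open>Dominated convergence with \<open>L\<^sup>1\<close>-convergent majorants, along sequences that converge in \<open>L\<^sup>1\<close> rather
  than almost everywhere: both kinds of convergence improve to almost everywhere along subsequences.\<close>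

lemma nn_integral_compose_L1_limit:
  fixes Y :: "nat \<Rightarrow> 'a \<Rightarrow> 'b :: euclidean_space" and \<Phi> :: "'a \<Rightarrow> 'b \<Rightarrow> real" and D :: "nat \<Rightarrow> 'a \<Rightarrow> real"
  assumes Y: "\<And>n. integrable M (Y n)" "integrable M Z" "(\<lambda>n. \<integral>\<^sup>+x. ennreal (norm (Y n x - Z x)) \<partial>M) \<longlonglongrightarrow> 0"
    and D: "\<And>n. integrable M (D n)" "integrable M E" "(\<lambda>n. \<integral>\<^sup>+x. ennreal (norm (D n x - E x)) \<partial>M) \<longlonglongrightarrow> 0"
    and \<Phi>: "\<And>x. x \<in> space M \<Longrightarrow> continuous_on UNIV (\<Phi> x)" "\<And>x \<xi>. x \<in> space M \<Longrightarrow> 0 \<le> \<Phi> x \<xi>"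
      "\<And>n. (\<lambda>x. \<Phi> x (Y n x)) \<in> borel_measurable M" "(\<lambda>x. \<Phi> x (Z x)) \<in> borel_measurable M"
    and dom: "\<And>n x. x \<in> space M \<Longrightarrow> \<Phi> x (Y n x) \<le> D n x"
  shows "(\<lambda>n. \<integral>\<^sup>+x. ennreal (\<Phi> x (Y n x)) \<partial>M) \<longlonglongrightarrow> (\<integral>\<^sup>+x. ennreal (\<Phi> x (Z x)) \<partial>M)"
proof (rule LIMSEQ_subsequence_principle)
  fix r :: "nat \<Rightarrow> nat" assume r: "strict_mono r"
  obtain s1 :: "nat \<Rightarrow> nat" where s1: "strict_mono s1" "AE x in M. (\<lambda>n. Y (r (s1 n)) x) \<longlonglongrightarrow> Z x"
    by (rule L1_AE_subseq[of M "\<lambda>n. Y (r n)" Z])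
       (use Y LIMSEQ_subseq_LIMSEQ[OF Y(3) r] in \<open>auto simp: o_def\<close>)
  have rs: "strict_mono (r \<circ> s1)" using r s1(1) by (rule strict_mono_o)
  obtain s2 :: "nat \<Rightarrow> nat" where s2: "strict_mono s2" "AE x in M. (\<lambda>n. D (r (s1 (s2 n))) x) \<longlonglongrightarrow> E x"
    by (rule L1_AE_subseq[of M "\<lambda>n. D (r (s1 n))" E])
       (use D LIMSEQ_subseq_LIMSEQ[OF D(3) rs] in \<open>auto simp: o_def\<close>)
  define q where "q = (\<lambda>n. r (s1 (s2 n)))"
  have q: "strict_mono q" using strict_mono_o[OF rs s2(1)] by (simp add: q_def o_def)
  have AE1: "AE x in M. (\<lambda>n. Y (q n) x) \<longlonglongrightarrow> Z x"
    using s1(2)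
  proof eventually_elim
    case (elim x)
    show ?case using LIMSEQ_subseq_LIMSEQ[OF elim s2(1)] by (simp add: q_def o_def)
  qed
  have AE2: "AE x in M. (\<lambda>n. D (q n) x) \<longlonglongrightarrow> E x" using s2(2) by (simp add: q_def)
  have sp: "AE x in M. x \<in> space M" by (rule AE_space)
  have AE3: "AE x in M. (\<lambda>n. \<Phi> x (Y (q n) x)) \<longlonglongrightarrow> \<Phi> x (Z x)"
    using AE1 sp
  proof eventually_elim
    case (elim x)
    show ?case by (rule continuous_on_tendsto_compose[OF \<Phi>(1)[OF elim(2)] elim(1)]) auto
  qed
  have AE4: "AE x in M. \<Phi> x (Z x) \<le> E x"
    using AE2 AE3 sp
  proof eventually_elim
    case (elim x)
    show ?case by (rule LIMSEQ_le[OF elim(2,1)]) (use dom[OF elim(3)] in auto)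
  qed
  have iF: "integrable M (\<lambda>x. \<Phi> x (Y n x))" for n
  proof (rule Bochner_Integration.integrable_bound[OF D(1)[of n] \<Phi>(3)])
    show "AE x in M. norm (\<Phi> x (Y n x)) \<le> norm (D n x)"
      using sp by eventually_elim (use \<Phi>(2) dom[of _ n] in \<open>force simp: abs_le_iff\<close>)
  qed
  have iG: "integrable M (\<lambda>x. \<Phi> x (Z x))"
  proof (rule Bochner_Integration.integrable_bound[OF D(2) \<Phi>(4)])
    show "AE x in M. norm (\<Phi> x (Z x)) \<le> norm (E x)"
      using sp AE4 by eventually_elim (use \<Phi>(2) in \<open>force simp: abs_le_iff\<close>)
  qed
  define g where "g = (\<lambda>n x. min \<bar>\<Phi> x (Y (q n) x) - \<Phi> x (Z x)\<bar> (2 * \<bar>E x\<bar>))"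
  have [measurable]: "(\<lambda>x. \<Phi> x (Y n x)) \<in> borel_measurable M" "(\<lambda>x. \<Phi> x (Z x)) \<in> borel_measurable M"
     "E \<in> borel_measurable M" for n using \<Phi>(3,4) D(2) by auto
  have gl: "(\<lambda>n. integral\<^sup>L M (g n)) \<longlonglongrightarrow> integral\<^sup>L M (\<lambda>x. 0)"
  proof (rule integral_dominated_convergence[where w="\<lambda>x. 2 * \<bar>E x\<bar>"])
    show "AE x in M. (\<lambda>n. g n x) \<longlonglongrightarrow> 0"
      using AE3
    proof eventually_elim
      case (elim x)
      have "(\<lambda>n. min \<bar>\<Phi> x (Y (q n) x) - \<Phi> x (Z x)\<bar> (2 * \<bar>E x\<bar>)) \<longlonglongrightarrow> min \<bar>\<Phi> x (Z x) - \<Phi> x (Z x)\<bar> (2 * \<bar>E x\<bar>)"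
        by (intro tendsto_intros elim)
      then show ?case by (simp add: g_def)
    qed
    show "g n \<in> borel_measurable M" for n unfolding g_def by measurable
  qed (use D(2) in \<open>auto simp: g_def\<close>)
  have dl: "(\<lambda>n. \<integral>x. norm (D (q n) x - E x) \<partial>M) \<longlonglongrightarrow> 0"
    using LIMSEQ_subseq_LIMSEQ[OF nn_L1_imp_integral_L1[OF D] q] by (simp add: o_def)
  have ig: "integrable M (g n)" for n
    by (rule Bochner_Integration.integrable_bound[where f="\<lambda>x. 2 * \<bar>E x\<bar>"])
       (use D(2) in \<open>auto simp: g_def\<close>)
  have iD: "integrable M (\<lambda>x. norm (D n x - E x))" for n using D by auto
  have "(\<lambda>n. \<integral>x. \<Phi> x (Y (q n) x) \<partial>M) \<longlonglongrightarrow> (\<integral>x. \<Phi> x (Z x) \<partial>M)"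
  proof (rule LIM_zero_cancel, rule Lim_null_comparison)
    show "(\<lambda>n. integral\<^sup>L M (g n) + (\<integral>x. norm (D (q n) x - E x) \<partial>M)) \<longlonglongrightarrow> 0"
      using tendsto_add[OF gl dl] by simp
    show "\<forall>\<^sub>F n in sequentially. norm ((\<integral>x. \<Phi> x (Y (q n) x) \<partial>M) - (\<integral>x. \<Phi> x (Z x) \<partial>M))
        \<le> integral\<^sup>L M (g n) + (\<integral>x. norm (D (q n) x - E x) \<partial>M)"
    proof (intro always_eventually allI)
      fix n
      have "norm ((\<integral>x. \<Phi> x (Y (q n) x) \<partial>M) - (\<integral>x. \<Phi> x (Z x) \<partial>M)) = norm (\<integral>x. \<Phi> x (Y (q n) x) - \<Phi> x (Z x) \<partial>M)"
        using iF iG by simp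
      also have "\<dots> \<le> (\<integral>x. norm (\<Phi> x (Y (q n) x) - \<Phi> x (Z x)) \<partial>M)" by (rule integral_norm_bound)
      also have "\<dots> \<le> (\<integral>x. g n x + norm (D (q n) x - E x) \<partial>M)"
      proof (rule integral_mono_AE)
        show "integrable M (\<lambda>x. norm (\<Phi> x (Y (q n) x) - \<Phi> x (Z x)))" using iF iG by auto
        show "integrable M (\<lambda>x. g n x + norm (D (q n) x - E x))" using ig iD by auto
        show "AE x in M. norm (\<Phi> x (Y (q n) x) - \<Phi> x (Z x)) \<le> g n x + norm (D (q n) x - E x)"
          using AE4 sp
        proof eventually_elim
          case (elim x)
          have "0 \<le> \<Phi> x (Z x)" "0 \<le> \<Phi> x (Y (q n) x)" "\<Phi> x (Y (q n) x) \<le> D (q n) x"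
            using \<Phi>(2) dom elim(2) by auto
          then show ?case using elim(1) unfolding g_def by (simp add: min_def)
        qed
      qed
      also have "\<dots> = integral\<^sup>L M (g n) + (\<integral>x. norm (D (q n) x - E x) \<partial>M)" using ig iD by simp
      finally show "norm ((\<integral>x. \<Phi> x (Y (q n) x) \<partial>M) - (\<integral>x. \<Phi> x (Z x) \<partial>M))
        \<le> integral\<^sup>L M (g n) + (\<integral>x. norm (D (q n) x - E x) \<partial>M)" .
    qed
  qed
  then have "(\<lambda>n. ennreal (\<integral>x. \<Phi> x (Y (q n) x) \<partial>M)) \<longlonglongrightarrow> ennreal (\<integral>x. \<Phi> x (Z x) \<partial>M)"
    by (rule tendsto_ennrealI)
  moreover have "(\<integral>\<^sup>+x. ennreal (\<Phi> x (Y n x)) \<partial>M) = ennreal (\<integral>x. \<Phi> x (Y n x) \<partial>M)" for n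
    by (rule nn_integral_eq_integral[OF iF]) (use sp in \<open>eventually_elim, simp add: \<Phi>(2)\<close>)
  moreover have "(\<integral>\<^sup>+x. ennreal (\<Phi> x (Z x)) \<partial>M) = ennreal (\<integral>x. \<Phi> x (Z x) \<partial>M)"
    by (rule nn_integral_eq_integral[OF iG]) (use sp in \<open>eventually_elim, simp add: \<Phi>(2)\<close>)
  ultimately have "(\<lambda>n. \<integral>\<^sup>+x. ennreal (\<Phi> x (Y (q n) x)) \<partial>M) \<longlonglongrightarrow> (\<integral>\<^sup>+x. ennreal (\<Phi> x (Z x)) \<partial>M)" by simp
  then show "\<exists>s :: nat \<Rightarrow> nat. strict_mono s \<and> (\<lambda>n. \<integral>\<^sup>+x. ennreal (\<Phi> x (Y (r (s n)) x)) \<partial>M) \<longlonglongrightarrow> (\<integral>\<^sup>+x. ennreal (\<Phi> x (Z x)) \<partial>M)"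
    using strict_mono_o[OF s1(1) s2(1)] by (intro exI[of _ "s1 \<circ> s2"]) (simp add: q_def)
qed

lemma (in regular_N_function) measurable_M_lebesgue:
  assumes "X \<in> borel_measurable (lebesgue_on \<Omega>)"
  shows "(\<lambda>x. M x (X x)) \<in> borel_measurable (lebesgue_on \<Omega>)"
proof -
  have \<Omega>b: "\<Omega> \<times> (UNIV :: 'a set) \<in> sets borel" using open_\<Omega> by (intro borel_open open_Times) auto
  have F: "(\<lambda>z. indicator (\<Omega> \<times> UNIV) z *\<^sub>R (case z of (x, \<xi>) \<Rightarrow> M x \<xi>)) \<in> borel_measurable borel"
    by (rule borel_measurable_continuous_on_indicator[OF \<Omega>b M_continuous])
  have "(\<lambda>x. x) \<in> borel_measurable (lebesgue_on \<Omega>)"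
    by (intro measurable_restrict_space1 measurable_completion) simp
  then have "(\<lambda>x. (x, X x)) \<in> borel_measurable (lebesgue_on \<Omega>)" using assms by simp
  from measurable_compose[OF this F]
  have "(\<lambda>x. indicator (\<Omega> \<times> UNIV) (x, X x) *\<^sub>R M x (X x)) \<in> borel_measurable (lebesgue_on \<Omega>)" by simp
  then show ?thesis by (rule measurable_cong[THEN iffD1, rotated]) (auto simp: indicator_def)
qed

lemma borel_imp_lebesgue_on:
  fixes f :: "real ^ 'n \<Rightarrow> 'b :: euclidean_space"
  shows "f \<in> borel_measurable borel \<Longrightarrow> f \<in> borel_measurable (lebesgue_on A)"
  by (intro measurable_restrict_space1 measurable_completion) simp

lemma integrable_lborel_imp_lebesgue_on:
  fixes f :: "real ^ 'n \<Rightarrow> 'b :: euclidean_space"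
  assumes "integrable lborel f" "A \<in> sets borel"
  shows "integrable (lebesgue_on A) f"
proof -
  have "integrable lborel (\<lambda>x. indicator A x *\<^sub>R f x)"
    using assms by (intro integrable_bounded_scaleR[where B=1]) (auto simp: indicator_def)
  then have "integrable lebesgue (\<lambda>x. indicator A x *\<^sub>R f x)"
    using integrable_borel_measurable by (subst integrable_completion) auto
  then show ?thesis using assms(2) by (subst integrable_restrict_space) auto
qed

text \<open>Besides making the modular of \<open>G\<close> finite, the scale \<open>\<mu>\<close> only has to dominate the constant \<open>H\<close> in the
  modulus of continuity of \<open>u\<close>, and the convergence of modulars persists when a fixed \<open>R\<close> is added to the
  gradients. Taking \<open>R = - G\<close> gives modular convergence; other choices of \<open>R\<close>, and the explicit form of the
  condition on \<open>\<mu>\<close>, serve to pass to unbounded functions.\<close>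

definition approximation_scale ::
    "(real ^ 'n) set \<Rightarrow> (real ^ 'n \<Rightarrow> real ^ 'n ^ 'd \<Rightarrow> real) \<Rightarrow> real \<Rightarrow> real \<Rightarrow> real \<Rightarrow> bool" where
  "approximation_scale \<Omega> M \<gamma> C A \<longleftrightarrow> 1 < C \<and> 0 < A \<and>
    (\<forall>(u :: real ^ 'n \<Rightarrow> real ^ 'd) G b H \<mu> R. sobolev_pair \<Omega> u G \<longrightarrow> (\<forall>x. norm (u x) \<le> b) \<longrightarrow>
      (\<forall>z \<delta> w. 0 < \<delta> \<longrightarrow> \<delta> \<le> 1 \<longrightarrow> norm w \<le> 1 \<longrightarrow> norm (u (z - \<delta> *\<^sub>R w) - u z) \<le> H * \<delta> powr \<gamma>) \<longrightarrow>
      0 < \<mu> \<longrightarrow> A * H \<le> \<mu> \<longrightarrow> integrable lborel (\<lambda>y. M y (G y /\<^sub>R \<mu>) * indicator \<Omega> y) \<longrightarrow>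
      R \<in> borel_measurable borel \<longrightarrow> integrable lborel (\<lambda>y. M y (R y /\<^sub>R (2 * C * \<mu>)) * indicator \<Omega> y) \<longrightarrow>
      (\<exists>f. (\<forall>n::nat. f n \<in> Cc_infty \<Omega>) \<and> (\<forall>n x. norm (f n x) \<le> b) \<and>
        (\<lambda>n. \<integral>\<^sup>+x. ennreal (norm (f n x - u x)) \<partial>lebesgue_on \<Omega>) \<longlonglongrightarrow> 0 \<and>
        (\<lambda>n. modular \<Omega> M (\<lambda>x. (grad (f n) x + R x) /\<^sub>R (4 * C * \<mu>))) \<longlonglongrightarrow> modular \<Omega> M (\<lambda>x. (G x + R x) /\<^sub>R (4 * C * \<mu>))))"

text \<open>The gradient of the glued mollification is a convex combination of shifted mollified gradients \<open>P\<close>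
  plus a bounded error \<open>E\<close>. If \<open>A * H \<le> \<mu>\<close>, then the mollified gradients are within the range of the balance
  condition, and, up to constants, \<open>M x (P x / (C \<mu>))\<close> is bounded by the glued mollification of \<open>M y (G y / \<mu>)\<close>, which
  converges in \<open>L\<^sup>1\<close>. Convexity combines this with the error at the scale \<open>2 C \<mu>\<close> and with \<open>R\<close> at
  \<open>4 C \<mu>\<close>.\<close>

lemma approximation_scale_exists:
  fixes \<Omega> :: "(real ^ 'n) set" and M :: "real ^ 'n \<Rightarrow> real ^ 'n ^ 'd \<Rightarrow> real"
  assumes \<Omega>: "bounded_Lipschitz_domain \<Omega>" and reg: "regular_N_function \<Omega> M m1 m2"
    and B: "B_gen \<Omega> \<gamma> M" and \<gamma>: "0 \<le> \<gamma>" "\<gamma> \<le> 1"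
  shows "\<exists>C A. approximation_scale \<Omega> M \<gamma> C A"
proof -
  interpret regular_N_function \<Omega> M m1 m2 by (rule reg)
  obtain \<rho> :: "real ^ 'n \<Rightarrow> real" where \<rho>: "mollifier \<rho>" using mollifier_exists by blast
  note t = mollifier_test_fun[OF \<rho>]
  have bd: "bounded \<Omega>" using \<Omega> by (simp add: bounded_Lipschitz_domain_def)
  have \<Omega>b: "\<Omega> \<in> sets borel" "\<Omega> \<in> sets lebesgue" using open_\<Omega> by (auto simp: borel_open)
  show ?thesis
  proof (rule conv_modular_bound[OF reg B \<gamma>(2) \<rho>], rule Lipschitz_domain_partition[OF \<Omega>], rule conv_gradient_bound[OF \<rho> bd, where 'd='d])
    fix c C c0 k and N :: nat and \<theta> :: "nat \<Rightarrow> real ^ 'n \<Rightarrow> real" and v :: "nat \<Rightarrow> real ^ 'n" and d C1 :: real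
    assume c: "1 < c" "1 < C" "0 \<le> c0" "0 \<le> k"
      and modb: "\<And>G \<mu> \<delta> v R x. integrable lborel G \<Longrightarrow> (\<And>x. x \<notin> \<Omega> \<Longrightarrow> G x = 0) \<Longrightarrow> 0 < \<mu> \<Longrightarrow>
       integrable lborel (\<lambda>y. M y (G y /\<^sub>R \<mu>) * indicator \<Omega> y) \<Longrightarrow> 0 < \<delta> \<Longrightarrow> norm v + 1 < R \<Longrightarrow> R * \<delta> \<le> 1 \<Longrightarrow>
       x \<in> \<Omega> \<Longrightarrow> 2 * norm (conv \<rho> \<delta> G (x - \<delta> *\<^sub>R v)) / \<mu> \<le> c * (R * \<delta>) powr (\<gamma> - 1) \<Longrightarrow>
       M x (conv \<rho> \<delta> G (x - \<delta> *\<^sub>R v) /\<^sub>R (C * \<mu>)) \<le> c0 * conv \<rho> \<delta> (\<lambda>y. M y (G y /\<^sub>R \<mu>) * indicator \<Omega> y) (x - \<delta> *\<^sub>R v) + k"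
      and d: "0 < d" and \<theta>: "\<And>j. test_fun (\<theta> j)" "\<And>j x. 0 \<le> \<theta> j x" "\<And>x. (\<Sum>j<N. \<theta> j x) \<le> 1"
        "\<And>x. x \<in> \<Omega> \<Longrightarrow> (\<Sum>j<N. \<theta> j x) = 1"
      and supp: "\<And>j \<delta>. j < N \<Longrightarrow> 0 < \<delta> \<Longrightarrow> \<delta> < d \<Longrightarrow> \<exists>K. compact K \<and> K \<subseteq> \<Omega> \<and>
         (\<forall>x w. \<theta> j x \<noteq> 0 \<and> norm w \<le> 1 \<and> x - \<delta> *\<^sub>R (v j + w) \<in> \<Omega> \<longrightarrow> x \<in> K)"
      and C1: "C1 > 0" and grb: "\<And>u :: real ^ 'n \<Rightarrow> real ^ 'd. \<And>G \<delta> H z. sobolev_pair \<Omega> u G \<Longrightarrow> \<delta> > 0 \<Longrightarrow>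
        (\<And>w. norm w \<le> 1 \<Longrightarrow> norm (u (z - \<delta> *\<^sub>R w) - u z) \<le> H) \<Longrightarrow> norm (conv \<rho> \<delta> G z) \<le> C1 * H / \<delta>"
    \<comment> \<open>Balls of radius \<open>Rr * \<delta>\<close> contain the points entering any of the \<open>N\<close> shifted averages.\<close>
    define Rr where "Rr = (\<Sum>j<N. norm (v j)) + 2"
    have Rr2: "2 \<le> Rr" by (simp add: Rr_def sum_nonneg)
    have Rrv: "norm (v j) + 1 < Rr" if "j < N" for j
      using member_le_sum[of j "{..<N}" "\<lambda>j. norm (v j)"] that by (simp add: Rr_def)
    obtain Bj where Bj: "\<And>j x. norm (tgrad (\<theta> j) x) \<le> Bj j" "\<And>j. 0 \<le> Bj j"
    proof -
      have "\<forall>j. \<exists>B. 0 \<le> B \<and> (\<forall>x. norm (tgrad (\<theta> j) x) \<le> B)" using tgrad_bounded[OF \<theta>(1)] by metis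
      then show ?thesis using that by metis
    qed
    \<comment> \<open>Replacing the indices from \<open>N\<close> on by zero makes one bound on the derivatives valid for all of them.\<close>
    define \<theta>' where "\<theta>' = (\<lambda>j. if j < N then \<theta> j else (\<lambda>x. 0))"
    define d1 where "d1 = min d (1 / Rr)"
    define \<delta> where "\<delta> = (\<lambda>n::nat. (d1 / 2) * (1 / 2) ^ n)"
    have d1: "0 < d1" "d1 \<le> d" "d1 * Rr \<le> 1" using d Rr2 by (auto simp: d1_def min_def field_simps)
    have \<delta>: "0 < \<delta> n" "\<delta> n < d" "Rr * \<delta> n \<le> 1" "\<delta> n \<le> 1" for n
    proof -
      show pos: "0 < \<delta> n" using d1 by (simp add: \<delta>_def)
      have "(1 / 2 :: real) ^ n \<le> 1" by (simp add: power_le_one)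
      then have le: "\<delta> n \<le> d1 / 2" using d1 by (simp add: \<delta>_def mult_left_le)
      then show "\<delta> n < d" using d1 by linarith
      have "Rr * \<delta> n \<le> Rr * d1" using le d1 Rr2 by (intro mult_left_mono) auto
      then show R1: "Rr * \<delta> n \<le> 1" using d1(3) by (simp add: mult.commute)
      have "1 * \<delta> n \<le> Rr * \<delta> n" using Rr2 pos by (intro mult_right_mono) auto
      then show "\<delta> n \<le> 1" using R1 by simp
    qed
    have \<delta>0: "\<delta> \<longlonglongrightarrow> 0"
      unfolding \<delta>_def using tendsto_mult_left[OF LIMSEQ_power_zero[of "1/2::real"], of "d1 / 2"] by simp
    define BB where "BB = (\<Sum>j<N. Bj j)"
    have tgr: "tgrad (\<lambda>x. 0) x = (0 :: real ^ 'n)" for x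
      using dirder_eqI[of "\<lambda>x :: real ^ 'n. 0" "\<lambda>h. 0"] by (simp add: tgrad_def vec_eq_iff)
    have t0: "test_fun (\<lambda>x :: real ^ 'n. 0)" unfolding test_fun_def by (auto intro: C_k_const)
    have \<theta>'1: "test_fun (\<theta>' j)" "0 \<le> \<theta>' j x" "norm (tgrad (\<theta>' j) x) \<le> BB" for j x
      using \<theta>(1,2) t0 Bj(2) order_trans[OF Bj(1) member_le_sum[of j "{..<N}" Bj]]
      by (auto simp: \<theta>'_def tgr BB_def sum_nonneg)
    have \<theta>'s: "(\<Sum>j<N. \<theta>' j x) = (\<Sum>j<N. \<theta> j x)" for x by (simp add: \<theta>'_def)
    have BB0: "0 \<le> BB" unfolding BB_def by (intro sum_nonneg Bj)
    have \<theta>'2: "(\<Sum>j<N. \<theta>' j x) \<le> 1" "x \<in> \<Omega> \<Longrightarrow> (\<Sum>j<N. \<theta>' j x) = 1" for x using \<theta>(3,4) \<theta>'s by auto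
    have supp': "\<exists>K. compact K \<and> K \<subseteq> \<Omega> \<and> (\<forall>x w. \<theta>' j x \<noteq> 0 \<and> norm w \<le> 1 \<and> x - \<delta> n *\<^sub>R (v j + w) \<in> \<Omega> \<longrightarrow> x \<in> K)"
      if "j < N" for j n using supp[OF that \<delta>(1,2)] that by (simp add: \<theta>'_def)
    have core: "\<exists>f. (\<forall>n::nat. f n \<in> Cc_infty \<Omega>) \<and> (\<forall>n x. norm (f n x) \<le> b) \<and>
        (\<lambda>n. \<integral>\<^sup>+x. ennreal (norm (f n x - u x)) \<partial>lebesgue_on \<Omega>) \<longlonglongrightarrow> 0 \<and>
        (\<lambda>n. modular \<Omega> M (\<lambda>x. (grad (f n) x + R x) /\<^sub>R (4 * C * \<mu>))) \<longlonglongrightarrow> modular \<Omega> M (\<lambda>x. (G x + R x) /\<^sub>R (4 * C * \<mu>))"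
      if u: "sobolev_pair \<Omega> u G" and b: "\<And>x. norm (u x) \<le> b"
        and H: "\<And>z \<delta> w. 0 < \<delta> \<Longrightarrow> \<delta> \<le> 1 \<Longrightarrow> norm w \<le> 1 \<Longrightarrow> norm (u (z - \<delta> *\<^sub>R w) - u z) \<le> H * \<delta> powr \<gamma>"
        and \<mu>: "0 < \<mu>" "2 * C1 * Rr * H \<le> \<mu>" and m: "integrable lborel (\<lambda>y. M y (G y /\<^sub>R \<mu>) * indicator \<Omega> y)"
        and R: "R \<in> borel_measurable borel" "integrable lborel (\<lambda>y. M y (R y /\<^sub>R (2 * C * \<mu>)) * indicator \<Omega> y)"
      for u :: "real ^ 'n \<Rightarrow> real ^ 'd" and G b H \<mu> R
    proof -
      have int: "integrable lborel u" "integrable lborel G" and out: "\<And>x. x \<notin> \<Omega> \<Longrightarrow> u x = 0" "\<And>x. x \<notin> \<Omega> \<Longrightarrow> G x = 0"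
        using u unfolding sobolev_pair_def by auto
      have H0: "0 \<le> H" using H[of 1 0 0] by simp
      define mm where "mm = (\<lambda>y. M y (G y /\<^sub>R \<mu>) * indicator \<Omega> y)"
      define f where "f = (\<lambda>n. glue \<rho> N \<theta>' v (\<delta> n) u)"
      define P where "P = (\<lambda>n. glue \<rho> N \<theta>' v (\<delta> n) G)"
      define E where "E = (\<lambda>n. glue_error \<rho> N \<theta>' v (\<delta> n) u)"
      have fC: "f n \<in> Cc_infty \<Omega>" for n
        unfolding f_def by (rule glue_Cc_infty[OF \<rho> int(1) out(1) \<theta>'1(1) \<delta>(1) supp'])
      have fb: "norm (f n x) \<le> b" for n x
        unfolding f_def by (rule glue_norm_le[OF \<rho> int(1) b _ \<theta>'1(2) \<theta>'2(1)]) (use \<delta>(1)[of n] in simp)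
      have grad_f: "grad (f n) x = P n x + E n x" for n x
        unfolding f_def P_def E_def by (rule glue_grad[OF t u bd \<theta>'1(1) \<delta>(1)])
      have L1f: "(\<lambda>n. \<integral>\<^sup>+x. ennreal (norm (f n x - u x)) \<partial>lebesgue_on \<Omega>) \<longlonglongrightarrow> 0"
        unfolding f_def lebesgue_on_nn_integral[OF \<Omega>b(2)]
        by (rule glue_L1[OF \<rho> int(1) \<theta>'1(1,2) \<theta>'2(2) \<delta>0 \<delta>(1)])
      have L1P: "(\<lambda>n. \<integral>\<^sup>+x. ennreal (norm (P n x - G x)) \<partial>lebesgue_on \<Omega>) \<longlonglongrightarrow> 0"
        unfolding P_def lebesgue_on_nn_integral[OF \<Omega>b(2)]
        by (rule glue_L1[OF \<rho> int(2) \<theta>'1(1,2) \<theta>'2(2) \<delta>0 \<delta>(1)])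
      have L1E: "(\<lambda>n. \<integral>\<^sup>+x. ennreal (norm (E n x)) \<partial>lebesgue_on \<Omega>) \<longlonglongrightarrow> 0"
        unfolding E_def lebesgue_on_nn_integral[OF \<Omega>b(2)]
        by (rule glue_error_L1[OF \<rho> int(1) open_\<Omega> \<theta>'1(1) \<theta>'2(2) \<theta>'1(3) BB0 \<delta>0 \<delta>(1)])
      have L1m: "(\<lambda>n. \<integral>\<^sup>+x. ennreal (norm (glue \<rho> N \<theta>' v (\<delta> n) mm x - mm x)) \<partial>lebesgue_on \<Omega>) \<longlonglongrightarrow> 0"
        unfolding lebesgue_on_nn_integral[OF \<Omega>b(2)] mm_def
        by (rule glue_L1[OF \<rho> m \<theta>'1(1,2) \<theta>'2(2) \<delta>0 \<delta>(1)])
      note C1p = Cc_infty_C1_pair[OF fC]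
      have gi: "integrable lborel (grad (f n))" for n by (rule C1_pair_integrable(2)[OF C1p bd])
      have gi\<Omega>: "integrable (lebesgue_on \<Omega>) (grad (f n))" for n by (rule integrable_lborel_imp_lebesgue_on[OF gi \<Omega>b(1)])
      have Gi\<Omega>: "integrable (lebesgue_on \<Omega>) G" by (rule integrable_lborel_imp_lebesgue_on[OF int(2) \<Omega>b(1)])
      have glue_int: "integrable lborel (glue \<rho> N \<theta>' v (\<delta> n) w)" if w: "integrable lborel w"
        for n and w :: "real ^ 'n \<Rightarrow> 'z :: euclidean_space"
      proof -
        have "integrable lborel (\<lambda>x. \<theta>' j x *\<^sub>R conv \<rho> (\<delta> n) w (x - \<delta> n *\<^sub>R v j))" for j
        proof -
          obtain Rj where Rj: "\<And>x. Rj < norm x \<Longrightarrow> \<theta>' j x = 0" using \<theta>'1(1)[of j] unfolding test_fun_def by blast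
          have "C_k 0 (conv \<rho> (\<delta> n) w)"
            unfolding conv_eq_mol[OF t w \<delta>(1)] using \<delta>(1)[of n] by (intro C_k_mol w test_fun_scaled[OF t]) auto
          then have "continuous_on UNIV (\<lambda>x. conv \<rho> (\<delta> n) w (x - \<delta> n *\<^sub>R v j))"
            by (auto intro!: continuous_on_compose2[of UNIV "conv \<rho> (\<delta> n) w"] continuous_intros)
          then show ?thesis
            using Rj by (intro integrable_continuous_bounded_support[where R=Rj] continuous_on_scaleR test_fun_continuous[OF \<theta>'1(1)]) auto
        qed
        then show ?thesis unfolding glue_def[abs_def] by (rule Bochner_Integration.integrable_sum)
      qed
      have L1g: "(\<lambda>n. \<integral>\<^sup>+x. ennreal (norm (grad (f n) x - G x)) \<partial>lebesgue_on \<Omega>) \<longlonglongrightarrow> 0"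
      proof (rule tendsto_sandwich[OF _ _ tendsto_const])
        show "(\<lambda>n. (\<integral>\<^sup>+x. ennreal (norm (P n x - G x)) \<partial>lebesgue_on \<Omega>) + (\<integral>\<^sup>+x. ennreal (norm (E n x)) \<partial>lebesgue_on \<Omega>)) \<longlonglongrightarrow> 0"
          using tendsto_add[OF L1P L1E] by simp
        have mP: "P n \<in> borel_measurable (lebesgue_on \<Omega>)" for n
          unfolding P_def by (intro borel_imp_lebesgue_on integrable_borel_measurable glue_int int)
        have mE: "E n \<in> borel_measurable (lebesgue_on \<Omega>)" for n
        proof -
          have "E n = (\<lambda>x. grad (f n) x - P n x)" using grad_f by (simp add: fun_eq_iff)
          then show ?thesis using mP borel_measurable_integrable[OF gi\<Omega>] by simp
        qed
        have mG: "G \<in> borel_measurable (lebesgue_on \<Omega>)" by (rule borel_measurable_integrable[OF Gi\<Omega>])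
        show "\<forall>\<^sub>F n in sequentially. (\<integral>\<^sup>+x. ennreal (norm (grad (f n) x - G x)) \<partial>lebesgue_on \<Omega>)
           \<le> (\<integral>\<^sup>+x. ennreal (norm (P n x - G x)) \<partial>lebesgue_on \<Omega>) + (\<integral>\<^sup>+x. ennreal (norm (E n x)) \<partial>lebesgue_on \<Omega>)"
        proof (intro always_eventually allI)
          fix n
          have "(\<integral>\<^sup>+x. ennreal (norm (grad (f n) x - G x)) \<partial>lebesgue_on \<Omega>)
             \<le> (\<integral>\<^sup>+x. ennreal (norm (P n x - G x)) + ennreal (norm (E n x)) \<partial>lebesgue_on \<Omega>)"
          proof (rule nn_integral_mono)
            fix x
            have "grad (f n) x - G x = (P n x - G x) + E n x" by (simp add: grad_f)
            then have "norm (grad (f n) x - G x) \<le> norm (P n x - G x) + norm (E n x)" using norm_triangle_ineq by metis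
            then show "ennreal (norm (grad (f n) x - G x)) \<le> ennreal (norm (P n x - G x)) + ennreal (norm (E n x))"
              by (simp add: ennreal_leI flip: ennreal_plus)
          qed
          then show "(\<integral>\<^sup>+x. ennreal (norm (grad (f n) x - G x)) \<partial>lebesgue_on \<Omega>)
           \<le> (\<integral>\<^sup>+x. ennreal (norm (P n x - G x)) \<partial>lebesgue_on \<Omega>) + (\<integral>\<^sup>+x. ennreal (norm (E n x)) \<partial>lebesgue_on \<Omega>)"
            using mP mE mG by (subst nn_integral_add[symmetric]) auto
        qed
      qed auto
      define Eb where "Eb = real N * (real CARD('d) * b * BB)"
      have Eb: "norm (E n x) \<le> Eb" for n x
        unfolding E_def Eb_def by (rule glue_error_norm_le[OF \<rho> int(1) b _ \<theta>'1(3)]) (use \<delta>(1)[of n] in simp)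
      define b0 where "b0 = m2 0 + m2 (Eb / (C * \<mu>))"
      define MR where "MR = (\<lambda>x. M x (R x /\<^sub>R (2 * C * \<mu>)) * indicator \<Omega> x)"
      define Dn where "Dn = (\<lambda>n x. c0 / 4 * glue \<rho> N \<theta>' v (\<delta> n) mm x + (k / 4 + b0 / 4 + MR x / 2))"
      define D where "D = (\<lambda>x. c0 / 4 * mm x + (k / 4 + b0 / 4 + MR x / 2))"
      have CM: "0 < C * \<mu>" using c \<mu> by simp
      have small: "2 * norm (conv \<rho> (\<delta> n) G (x - \<delta> n *\<^sub>R v j)) / \<mu> \<le> c * (Rr * \<delta> n) powr (\<gamma> - 1)" for n x j
      proof -
        have "norm (conv \<rho> (\<delta> n) G (x - \<delta> n *\<^sub>R v j)) \<le> C1 * (H * \<delta> n powr \<gamma>) / \<delta> n"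
          by (rule grb[OF u \<delta>(1)]) (rule H[OF \<delta>(1,4)])
        also have "\<dots> = C1 * H * \<delta> n powr (\<gamma> - 1)" using \<delta>(1)[of n] by (simp add: powr_diff)
        finally have n1: "2 * norm (conv \<rho> (\<delta> n) G (x - \<delta> n *\<^sub>R v j)) \<le> 2 * C1 * H * \<delta> n powr (\<gamma> - 1)" by simp
        \<comment> \<open>The enlarged radius costs a factor \<open>Rr powr (\<gamma> - 1)\<close>, which may be less than one; the factor \<open>Rr\<close> in
           \<open>2 * C1 * Rr\<close> makes up for it.\<close>
        have RR: "1 \<le> Rr * Rr powr (\<gamma> - 1)"
        proof -
          have "Rr * Rr powr (\<gamma> - 1) = Rr powr \<gamma>" using Rr2 by (simp add: powr_diff)
          moreover have "1 \<le> Rr powr \<gamma>" using Rr2 \<gamma> by (intro ge_one_powr_ge_zero) auto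
          ultimately show ?thesis by simp
        qed
        have "2 * C1 * H \<le> (2 * C1 * H) * (Rr * Rr powr (\<gamma> - 1))"
          using mult_left_mono[OF RR, of "2 * C1 * H"] C1 H0 by simp
        also have "\<dots> = (2 * C1 * Rr * H) * Rr powr (\<gamma> - 1)" by simp
        also have "\<dots> \<le> \<mu> * Rr powr (\<gamma> - 1)" by (rule mult_right_mono[OF \<mu>(2)]) simp
        also have "\<dots> \<le> \<mu> * (c * Rr powr (\<gamma> - 1))"
        proof (rule mult_left_mono)
          have "1 * Rr powr (\<gamma> - 1) \<le> c * Rr powr (\<gamma> - 1)" using c(1) by (intro mult_right_mono) auto
          then show "Rr powr (\<gamma> - 1) \<le> c * Rr powr (\<gamma> - 1)" by simp
        qed (use \<mu> in simp)
        finally have "2 * C1 * H * \<delta> n powr (\<gamma> - 1) \<le> \<mu> * (c * Rr powr (\<gamma> - 1)) * \<delta> n powr (\<gamma> - 1)"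
          by (intro mult_right_mono) auto
        also have "\<dots> = \<mu> * (c * (Rr * \<delta> n) powr (\<gamma> - 1))"
          using Rr2 \<delta>(1)[of n] by (simp add: powr_mult)
        finally have "2 * norm (conv \<rho> (\<delta> n) G (x - \<delta> n *\<^sub>R v j)) \<le> \<mu> * (c * (Rr * \<delta> n) powr (\<gamma> - 1))" using n1 by linarith
        then show ?thesis using \<mu>(1) by (simp add: divide_le_eq mult.commute)
      qed
      have dom: "M x ((grad (f n) x + R x) /\<^sub>R (4 * C * \<mu>)) \<le> Dn n x" if x: "x \<in> \<Omega>" for n x
      proof -
        have "P n x /\<^sub>R (C * \<mu>) = (\<Sum>j<N. \<theta>' j x *\<^sub>R (conv \<rho> (\<delta> n) G (x - \<delta> n *\<^sub>R v j) /\<^sub>R (C * \<mu>)))"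
          unfolding P_def glue_def scaleR_sum_right by (intro sum.cong refl) simp
        then have "M x (P n x /\<^sub>R (C * \<mu>)) = M x (\<Sum>j<N. \<theta>' j x *\<^sub>R (conv \<rho> (\<delta> n) G (x - \<delta> n *\<^sub>R v j) /\<^sub>R (C * \<mu>)))"
          by (simp only:)
        also have "\<dots> \<le> (\<Sum>j<N. \<theta>' j x * M x (conv \<rho> (\<delta> n) G (x - \<delta> n *\<^sub>R v j) /\<^sub>R (C * \<mu>)))"
          by (rule M_sum_convex[OF x _ \<theta>'1(2) \<theta>'2(1)]) simp
        also have "\<dots> \<le> (\<Sum>j<N. \<theta>' j x * (c0 * conv \<rho> (\<delta> n) mm (x - \<delta> n *\<^sub>R v j) + k))"
          unfolding mm_def
          by (intro sum_mono mult_left_mono modb[OF int(2) out(2) \<mu>(1) m \<delta>(1) Rrv \<delta>(3) x small] \<theta>'1(2)) auto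
        also have "\<dots> = c0 * glue \<rho> N \<theta>' v (\<delta> n) mm x + (\<Sum>j<N. \<theta>' j x) * k"
          by (simp add: glue_def algebra_simps sum.distrib sum_distrib_left)
        also have "\<dots> \<le> c0 * glue \<rho> N \<theta>' v (\<delta> n) mm x + k" using mult_right_mono[OF \<theta>'2(1)[of x] c(4)] by simp
        finally have MP: "M x (P n x /\<^sub>R (C * \<mu>)) \<le> c0 * glue \<rho> N \<theta>' v (\<delta> n) mm x + k" .
        have "norm (E n x /\<^sub>R (C * \<mu>)) \<le> Eb / (C * \<mu>)"
        proof -
          have "norm (E n x /\<^sub>R (C * \<mu>)) = \<bar>inverse (C * \<mu>)\<bar> * norm (E n x)" by (rule norm_scaleR)
          also have "\<dots> = norm (E n x) / (C * \<mu>)"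
            using CM by (simp only: abs_inverse abs_of_pos divide_inverse mult.commute)
          also have "\<dots> \<le> Eb / (C * \<mu>)" using Eb[of n x] CM by (intro divide_right_mono) auto
          finally show ?thesis .
        qed
        then have ME: "M x (E n x /\<^sub>R (C * \<mu>)) \<le> b0" unfolding b0_def by (rule M_bounded[OF x])
        have e1: "grad (f n) x /\<^sub>R (2 * C * \<mu>) = (1/2) *\<^sub>R (P n x /\<^sub>R (C * \<mu>) + E n x /\<^sub>R (C * \<mu>))"
          using CM by (simp add: grad_f scaleR_right_distrib)
        have e2: "(grad (f n) x + R x) /\<^sub>R (4 * C * \<mu>) = (1/2) *\<^sub>R (grad (f n) x /\<^sub>R (2 * C * \<mu>) + R x /\<^sub>R (2 * C * \<mu>))"
          using CM by (simp add: scaleR_right_distrib)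
        have "M x (grad (f n) x /\<^sub>R (2 * C * \<mu>)) \<le> (c0 * glue \<rho> N \<theta>' v (\<delta> n) mm x + k) / 2 + b0 / 2"
          unfolding e1 by (rule order_trans[OF M_half[OF x] add_mono[OF divide_right_mono[OF MP] divide_right_mono[OF ME]]]) simp_all
        then have "M x (grad (f n) x /\<^sub>R (2 * C * \<mu>)) / 2 + M x (R x /\<^sub>R (2 * C * \<mu>)) / 2
            \<le> ((c0 * glue \<rho> N \<theta>' v (\<delta> n) mm x + k) / 2 + b0 / 2) / 2 + MR x / 2"
          unfolding MR_def using x by (intro add_mono divide_right_mono) auto
        then have "M x ((grad (f n) x + R x) /\<^sub>R (4 * C * \<mu>)) \<le> ((c0 * glue \<rho> N \<theta>' v (\<delta> n) mm x + k) / 2 + b0 / 2) / 2 + MR x / 2"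
          unfolding e2 by (rule order_trans[OF M_half[OF x]])
        then show ?thesis unfolding Dn_def by (simp add: field_simps)
      qed
      have ci: "integrable (lebesgue_on \<Omega>) (\<lambda>x. a :: real)" for a
      proof -
        have "emeasure (lebesgue_on \<Omega>) (space (lebesgue_on \<Omega>)) < \<infinity>"
          using emeasure_bounded_finite[OF bd] \<Omega>b by (simp add: emeasure_restrict_space)
        then show ?thesis by (simp add: finite_measure.integrable_const finite_measureI)
      qed
      have MRi: "integrable (lebesgue_on \<Omega>) MR" unfolding MR_def by (rule integrable_lborel_imp_lebesgue_on[OF R(2) \<Omega>b(1)])
      have mi: "integrable (lebesgue_on \<Omega>) mm" unfolding mm_def by (rule integrable_lborel_imp_lebesgue_on[OF m \<Omega>b(1)])
      have gmi: "integrable (lebesgue_on \<Omega>) (glue \<rho> N \<theta>' v (\<delta> n) mm)" for n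
        by (rule integrable_lborel_imp_lebesgue_on[OF glue_int \<Omega>b(1)]) (use m in \<open>simp add: mm_def\<close>)
      have Ri: "R \<in> borel_measurable (lebesgue_on \<Omega>)" by (rule borel_imp_lebesgue_on[OF R(1)])
      have "(\<lambda>n. \<integral>\<^sup>+x. ennreal (M x ((grad (f n) x + R x) /\<^sub>R (4 * C * \<mu>))) \<partial>lebesgue_on \<Omega>)
          \<longlonglongrightarrow> (\<integral>\<^sup>+x. ennreal (M x ((G x + R x) /\<^sub>R (4 * C * \<mu>))) \<partial>lebesgue_on \<Omega>)"
      proof (rule nn_integral_compose_L1_limit[where \<Phi>="\<lambda>x \<xi>. M x ((\<xi> + R x) /\<^sub>R (4 * C * \<mu>))" and D=Dn and E=D, OF gi\<Omega> Gi\<Omega> L1g])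
        show "integrable (lebesgue_on \<Omega>) (Dn n)" for n
          unfolding Dn_def by (intro Bochner_Integration.integrable_add integrable_mult_right gmi ci integrable_divide_zero MRi)
        show "integrable (lebesgue_on \<Omega>) D"
          unfolding D_def by (intro Bochner_Integration.integrable_add integrable_mult_right mi ci integrable_divide_zero MRi)
        show "(\<lambda>n. \<integral>\<^sup>+x. ennreal (norm (Dn n x - D x)) \<partial>lebesgue_on \<Omega>) \<longlonglongrightarrow> 0"
        proof -
          have "(\<integral>\<^sup>+x. ennreal (norm (Dn n x - D x)) \<partial>lebesgue_on \<Omega>)
              = ennreal (c0 / 4) * (\<integral>\<^sup>+x. ennreal (norm (glue \<rho> N \<theta>' v (\<delta> n) mm x - mm x)) \<partial>lebesgue_on \<Omega>)" for n
          proof -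
            have "norm (Dn n x - D x) = c0 / 4 * norm (glue \<rho> N \<theta>' v (\<delta> n) mm x - mm x)" for x
            proof -
              have "Dn n x - D x = c0 / 4 * (glue \<rho> N \<theta>' v (\<delta> n) mm x - mm x)" by (simp add: Dn_def D_def algebra_simps)
              then have "norm (Dn n x - D x) = \<bar>c0 / 4\<bar> * \<bar>glue \<rho> N \<theta>' v (\<delta> n) mm x - mm x\<bar>"
                by (simp only: real_norm_def abs_mult)
              then show ?thesis using c(3) by simp
            qed
            then have "(\<integral>\<^sup>+x. ennreal (norm (Dn n x - D x)) \<partial>lebesgue_on \<Omega>)
              = (\<integral>\<^sup>+x. ennreal (c0 / 4) * ennreal (norm (glue \<rho> N \<theta>' v (\<delta> n) mm x - mm x)) \<partial>lebesgue_on \<Omega>)"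
              using c(3) by (simp only: ennreal_mult norm_ge_zero divide_nonneg_pos zero_less_numeral)
            also have "\<dots> = ennreal (c0 / 4) * (\<integral>\<^sup>+x. ennreal (norm (glue \<rho> N \<theta>' v (\<delta> n) mm x - mm x)) \<partial>lebesgue_on \<Omega>)"
              using borel_measurable_integrable[OF gmi] borel_measurable_integrable[OF mi] by (intro nn_integral_cmult) measurable
            finally show ?thesis .
          qed
          then show ?thesis using ennreal_tendsto_cmult[OF _ L1m, of "ennreal (c0 / 4)"] by simp
        qed
        fix x assume "x \<in> space (lebesgue_on \<Omega>)"
        then have x: "x \<in> \<Omega>" by simp
        show "continuous_on UNIV (\<lambda>\<xi>. M x ((\<xi> + R x) /\<^sub>R (4 * C * \<mu>)))"
          by (rule M_continuous_compose) (use x in \<open>auto intro!: continuous_intros\<close>)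
        show "0 \<le> M x ((\<xi> + R x) /\<^sub>R (4 * C * \<mu>))" for \<xi> by (rule M_nonneg[OF x])
        show "M x ((grad (f n) x + R x) /\<^sub>R (4 * C * \<mu>)) \<le> Dn n x" for n by (rule dom[OF x])
      next
        show "(\<lambda>x. M x ((grad (f n) x + R x) /\<^sub>R (4 * C * \<mu>))) \<in> borel_measurable (lebesgue_on \<Omega>)" for n
          using Ri borel_measurable_integrable[OF gi\<Omega>] by (intro measurable_M_lebesgue) simp
        show "(\<lambda>x. M x ((G x + R x) /\<^sub>R (4 * C * \<mu>))) \<in> borel_measurable (lebesgue_on \<Omega>)"
          using Ri borel_measurable_integrable[OF Gi\<Omega>] by (intro measurable_M_lebesgue) simp
      qed
      then have "(\<lambda>n. modular \<Omega> M (\<lambda>x. (grad (f n) x + R x) /\<^sub>R (4 * C * \<mu>))) \<longlonglongrightarrow> modular \<Omega> M (\<lambda>x. (G x + R x) /\<^sub>R (4 * C * \<mu>))"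
        unfolding modular_def .
      then show ?thesis using fC fb L1f by blast
    qed
    have "0 < 2 * C1 * Rr" using C1 Rr2 by simp
    have "approximation_scale \<Omega> M \<gamma> C (2 * C1 * Rr)"
      unfolding approximation_scale_def
    proof (intro conjI allI impI)
      fix u :: "real ^ 'n \<Rightarrow> real ^ 'd" and G b H \<mu> R
      assume *: "sobolev_pair \<Omega> u G" "\<forall>x. norm (u x) \<le> b"
        "\<forall>z \<delta> w. 0 < \<delta> \<longrightarrow> \<delta> \<le> 1 \<longrightarrow> norm w \<le> 1 \<longrightarrow> norm (u (z - \<delta> *\<^sub>R w) - u z) \<le> H * \<delta> powr \<gamma>"
        "0 < \<mu>" "2 * C1 * Rr * H \<le> \<mu>" "integrable lborel (\<lambda>y. M y (G y /\<^sub>R \<mu>) * indicator \<Omega> y)"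
        "R \<in> borel_measurable borel" "integrable lborel (\<lambda>y. M y (R y /\<^sub>R (2 * C * \<mu>)) * indicator \<Omega> y)"
      show "\<exists>f. (\<forall>n::nat. f n \<in> Cc_infty \<Omega>) \<and> (\<forall>n x. norm (f n x) \<le> b) \<and>
        (\<lambda>n. \<integral>\<^sup>+x. ennreal (norm (f n x - u x)) \<partial>lebesgue_on \<Omega>) \<longlonglongrightarrow> 0 \<and>
        (\<lambda>n. modular \<Omega> M (\<lambda>x. (grad (f n) x + R x) /\<^sub>R (4 * C * \<mu>))) \<longlonglongrightarrow> modular \<Omega> M (\<lambda>x. (G x + R x) /\<^sub>R (4 * C * \<mu>))"
        by (rule core[OF *(1) _ _ *(4-8)]) (simp_all add: *(2,3))
    qed (use c(2) C1 Rr2 in auto)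
    then show ?thesis by blast
  qed
qed

section \<open>Modulars, Orlicz classes and truncations\<close>

lemma modular_cong_AE:
  "AE x in lebesgue_on \<Omega>. f x = g x \<Longrightarrow> modular \<Omega> M f = modular \<Omega> M g"
  unfolding modular_def by (rule nn_integral_cong_AE) (auto elim!: eventually_mono)

context regular_N_function
begin

lemma modular_mono_scale:
  assumes "0 < \<mu>" "\<mu> \<le> \<nu>"
  shows "modular \<Omega> M (\<lambda>x. f x /\<^sub>R \<nu>) \<le> modular \<Omega> M (\<lambda>x. f x /\<^sub>R \<mu>)"
  unfolding modular_def
proof (rule nn_integral_mono)
  fix x assume "x \<in> space (lebesgue_on \<Omega>)"
  then have x: "x \<in> \<Omega>" by simp
  have eq: "f x /\<^sub>R \<nu> = (\<mu> / \<nu>) *\<^sub>R (f x /\<^sub>R \<mu>)" using assms by (simp add: divide_inverse)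
  have "M x (f x /\<^sub>R \<nu>) \<le> M x (f x /\<^sub>R \<mu>)"
    unfolding eq by (rule M_scale_le[OF x]) (use assms in auto)
  then show "ennreal (M x (f x /\<^sub>R \<nu>)) \<le> ennreal (M x (f x /\<^sub>R \<mu>))" by (rule ennreal_leI)
qed

lemma modular_half:
  assumes "f \<in> borel_measurable (lebesgue_on \<Omega>)" "g \<in> borel_measurable (lebesgue_on \<Omega>)"
  shows "modular \<Omega> M (\<lambda>x. (1/2) *\<^sub>R (f x + g x)) \<le> modular \<Omega> M f + modular \<Omega> M g"
proof -
  have "modular \<Omega> M (\<lambda>x. (1/2) *\<^sub>R (f x + g x))
      \<le> (\<integral>\<^sup>+x. ennreal (M x (f x)) + ennreal (M x (g x)) \<partial>lebesgue_on \<Omega>)"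
    unfolding modular_def
  proof (rule nn_integral_mono)
    fix x assume "x \<in> space (lebesgue_on \<Omega>)"
    then have x: "x \<in> \<Omega>" by simp
    have "M x ((1/2) *\<^sub>R (f x + g x)) \<le> M x (f x) + M x (g x)"
      using M_half[OF x, of "f x" "g x"] M_nonneg[OF x, of "f x"] M_nonneg[OF x, of "g x"] by simp
    then show "ennreal (M x ((1/2) *\<^sub>R (f x + g x))) \<le> ennreal (M x (f x)) + ennreal (M x (g x))"
      using M_nonneg[OF x] by (simp add: ennreal_leI flip: ennreal_plus)
  qed
  also have "\<dots> = modular \<Omega> M f + modular \<Omega> M g"
    unfolding modular_def using measurable_M_lebesgue[OF assms(1)] measurable_M_lebesgue[OF assms(2)]
    by (intro nn_integral_add) auto
  finally show ?thesis .
qed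

text \<open>By convexity, the functions with finite modular at some scale form a linear space, which therefore
  contains the smallest one.\<close>

lemma L_M_finite_modular:
  assumes "\<xi> \<in> L_M \<Omega> M"
  shows "\<xi> \<in> borel_measurable (lebesgue_on \<Omega>) \<and> (\<exists>\<mu>>0. modular \<Omega> M (\<lambda>x. \<xi> x /\<^sub>R \<mu>) < \<infinity>)"
proof -
  define S where "S = {\<xi> \<in> borel_measurable (lebesgue_on \<Omega>). \<exists>\<mu>>0. modular \<Omega> M (\<lambda>x. \<xi> x /\<^sub>R \<mu>) < \<infinity>}"
  have zero: "modular \<Omega> M (\<lambda>x. 0) = 0"
  proof -
    have "modular \<Omega> M (\<lambda>x. 0) = (\<integral>\<^sup>+x. 0 \<partial>lebesgue_on \<Omega>)"
      unfolding modular_def by (rule nn_integral_cong) (simp add: M_zero)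
    then show ?thesis by simp
  qed
  have "linear_function_space S"
    unfolding linear_function_space_def
  proof (intro conjI ballI allI)
    show "(\<lambda>x. 0) \<in> S" unfolding S_def using zero by (auto intro: exI[of _ 1])
    fix f assume f: "f \<in> S"
    then obtain \<mu> where \<mu>: "\<mu> > 0" "modular \<Omega> M (\<lambda>x. f x /\<^sub>R \<mu>) < \<infinity>" and fm: "f \<in> borel_measurable (lebesgue_on \<Omega>)"
      unfolding S_def by blast
    {
      fix g assume "g \<in> S"
      then obtain \<nu> where \<nu>: "\<nu> > 0" "modular \<Omega> M (\<lambda>x. g x /\<^sub>R \<nu>) < \<infinity>" and gm: "g \<in> borel_measurable (lebesgue_on \<Omega>)"
        unfolding S_def by blast
      define \<kappa> where "\<kappa> = max \<mu> \<nu>"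
      have \<kappa>: "\<kappa> > 0" "\<mu> \<le> \<kappa>" "\<nu> \<le> \<kappa>" using \<mu> by (auto simp: \<kappa>_def)
      have "modular \<Omega> M (\<lambda>x. (f x + g x) /\<^sub>R (2 * \<kappa>)) = modular \<Omega> M (\<lambda>x. (1/2) *\<^sub>R (f x /\<^sub>R \<kappa> + g x /\<^sub>R \<kappa>))"
        by (simp add: scaleR_right_distrib)
      also have "\<dots> \<le> modular \<Omega> M (\<lambda>x. f x /\<^sub>R \<kappa>) + modular \<Omega> M (\<lambda>x. g x /\<^sub>R \<kappa>)"
        using fm gm by (intro modular_half) auto
      also have "\<dots> \<le> modular \<Omega> M (\<lambda>x. f x /\<^sub>R \<mu>) + modular \<Omega> M (\<lambda>x. g x /\<^sub>R \<nu>)"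
        by (intro add_mono modular_mono_scale \<mu> \<nu> \<kappa>)
      also have "\<dots> < \<infinity>" using \<mu> \<nu> by (simp add: ennreal_add_less_top)
      finally show "(\<lambda>x. f x + g x) \<in> S" unfolding S_def using fm gm \<kappa> by (auto intro!: exI[of _ "2 * \<kappa>"])
    }
    fix c :: real
    show "(\<lambda>x. c *\<^sub>R f x) \<in> S"
    proof (cases "c = 0")
      case True
      then show ?thesis unfolding S_def using zero by (auto intro: exI[of _ 1])
    next
      case False
      have "modular \<Omega> M (\<lambda>x. (c *\<^sub>R f x) /\<^sub>R (\<bar>c\<bar> * \<mu>)) = modular \<Omega> M (\<lambda>x. f x /\<^sub>R \<mu>)"
        unfolding modular_def
      proof (rule nn_integral_cong)
        fix x assume "x \<in> space (lebesgue_on \<Omega>)"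
        then have x: "x \<in> \<Omega>" by simp
        have "inverse (\<bar>c\<bar> * \<mu>) * c = sgn c * inverse \<mu>"
          using False by (cases "c > 0") (auto simp: sgn_if)
        then have eq: "(c *\<^sub>R f x) /\<^sub>R (\<bar>c\<bar> * \<mu>) = sgn c *\<^sub>R (f x /\<^sub>R \<mu>)" by (simp only: scaleR_scaleR)
        show "ennreal (M x ((c *\<^sub>R f x) /\<^sub>R (\<bar>c\<bar> * \<mu>))) = ennreal (M x (f x /\<^sub>R \<mu>))"
          unfolding eq using False M_even[OF x, of "f x /\<^sub>R \<mu>"] by (simp add: sgn_if)
      qed
      then show ?thesis unfolding S_def using False \<mu> fm by (auto intro!: exI[of _ "\<bar>c\<bar> * \<mu>"])
    qed
  qed
  moreover have "{\<xi> \<in> borel_measurable (lebesgue_on \<Omega>). modular \<Omega> M \<xi> < \<infinity>} \<subseteq> S"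
    unfolding S_def by (auto intro!: exI[of _ 1])
  ultimately have "L_M \<Omega> M \<subseteq> S" unfolding L_M_def by (intro Inter_lower) simp
  then show ?thesis using assms unfolding S_def by blast
qed

lemma modular_finite_integrable:
  assumes "G \<in> borel_measurable borel" "modular \<Omega> M (\<lambda>x. G x /\<^sub>R \<mu>) < \<infinity>"
  shows "integrable lborel (\<lambda>y. M y (G y /\<^sub>R \<mu>) * indicator \<Omega> y)"
proof (rule integrableI_nonneg)
  have \<Omega>l: "\<Omega> \<in> sets lebesgue" using open_\<Omega> by (auto simp: borel_open)
  show "(\<lambda>y. M y (G y /\<^sub>R \<mu>) * indicator \<Omega> y) \<in> borel_measurable lborel"
    using borel_measurable_M[of "\<lambda>y. G y /\<^sub>R \<mu>"] assms(1) by simp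
  show "AE x in lborel. 0 \<le> M x (G x /\<^sub>R \<mu>) * indicator \<Omega> x"
    by (intro always_eventually allI) (auto simp: indicator_def M_nonneg)
  have "(\<integral>\<^sup>+x. ennreal (M x (G x /\<^sub>R \<mu>) * indicator \<Omega> x) \<partial>lborel) = modular \<Omega> M (\<lambda>x. G x /\<^sub>R \<mu>)"
    unfolding modular_def lebesgue_on_nn_integral[OF \<Omega>l] by (rule nn_integral_cong) (auto simp: indicator_def)
  then show "(\<integral>\<^sup>+x. ennreal (M x (G x /\<^sub>R \<mu>) * indicator \<Omega> x) \<partial>lborel) < \<infinity>" using assms(2) by simp
qed

end

text \<open>Smooth truncations: \<open>k t / (k + \<bar>t\<bar>)\<close> is bounded by \<open>k\<close> and tends to \<open>t\<close>. Consecutive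
  truncations differ by at most one, whatever \<open>k\<close> is.\<close>

definition soft_trunc :: "nat \<Rightarrow> real \<Rightarrow> real" where
  "soft_trunc k t = real k * t / (real k + \<bar>t\<bar>)"

definition soft_trunc' :: "nat \<Rightarrow> real \<Rightarrow> real" where
  "soft_trunc' k t = (real k / (real k + \<bar>t\<bar>))\<^sup>2"

lemma soft_trunc_0 [simp]: "soft_trunc 0 t = 0" "soft_trunc' 0 t = 0" "soft_trunc k 0 = 0"
  by (simp_all add: soft_trunc_def soft_trunc'_def)

lemma soft_trunc_has_derivative: "(soft_trunc k has_real_derivative soft_trunc' k t) (at t)"
proof (cases "k = 0")
  case True
  have "soft_trunc 0 = (\<lambda>t. 0)" "soft_trunc' 0 t = 0" by (auto simp: fun_eq_iff)
  then show ?thesis using True by simp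
next
  case False
  then have k: "0 < real k" by simp
  let ?q = "\<lambda>s. (real k)\<^sup>2 / ((real k + \<bar>s\<bar>) * (real k + \<bar>t\<bar>))"
  have pos: "0 < real k + \<bar>s\<bar>" for s using k by linarith
  have ne: "real k + \<bar>s\<bar> \<noteq> 0" for s using pos[of s] by simp
  have "(?q \<longlongrightarrow> ?q t) (at t)"
    using ne by (intro tendsto_intros) auto
  moreover have "?q t = soft_trunc' k t" by (simp add: soft_trunc'_def power2_eq_square)
  ultimately have lim: "(?q \<longlongrightarrow> soft_trunc' k t) (at t)" by (simp only:)
  have "\<forall>\<^sub>F s in at t. ?q s = (soft_trunc k s - soft_trunc k t) / (s - t)"
  proof -
    have "\<forall>\<^sub>F s in at t. s * t \<ge> 0"
    proof (cases "t = 0")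
      case False
      then have "0 < t * t" using not_real_square_gt_zero[of t] by blast
      moreover have "((\<lambda>s. s * t) \<longlongrightarrow> t * t) (at t)" by (intro tendsto_intros)
      ultimately have "\<forall>\<^sub>F s in at t. 0 < s * t" by (simp add: order_tendstoD(1))
      then show ?thesis by eventually_elim simp
    qed simp
    moreover have "\<forall>\<^sub>F s in at t. s \<noteq> t" by (simp add: eventually_at_filter)
    ultimately show ?thesis
    proof eventually_elim
      case (elim s)
      have st: "s * \<bar>t\<bar> = t * \<bar>s\<bar>"
        using elim(1) by (cases "0 \<le> s"; cases "0 \<le> t") (auto simp: zero_le_mult_iff)
      have "soft_trunc k s - soft_trunc k t
          = real k * (s * (real k + \<bar>t\<bar>) - t * (real k + \<bar>s\<bar>)) / ((real k + \<bar>s\<bar>) * (real k + \<bar>t\<bar>))"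
        unfolding soft_trunc_def using ne[of s] ne[of t] by (simp add: diff_frac_eq algebra_simps)
      also have "s * (real k + \<bar>t\<bar>) - t * (real k + \<bar>s\<bar>) = real k * (s - t)"
        using st by (simp add: algebra_simps)
      finally show ?case using elim(2) by (simp add: power2_eq_square)
    qed
  qed
  then show ?thesis
    unfolding has_field_derivative_iff by (rule Lim_transform_eventually[OF lim])
qed

lemma soft_trunc'_bounds: "0 \<le> soft_trunc' k t" "soft_trunc' k t \<le> 1" "soft_trunc' k t \<le> soft_trunc' (Suc k) t"
proof -
  show "0 \<le> soft_trunc' k t" by (simp add: soft_trunc'_def)
  have q: "0 \<le> real k / (real k + \<bar>t\<bar>)" "real k / (real k + \<bar>t\<bar>) \<le> 1" by (auto simp: divide_le_eq_1)
  show "soft_trunc' k t \<le> 1" unfolding soft_trunc'_def using q by (simp add: power_le_one)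
  have "real k / (real k + \<bar>t\<bar>) \<le> real (Suc k) / (real (Suc k) + \<bar>t\<bar>)"
  proof (cases "k = 0")
    case False
    then have "0 < real k + \<bar>t\<bar>" "0 < real (Suc k) + \<bar>t\<bar>" by linarith+
    moreover have "real k * \<bar>t\<bar> \<le> real (Suc k) * \<bar>t\<bar>" by (intro mult_right_mono) auto
    ultimately show ?thesis by (subst frac_le_eq) (auto simp: algebra_simps intro!: divide_nonpos_pos mult_pos_pos)
  qed simp
  then show "soft_trunc' k t \<le> soft_trunc' (Suc k) t" unfolding soft_trunc'_def using q by (intro power_mono) auto
qed

lemma soft_trunc'_continuous: "continuous_on UNIV (soft_trunc' k)"
proof (cases "k = 0")
  case True
  then show ?thesis by (simp add: soft_trunc'_def)
next
  case False
  then have "real k + \<bar>t\<bar> \<noteq> 0" for t :: real using abs_ge_zero[of t] by linarith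
  then show ?thesis unfolding soft_trunc'_def[abs_def] by (intro continuous_intros) auto
qed

lemma soft_trunc_diff_le: "\<bar>soft_trunc (Suc k) t - soft_trunc k t\<bar> \<le> 1"
proof (cases "t = 0")
  case False
  have p: "0 < real k + \<bar>t\<bar>" "0 < real (Suc k) + \<bar>t\<bar>" using False by linarith+
  have "soft_trunc (Suc k) t - soft_trunc k t = t * \<bar>t\<bar> / ((real (Suc k) + \<bar>t\<bar>) * (real k + \<bar>t\<bar>))"
    unfolding soft_trunc_def using p by (simp add: diff_frac_eq) (simp add: algebra_simps)
  then have "\<bar>soft_trunc (Suc k) t - soft_trunc k t\<bar> = (\<bar>t\<bar> * \<bar>t\<bar>) / ((real (Suc k) + \<bar>t\<bar>) * (real k + \<bar>t\<bar>))"
    using p by (simp add: abs_mult abs_of_pos)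
  also have "\<dots> \<le> 1"
  proof -
    have "\<bar>t\<bar> * \<bar>t\<bar> \<le> (real (Suc k) + \<bar>t\<bar>) * (real k + \<bar>t\<bar>)" by (intro mult_mono) auto
    moreover have "0 < (real (Suc k) + \<bar>t\<bar>) * (real k + \<bar>t\<bar>)" using p by (intro mult_pos_pos)
    ultimately show ?thesis by (simp only: pos_divide_le_eq mult_1)
  qed
  finally show ?thesis .
qed simp

lemma soft_trunc_abs_le: "\<bar>soft_trunc k t\<bar> \<le> \<bar>t\<bar>"
proof -
  have q: "0 \<le> real k / (real k + \<bar>t\<bar>)" "real k / (real k + \<bar>t\<bar>) \<le> 1" by (auto simp: divide_le_eq_1)
  have "soft_trunc k t = (real k / (real k + \<bar>t\<bar>)) * t" by (simp add: soft_trunc_def)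
  then show ?thesis using q by (simp only: abs_mult abs_of_nonneg mult_left_le_one_le abs_ge_zero)
qed

lemma trunc_ratio_limit: "(\<lambda>k. real k / (real k + \<bar>t\<bar>)) \<longlonglongrightarrow> 1"
  by real_asymp

lemma soft_trunc_limits: "(\<lambda>k. soft_trunc k t) \<longlonglongrightarrow> t" "(\<lambda>k. soft_trunc' k t) \<longlonglongrightarrow> 1"
proof -
  have "soft_trunc k t = (real k / (real k + \<bar>t\<bar>)) * t" for k by (simp add: soft_trunc_def)
  then show "(\<lambda>k. soft_trunc k t) \<longlonglongrightarrow> t" using tendsto_mult_right[OF trunc_ratio_limit[of t], of t] by simp
  show "(\<lambda>k. soft_trunc' k t) \<longlonglongrightarrow> 1"
    unfolding soft_trunc'_def using tendsto_power[OF trunc_ratio_limit[of t], of 2] by simp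
qed

text \<open>A truncation of the components of \<open>u\<close> multiplies each row of the gradient by a factor of its own.
  Convexity of \<open>M x\<close> alone does not control this; that of the functions of the single rows does.\<close>

lemma row_contraction:
  fixes M :: "real ^ 'n \<Rightarrow> real ^ 'n ^ 'd \<Rightarrow> real"
  assumes reg: "regular_N_function \<Omega> M m1 m2"
    and Mi: "\<And>i. weak_N_function \<Omega> UNIV (Mi i)" "\<And>x \<xi>. x \<in> \<Omega> \<Longrightarrow> M x \<xi> = (\<Sum>i\<in>UNIV. Mi i x (\<xi> $ i))"
    and x: "x \<in> \<Omega>" and t: "\<And>i. 0 \<le> t i" "\<And>i. t i \<le> 1"
  shows "M x (\<chi> i. t i *\<^sub>R \<xi> $ i) \<le> M x \<xi>"
proof -
  interpret regular_N_function \<Omega> M m1 m2 by (rule reg)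
  have "M x (\<chi> i. t i *\<^sub>R \<xi> $ i) - M x \<xi> \<le> 0"
  proof (rule AE_le_continuous[OF open_\<Omega> _ _ x])
    show "continuous_on \<Omega> (\<lambda>x. M x (\<chi> i. t i *\<^sub>R \<xi> $ i) - M x \<xi>)"
      by (intro continuous_on_diff M_continuous_compose continuous_on_id continuous_on_const) auto
    have "AE x in lebesgue_on \<Omega>. \<forall>i\<in>UNIV. Mi i x 0 = 0 \<and> convex_on UNIV (Mi i x)"
      using Mi(1) unfolding weak_N_function_def by (intro AE_finite_allI) auto
    moreover have "AE x in lebesgue_on \<Omega>. x \<in> \<Omega>" by (intro AE_I2) simp
    ultimately show "AE x in lebesgue_on \<Omega>. M x (\<chi> i. t i *\<^sub>R \<xi> $ i) - M x \<xi> \<le> 0"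
    proof eventually_elim
      case (elim x)
      have "Mi i x (t i *\<^sub>R \<xi> $ i) \<le> Mi i x (\<xi> $ i)" for i
      proof -
        have "Mi i x ((1 - t i) *\<^sub>R 0 + t i *\<^sub>R \<xi> $ i) \<le> (1 - t i) * Mi i x 0 + t i * Mi i x (\<xi> $ i)"
          using elim(1) t by (intro convex_onD[of UNIV "Mi i x"]) auto
        moreover have "0 \<le> Mi i x (\<xi> $ i)" using Mi(1)[of i] elim(2) unfolding weak_N_function_def by auto
        then have "t i * Mi i x (\<xi> $ i) \<le> Mi i x (\<xi> $ i)" using t by (simp add: mult_left_le_one_le)
        ultimately show ?thesis using elim(1) by simp
      qed
      then have "(\<Sum>i\<in>UNIV. Mi i x (t i *\<^sub>R \<xi> $ i)) \<le> (\<Sum>i\<in>UNIV. Mi i x (\<xi> $ i))" by (intro sum_mono)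
      then show ?case by (simp add: Mi(2)[OF elim(2)])
    qed
  qed
  then show ?thesis by simp
qed

lemma sobolev_pair_cong_AE:
  assumes "sobolev_pair \<Omega> u G" "w \<in> borel_measurable borel" "AE x in lborel. w x = u x" "\<And>x. x \<notin> \<Omega> \<Longrightarrow> w x = 0"
  shows "sobolev_pair \<Omega> w G"
proof -
  obtain \<psi> D where \<psi>: "\<And>m::nat. C1_pair \<Omega> (\<psi> m) (D m)"
     "(\<lambda>m. \<integral>\<^sup>+x. ennreal (norm (\<psi> m x - u x)) \<partial>lborel) \<longlonglongrightarrow> 0"
     "(\<lambda>m. \<integral>\<^sup>+x. ennreal (norm (D m x - G x)) \<partial>lborel) \<longlonglongrightarrow> 0"
    and int: "integrable lborel u" "integrable lborel G" "\<And>x. x \<notin> \<Omega> \<Longrightarrow> u x = 0 \<and> G x = 0"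
    using assms(1) unfolding sobolev_pair_def by blast
  have "integrable lborel w"
    using int(1) assms(2,3) by (subst integrable_cong_AE[of w lborel u]) (auto simp: integrable_borel_measurable)
  moreover have "(\<integral>\<^sup>+x. ennreal (norm (\<psi> m x - w x)) \<partial>lborel) = (\<integral>\<^sup>+x. ennreal (norm (\<psi> m x - u x)) \<partial>lborel)" for m
    by (rule nn_integral_cong_AE) (use assms(3) in \<open>eventually_elim, simp\<close>)
  ultimately show ?thesis
    unfolding sobolev_pair_def using \<psi> int(2,3) assms(4)
    by (intro conjI exI[of _ \<psi>] exI[of _ D]) auto
qed

section \<open>Boundary values of Hoelder continuous Sobolev functions\<close>

lemma flat_exp_2_bound: "\<bar>flat_exp 2 t\<bar> \<le> 2"
proof (cases "t > 0")
  case True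
  have "1 + 1 / t + (1 / t)\<^sup>2 / 2 \<le> exp (1 / t)" using True by (intro exp_lower_Taylor_quadratic) auto
  then have "(1 / t)\<^sup>2 \<le> 2 * exp (1 / t)" using True by (smt (verit) divide_pos_pos field_sum_of_halves)
  then have "exp (- (1 / t)) * (1 / t)\<^sup>2 \<le> exp (- (1 / t)) * (2 * exp (1 / t))" by (intro mult_left_mono) auto
  also have "\<dots> = 2" by (simp add: exp_minus)
  finally show ?thesis using True by (simp add: flat_exp_def power_divide)
qed (simp add: flat_exp_def)

lemma conv_nth:
  fixes f :: "real ^ 'n \<Rightarrow> 'b :: euclidean_space ^ 'm"
  assumes "test_fun \<rho>" "integrable lborel f" "\<delta> > 0"
  shows "conv \<rho> \<delta> f z $ i = (\<integral>w. \<rho> w *\<^sub>R (f (z - \<delta> *\<^sub>R w) $ i) \<partial>lborel)"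
  unfolding conv_def
  using integral_bounded_linear[OF bounded_linear_vec_nth[of i] conv_integrable[OF assms(1,2), of \<delta> z]] assms(3) by simp

lemma Lipschitz_domain_exterior_point:
  fixes \<Omega> :: "(real ^ 'n) set"
  assumes \<Omega>: "bounded_Lipschitz_domain \<Omega>" and a: "a \<in> frontier \<Omega>" and R: "R > 0"
  obtains z s where "s > 0" "ball z s \<subseteq> - \<Omega>" "z \<in> ball a R"
proof -
  have op: "open \<Omega>" using \<Omega> by (simp add: bounded_Lipschitz_domain_def)
  have aO: "a \<notin> \<Omega>" using a op by (simp add: frontier_def interior_open)
  obtain r e L g where r: "r > 0" and e: "norm e = 1"
    and g: "L-lipschitz_on {y. y \<bullet> e = 0} g"
    and epi: "\<Omega> \<inter> ball a r = {x \<in> ball a r. g (x - (x \<bullet> e) *\<^sub>R e) < x \<bullet> e}"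
    using \<Omega> a unfolding bounded_Lipschitz_domain_def by blast
  define p where "p = (\<lambda>x :: real ^ 'n. x - (x \<bullet> e) *\<^sub>R e)"
  have ee: "e \<bullet> e = 1" using e by (simp add: dot_square_norm)
  have cg: "continuous_on UNIV (\<lambda>x. g (p x))"
    by (rule continuous_on_compose2[OF lipschitz_on_continuous_on[OF g]])
       (auto simp: p_def inner_diff_left ee intro!: continuous_intros)
  define X where "X = ball a r \<inter> {x. x \<bullet> e < g (p x)}"
  have "open X" unfolding X_def by (intro open_Int open_ball open_Collect_less cg continuous_intros)
  have XO: "X \<subseteq> - \<Omega>"
  proof
    fix x assume x: "x \<in> X"
    show "x \<in> - \<Omega>"
    proof
      assume "x \<in> \<Omega>"
      then have "x \<in> \<Omega> \<inter> ball a r" using x by (simp add: X_def)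
      then have "g (p x) < x \<bullet> e" unfolding epi by (simp add: p_def)
      then show False using x by (simp add: X_def)
    qed
  qed
  define t where "t = min r R / 2"
  have t: "0 < t" "t < r" "t < R" using r R by (auto simp: t_def)
  define z where "z = a - t *\<^sub>R e"
  have "a \<in> ball a r" using r by simp
  then have ga: "a \<bullet> e \<le> g (p a)"
  proof (intro ccontr[of "a \<bullet> e \<le> g (p a)"])
    assume "\<not> a \<bullet> e \<le> g (p a)"
    then have "a \<in> {x \<in> ball a r. g (x - (x \<bullet> e) *\<^sub>R e) < x \<bullet> e}" using r by (simp add: p_def)
    then show False unfolding epi[symmetric] using aO by simp
  qed
  have "p z = p a" by (simp add: p_def z_def inner_diff_left ee algebra_simps)
  moreover have "z \<bullet> e = a \<bullet> e - t" by (simp add: z_def inner_diff_left ee)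
  moreover have dz: "dist a z = t" using t e by (simp add: z_def dist_norm)
  ultimately have "z \<in> X" using ga t by (simp add: X_def)
  then obtain s where "s > 0" "ball z s \<subseteq> X" using \<open>open X\<close> open_contains_ball by blast
  moreover have "z \<in> ball a R" using dz t by simp
  ultimately show ?thesis using that[of s z] XO by blast
qed

text \<open>If \<open>u\<close> had a nonzero limit at a boundary point, then composing with a function that is flat near
  that limit would give a Sobolev function which is, near the point, a nonzero multiple of the indicator
  of \<open>\<Omega>\<close> and has zero gradient there. Its mollifications at small scales would be constant near the point, although they vanish at some points
  outside \<open>\<Omega>\<close> and not at some points inside.\<close>

lemma sobolev_pair_boundary_limit_zero:
  fixes u :: "real ^ 'n \<Rightarrow> real ^ 'd"
  assumes \<Omega>: "bounded_Lipschitz_domain \<Omega>" and u: "sobolev_pair \<Omega> u G" and a: "a \<in> frontier \<Omega>"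
    and lim: "(u \<longlongrightarrow> l) (at a within \<Omega>)"
  shows "l = 0"
proof (rule ccontr)
  assume "l \<noteq> 0"
  then obtain i where i: "l $ i \<noteq> 0" by (auto simp: vec_eq_iff)
  have op: "open \<Omega>" and bd: "bounded \<Omega>" using \<Omega> by (auto simp: bounded_Lipschitz_domain_def)
  have aO: "a \<notin> \<Omega>" using a op by (simp add: frontier_def interior_open)
  have acl: "a \<in> closure \<Omega>" using a by (simp add: frontier_def)
  define \<sigma> where "\<sigma> = sgn (l $ i)"
  define \<beta> where "\<beta> = \<bar>l $ i\<bar> / 2"
  have \<beta>: "\<beta> > 0" "\<sigma> * l $ i = 2 * \<beta>" using i by (auto simp: \<beta>_def \<sigma>_def sgn_if)
  have "((\<lambda>x. \<sigma> * u x $ i) \<longlongrightarrow> \<sigma> * l $ i) (at a within \<Omega>)" by (intro tendsto_intros lim)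
  then have "\<forall>\<^sub>F x in at a within \<Omega>. \<beta> < \<sigma> * u x $ i" by (rule order_tendstoD) (use \<beta> in simp)
  then obtain R where R: "R > 0" "\<And>x. x \<in> \<Omega> \<Longrightarrow> dist x a < R \<Longrightarrow> \<beta> < \<sigma> * u x $ i"
    unfolding eventually_at using aO by metis
  \<comment> \<open>\<open>F\<close> vanishes at zero and is constant and positive where \<open>\<sigma> * t\<close> exceeds \<open>\<beta>\<close>, half the limit of \<open>\<bar>u $ i\<bar>\<close>.\<close>
  define F where "F = (\<lambda>t. flat_exp 0 \<beta> - flat_exp 0 (\<beta> - \<sigma> * t))"
  define F' where "F' = (\<lambda>t. \<sigma> * flat_exp 2 (\<beta> - \<sigma> * t))"
  have F1: "(F has_real_derivative F' t) (at t)" for t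
  proof -
    have "((\<lambda>t. \<beta> - \<sigma> * t) has_real_derivative - \<sigma>) (at t)" by (auto intro!: derivative_eq_intros)
    from DERIV_chain2[OF flat_exp_has_derivative[of 0] this]
    have "((\<lambda>t. flat_exp 0 (\<beta> - \<sigma> * t)) has_real_derivative flat_exp 2 (\<beta> - \<sigma> * t) * (- \<sigma>)) (at t)" by (simp add: numeral_2_eq_2)
    from DERIV_diff[OF DERIV_const[of "flat_exp 0 \<beta>"] this] show ?thesis by (simp add: F_def F'_def mult.commute)
  qed
  have cfe: "continuous_on UNIV (flat_exp 2)"
    by (intro continuous_at_imp_continuous_on ballI DERIV_isCont[OF flat_exp_has_derivative])
  have F2: "continuous_on UNIV F'"
    unfolding F'_def by (intro continuous_intros continuous_on_compose2[OF cfe]) auto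
  have F3: "F 0 = 0" by (simp add: F_def)
  have s1: "\<bar>\<sigma>\<bar> = 1" using i by (simp add: \<sigma>_def abs_sgn_eq)
  have F4: "\<bar>F' t\<bar> \<le> 2" for t using flat_exp_2_bound s1 by (simp add: F'_def abs_mult)
  have flat: "F t = flat_exp 0 \<beta>" "F' t = 0" if "\<beta> < \<sigma> * t" for t
    using that by (auto simp: F_def F'_def flat_exp_def)
  define V where "V = comp_rows F u"
  define W where "W = scale_rows F' u G"
  have VW: "sobolev_pair \<Omega> V W" unfolding V_def W_def by (rule sobolev_pair_comp_rows[OF u bd F1 F2 F3 F4])
  then have iV: "integrable lborel V" and iW: "integrable lborel W"
    and out: "\<And>x. x \<notin> \<Omega> \<Longrightarrow> V x = 0 \<and> W x = 0" unfolding sobolev_pair_def by auto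
  have W0: "W x $ i = 0" if "dist x a < R" for x
    using out[of x] flat(2)[OF R(2)[OF _ that]] by (cases "x \<in> \<Omega>") (auto simp: W_def scale_rows_def)
  have V1: "V x $ i = flat_exp 0 \<beta>" if "x \<in> \<Omega>" "dist x a < R" for x
    using flat(1)[OF R(2)[OF that]] by (simp add: V_def comp_rows_def)
  obtain z1 where z1: "z1 \<in> \<Omega>" "dist z1 a < R / 2" using acl R(1) closure_approachable[of a \<Omega>] by (meson half_gt_zero)
  have "open (\<Omega> \<inter> ball a (R / 2))" using op by auto
  moreover have "z1 \<in> \<Omega> \<inter> ball a (R / 2)" using z1 by (simp add: dist_commute)
  ultimately obtain e1 where e1: "e1 > 0" "ball z1 e1 \<subseteq> \<Omega> \<inter> ball a (R / 2)" using open_contains_ball by blast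
  obtain z2 e2 where e2: "e2 > 0" "ball z2 e2 \<subseteq> - \<Omega>" "z2 \<in> ball a (R / 2)"
  proof (rule Lipschitz_domain_exterior_point[OF \<Omega> a half_gt_zero[OF R(1)]])
    fix z s assume "s > 0" "ball z s \<subseteq> - \<Omega>" "z \<in> ball a (R / 2)"
    then show thesis by (rule that)
  qed
  define \<delta> where "\<delta> = min (min e1 e2) (R / 2) / 2"
  have \<delta>: "0 < \<delta>" "\<delta> < e1" "\<delta> < e2" "\<delta> < R / 2" using e1(1) e2(1) R(1) by (auto simp: \<delta>_def)
  obtain \<rho> :: "real ^ 'n \<Rightarrow> real" where \<rho>: "mollifier \<rho>" using mollifier_exists by blast
  note t = mollifier_test_fun[OF \<rho>]
  have \<rho>out: "1 < norm w \<Longrightarrow> \<rho> w = 0" for w using \<rho> by (auto simp: mollifier_def)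
  have near: "dist z (z - \<delta> *\<^sub>R w) \<le> \<delta>" if "norm w \<le> 1" for z w :: "real ^ 'n"
    using that \<delta>(1) by (simp add: dist_norm mult_left_le)
  have const: "\<exists>c. \<forall>z\<in>ball a (R / 2). conv \<rho> \<delta> V z $ i = c"
  proof (rule has_derivative_zero_constant)
    fix z assume z: "z \<in> ball a (R / 2)"
    have "\<rho> w *\<^sub>R (W (z - \<delta> *\<^sub>R w) $ i) = 0" for w
    proof (cases "norm w \<le> 1")
      case True
      have "dist (z - \<delta> *\<^sub>R w) a \<le> dist (z - \<delta> *\<^sub>R w) z + dist z a" by (rule dist_triangle)
      then have "dist (z - \<delta> *\<^sub>R w) a < R" using near[OF True, of z] z \<delta>(4) by (simp add: dist_commute)
      then show ?thesis by (simp add: W0)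
    qed (simp add: \<rho>out)
    then have W0z: "conv \<rho> \<delta> W z $ i = 0"
      unfolding conv_nth[OF t iW \<delta>(1)] by (simp only: Bochner_Integration.integral_zero)
    have "((\<lambda>z. conv \<rho> \<delta> V z $ i) has_derivative (\<lambda>h. (conv \<rho> \<delta> W z *v h) $ i)) (at z)"
      by (rule bounded_linear.has_derivative[OF bounded_linear_vec_nth conv_sobolev_has_derivative[OF t VW bd \<delta>(1)]])
    then show "((\<lambda>z. conv \<rho> \<delta> V z $ i) has_derivative (\<lambda>h. 0)) (at z within ball a (R / 2))"
      by (simp add: matrix_vector_mul_component W0z has_derivative_at_withinI)
  qed simp
  have c1: "conv \<rho> \<delta> V z1 $ i = flat_exp 0 \<beta>"
  proof -
    have "\<rho> w *\<^sub>R (V (z1 - \<delta> *\<^sub>R w) $ i) = \<rho> w * flat_exp 0 \<beta>" for w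
    proof (cases "norm w \<le> 1")
      case True
      then have "z1 - \<delta> *\<^sub>R w \<in> ball z1 e1" using near[OF True, of z1] \<delta>(2) by simp
      then have "z1 - \<delta> *\<^sub>R w \<in> \<Omega> \<inter> ball a (R / 2)" using e1(2) by blast
      then have "z1 - \<delta> *\<^sub>R w \<in> \<Omega>" "dist (z1 - \<delta> *\<^sub>R w) a < R" using R(1) by (auto simp: dist_commute)
      then show ?thesis by (simp add: V1)
    qed (simp add: \<rho>out)
    then have "conv \<rho> \<delta> V z1 $ i = (\<integral>w. \<rho> w * flat_exp 0 \<beta> \<partial>lborel)"
      unfolding conv_nth[OF t iV \<delta>(1)] by (simp only:)
    then show ?thesis using \<rho> by (simp add: mollifier_def)
  qed
  have c2: "conv \<rho> \<delta> V z2 $ i = 0"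
  proof -
    have "\<rho> w *\<^sub>R (V (z2 - \<delta> *\<^sub>R w) $ i) = 0" for w
    proof (cases "norm w \<le> 1")
      case True
      then have "z2 - \<delta> *\<^sub>R w \<in> ball z2 e2" using near[OF True, of z2] \<delta>(3) by simp
      then have "z2 - \<delta> *\<^sub>R w \<notin> \<Omega>" using e2(2) by blast
      then show ?thesis by (simp add: out)
    qed (simp add: \<rho>out)
    then show ?thesis unfolding conv_nth[OF t iV \<delta>(1)] by (simp only: Bochner_Integration.integral_zero)
  qed
  have "z1 \<in> ball a (R / 2)" using z1 by (simp add: dist_commute)
  with const e2(3) have "conv \<rho> \<delta> V z1 $ i = conv \<rho> \<delta> V z2 $ i" by metis
  then show False using c1 c2 \<beta>(1) by (simp add: flat_exp_def)
qed
lemma Hoelder_bound: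
  fixes u :: "real ^ 'n \<Rightarrow> real ^ 'd"
  assumes h: "u \<in> Hoelder \<Omega> \<gamma>"
  obtains H where "0 \<le> H" "\<And>x y. x \<in> \<Omega> \<Longrightarrow> y \<in> \<Omega> \<Longrightarrow> norm (u x - u y) \<le> H * norm (x - y) powr \<gamma>"
proof -
  obtain H1 where H1: "\<And>q. q \<in> {norm (u x - u y) / norm (x - y) powr \<gamma> | x y. x \<in> \<Omega> \<and> y \<in> \<Omega> \<and> x \<noteq> y} \<Longrightarrow> q \<le> H1"
    using h unfolding Hoelder_def bdd_above_def by auto
  define H where "H = max H1 0"
  have H0: "0 \<le> H" by (simp add: H_def)
  have inside: "norm (u x - u y) \<le> H * norm (x - y) powr \<gamma>" if "x \<in> \<Omega>" "y \<in> \<Omega>" for x y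
  proof (cases "x = y")
    case False
    then have "norm (u x - u y) / norm (x - y) powr \<gamma> \<le> H1" using that by (intro H1) blast
    then have "norm (u x - u y) / norm (x - y) powr \<gamma> \<le> H" by (simp add: H_def)
    then show ?thesis using False by (simp add: divide_le_eq)
  qed simp
  show ?thesis by (rule that[OF H0 inside])
qed

lemma Hoelder_uniformly_continuous_on:
  fixes u :: "real ^ 'n \<Rightarrow> real ^ 'd"
  assumes \<gamma>: "0 < \<gamma>" and h: "u \<in> Hoelder \<Omega> \<gamma>"
  shows "uniformly_continuous_on \<Omega> u"
proof (rule Hoelder_bound[OF h])
  fix H assume H0: "0 \<le> H"
    and inside: "\<And>x y. x \<in> \<Omega> \<Longrightarrow> y \<in> \<Omega> \<Longrightarrow> norm (u x - u y) \<le> H * norm (x - y) powr \<gamma>"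
  show "uniformly_continuous_on \<Omega> u"
    unfolding uniformly_continuous_on_def
  proof (intro allI impI)
    fix e :: real assume e: "e > 0"
    define d where "d = (e / (H + 1)) powr (1 / \<gamma>)"
    have q: "0 < e / (H + 1)" using e H0 by simp
    have d: "d > 0" "d powr \<gamma> = e / (H + 1)" using q \<gamma> e H0 by (auto simp: d_def powr_powr)
    show "\<exists>d>0. \<forall>x\<in>\<Omega>. \<forall>x'\<in>\<Omega>. dist x' x < d \<longrightarrow> dist (u x') (u x) < e"
    proof (intro exI[of _ d] conjI d(1) ballI impI)
      fix x x' assume x: "x \<in> \<Omega>" "x' \<in> \<Omega>" "dist x' x < d"
      have "dist (u x') (u x) \<le> H * norm (x' - x) powr \<gamma>" using inside[OF x(2,1)] by (simp add: dist_norm)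
      also have "\<dots> \<le> H * d powr \<gamma>" using x(3) \<gamma> H0 by (intro mult_left_mono powr_mono2) (auto simp: dist_norm)
      also have "\<dots> < (H + 1) * (e / (H + 1))" unfolding d(2) using q by (intro mult_strict_right_mono) auto
      also have "\<dots> = e" using H0 by simp
      finally show "dist (u x') (u x) < e" .
    qed
  qed
qed

text \<open>A segment from a point of \<open>\<Omega>\<close> to a point outside crosses the boundary, where \<open>u\<close> tends to zero, and
  its part inside is no longer than the whole. So the constant \<open>H\<close> does not change.\<close>

lemma Hoelder_zero_extension:
  fixes u :: "real ^ 'n \<Rightarrow> real ^ 'd"
  assumes \<Omega>: "bounded_Lipschitz_domain \<Omega>" and u: "sobolev_pair \<Omega> u G" and \<gamma>: "0 < \<gamma>"
    and h: "u \<in> Hoelder \<Omega> \<gamma>"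
  obtains H where "0 \<le> H" "\<And>y z. norm (u y - u z) \<le> H * norm (y - z) powr \<gamma>"
proof -
  have op: "open \<Omega>" using \<Omega> by (auto simp: bounded_Lipschitz_domain_def)
  have out: "u x = 0" if "x \<notin> \<Omega>" for x using u that unfolding sobolev_pair_def by auto
  note uc = Hoelder_uniformly_continuous_on[OF \<gamma> h]
  show ?thesis
  proof (rule Hoelder_bound[OF h])
    fix H assume H0: "0 \<le> H"
    and inside: "\<And>x y. x \<in> \<Omega> \<Longrightarrow> y \<in> \<Omega> \<Longrightarrow> norm (u x - u y) \<le> H * norm (x - y) powr \<gamma>"
    have bdry: "norm (u y) \<le> H * norm (y - a) powr \<gamma>" if y: "y \<in> \<Omega>" and a: "a \<in> frontier \<Omega>" for y a
    proof -
      have acl: "a \<in> closure \<Omega>" using a by (simp add: frontier_def)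
      have aO: "a \<notin> \<Omega>" using a op by (simp add: frontier_def interior_open)
      obtain l where l: "(u \<longlongrightarrow> l) (at a within \<Omega>)"
        using uniformly_continuous_on_extension_at_closure[OF uc acl] by blast
      have "l = 0" by (rule sobolev_pair_boundary_limit_zero[OF \<Omega> u a l])
      then have lim0: "(u \<longlongrightarrow> 0) (at a within \<Omega>)" using l by simp
      have nt: "at a within \<Omega> \<noteq> bot" using acl aO by (simp add: at_within_eq_bot_iff)
      have lim1: "((\<lambda>x. norm (u y - u x)) \<longlongrightarrow> norm (u y - 0)) (at a within \<Omega>)" by (intro tendsto_intros lim0)
      have lim2: "((\<lambda>x. H * norm (y - x) powr \<gamma>) \<longlongrightarrow> H * norm (y - a) powr \<gamma>) (at a within \<Omega>)"
        using aO y by (intro tendsto_intros) auto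
      have ev: "\<forall>\<^sub>F x in at a within \<Omega>. norm (u y - u x) \<le> H * norm (y - x) powr \<gamma>"
        using inside[OF y] by (auto simp: eventually_at_filter)
      from tendsto_le[OF nt lim2 lim1 ev] show ?thesis by simp
    qed
    have mixed: "norm (u y) \<le> H * norm (y - z) powr \<gamma>" if y: "y \<in> \<Omega>" and z: "z \<notin> \<Omega>" for y z
    proof -
      have "closed_segment y z \<inter> frontier \<Omega> \<noteq> {}"
        by (rule connected_Int_frontier) (use y z in auto)
      then obtain a where a: "a \<in> closed_segment y z" "a \<in> frontier \<Omega>" by blast
      have "norm (y - a) \<le> norm (y - z)" using segment_bound(1)[OF a(1)] by (simp add: norm_minus_commute)
      then have "H * norm (y - a) powr \<gamma> \<le> H * norm (y - z) powr \<gamma>"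
        using H0 \<gamma> by (intro mult_left_mono powr_mono2) auto
      then show ?thesis using bdry[OF y a(2)] by linarith
    qed
    show ?thesis
    proof (rule that[OF H0])
      fix y z
      show "norm (u y - u z) \<le> H * norm (y - z) powr \<gamma>"
        using inside[of y z] mixed[of y z] mixed[of z y] out H0
        by (cases "y \<in> \<Omega>"; cases "z \<in> \<Omega>") (auto simp: norm_minus_commute)
    qed
  qed
qed

section \<open>Bounded and unbounded functions\<close>

lemma (in regular_N_function) integrable_M_dominated:
  assumes "X \<in> borel_measurable borel" "integrable lborel D" "\<And>x. x \<in> \<Omega> \<Longrightarrow> M x (X x) \<le> D x"
  shows "integrable lborel (\<lambda>y. M y (X y) * indicator \<Omega> y)"
proof (rule Bochner_Integration.integrable_bound[OF assms(2)])
  show "(\<lambda>y. M y (X y) * indicator \<Omega> y) \<in> borel_measurable lborel" using borel_measurable_M[OF assms(1)] by simp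
  show "AE x in lborel. norm (M x (X x) * indicator \<Omega> x) \<le> norm (D x)"
  proof (intro always_eventually allI)
    fix x
    show "norm (M x (X x) * indicator \<Omega> x) \<le> norm (D x)"
      using assms(3)[of x] M_nonneg[of x "X x"] by (cases "x \<in> \<Omega>") auto
  qed
qed

lemma approximation_scaleD:
  fixes M :: "real ^ 'n \<Rightarrow> real ^ 'n ^ 'd \<Rightarrow> real"
  assumes "approximation_scale \<Omega> M \<gamma> C A" "sobolev_pair \<Omega> u G" "\<And>x. norm (u x) \<le> b"
    "\<And>z \<delta> w. 0 < \<delta> \<Longrightarrow> \<delta> \<le> 1 \<Longrightarrow> norm w \<le> 1 \<Longrightarrow> norm (u (z - \<delta> *\<^sub>R w) - u z) \<le> H * \<delta> powr \<gamma>"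
    "0 < \<mu>" "A * H \<le> \<mu>" "integrable lborel (\<lambda>y. M y (G y /\<^sub>R \<mu>) * indicator \<Omega> y)"
    "R \<in> borel_measurable borel" "integrable lborel (\<lambda>y. M y (R y /\<^sub>R (2 * C * \<mu>)) * indicator \<Omega> y)"
  shows "\<exists>f. (\<forall>n::nat. f n \<in> Cc_infty \<Omega>) \<and> (\<forall>n x. norm (f n x) \<le> b) \<and>
        (\<lambda>n. \<integral>\<^sup>+x. ennreal (norm (f n x - u x)) \<partial>lebesgue_on \<Omega>) \<longlonglongrightarrow> 0 \<and>
        (\<lambda>n. modular \<Omega> M (\<lambda>x. (grad (f n) x + R x) /\<^sub>R (4 * C * \<mu>))) \<longlonglongrightarrow> modular \<Omega> M (\<lambda>x. (G x + R x) /\<^sub>R (4 * C * \<mu>))"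
  by (rule assms(1)[unfolded approximation_scale_def, THEN conjunct2, THEN conjunct2, rule_format, OF assms(2-9)])

text \<open>With \<open>R = - G\<close> the limit of the modulars is the modular of zero.\<close>

lemma approximation_bounded:
  fixes M :: "real ^ 'n \<Rightarrow> real ^ 'n ^ 'd \<Rightarrow> real"
  assumes reg: "regular_N_function \<Omega> M m1 m2" and sc: "approximation_scale \<Omega> M \<gamma> C A"
    and u: "sobolev_pair \<Omega> u G" and b: "\<And>x. norm (u x) \<le> b"
    and H: "\<And>z \<delta> w. 0 < \<delta> \<Longrightarrow> \<delta> \<le> 1 \<Longrightarrow> norm w \<le> 1 \<Longrightarrow> norm (u (z - \<delta> *\<^sub>R w) - u z) \<le> H * \<delta> powr \<gamma>"
    and \<mu>: "0 < \<mu>" "A * H \<le> \<mu>" and m: "integrable lborel (\<lambda>y. M y (G y /\<^sub>R \<mu>) * indicator \<Omega> y)" and \<epsilon>: "\<epsilon> > 0"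
  shows "\<exists>f\<in>Cc_infty \<Omega>. (\<forall>x. norm (f x) \<le> b) \<and> (\<integral>\<^sup>+x. ennreal (norm (f x - u x)) \<partial>lebesgue_on \<Omega>) < ennreal \<epsilon> \<and>
    modular \<Omega> M (\<lambda>x. (grad f x - G x) /\<^sub>R (4 * C * \<mu>)) < ennreal \<epsilon>"
proof -
  interpret regular_N_function \<Omega> M m1 m2 by (rule reg)
  have C: "1 < C" using sc by (simp add: approximation_scale_def)
  have Gb: "G \<in> borel_measurable borel" using u integrable_borel_measurable unfolding sobolev_pair_def by blast
  have Rm: "integrable lborel (\<lambda>y. M y ((- G y) /\<^sub>R (2 * C * \<mu>)) * indicator \<Omega> y)"
  proof (rule integrable_M_dominated[OF _ m])
    fix x assume x: "x \<in> \<Omega>"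
    have "inverse (2 * C * \<mu>) = (1 / (2 * C)) * inverse \<mu>" by (simp add: inverse_eq_divide)
    then have eq: "(- G x) /\<^sub>R (2 * C * \<mu>) = (1 / (2 * C)) *\<^sub>R (- (G x /\<^sub>R \<mu>))"
      by (simp only: scaleR_scaleR scaleR_minus_right)
    have "M x ((- G x) /\<^sub>R (2 * C * \<mu>)) \<le> M x (- (G x /\<^sub>R \<mu>))"
      unfolding eq by (rule M_scale_le[OF x]) (use C in auto)
    then show "M x ((- G x) /\<^sub>R (2 * C * \<mu>)) \<le> M x (G x /\<^sub>R \<mu>) * indicator \<Omega> x" using x M_even[OF x] by simp
  qed (use Gb in simp)
  have "\<exists>f. (\<forall>n::nat. f n \<in> Cc_infty \<Omega>) \<and> (\<forall>n x. norm (f n x) \<le> b) \<and>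
        (\<lambda>n. \<integral>\<^sup>+x. ennreal (norm (f n x - u x)) \<partial>lebesgue_on \<Omega>) \<longlonglongrightarrow> 0 \<and>
        (\<lambda>n. modular \<Omega> M (\<lambda>x. (grad (f n) x + - G x) /\<^sub>R (4 * C * \<mu>))) \<longlonglongrightarrow> modular \<Omega> M (\<lambda>x. (G x + - G x) /\<^sub>R (4 * C * \<mu>))"
  proof -
    have Rb: "(\<lambda>x. - G x) \<in> borel_measurable borel" using Gb by simp
    show ?thesis by (rule approximation_scaleD[OF sc u b H \<mu> m Rb Rm])
  qed
  then obtain f where f: "\<And>n::nat. f n \<in> Cc_infty \<Omega>" "\<And>n x. norm (f n x) \<le> b"
    and l1: "(\<lambda>n. \<integral>\<^sup>+x. ennreal (norm (f n x - u x)) \<partial>lebesgue_on \<Omega>) \<longlonglongrightarrow> 0"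
    and l2: "(\<lambda>n. modular \<Omega> M (\<lambda>x. (grad (f n) x + - G x) /\<^sub>R (4 * C * \<mu>))) \<longlonglongrightarrow> modular \<Omega> M (\<lambda>x. (G x + - G x) /\<^sub>R (4 * C * \<mu>))"
    by blast
  have "modular \<Omega> M (\<lambda>x. (G x + - G x) /\<^sub>R (4 * C * \<mu>)) = 0"
  proof -
    have "modular \<Omega> M (\<lambda>x. (G x + - G x) /\<^sub>R (4 * C * \<mu>)) = (\<integral>\<^sup>+x. 0 \<partial>lebesgue_on \<Omega>)"
      unfolding modular_def by (rule nn_integral_cong) (simp add: M_zero)
    then show ?thesis by simp
  qed
  then have "\<forall>\<^sub>F n in sequentially. modular \<Omega> M (\<lambda>x. (grad (f n) x + - G x) /\<^sub>R (4 * C * \<mu>)) < ennreal \<epsilon>"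
    using l2 \<epsilon> by (intro order_tendstoD(2)[OF l2]) simp
  moreover have "\<forall>\<^sub>F n in sequentially. (\<integral>\<^sup>+x. ennreal (norm (f n x - u x)) \<partial>lebesgue_on \<Omega>) < ennreal \<epsilon>"
    using \<epsilon> by (intro order_tendstoD(2)[OF l1]) simp
  ultimately have "\<forall>\<^sub>F n in sequentially. (\<integral>\<^sup>+x. ennreal (norm (f n x - u x)) \<partial>lebesgue_on \<Omega>) < ennreal \<epsilon> \<and>
      modular \<Omega> M (\<lambda>x. (grad (f n) x + - G x) /\<^sub>R (4 * C * \<mu>)) < ennreal \<epsilon>" by eventually_elim simp
  then obtain n where "(\<integral>\<^sup>+x. ennreal (norm (f n x - u x)) \<partial>lebesgue_on \<Omega>) < ennreal \<epsilon>"
      "modular \<Omega> M (\<lambda>x. (grad (f n) x + - G x) /\<^sub>R (4 * C * \<mu>)) < ennreal \<epsilon>"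
    unfolding eventually_sequentially by blast
  then show ?thesis using f by (intro bexI[of _ "f n"]) auto
qed

lemma Cc_infty_zero: "(\<lambda>x. 0) \<in> Cc_infty \<Omega>"
  by (simp add: Cc_infty_def C_k_const)

lemma Cc_infty_add:
  assumes f: "f \<in> Cc_infty \<Omega>" and g: "g \<in> Cc_infty \<Omega>"
  shows "(\<lambda>x. f x + g x) \<in> Cc_infty \<Omega>"
proof -
  let ?K = "closure {x. f x \<noteq> 0} \<union> closure {x. g x \<noteq> 0}"
  have K: "compact ?K" "?K \<subseteq> \<Omega>" using f g by (auto simp: Cc_infty_def)
  have "{x. f x + g x \<noteq> 0} \<subseteq> {x. f x \<noteq> 0} \<union> {x. g x \<noteq> 0}" by auto
  from closure_mono[OF this] have sub: "closure {x. f x + g x \<noteq> 0} \<subseteq> ?K" by (simp only: closure_Un)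
  then have "closure {x. f x + g x \<noteq> 0} = ?K \<inter> closure {x. f x + g x \<noteq> 0}" by blast
  then have "compact (closure {x. f x + g x \<noteq> 0})" by (rule ssubst) (rule compact_Int_closed[OF K(1) closed_closure])
  moreover have "C_k k (\<lambda>x. f x + g x)" for k using f g by (intro C_k_add) (auto simp: Cc_infty_def)
  ultimately show ?thesis using sub K(2) by (auto simp: Cc_infty_def)
qed

lemma grad_add:
  fixes f g :: "real ^ 'n \<Rightarrow> real ^ 'd"
  assumes "f \<in> Cc_infty \<Omega>" "g \<in> Cc_infty \<Omega>"
  shows "grad (\<lambda>x. f x + g x) x = grad f x + grad g x"
proof (rule grad_eqI)
  have "((\<lambda>x. f x + g x) has_derivative (\<lambda>h. grad f x *v h + grad g x *v h)) (at x)"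
    using Cc_infty_C1_pair[OF assms(1)] Cc_infty_C1_pair[OF assms(2)] unfolding C1_pair_def
    by (intro has_derivative_add) auto
  then show "((\<lambda>x. f x + g x) has_derivative (\<lambda>h. (grad f x + grad g x) *v h)) (at x)"
    by (simp add: matrix_vector_mult_add_rdistrib)
qed

text \<open>Unbounded functions are built up layer by layer. Once \<open>f\<close> approximates the \<open>k\<close>-th
  truncation, it is a fixed smooth function with bounded gradient; adding an approximation of the next layer,
  whose components are bounded by one, does not enlarge the scale \<open>\<mu>\<close>: the perturbation \<open>R\<close> is the gradient of
  \<open>f\<close> minus that of the next truncation, and the limit of the modulars is the modular that is already small
  by induction. Applying the bounded case directly to the truncations would make \<open>\<mu>\<close> grow with
  \<open>k\<close>.\<close>

lemma layered_approximation:
  fixes M :: "real ^ 'n \<Rightarrow> real ^ 'n ^ 'd \<Rightarrow> real" and u :: "real ^ 'n \<Rightarrow> real ^ 'd"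
  assumes reg: "regular_N_function \<Omega> M m1 m2" and bd: "bounded \<Omega>" and sc: "approximation_scale \<Omega> M 0 C A"
    and Mi: "\<And>i. weak_N_function \<Omega> UNIV (Mi i)" "\<And>x \<xi>. x \<in> \<Omega> \<Longrightarrow> M x \<xi> = (\<Sum>i\<in>UNIV. Mi i x (\<xi> $ i))"
    and u: "sobolev_pair \<Omega> u G" and \<mu>: "0 < \<mu>" "A * (2 * real CARD('d)) \<le> \<mu>"
    and m: "integrable lborel (\<lambda>y. M y (G y /\<^sub>R \<mu>) * indicator \<Omega> y)"
  shows "0 < \<epsilon> \<Longrightarrow> \<exists>f\<in>Cc_infty \<Omega>. (\<integral>\<^sup>+x. ennreal (norm (f x - comp_rows (soft_trunc k) u x)) \<partial>lebesgue_on \<Omega>) < ennreal \<epsilon> \<and>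
    modular \<Omega> M (\<lambda>x. (grad f x - scale_rows (soft_trunc' k) u G x) /\<^sub>R (4 * C * \<mu>)) < ennreal \<epsilon>"
proof (induction k arbitrary: \<epsilon>)
  case 0
  interpret regular_N_function \<Omega> M m1 m2 by (rule reg)
  have c0: "comp_rows (soft_trunc 0) u x = 0" "scale_rows (soft_trunc' 0) u G x = 0" for x
    by (simp_all add: comp_rows_def scale_rows_def vec_eq_iff)
  have g0: "grad (\<lambda>x. 0 :: real ^ 'd) x = (0 :: real ^ 'n ^ 'd)" for x
    by (rule grad_eqI) simp
  have "modular \<Omega> M (\<lambda>x. (grad (\<lambda>x. 0) x - scale_rows (soft_trunc' 0) u G x) /\<^sub>R (4 * C * \<mu>)) = (\<integral>\<^sup>+x. 0 \<partial>lebesgue_on \<Omega>)"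
    unfolding modular_def by (rule nn_integral_cong) (simp add: M_zero c0 g0)
  then have m0: "modular \<Omega> M (\<lambda>x. (grad (\<lambda>x. 0) x - scale_rows (soft_trunc' 0) u G x) /\<^sub>R (4 * C * \<mu>)) = 0"
    by (simp only: nn_integral_const mult_zero_left)
  have l0: "(\<integral>\<^sup>+x. ennreal (norm (0 - comp_rows (soft_trunc 0) u x)) \<partial>lebesgue_on \<Omega>) = 0"
    unfolding c0 by simp
  show ?case
    by (rule bexI[OF _ Cc_infty_zero]) (unfold m0 l0, use 0 in simp)
next
  case (Suc k)
  interpret regular_N_function \<Omega> M m1 m2 by (rule reg)
  have \<Omega>b: "\<Omega> \<in> sets borel" "\<Omega> \<in> sets lebesgue" using open_\<Omega> by (auto simp: borel_open)
  have C: "1 < C" using sc by (simp add: approximation_scale_def)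
  have int: "integrable lborel u" "integrable lborel G" using u unfolding sobolev_pair_def by auto
  note ub = integrable_borel_measurable[OF int(1)] and Gb = integrable_borel_measurable[OF int(2)]
  obtain f where f: "f \<in> Cc_infty \<Omega>"
    and f1: "(\<integral>\<^sup>+x. ennreal (norm (f x - comp_rows (soft_trunc k) u x)) \<partial>lebesgue_on \<Omega>) < ennreal (\<epsilon> / 2)"
    and f2: "modular \<Omega> M (\<lambda>x. (grad f x - scale_rows (soft_trunc' k) u G x) /\<^sub>R (4 * C * \<mu>)) < ennreal (\<epsilon> / 2)"
    using Suc.IH[of "\<epsilon> / 2"] Suc.prems by auto
  define F where "F = (\<lambda>t. soft_trunc (Suc k) t - soft_trunc k t)"
  define F' where "F' = (\<lambda>t. soft_trunc' (Suc k) t - soft_trunc' k t)"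
  have F'01: "0 \<le> F' t" "F' t \<le> 1" for t
    using soft_trunc'_bounds(1)[of k t] soft_trunc'_bounds(2)[of "Suc k" t] soft_trunc'_bounds(3)[of k t]
    unfolding F'_def by linarith+
  have F1: "(F has_real_derivative F' t) (at t)" for t
    unfolding F_def F'_def by (intro DERIV_diff soft_trunc_has_derivative)
  have F2: "continuous_on UNIV F'" unfolding F'_def by (intro continuous_on_diff soft_trunc'_continuous)
  have F3: "F 0 = 0" by (simp add: F_def)
  have F4: "\<bar>F' t\<bar> \<le> 1" for t using F'01[of t] by simp
  define w where "w = comp_rows F u"
  define W where "W = scale_rows F' u G"
  have wW: "sobolev_pair \<Omega> w W" unfolding w_def W_def by (rule sobolev_pair_comp_rows[OF u bd F1 F2 F3 F4])
  then have wb: "w \<in> borel_measurable borel" using integrable_borel_measurable unfolding sobolev_pair_def by blast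
  have wbd: "norm (w x) \<le> real CARD('d)" for x
  proof -
    have "norm (w x) \<le> (\<Sum>i\<in>UNIV. norm (w x $ i))" by (rule norm_vec_le_sum)
    also have "\<dots> \<le> (\<Sum>i\<in>(UNIV :: 'd set). 1)"
      by (intro sum_mono) (simp add: w_def comp_rows_def F_def soft_trunc_diff_le)
    finally show ?thesis by simp
  qed
  have osc: "norm (w (z - \<delta> *\<^sub>R v) - w z) \<le> (2 * real CARD('d)) * \<delta> powr 0" if "0 < \<delta>" for z \<delta> v
  proof -
    have "norm (w (z - \<delta> *\<^sub>R v) - w z) \<le> norm (w (z - \<delta> *\<^sub>R v)) + norm (w z)" by (rule norm_triangle_ineq4)
    then show ?thesis using wbd[of "z - \<delta> *\<^sub>R v"] wbd[of z] that by simp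
  qed
  have contr: "M x (scale_rows T u G x /\<^sub>R \<nu>) \<le> M x (G x /\<^sub>R \<nu>)" if x: "x \<in> \<Omega>" and T: "\<And>t. 0 \<le> T t" "\<And>t. T t \<le> 1" for T x \<nu>
  proof -
    have "scale_rows T u G x /\<^sub>R \<nu> = (\<chi> i. T (u x $ i) *\<^sub>R (G x /\<^sub>R \<nu>) $ i)"
      by (simp add: scale_rows_def vec_eq_iff)
    then show ?thesis using row_contraction[OF reg Mi x, of "\<lambda>i. T (u x $ i)" "G x /\<^sub>R \<nu>"] T by simp
  qed
  have Wm: "integrable lborel (\<lambda>y. M y (W y /\<^sub>R \<mu>) * indicator \<Omega> y)"
  proof (rule integrable_M_dominated[OF _ m])
    show "(\<lambda>y. W y /\<^sub>R \<mu>) \<in> borel_measurable borel"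
      unfolding W_def using borel_measurable_scale_rows[OF F2 ub Gb] by simp
    show "M x (W x /\<^sub>R \<mu>) \<le> M x (G x /\<^sub>R \<mu>) * indicator \<Omega> x" if "x \<in> \<Omega>" for x
      using contr[OF that F'01] that by (simp add: W_def)
  qed
  define S where "S = scale_rows (soft_trunc' (Suc k)) u G"
  have Sb: "S \<in> borel_measurable borel"
    unfolding S_def by (rule borel_measurable_scale_rows[OF soft_trunc'_continuous ub Gb])
  have fC1: "C1_pair \<Omega> f (grad f)" by (rule Cc_infty_C1_pair[OF f])
  have gfb: "grad f \<in> borel_measurable borel"
    by (rule integrable_borel_measurable[OF C1_pair_integrable(2)[OF fC1 bd]])
  obtain Bf where Bf: "\<And>x. norm (grad f x) \<le> Bf"
  proof -
    obtain r where r: "\<And>x. x \<in> \<Omega> \<Longrightarrow> norm x \<le> r" using bd bounded_iff by blast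
    have "grad f x = 0" if "r < norm x" for x using fC1 r[of x] that unfolding C1_pair_def by force
    then show ?thesis
      using continuous_bounded_support_bounded[of "grad f" r] fC1 that unfolding C1_pair_def by blast
  qed
  define R where "R = (\<lambda>x. grad f x - S x)"
  have Rb: "R \<in> borel_measurable borel" unfolding R_def using gfb Sb by simp
  have Rm: "integrable lborel (\<lambda>y. M y (R y /\<^sub>R (2 * C * \<mu>)) * indicator \<Omega> y)"
  proof (rule integrable_M_dominated[where D="\<lambda>y. (m2 0 + m2 (Bf / (C * \<mu>))) * indicator \<Omega> y + M y (G y /\<^sub>R \<mu>) * indicator \<Omega> y"])
    show "(\<lambda>y. R y /\<^sub>R (2 * C * \<mu>)) \<in> borel_measurable borel" using Rb by simp
    have "emeasure lborel \<Omega> < \<infinity>" by (rule emeasure_bounded_finite[OF bd])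
    then have "integrable lborel (\<lambda>y. indicat_real \<Omega> y)" using \<Omega>b by (intro integrable_real_indicator) auto
    then show "integrable lborel (\<lambda>y. (m2 0 + m2 (Bf / (C * \<mu>))) * indicator \<Omega> y + M y (G y /\<^sub>R \<mu>) * indicator \<Omega> y)"
      using m by (intro Bochner_Integration.integrable_add integrable_mult_right)
    fix x assume x: "x \<in> \<Omega>"
    have CM: "0 < C * \<mu>" using C \<mu> by simp
    have eq: "R x /\<^sub>R (2 * C * \<mu>) = (1/2) *\<^sub>R (grad f x /\<^sub>R (C * \<mu>) + - (S x /\<^sub>R (C * \<mu>)))"
      unfolding R_def by (simp add: scaleR_right_diff_distrib)
    have "norm (grad f x /\<^sub>R (C * \<mu>)) \<le> Bf / (C * \<mu>)"
    proof -
      have "norm (grad f x /\<^sub>R (C * \<mu>)) = \<bar>inverse (C * \<mu>)\<bar> * norm (grad f x)" by (rule norm_scaleR)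
      also have "\<dots> = norm (grad f x) / (C * \<mu>)"
        using CM by (simp only: abs_inverse abs_of_pos divide_inverse mult.commute)
      also have "\<dots> \<le> Bf / (C * \<mu>)" using Bf CM by (intro divide_right_mono) auto
      finally show ?thesis .
    qed
    then have a: "M x (grad f x /\<^sub>R (C * \<mu>)) \<le> m2 0 + m2 (Bf / (C * \<mu>))" by (rule M_bounded[OF x])
    have eqS: "S x /\<^sub>R (C * \<mu>) = (1 / C) *\<^sub>R (S x /\<^sub>R \<mu>)" using C by (simp add: divide_inverse)
    have "M x (S x /\<^sub>R (C * \<mu>)) \<le> M x (S x /\<^sub>R \<mu>)" unfolding eqS by (rule M_scale_le[OF x]) (use C in auto)
    also have "\<dots> \<le> M x (G x /\<^sub>R \<mu>)" unfolding S_def by (rule contr[OF x soft_trunc'_bounds(1,2)])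
    finally have b: "M x (S x /\<^sub>R (C * \<mu>)) \<le> M x (G x /\<^sub>R \<mu>)" .
    have "M x (R x /\<^sub>R (2 * C * \<mu>)) \<le> M x (grad f x /\<^sub>R (C * \<mu>)) / 2 + M x (- (S x /\<^sub>R (C * \<mu>))) / 2"
      unfolding eq by (rule M_half[OF x])
    then show "M x (R x /\<^sub>R (2 * C * \<mu>)) \<le> (m2 0 + m2 (Bf / (C * \<mu>))) * indicator \<Omega> x + M x (G x /\<^sub>R \<mu>) * indicator \<Omega> x"
      using a b x M_even[OF x] M_nonneg[OF x, of "grad f x /\<^sub>R (C * \<mu>)"] M_nonneg[OF x, of "G x /\<^sub>R \<mu>"] by simp
  qed
  obtain g where g: "\<And>n::nat. g n \<in> Cc_infty \<Omega>"
    and l1: "(\<lambda>n. \<integral>\<^sup>+x. ennreal (norm (g n x - w x)) \<partial>lebesgue_on \<Omega>) \<longlonglongrightarrow> 0"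
    and l2: "(\<lambda>n. modular \<Omega> M (\<lambda>x. (grad (g n) x + R x) /\<^sub>R (4 * C * \<mu>))) \<longlonglongrightarrow> modular \<Omega> M (\<lambda>x. (W x + R x) /\<^sub>R (4 * C * \<mu>))"
    using approximation_scaleD[OF sc wW wbd osc \<mu> Wm Rb Rm] by blast
  have WR: "W x + R x = grad f x - scale_rows (soft_trunc' k) u G x" for x
    by (simp add: W_def R_def S_def F'_def scale_rows_def vec_eq_iff algebra_simps)
  have "\<forall>\<^sub>F n in sequentially. modular \<Omega> M (\<lambda>x. (grad (g n) x + R x) /\<^sub>R (4 * C * \<mu>)) < ennreal (\<epsilon> / 2)"
    by (rule order_tendstoD(2)[OF l2]) (simp only: WR f2)
  moreover have "\<forall>\<^sub>F n in sequentially. (\<integral>\<^sup>+x. ennreal (norm (g n x - w x)) \<partial>lebesgue_on \<Omega>) < ennreal (\<epsilon> / 2)"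
    using Suc.prems by (intro order_tendstoD(2)[OF l1]) simp
  ultimately have "\<forall>\<^sub>F n in sequentially. modular \<Omega> M (\<lambda>x. (grad (g n) x + R x) /\<^sub>R (4 * C * \<mu>)) < ennreal (\<epsilon> / 2) \<and>
      (\<integral>\<^sup>+x. ennreal (norm (g n x - w x)) \<partial>lebesgue_on \<Omega>) < ennreal (\<epsilon> / 2)" by eventually_elim simp
  then obtain n where n1: "modular \<Omega> M (\<lambda>x. (grad (g n) x + R x) /\<^sub>R (4 * C * \<mu>)) < ennreal (\<epsilon> / 2)"
      and n2: "(\<integral>\<^sup>+x. ennreal (norm (g n x - w x)) \<partial>lebesgue_on \<Omega>) < ennreal (\<epsilon> / 2)"
    unfolding eventually_sequentially by blast
  define h where "h = (\<lambda>x. g n x + f x)"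
  have h: "h \<in> Cc_infty \<Omega>" unfolding h_def by (rule Cc_infty_add[OF g f])
  have gh: "grad h x - S x = grad (g n) x + R x" for x
    unfolding h_def grad_add[OF g f] R_def by simp
  have "modular \<Omega> M (\<lambda>x. (grad h x - S x) /\<^sub>R (4 * C * \<mu>)) < ennreal \<epsilon>"
    unfolding gh using n1 Suc.prems by (elim less_trans) (simp add: ennreal_lessI)
  moreover have "(\<integral>\<^sup>+x. ennreal (norm (h x - comp_rows (soft_trunc (Suc k)) u x)) \<partial>lebesgue_on \<Omega>) < ennreal \<epsilon>"
  proof -
    have gnb: "g n \<in> borel_measurable borel" and fb: "f \<in> borel_measurable borel"
      using integrable_borel_measurable[OF C1_pair_integrable(1)[OF Cc_infty_C1_pair[OF g] bd]]
        integrable_borel_measurable[OF C1_pair_integrable(1)[OF fC1 bd]] by auto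
    have cb: "comp_rows (soft_trunc k) u \<in> borel_measurable borel"
      by (intro borel_measurable_comp_rows ub continuous_at_imp_continuous_on ballI DERIV_isCont[OF soft_trunc_has_derivative])
    have "(\<integral>\<^sup>+x. ennreal (norm (h x - comp_rows (soft_trunc (Suc k)) u x)) \<partial>lebesgue_on \<Omega>)
        \<le> (\<integral>\<^sup>+x. ennreal (norm (g n x - w x)) + ennreal (norm (f x - comp_rows (soft_trunc k) u x)) \<partial>lebesgue_on \<Omega>)"
    proof (rule nn_integral_mono)
      fix x
      have "h x - comp_rows (soft_trunc (Suc k)) u x = (g n x - w x) + (f x - comp_rows (soft_trunc k) u x)"
        by (simp add: h_def w_def F_def comp_rows_def vec_eq_iff)
      then have "norm (h x - comp_rows (soft_trunc (Suc k)) u x) \<le> norm (g n x - w x) + norm (f x - comp_rows (soft_trunc k) u x)"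
        by (simp only: norm_triangle_ineq)
      then show "ennreal (norm (h x - comp_rows (soft_trunc (Suc k)) u x))
          \<le> ennreal (norm (g n x - w x)) + ennreal (norm (f x - comp_rows (soft_trunc k) u x))"
        by (simp add: ennreal_leI flip: ennreal_plus)
    qed
    also have "\<dots> = (\<integral>\<^sup>+x. ennreal (norm (g n x - w x)) \<partial>lebesgue_on \<Omega>) + (\<integral>\<^sup>+x. ennreal (norm (f x - comp_rows (soft_trunc k) u x)) \<partial>lebesgue_on \<Omega>)"
    proof (rule nn_integral_add)
      have "(\<lambda>x. norm (g n x - w x)) \<in> borel_measurable (lebesgue_on \<Omega>)"
        using gnb wb by (intro borel_imp_lebesgue_on) simp
      then show "(\<lambda>x. ennreal (norm (g n x - w x))) \<in> borel_measurable (lebesgue_on \<Omega>)" by simp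
      have "(\<lambda>x. norm (f x - comp_rows (soft_trunc k) u x)) \<in> borel_measurable (lebesgue_on \<Omega>)"
        using fb cb by (intro borel_imp_lebesgue_on) simp
      then show "(\<lambda>x. ennreal (norm (f x - comp_rows (soft_trunc k) u x))) \<in> borel_measurable (lebesgue_on \<Omega>)" by simp
    qed
    also have "\<dots> < ennreal (\<epsilon> / 2) + ennreal (\<epsilon> / 2)" using n2 f1 by (rule add_strict_mono)
    also have "\<dots> = ennreal \<epsilon>" using Suc.prems by (simp flip: ennreal_plus)
    finally show ?thesis .
  qed
  ultimately show ?case using h unfolding S_def by blast
qed

lemma nn_integral_null_limit:
  fixes f :: "nat \<Rightarrow> 'a \<Rightarrow> real"
  assumes f: "\<And>n. f n \<in> borel_measurable M" "\<And>n x. x \<in> space M \<Longrightarrow> 0 \<le> f n x"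
    and lim: "\<And>x. x \<in> space M \<Longrightarrow> (\<lambda>n. f n x) \<longlonglongrightarrow> 0"
    and D: "\<And>n x. x \<in> space M \<Longrightarrow> f n x \<le> D x" "integrable M D"
  shows "(\<lambda>n. \<integral>\<^sup>+x. ennreal (f n x) \<partial>M) \<longlonglongrightarrow> 0"
proof -
  have sp: "AE x in M. x \<in> space M" by (rule AE_space)
  have "(\<lambda>n. integral\<^sup>L M (f n)) \<longlonglongrightarrow> integral\<^sup>L M (\<lambda>x. 0)"
  proof (rule integral_dominated_convergence[OF _ f(1) D(2)])
    show "AE x in M. (\<lambda>n. f n x) \<longlonglongrightarrow> 0" using sp by eventually_elim (rule lim)
    show "AE x in M. norm (f n x) \<le> D x" for n
      using sp
    proof eventually_elim
      case (elim x)
      show ?case using f(2)[OF elim, of n] D(1)[OF elim, of n] by simp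
    qed
  qed simp
  moreover have "integrable M (f n)" for n
  proof (rule Bochner_Integration.integrable_bound[OF D(2) f(1)])
    show "AE x in M. norm (f n x) \<le> norm (D x)"
      using sp
    proof eventually_elim
      case (elim x)
      show ?case using f(2)[OF elim, of n] D(1)[OF elim, of n] by simp
    qed
  qed
  then have "(\<integral>\<^sup>+x. ennreal (f n x) \<partial>M) = ennreal (integral\<^sup>L M (f n))" for n
    by (rule nn_integral_eq_integral) (use sp in \<open>eventually_elim, simp add: f(2)\<close>)
  ultimately show ?thesis using tendsto_ennrealI[of "\<lambda>n. integral\<^sup>L M (f n)" 0] by simp
qed

text \<open>The truncations converge to \<open>u\<close>, and their gradients in modular, by dominated convergence; each of them is
  approximated by layers. Half of the scale \<open>8 C \<mu>\<close> is spent on each of the two errors.\<close>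

lemma approximation_unbounded:
  fixes M :: "real ^ 'n \<Rightarrow> real ^ 'n ^ 'd \<Rightarrow> real" and u :: "real ^ 'n \<Rightarrow> real ^ 'd"
  assumes reg: "regular_N_function \<Omega> M m1 m2" and bd: "bounded \<Omega>" and sc: "approximation_scale \<Omega> M 0 C A"
    and Mi: "\<And>i. weak_N_function \<Omega> UNIV (Mi i)" "\<And>x \<xi>. x \<in> \<Omega> \<Longrightarrow> M x \<xi> = (\<Sum>i\<in>UNIV. Mi i x (\<xi> $ i))"
    and u: "sobolev_pair \<Omega> u G" and \<mu>: "0 < \<mu>" "A * (2 * real CARD('d)) \<le> \<mu>"
    and m: "integrable lborel (\<lambda>y. M y (G y /\<^sub>R \<mu>) * indicator \<Omega> y)" and \<epsilon>: "0 < \<epsilon>"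
  shows "\<exists>f\<in>Cc_infty \<Omega>. (\<integral>\<^sup>+x. ennreal (norm (f x - u x)) \<partial>lebesgue_on \<Omega>) < ennreal \<epsilon> \<and>
    modular \<Omega> M (\<lambda>x. (grad f x - G x) /\<^sub>R (8 * C * \<mu>)) < ennreal \<epsilon>"
proof -
  interpret regular_N_function \<Omega> M m1 m2 by (rule reg)
  have \<Omega>b: "\<Omega> \<in> sets borel" "\<Omega> \<in> sets lebesgue" using open_\<Omega> by (auto simp: borel_open)
  have C: "1 < C" using sc by (simp add: approximation_scale_def)
  define \<Lambda> where "\<Lambda> = 4 * C * \<mu>"
  have \<Lambda>: "0 < \<Lambda>" "\<mu> \<le> \<Lambda>" using C \<mu> by (auto simp: \<Lambda>_def)
  have int: "integrable lborel u" "integrable lborel G" using u unfolding sobolev_pair_def by auto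
  note ub = integrable_borel_measurable[OF int(1)] and Gb = integrable_borel_measurable[OF int(2)]
  let ?T = "\<lambda>k. comp_rows (soft_trunc k) u" and ?S = "\<lambda>k. scale_rows (soft_trunc' k) u G"
  have Tb: "?T k \<in> borel_measurable borel" for k
    by (intro borel_measurable_comp_rows ub continuous_at_imp_continuous_on ballI DERIV_isCont[OF soft_trunc_has_derivative])
  have Sb: "?S k \<in> borel_measurable borel" for k
    by (rule borel_measurable_scale_rows[OF soft_trunc'_continuous ub Gb])
  have lim1: "(\<lambda>k. \<integral>\<^sup>+x. ennreal (norm (?T k x - u x)) \<partial>lebesgue_on \<Omega>) \<longlonglongrightarrow> 0"
  proof (rule nn_integral_null_limit[where D="\<lambda>x. 2 * norm (u x)"])
    show "(\<lambda>x. norm (?T k x - u x)) \<in> borel_measurable (lebesgue_on \<Omega>)" for k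
      using Tb ub by (intro borel_imp_lebesgue_on) simp
    show "integrable (lebesgue_on \<Omega>) (\<lambda>x. 2 * norm (u x))"
      using integrable_lborel_imp_lebesgue_on[OF int(1) \<Omega>b(1)] by simp
    fix x
    have "(\<lambda>k. ?T k x) \<longlonglongrightarrow> (\<chi> i. u x $ i)"
      unfolding comp_rows_def by (intro tendsto_vec_lambda soft_trunc_limits)
    then show "(\<lambda>k. norm (?T k x - u x)) \<longlonglongrightarrow> 0" by (intro tendsto_norm_zero) (simp add: LIM_zero)
    fix k
    have "norm (?T k x) \<le> norm (u x)"
      by (rule norm_le_componentwise_cart) (simp add: comp_rows_def soft_trunc_abs_le)
    then show "norm (?T k x - u x) \<le> 2 * norm (u x)" using norm_triangle_ineq4[of "?T k x" "u x"] by linarith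
  qed simp
  have lim2: "(\<lambda>k. modular \<Omega> M (\<lambda>x. (?S k x - G x) /\<^sub>R \<Lambda>)) \<longlonglongrightarrow> 0"
    unfolding modular_def
  proof (rule nn_integral_null_limit[where D="\<lambda>y. M y (G y /\<^sub>R \<mu>) * indicator \<Omega> y"])
    show "(\<lambda>x. M x ((?S k x - G x) /\<^sub>R \<Lambda>)) \<in> borel_measurable (lebesgue_on \<Omega>)" for k
      using Sb Gb by (intro measurable_M_lebesgue borel_imp_lebesgue_on) simp
    show "integrable (lebesgue_on \<Omega>) (\<lambda>y. M y (G y /\<^sub>R \<mu>) * indicator \<Omega> y)"
      by (rule integrable_lborel_imp_lebesgue_on[OF m \<Omega>b(1)])
    fix x assume "x \<in> space (lebesgue_on \<Omega>)"
    then have x: "x \<in> \<Omega>" by simp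
    show "0 \<le> M x ((?S k x - G x) /\<^sub>R \<Lambda>)" for k by (rule M_nonneg[OF x])
    have "(\<lambda>k. ?S k x) \<longlonglongrightarrow> (\<chi> i. 1 *\<^sub>R G x $ i)"
      unfolding scale_rows_def by (intro tendsto_vec_lambda tendsto_scaleR soft_trunc_limits tendsto_const)
    then have "(\<lambda>k. ?S k x) \<longlonglongrightarrow> G x" by simp
    then have l: "(\<lambda>k. (?S k x - G x) /\<^sub>R \<Lambda>) \<longlonglongrightarrow> (G x - G x) /\<^sub>R \<Lambda>" by (intro tendsto_intros)
    have "continuous_on UNIV (M x)"
      using M_continuous_compose[of UNIV "\<lambda>_. x" "\<lambda>\<xi>. \<xi>"] x by (auto intro: continuous_intros)
    from continuous_on_tendsto_compose[OF this l]
    show "(\<lambda>k. M x ((?S k x - G x) /\<^sub>R \<Lambda>)) \<longlonglongrightarrow> 0" using M_zero[OF x] by simp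
    fix k
    have eq: "(?S k x - G x) /\<^sub>R \<Lambda> = - (\<chi> i. (1 - soft_trunc' k (u x $ i)) *\<^sub>R (G x /\<^sub>R \<Lambda>) $ i)"
      by (simp add: scale_rows_def vec_eq_iff algebra_simps)
    have "M x ((?S k x - G x) /\<^sub>R \<Lambda>) \<le> M x (G x /\<^sub>R \<Lambda>)"
      unfolding eq M_even[OF x] by (rule row_contraction[OF reg Mi x]) (simp_all add: soft_trunc'_bounds)
    also have "G x /\<^sub>R \<Lambda> = (\<mu> / \<Lambda>) *\<^sub>R (G x /\<^sub>R \<mu>)" using \<mu>(1) by (simp add: divide_inverse)
    also have "M x ((\<mu> / \<Lambda>) *\<^sub>R (G x /\<^sub>R \<mu>)) \<le> M x (G x /\<^sub>R \<mu>)" by (rule M_scale_le[OF x]) (use \<Lambda> \<mu>(1) in auto)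
    finally show "M x ((?S k x - G x) /\<^sub>R \<Lambda>) \<le> M x (G x /\<^sub>R \<mu>) * indicator \<Omega> x" using x by simp
  qed
  have "\<forall>\<^sub>F k in sequentially. (\<integral>\<^sup>+x. ennreal (norm (?T k x - u x)) \<partial>lebesgue_on \<Omega>) < ennreal (\<epsilon> / 2)"
    using \<epsilon> by (intro order_tendstoD(2)[OF lim1]) simp
  moreover have "\<forall>\<^sub>F k in sequentially. modular \<Omega> M (\<lambda>x. (?S k x - G x) /\<^sub>R \<Lambda>) < ennreal (\<epsilon> / 2)"
    using \<epsilon> by (intro order_tendstoD(2)[OF lim2]) simp
  ultimately have "\<forall>\<^sub>F k in sequentially. (\<integral>\<^sup>+x. ennreal (norm (?T k x - u x)) \<partial>lebesgue_on \<Omega>) < ennreal (\<epsilon> / 2) \<and>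
      modular \<Omega> M (\<lambda>x. (?S k x - G x) /\<^sub>R \<Lambda>) < ennreal (\<epsilon> / 2)" by eventually_elim simp
  then obtain k where k1: "(\<integral>\<^sup>+x. ennreal (norm (?T k x - u x)) \<partial>lebesgue_on \<Omega>) < ennreal (\<epsilon> / 2)"
      and k2: "modular \<Omega> M (\<lambda>x. (?S k x - G x) /\<^sub>R \<Lambda>) < ennreal (\<epsilon> / 2)"
    unfolding eventually_sequentially by blast
  obtain f where f: "f \<in> Cc_infty \<Omega>"
    and f1: "(\<integral>\<^sup>+x. ennreal (norm (f x - ?T k x)) \<partial>lebesgue_on \<Omega>) < ennreal (\<epsilon> / 2)"
    and f2: "modular \<Omega> M (\<lambda>x. (grad f x - ?S k x) /\<^sub>R \<Lambda>) < ennreal (\<epsilon> / 2)"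
    using layered_approximation[OF reg bd sc Mi u \<mu> m half_gt_zero[OF \<epsilon>], of k] unfolding \<Lambda>_def by blast
  note fC1 = Cc_infty_C1_pair[OF f]
  have fb: "f \<in> borel_measurable borel" "grad f \<in> borel_measurable borel"
    using integrable_borel_measurable[OF C1_pair_integrable(1)[OF fC1 bd]] integrable_borel_measurable[OF C1_pair_integrable(2)[OF fC1 bd]] by auto
  have e2: "ennreal (\<epsilon> / 2) + ennreal (\<epsilon> / 2) = ennreal \<epsilon>" using \<epsilon> by (simp flip: ennreal_plus)
  have "(\<integral>\<^sup>+x. ennreal (norm (f x - u x)) \<partial>lebesgue_on \<Omega>)
      \<le> (\<integral>\<^sup>+x. ennreal (norm (f x - ?T k x)) + ennreal (norm (?T k x - u x)) \<partial>lebesgue_on \<Omega>)"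
  proof (rule nn_integral_mono)
    fix x
    have "norm (f x - u x) \<le> norm (f x - ?T k x) + norm (?T k x - u x)"
      using norm_triangle_ineq[of "f x - ?T k x" "?T k x - u x"] by simp
    then show "ennreal (norm (f x - u x)) \<le> ennreal (norm (f x - ?T k x)) + ennreal (norm (?T k x - u x))"
      by (simp add: ennreal_leI flip: ennreal_plus)
  qed
  also have "\<dots> = (\<integral>\<^sup>+x. ennreal (norm (f x - ?T k x)) \<partial>lebesgue_on \<Omega>) + (\<integral>\<^sup>+x. ennreal (norm (?T k x - u x)) \<partial>lebesgue_on \<Omega>)"
  proof (rule nn_integral_add)
    have "(\<lambda>x. norm (f x - ?T k x)) \<in> borel_measurable (lebesgue_on \<Omega>)" "(\<lambda>x. norm (?T k x - u x)) \<in> borel_measurable (lebesgue_on \<Omega>)"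
      using fb Tb ub by (auto intro!: borel_imp_lebesgue_on)
    then show "(\<lambda>x. ennreal (norm (f x - ?T k x))) \<in> borel_measurable (lebesgue_on \<Omega>)"
       "(\<lambda>x. ennreal (norm (?T k x - u x))) \<in> borel_measurable (lebesgue_on \<Omega>)" by simp_all
  qed
  also have "\<dots> < ennreal \<epsilon>" unfolding e2[symmetric] using f1 k1 by (rule add_strict_mono)
  finally have r1: "(\<integral>\<^sup>+x. ennreal (norm (f x - u x)) \<partial>lebesgue_on \<Omega>) < ennreal \<epsilon>" .
  have eq: "(grad f x - G x) /\<^sub>R (8 * C * \<mu>) = (1/2) *\<^sub>R ((grad f x - ?S k x) /\<^sub>R \<Lambda> + (?S k x - G x) /\<^sub>R \<Lambda>)" for x
    unfolding \<Lambda>_def by (simp add: scaleR_right_distrib[symmetric] del: scaleR_right_distrib)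
  have "modular \<Omega> M (\<lambda>x. (grad f x - G x) /\<^sub>R (8 * C * \<mu>))
      \<le> modular \<Omega> M (\<lambda>x. (grad f x - ?S k x) /\<^sub>R \<Lambda>) + modular \<Omega> M (\<lambda>x. (?S k x - G x) /\<^sub>R \<Lambda>)"
    unfolding eq using fb Sb Gb by (intro modular_half borel_imp_lebesgue_on) auto
  also have "\<dots> < ennreal \<epsilon>" unfolding e2[symmetric] using f2 k2 by (rule add_strict_mono)
  finally show ?thesis using f r1 by blast
qed

section \<open>Density of smooth functions\<close>

text \<open>An approximant for every tolerance \<open>\<epsilon>\<close> gives a family indexed by \<open>\<delta> = \<epsilon>\<close>. Convergence in measure follows
  from convergence in \<open>L\<^sup>1\<close> by Markov's inequality.\<close>

lemma approximated_byI:
  fixes M :: "real ^ 'n \<Rightarrow> real ^ 'n ^ 'd \<Rightarrow> real" and \<phi> :: "real ^ 'n \<Rightarrow> real ^ 'd"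
  assumes \<Omega>: "open \<Omega>" "bounded \<Omega>" and \<phi>: "\<phi> \<in> borel_measurable (lebesgue_on \<Omega>)"
    and u: "AE x in lborel. x \<in> \<Omega> \<longrightarrow> u x = \<phi> x"
    and G: "\<And>G'. weak_gradient \<Omega> \<phi> G' \<Longrightarrow> AE x in lborel. x \<in> \<Omega> \<longrightarrow> G' x = G x"
    and \<Lambda>: "0 < \<Lambda>"
    and ex: "\<And>\<epsilon>. 0 < \<epsilon> \<Longrightarrow> \<exists>f\<in>Cc_infty \<Omega>. P f \<and> (\<integral>\<^sup>+x. ennreal (norm (f x - u x)) \<partial>lebesgue_on \<Omega>) < ennreal \<epsilon> \<and>
      modular \<Omega> M (\<lambda>x. (grad f x - G x) /\<^sub>R \<Lambda>) < ennreal \<epsilon>"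
  shows "\<exists>fs. approximated_by \<Omega> M \<phi> fs \<and> (\<forall>\<delta>>0. P (fs \<delta>))"
proof -
  have \<Omega>l: "\<Omega> \<in> sets lebesgue" using \<Omega> by (auto simp: borel_open)
  have "\<forall>\<delta>::real. \<exists>f. 0 < \<delta> \<longrightarrow> f \<in> Cc_infty \<Omega> \<and> P f \<and> (\<integral>\<^sup>+x. ennreal (norm (f x - u x)) \<partial>lebesgue_on \<Omega>) < ennreal \<delta> \<and>
      modular \<Omega> M (\<lambda>x. (grad f x - G x) /\<^sub>R \<Lambda>) < ennreal \<delta>"
    using ex by blast
  then have "\<exists>fs. \<forall>\<delta>::real. 0 < \<delta> \<longrightarrow> fs \<delta> \<in> Cc_infty \<Omega> \<and> P (fs \<delta>) \<and>
      (\<integral>\<^sup>+x. ennreal (norm (fs \<delta> x - u x)) \<partial>lebesgue_on \<Omega>) < ennreal \<delta> \<and>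
      modular \<Omega> M (\<lambda>x. (grad (fs \<delta>) x - G x) /\<^sub>R \<Lambda>) < ennreal \<delta>" by (rule choice)
  then obtain fs where fs: "\<And>\<delta>::real. 0 < \<delta> \<Longrightarrow> fs \<delta> \<in> Cc_infty \<Omega> \<and> P (fs \<delta>) \<and>
      (\<integral>\<^sup>+x. ennreal (norm (fs \<delta> x - u x)) \<partial>lebesgue_on \<Omega>) < ennreal \<delta> \<and>
      modular \<Omega> M (\<lambda>x. (grad (fs \<delta>) x - G x) /\<^sub>R \<Lambda>) < ennreal \<delta>"
    by blast
  have small: "(a \<longlongrightarrow> 0) (at_right 0)" if less: "\<And>\<delta>::real. 0 < \<delta> \<Longrightarrow> a \<delta> < ennreal \<delta>" for a :: "real \<Rightarrow> ennreal"
  proof (rule tendsto_zero_ennreal)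
    fix r :: real assume r: "0 < r"
    have "a \<delta> < ennreal r" if "0 < \<delta>" "\<delta> < r" for \<delta>
      using that(2) by (intro order_less_le_trans[OF less[OF that(1)]] ennreal_leI) simp
    then show "\<forall>\<^sub>F \<delta> in at_right 0. a \<delta> < ennreal r"
      unfolding eventually_at_right_field using r by blast
  qed
  have l1: "(\<integral>\<^sup>+x. ennreal (norm (fs \<delta> x - \<phi> x)) \<partial>lebesgue_on \<Omega>) < ennreal \<delta>" if "0 < \<delta>" for \<delta>
  proof -
    have "(\<integral>\<^sup>+x. ennreal (norm (fs \<delta> x - \<phi> x)) \<partial>lebesgue_on \<Omega>) = (\<integral>\<^sup>+x. ennreal (norm (fs \<delta> x - u x)) \<partial>lebesgue_on \<Omega>)"
    proof (rule nn_integral_cong_AE)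
      have "AE x in lebesgue_on \<Omega>. u x = \<phi> x" using u by (simp add: lebesgue_on_AE_iff[OF \<Omega>l])
      then show "AE x in lebesgue_on \<Omega>. ennreal (norm (fs \<delta> x - \<phi> x)) = ennreal (norm (fs \<delta> x - u x))"
        by eventually_elim simp
    qed
    then show ?thesis using fs[OF that] by simp
  qed
  have L1: "L1_convergence \<Omega> fs \<phi> (at_right 0)" unfolding L1_convergence_def by (rule small[OF l1])
  have "approximated_by \<Omega> M \<phi> fs"
    unfolding approximated_by_def
  proof (intro conjI allI impI L1)
    show "fs \<delta> \<in> Cc_infty \<Omega>" if "0 < \<delta>" for \<delta> using fs[OF that] by blast
    show "measure_convergence \<Omega> fs \<phi> (at_right 0)"
      unfolding measure_convergence_def
    proof (intro allI impI)
      fix e :: real assume e: "0 < e"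
      have bound: "emeasure lebesgue {x \<in> \<Omega>. e \<le> norm (fs \<delta> x - \<phi> x)}
          \<le> ennreal (1 / e) * (\<integral>\<^sup>+x. ennreal (norm (fs \<delta> x - \<phi> x)) \<partial>lebesgue_on \<Omega>)" if "0 < \<delta>" for \<delta>
      proof -
        have "fs \<delta> \<in> Cc_infty \<Omega>" using fs[OF that] by blast
        then have "integrable lborel (fs \<delta>)" using C1_pair_integrable(1)[OF Cc_infty_C1_pair \<Omega>(2)] by blast
        then have m: "(\<lambda>x. norm (fs \<delta> x - \<phi> x)) \<in> borel_measurable (lebesgue_on \<Omega>)"
          using \<phi> borel_imp_lebesgue_on[OF integrable_borel_measurable, of "fs \<delta>"] by simp
        have "{x \<in> \<Omega>. e \<le> norm (fs \<delta> x - \<phi> x)} = {x \<in> \<Omega>. 1 \<le> ennreal (1 / e) * ennreal (norm (fs \<delta> x - \<phi> x))}"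
          using e by (auto simp: ennreal_mult[symmetric] field_simps simp flip: ennreal_1)
        then have "emeasure lebesgue {x \<in> \<Omega>. e \<le> norm (fs \<delta> x - \<phi> x)}
            = emeasure (lebesgue_on \<Omega>) {x \<in> \<Omega>. 1 \<le> ennreal (1 / e) * ennreal (norm (fs \<delta> x - \<phi> x))}"
          using \<Omega>l by (subst emeasure_restrict_space) auto
        also have "\<dots> \<le> ennreal (1 / e) * (\<integral>\<^sup>+x. ennreal (norm (fs \<delta> x - \<phi> x)) * indicator \<Omega> x \<partial>lebesgue_on \<Omega>)"
        proof (rule nn_integral_Markov_inequality)
          show \<Omega>s: "\<Omega> \<in> sets (lebesgue_on \<Omega>)" using sets.top[of "lebesgue_on \<Omega>"] by simp
          show "(\<lambda>x. ennreal (norm (fs \<delta> x - \<phi> x)) * indicator \<Omega> x) \<in> borel_measurable (lebesgue_on \<Omega>)"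
            by (intro borel_measurable_times_ennreal borel_measurable_indicator \<Omega>s measurable_compose[OF m measurable_ennreal])
        qed
        also have "(\<integral>\<^sup>+x. ennreal (norm (fs \<delta> x - \<phi> x)) * indicator \<Omega> x \<partial>lebesgue_on \<Omega>)
            = (\<integral>\<^sup>+x. ennreal (norm (fs \<delta> x - \<phi> x)) \<partial>lebesgue_on \<Omega>)" by (rule nn_integral_cong) simp
        finally show ?thesis .
      qed
      show "((\<lambda>\<delta>. emeasure lebesgue {x \<in> \<Omega>. e \<le> norm (fs \<delta> x - \<phi> x)}) \<longlongrightarrow> 0) (at_right 0)"
      proof (rule tendsto_sandwich[OF _ _ tendsto_const])
        show "((\<lambda>\<delta>. ennreal (1 / e) * (\<integral>\<^sup>+x. ennreal (norm (fs \<delta> x - \<phi> x)) \<partial>lebesgue_on \<Omega>)) \<longlongrightarrow> 0) (at_right 0)"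
          using ennreal_tendsto_cmult[OF _ L1[unfolded L1_convergence_def], of "ennreal (1 / e)"] by simp
        show "\<forall>\<^sub>F \<delta> in at_right 0. emeasure lebesgue {x \<in> \<Omega>. e \<le> norm (fs \<delta> x - \<phi> x)}
            \<le> ennreal (1 / e) * (\<integral>\<^sup>+x. ennreal (norm (fs \<delta> x - \<phi> x)) \<partial>lebesgue_on \<Omega>)"
          unfolding eventually_at_right_field using bound by (intro exI[of _ 1]) simp
      qed simp
    qed
    fix G' assume "weak_gradient \<Omega> \<phi> G'"
    then have "AE x in lebesgue_on \<Omega>. G' x = G x" using G by (simp add: lebesgue_on_AE_iff[OF \<Omega>l])
    then have "modular \<Omega> M (\<lambda>x. (grad (fs \<delta>) x - G' x) /\<^sub>R \<Lambda>) = modular \<Omega> M (\<lambda>x. (grad (fs \<delta>) x - G x) /\<^sub>R \<Lambda>)" for \<delta>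
      by (intro modular_cong_AE) (auto elim!: eventually_mono)
    moreover have "((\<lambda>\<delta>. modular \<Omega> M (\<lambda>x. (grad (fs \<delta>) x - G x) /\<^sub>R \<Lambda>)) \<longlongrightarrow> 0) (at_right 0)"
      by (rule small) (use fs in blast)
    ultimately show "modular_convergence \<Omega> M (\<lambda>\<delta>. grad (fs \<delta>)) G' (at_right 0)"
      unfolding modular_convergence_def using \<Lambda> by (intro exI[of _ \<Lambda>]) simp
  qed
  then show ?thesis using fs by blast
qed

lemma Linf_norm_real:
  fixes \<phi> :: "real ^ 'n \<Rightarrow> real ^ 'd"
  assumes \<Omega>: "open \<Omega>" "\<Omega> \<noteq> {}" and \<phi>: "\<phi> \<in> Linf \<Omega>"
  obtains b where "Linf_norm \<Omega> \<phi> = ereal b" "0 \<le> b" "AE x in lborel. x \<in> \<Omega> \<longrightarrow> norm (\<phi> x) \<le> b"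
proof -
  have \<Omega>l: "\<Omega> \<in> sets lebesgue" using \<Omega> by (auto simp: borel_open)
  have ae: "AE x in lebesgue_on \<Omega>. ereal (norm (\<phi> x)) \<le> Linf_norm \<Omega> \<phi>" unfolding Linf_norm_def by (rule esssup_AE)
  have nn: "0 \<le> Linf_norm \<Omega> \<phi>"
  proof (rule ccontr)
    assume neg: "\<not> 0 \<le> Linf_norm \<Omega> \<phi>"
    have "AE x in lborel. x \<notin> \<Omega>"
      using ae unfolding lebesgue_on_AE_iff[OF \<Omega>l]
    proof eventually_elim
      case (elim x)
      show ?case
      proof
        assume "x \<in> \<Omega>"
        then have "ereal (norm (\<phi> x)) \<le> Linf_norm \<Omega> \<phi>" using elim by blast
        moreover have "0 \<le> ereal (norm (\<phi> x))" by simp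
        ultimately show False using neg order_trans by blast
      qed
    qed
    then show False using open_AE_empty[OF \<Omega>(1)] \<Omega>(2) by blast
  qed
  moreover have "Linf_norm \<Omega> \<phi> < \<infinity>" using \<phi> by (simp add: Linf_def)
  ultimately obtain b where b: "Linf_norm \<Omega> \<phi> = ereal b" "0 \<le> b" by (cases "Linf_norm \<Omega> \<phi>") auto
  have "AE x in lborel. x \<in> \<Omega> \<longrightarrow> norm (\<phi> x) \<le> b" using ae unfolding lebesgue_on_AE_iff[OF \<Omega>l] b(1) by simp
  with b that show ?thesis by blast
qed

lemma Linf_norm_le:
  fixes f :: "real ^ 'n \<Rightarrow> real ^ 'd"
  assumes "bounded \<Omega>" "f \<in> Cc_infty \<Omega>" "\<And>x. norm (f x) \<le> b"
  shows "Linf_norm \<Omega> f \<le> ereal b"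
  unfolding Linf_norm_def
proof (rule esssup_I)
  have "f \<in> borel_measurable (lebesgue_on \<Omega>)"
    by (intro borel_imp_lebesgue_on integrable_borel_measurable C1_pair_integrable(1)[OF Cc_infty_C1_pair[OF assms(2)] assms(1)])
  then show "(\<lambda>x. ereal (norm (f x))) \<in> borel_measurable (lebesgue_on \<Omega>)" by simp
qed (simp add: assms(3))

lemma Hoelder_bounded:
  fixes u :: "real ^ 'n \<Rightarrow> real ^ 'd"
  assumes \<Omega>: "bounded \<Omega>" and out: "\<And>x. x \<notin> \<Omega> \<Longrightarrow> u x = 0" and \<gamma>: "0 < \<gamma>" and H: "0 \<le> H" "\<And>y z. norm (u y - u z) \<le> H * norm (y - z) powr \<gamma>"
  obtains b where "\<And>x. norm (u x) \<le> b"
proof -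
  obtain r where r: "\<And>x. x \<in> \<Omega> \<Longrightarrow> norm x \<le> r" using \<Omega> bounded_iff by blast
  have "norm (u x) \<le> norm (u 0) + H * r powr \<gamma>" if "x \<in> \<Omega>" for x
  proof -
    have "norm (u x) \<le> norm (u 0) + norm (u x - u 0)" by norm
    also have "norm (u x - u 0) \<le> H * norm x powr \<gamma>" using H(2)[of x 0] by simp
    also have "\<dots> \<le> H * r powr \<gamma>" using r[OF that] \<gamma> H(1) by (intro mult_left_mono powr_mono2) auto
    finally show ?thesis by simp
  qed
  then have "norm (u x) \<le> norm (u 0) + H * r powr \<gamma>" for x
    using out[of x] H(1) by (cases "x \<in> \<Omega>") auto
  then show ?thesis by (rule that)
qed

theorem theorem6:
  fixes \<Omega> :: "(real ^ 'n) set"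
  assumes "bounded_Lipschitz_domain \<Omega>"
  shows "\<exists>c>0. \<forall>(M :: real ^ 'n \<Rightarrow> real ^ 'n ^ 'd \<Rightarrow> real) Mi.
    weak_N_function \<Omega> UNIV M \<and>
    continuous_on (\<Omega> \<times> UNIV) (\<lambda>(x, \<xi>). M x \<xi>) \<and>
    (\<forall>i. weak_N_function \<Omega> UNIV (Mi i)) \<and>
    (\<forall>x\<in>\<Omega>. \<forall>\<xi>. M x \<xi> = (\<Sum>i\<in>UNIV. Mi i x (\<xi> $ i))) \<longrightarrow>
      (B_gen \<Omega> 0 M \<longrightarrow>
        (\<forall>\<phi> \<in> V01_L_M \<Omega> M. \<exists>\<phi>s. approximated_by \<Omega> M \<phi> \<phi>s \<and>
          (\<phi> \<in> Linf \<Omega> \<longrightarrow> (\<forall>\<delta>>0. Linf_norm \<Omega> (\<phi>s \<delta>) \<le> ereal c * Linf_norm \<Omega> \<phi>)))) \<and>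
      (\<forall>\<gamma>. 0 < \<gamma> \<and> \<gamma> \<le> 1 \<longrightarrow> B_gen \<Omega> \<gamma> M \<longrightarrow>
        (\<forall>\<phi> \<in> V01_L_M \<Omega> M \<inter> Hoelder \<Omega> \<gamma>. \<exists>\<phi>s. approximated_by \<Omega> M \<phi> \<phi>s \<and>
          (\<phi> \<in> Linf \<Omega> \<longrightarrow> (\<forall>\<delta>>0. Linf_norm \<Omega> (\<phi>s \<delta>) \<le> ereal c * Linf_norm \<Omega> \<phi>))))"
proof (intro exI[of _ 1] conjI allI impI ballI, simp)
  have op: "open \<Omega>" and ne: "\<Omega> \<noteq> {}" and bd: "bounded \<Omega>" using assms by (auto simp: bounded_Lipschitz_domain_def)
  have \<Omega>b: "\<Omega> \<in> sets borel" "\<Omega> \<in> sets lebesgue" using op by (auto simp: borel_open)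
  fix M :: "real ^ 'n \<Rightarrow> real ^ 'n ^ 'd \<Rightarrow> real" and Mi
  assume hyp: "weak_N_function \<Omega> UNIV M \<and>
    continuous_on (\<Omega> \<times> UNIV) (\<lambda>(x, \<xi>). M x \<xi>) \<and>
    (\<forall>i. weak_N_function \<Omega> UNIV (Mi i)) \<and>
    (\<forall>x\<in>\<Omega>. \<forall>\<xi>. M x \<xi> = (\<Sum>i\<in>UNIV. Mi i x (\<xi> $ i)))"
  then have Mi: "\<And>i. weak_N_function \<Omega> UNIV (Mi i)" "\<And>x \<xi>. x \<in> \<Omega> \<Longrightarrow> M x \<xi> = (\<Sum>i\<in>UNIV. Mi i x (\<xi> $ i))" by auto
  obtain m1 m2 where reg: "regular_N_function \<Omega> M m1 m2"
    using weak_N_function_regular[OF op] hyp by blast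
  interpret regular_N_function \<Omega> M m1 m2 by (rule reg)
  \<comment> \<open>Borel representatives, and a scale at which the gradient has finite modular.\<close>
  have repr: "\<exists>u G \<mu>0. sobolev_pair \<Omega> u G \<and> (AE x in lborel. x \<in> \<Omega> \<longrightarrow> u x = \<phi> x) \<and>
      (\<forall>G'. weak_gradient \<Omega> \<phi> G' \<longrightarrow> (AE x in lborel. x \<in> \<Omega> \<longrightarrow> G' x = G x)) \<and>
      \<phi> \<in> borel_measurable (lebesgue_on \<Omega>) \<and>
      0 < \<mu>0 \<and> (\<forall>\<mu>\<ge>\<mu>0. integrable lborel (\<lambda>y. M y (G y /\<^sub>R \<mu>) * indicator \<Omega> y))"
    if \<phi>: "\<phi> \<in> V01_L_M \<Omega> M" for \<phi>
  proof -
    have W: "\<phi> \<in> W11_0 \<Omega>" using \<phi> by (simp add: V01_L_M_def)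
    obtain G' where G': "weak_gradient \<Omega> \<phi> G'" "G' \<in> L_M \<Omega> M" using \<phi> by (auto simp: V01_L_M_def)
    have \<phi>m: "\<phi> \<in> borel_measurable (lebesgue_on \<Omega>)"
      using W by (auto simp: W11_0_def W11_def intro: borel_measurable_integrable)
    show ?thesis
    proof (rule W11_0_sobolev_pair[OF W op])
      fix u G assume u: "sobolev_pair \<Omega> u G" "AE x in lborel. x \<in> \<Omega> \<longrightarrow> u x = \<phi> x"
        and uniq: "\<And>G'. weak_gradient \<Omega> \<phi> G' \<Longrightarrow> AE x in lborel. x \<in> \<Omega> \<longrightarrow> G' x = G x"
      obtain \<mu>0 where \<mu>0: "0 < \<mu>0" "modular \<Omega> M (\<lambda>x. G' x /\<^sub>R \<mu>0) < \<infinity>" using L_M_finite_modular[OF G'(2)] by blast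
      have "AE x in lebesgue_on \<Omega>. G' x = G x" using uniq[OF G'(1)] by (simp add: lebesgue_on_AE_iff[OF \<Omega>b(2)])
      then have "modular \<Omega> M (\<lambda>x. G' x /\<^sub>R \<mu>0) = modular \<Omega> M (\<lambda>x. G x /\<^sub>R \<mu>0)"
        by (intro modular_cong_AE) (auto elim!: eventually_mono)
      then have fin: "modular \<Omega> M (\<lambda>x. G x /\<^sub>R \<mu>0) < \<infinity>" using \<mu>0(2) by simp
      have Gb: "G \<in> borel_measurable borel" using u(1) integrable_borel_measurable unfolding sobolev_pair_def by blast
      have "integrable lborel (\<lambda>y. M y (G y /\<^sub>R \<mu>) * indicator \<Omega> y)" if "\<mu>0 \<le> \<mu>" for \<mu>
        by (rule modular_finite_integrable[OF Gb order_le_less_trans[OF modular_mono_scale[OF \<mu>0(1) that] fin]])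
      then show ?thesis using u uniq \<phi>m \<mu>0(1) by blast
    qed
  qed
  {
    fix \<phi> assume B: "B_gen \<Omega> 0 M" and \<phi>: "\<phi> \<in> V01_L_M \<Omega> M"
    obtain u G \<mu>0 where u: "sobolev_pair \<Omega> u G" "AE x in lborel. x \<in> \<Omega> \<longrightarrow> u x = \<phi> x"
      and uniq: "\<And>G'. weak_gradient \<Omega> \<phi> G' \<Longrightarrow> AE x in lborel. x \<in> \<Omega> \<longrightarrow> G' x = G x"
      and \<phi>m: "\<phi> \<in> borel_measurable (lebesgue_on \<Omega>)"
      and \<mu>0: "0 < \<mu>0" "\<And>\<mu>. \<mu>0 \<le> \<mu> \<Longrightarrow> integrable lborel (\<lambda>y. M y (G y /\<^sub>R \<mu>) * indicator \<Omega> y)"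
      using repr[OF \<phi>] by blast
    obtain C A where sc: "approximation_scale \<Omega> M 0 C A"
      using approximation_scale_exists[OF assms reg B] by auto
    have CA: "1 < C" "0 < A" using sc by (auto simp: approximation_scale_def)
    show "\<exists>\<phi>s. approximated_by \<Omega> M \<phi> \<phi>s \<and> (\<phi> \<in> Linf \<Omega> \<longrightarrow> (\<forall>\<delta>>0. Linf_norm \<Omega> (\<phi>s \<delta>) \<le> ereal 1 * Linf_norm \<Omega> \<phi>))"
    proof (cases "\<phi> \<in> Linf \<Omega>")
      case True
      show ?thesis
      proof (rule Linf_norm_real[OF op ne True])
        fix b assume b: "Linf_norm \<Omega> \<phi> = ereal b" "0 \<le> b" "AE x in lborel. x \<in> \<Omega> \<longrightarrow> norm (\<phi> x) \<le> b"
        \<comment> \<open>A representative that is bounded everywhere.\<close>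
        define w where "w = (\<lambda>x. if norm (u x) \<le> b then u x else 0)"
        have ub: "u \<in> borel_measurable borel" and out: "\<And>x. x \<notin> \<Omega> \<Longrightarrow> u x = 0"
          using u(1) integrable_borel_measurable unfolding sobolev_pair_def by blast+
        have wb: "w \<in> borel_measurable borel" unfolding w_def using ub by measurable
        have wu: "AE x in lborel. w x = u x"
          using u(2) b(3) by eventually_elim (use out in \<open>auto simp: w_def\<close>)
        have w: "sobolev_pair \<Omega> w G"
          by (rule sobolev_pair_cong_AE[OF u(1) wb wu]) (simp add: w_def out)
        have w\<phi>: "AE x in lborel. x \<in> \<Omega> \<longrightarrow> w x = \<phi> x" using wu u(2) by eventually_elim simp
        have wbd: "norm (w x) \<le> b" for x using b(2) by (simp add: w_def)
        \<comment> \<open>A bound \<open>b\<close> is a modulus of continuity \<open>2 * b\<close> of order \<open>\<gamma> = 0\<close>.\<close>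
        have osc: "norm (w (z - \<delta> *\<^sub>R v) - w z) \<le> (2 * b) * \<delta> powr 0" if "0 < \<delta>" for z \<delta> v
          using norm_triangle_ineq4[of "w (z - \<delta> *\<^sub>R v)" "w z"] wbd[of "z - \<delta> *\<^sub>R v"] wbd[of z] that by simp
        define \<mu> where "\<mu> = \<mu>0 + A * (2 * b)"
        have \<mu>: "0 < \<mu>" "A * (2 * b) \<le> \<mu>" "\<mu>0 \<le> \<mu>" using \<mu>0(1) CA b(2) by (auto simp: \<mu>_def add_pos_nonneg)
        have "\<exists>fs. approximated_by \<Omega> M \<phi> fs \<and> (\<forall>\<delta>>0. fs \<delta> \<in> Cc_infty \<Omega> \<and> (\<forall>x. norm (fs \<delta> x) \<le> b))"
        proof (rule approximated_byI[OF op bd \<phi>m w\<phi> uniq, where \<Lambda>="4 * C * \<mu>"])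
          show "0 < 4 * C * \<mu>" using CA \<mu> by simp
          show "\<exists>f\<in>Cc_infty \<Omega>. (f \<in> Cc_infty \<Omega> \<and> (\<forall>x. norm (f x) \<le> b)) \<and> (\<integral>\<^sup>+x. ennreal (norm (f x - w x)) \<partial>lebesgue_on \<Omega>) < ennreal \<epsilon> \<and>
            modular \<Omega> M (\<lambda>x. (grad f x - G x) /\<^sub>R (4 * C * \<mu>)) < ennreal \<epsilon>" if "0 < \<epsilon>" for \<epsilon>
            using approximation_bounded[OF reg sc w wbd osc \<mu>(1,2) \<mu>0(2)[OF \<mu>(3)] that] by blast
        qed
        then obtain fs where fs: "approximated_by \<Omega> M \<phi> fs" "\<And>\<delta>. 0 < \<delta> \<Longrightarrow> fs \<delta> \<in> Cc_infty \<Omega> \<and> (\<forall>x. norm (fs \<delta> x) \<le> b)" by blast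
        show ?thesis
        proof (intro exI[of _ fs] conjI impI allI fs(1))
          fix \<delta> :: real assume "0 < \<delta>"
          then have "Linf_norm \<Omega> (fs \<delta>) \<le> ereal b" using Linf_norm_le[OF bd] fs(2) by blast
          then show "Linf_norm \<Omega> (fs \<delta>) \<le> ereal 1 * Linf_norm \<Omega> \<phi>" by (simp add: b(1))
        qed
      qed
    next
      case False
      define \<mu> where "\<mu> = \<mu>0 + A * (2 * real CARD('d))"
      have \<mu>: "0 < \<mu>" "A * (2 * real CARD('d)) \<le> \<mu>" "\<mu>0 \<le> \<mu>" using \<mu>0(1) CA by (auto simp: \<mu>_def add_pos_nonneg)
      have "\<exists>fs. approximated_by \<Omega> M \<phi> fs \<and> (\<forall>\<delta>>0. (\<lambda>_. True) (fs \<delta>))"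
      proof (rule approximated_byI[OF op bd \<phi>m u(2) uniq, where \<Lambda>="8 * C * \<mu>"])
        show "0 < 8 * C * \<mu>" using CA \<mu> by simp
        show "\<exists>f\<in>Cc_infty \<Omega>. True \<and> (\<integral>\<^sup>+x. ennreal (norm (f x - u x)) \<partial>lebesgue_on \<Omega>) < ennreal \<epsilon> \<and>
          modular \<Omega> M (\<lambda>x. (grad f x - G x) /\<^sub>R (8 * C * \<mu>)) < ennreal \<epsilon>" if "0 < \<epsilon>" for \<epsilon>
          using approximation_unbounded[OF reg bd sc Mi u(1) \<mu>(1,2) \<mu>0(2)[OF \<mu>(3)] that] by blast
      qed
      then show ?thesis using False by blast
    qed
  }
  {
    fix \<gamma> :: real and \<phi> assume \<gamma>: "0 < \<gamma> \<and> \<gamma> \<le> 1" and B: "B_gen \<Omega> \<gamma> M" and "\<phi> \<in> V01_L_M \<Omega> M \<inter> Hoelder \<Omega> \<gamma>"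
    then have \<phi>: "\<phi> \<in> V01_L_M \<Omega> M" and hoel: "\<phi> \<in> Hoelder \<Omega> \<gamma>" by auto
    obtain u G \<mu>0 where u: "sobolev_pair \<Omega> u G" "AE x in lborel. x \<in> \<Omega> \<longrightarrow> u x = \<phi> x"
      and uniq: "\<And>G'. weak_gradient \<Omega> \<phi> G' \<Longrightarrow> AE x in lborel. x \<in> \<Omega> \<longrightarrow> G' x = G x"
      and \<phi>m: "\<phi> \<in> borel_measurable (lebesgue_on \<Omega>)"
      and \<mu>0: "0 < \<mu>0" "\<And>\<mu>. \<mu>0 \<le> \<mu> \<Longrightarrow> integrable lborel (\<lambda>y. M y (G y /\<^sub>R \<mu>) * indicator \<Omega> y)"
      using repr[OF \<phi>] by blast
    obtain C A where sc: "approximation_scale \<Omega> M \<gamma> C A"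
      using approximation_scale_exists[OF assms reg B] \<gamma> by auto
    have CA: "1 < C" "0 < A" using sc by (auto simp: approximation_scale_def)
    define w where "w = (\<lambda>x. if x \<in> \<Omega> then \<phi> x else 0)"
    have \<phi>c: "continuous_on \<Omega> \<phi>" by (rule uniformly_continuous_imp_continuous[OF Hoelder_uniformly_continuous_on[OF _ hoel]]) (use \<gamma> in simp)
    have wb: "w \<in> borel_measurable borel"
    proof -
      have "(\<lambda>x. indicator \<Omega> x *\<^sub>R \<phi> x) \<in> borel_measurable borel"
        by (rule borel_measurable_continuous_on_indicator[OF \<Omega>b(1) \<phi>c])
      moreover have "(\<lambda>x. indicator \<Omega> x *\<^sub>R \<phi> x) = w" by (auto simp: w_def)
      ultimately show ?thesis by simp
    qed
    have out: "\<And>x. x \<notin> \<Omega> \<Longrightarrow> u x = 0" using u(1) unfolding sobolev_pair_def by blast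
    have wu: "AE x in lborel. w x = u x" using u(2) by eventually_elim (use out in \<open>auto simp: w_def\<close>)
    have w: "sobolev_pair \<Omega> w G" by (rule sobolev_pair_cong_AE[OF u(1) wb wu]) (simp add: w_def)
    have w\<phi>: "AE x in lborel. x \<in> \<Omega> \<longrightarrow> w x = \<phi> x" by (simp add: w_def)
    have "w \<in> Hoelder \<Omega> \<gamma>"
    proof -
      have "{norm (w x - w y) / norm (x - y) powr \<gamma> | x y. x \<in> \<Omega> \<and> y \<in> \<Omega> \<and> x \<noteq> y}
          = {norm (\<phi> x - \<phi> y) / norm (x - y) powr \<gamma> | x y. x \<in> \<Omega> \<and> y \<in> \<Omega> \<and> x \<noteq> y}"
        unfolding w_def by (intro Collect_cong ex_cong1) auto
      then show ?thesis using hoel by (simp add: Hoelder_def)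
    qed
    then obtain H where H: "0 \<le> H" "\<And>y z. norm (w y - w z) \<le> H * norm (y - z) powr \<gamma>"
      using Hoelder_zero_extension[OF assms w] \<gamma> by blast
    have osc: "norm (w (z - \<delta> *\<^sub>R v) - w z) \<le> H * \<delta> powr \<gamma>" if "0 < \<delta>" "\<delta> \<le> 1" "norm v \<le> 1" for z \<delta> v
    proof -
      have "norm (z - \<delta> *\<^sub>R v - z) \<le> \<delta>" using that by (simp add: mult_left_le)
      then have "H * norm (z - \<delta> *\<^sub>R v - z) powr \<gamma> \<le> H * \<delta> powr \<gamma>"
        using H(1) \<gamma> by (intro mult_left_mono powr_mono2) auto
      then show ?thesis using H(2)[of "z - \<delta> *\<^sub>R v" z] by linarith
    qed
    have wout: "w x = 0" if "x \<notin> \<Omega>" for x using that by (simp add: w_def)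
    have "\<exists>b. (\<forall>x. norm (w x) \<le> b) \<and> (\<phi> \<in> Linf \<Omega> \<longrightarrow> ereal b = Linf_norm \<Omega> \<phi>)"
    proof (cases "\<phi> \<in> Linf \<Omega>")
      case True
      show ?thesis
      proof (rule Linf_norm_real[OF op ne True])
        fix b assume b: "Linf_norm \<Omega> \<phi> = ereal b" "0 \<le> b" "AE x in lborel. x \<in> \<Omega> \<longrightarrow> norm (\<phi> x) \<le> b"
        have "norm (\<phi> x) \<le> b" if "x \<in> \<Omega>" for x
          by (rule AE_le_continuous[OF op continuous_on_norm[OF \<phi>c] _ that]) (use b(3) in \<open>simp add: lebesgue_on_AE_iff[OF \<Omega>b(2)]\<close>)
        then show ?thesis using b(1,2) by (intro exI[of _ b]) (simp add: w_def)
      qed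
    next
      case False
      obtain b where "\<And>x. norm (w x) \<le> b"
        using Hoelder_bounded[OF bd wout _ H] \<gamma> by blast
      then show ?thesis using False by blast
    qed
    then obtain b where b: "\<And>x. norm (w x) \<le> b" "\<phi> \<in> Linf \<Omega> \<longrightarrow> ereal b = Linf_norm \<Omega> \<phi>" by blast
    define \<mu> where "\<mu> = \<mu>0 + A * H"
    have \<mu>: "0 < \<mu>" "A * H \<le> \<mu>" "\<mu>0 \<le> \<mu>" using \<mu>0(1) CA H(1) by (auto simp: \<mu>_def add_pos_nonneg)
    have "\<exists>fs. approximated_by \<Omega> M \<phi> fs \<and> (\<forall>\<delta>>0. fs \<delta> \<in> Cc_infty \<Omega> \<and> (\<forall>x. norm (fs \<delta> x) \<le> b))"
    proof (rule approximated_byI[OF op bd \<phi>m w\<phi> uniq, where \<Lambda>="4 * C * \<mu>"])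
      show "0 < 4 * C * \<mu>" using CA \<mu> by simp
      show "\<exists>f\<in>Cc_infty \<Omega>. (f \<in> Cc_infty \<Omega> \<and> (\<forall>x. norm (f x) \<le> b)) \<and> (\<integral>\<^sup>+x. ennreal (norm (f x - w x)) \<partial>lebesgue_on \<Omega>) < ennreal \<epsilon> \<and>
        modular \<Omega> M (\<lambda>x. (grad f x - G x) /\<^sub>R (4 * C * \<mu>)) < ennreal \<epsilon>" if "0 < \<epsilon>" for \<epsilon>
        using approximation_bounded[OF reg sc w b(1) osc \<mu>(1,2) \<mu>0(2)[OF \<mu>(3)] that] by blast
    qed
    then obtain fs where fs: "approximated_by \<Omega> M \<phi> fs" "\<And>\<delta>. 0 < \<delta> \<Longrightarrow> fs \<delta> \<in> Cc_infty \<Omega> \<and> (\<forall>x. norm (fs \<delta> x) \<le> b)" by blast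
    show "\<exists>\<phi>s. approximated_by \<Omega> M \<phi> \<phi>s \<and> (\<phi> \<in> Linf \<Omega> \<longrightarrow> (\<forall>\<delta>>0. Linf_norm \<Omega> (\<phi>s \<delta>) \<le> ereal 1 * Linf_norm \<Omega> \<phi>))"
    proof (intro exI[of _ fs] conjI impI allI fs(1))
      fix \<delta> :: real assume "\<phi> \<in> Linf \<Omega>" "0 < \<delta>"
      then have "Linf_norm \<Omega> (fs \<delta>) \<le> ereal b" "ereal b = Linf_norm \<Omega> \<phi>" using Linf_norm_le[OF bd] fs(2) b(2) by blast+
      then show "Linf_norm \<Omega> (fs \<delta>) \<le> ereal 1 * Linf_norm \<Omega> \<phi>" by simp
    qed
  }
qed

end
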